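(* Let $N_0:\tilde H^{1/2}(-1,1)\to H^{-1/2}(-1,1)$ be the Laplace hypersingular operator on the segment $[-1,1]$, let $\omega(x)=\sqrt{1-x^2}$, and let $N_{0,\omega}=N_0\,\omega$ be the weighted hypersingular operator. Then $$N_{0,\omega}^{-1}=2\left[-(\partial_x\omega)^2\right]^{-1/2}\quad\text{in } U^{-\infty},$$ or equivalently $$N_0^{-1}=2\,\omega\left[-(\partial_x\omega)^2\right]^{-1/2}.$$
   Context: $U_n(x)=\frac{\sin((n+1)\arccos x)}{\sqrt{1-x^2}}$ are the Chebyshev polynomials of the second kind on $[-1,1]$. Set $\omega(x)=\sqrt{1-x^2}$; $\omega$ also denotes the operator of multiplication by $\omega(x)$, and $\partial_x\omega$ denotes the composition $\partial_x\omega f=\frac{d}{dx}(\omega f)$, so $(\partial_x\omega)^2f=\frac{d}{dx}\big(\omega\frac{d}{dx}(\omega f)\big)$. $L^2_\omega$ is the space of $u\in L^1_{loc}(-1,1)$ with $\int_{-1}^1|u|^2\omega\,dx<\infty$, with bilinear form $(u,v)_\omega=\int_{-1}^1uv\,\omega\,dx$. The family $(U_n)_{n\ge0}$ is a complete orthogonal family of it, and $\check u_n=(u,U_n)_\omega/(U_n,U_n)_\omega$. For $s\ge0$, $U^s=\{u\in L^2_\omega:\sum_{n\ge0}(1+n^2)^s|\check u_n|^2<\infty\}$ with squared norm $\frac12\sum_{n\ge 0}(1+(n+1)^2)^s|\check u_n|^2$. For $s<0$, $U^s$ is the analogous space of formal series $\sum\check u_nU_n$ satisfying the same summability condition, identified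 with the dual of $U^{-s}$ through the extension of $(\cdot,\cdot)_\omega$. Put $U^\infty=\bigcap_{s}U^s$ (it equals $C^\infty([-1,1])$) and $U^{-\infty}=\bigcup_{s}U^s$. The operator $-(\partial_x\omega)^2$ is regarded as a positive self-adjoint operator in $L^2_\omega$ (the realization having the $U_n$ as eigenfunctions); $[-(\partial_x\omega)^2]^{-1/2}$ is defined by functional calculus and extended by continuity to $U^s\to U^{s+1}$ for every real $s$. $H^{-1/2}(-1,1)$ is the space of restrictions to $(-1,1)$ of elements of $H^{-1/2}(\mathbb R)$ and $\tilde H^{1/2}(-1,1)$ is the space of elements of $H^{1/2}(\mathbb R)$ supported in $[-1,1]$. One has $U^{-1/2}=H^{-1/2}(-1,1)$ and $U^{1/2}=\frac1\omega\tilde H^{1/2}(-1,1)$. The operator $N_0$ is the continuous extension $\tilde H^{1/2}(-1,1)\to H^{-1/2}(-1,1)$ of the operator $N_0:C_c^\infty(-1,1)\to\mathcal D'(-1,1)$ defined by $$\langle N_0\phi,\psi\rangle=-\frac1{2\pi}\int_{-1}^1\int_{-1}^1\ln|x-y|\,\phi'(x)\psi'(y)\,dx\,dy .$$ $N_{0,\omega}\beta=N_0(\omega\beta)$, defined for $\beta\in U^{1/2}$ and extended by continuity to $U^{-\infty}$ (as operators $U^s\to U^{s-1}$). In the second formula, $N_0^{-1}$ is the inverse $H^{-1/2}(-1,1)\to\tilde H^{1/2}(-1,1)$. *)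

theory Defs
  imports "HOL-Analysis.Analysis" "HOL-Library.FuncSet"
begin

text \<open>
  All functions and distributions are complex valued, and all pairings are bilinear (no conjugation).
  A distribution is a functional on functions \<open>real \<Rightarrow> complex\<close>; every such functional is set to 0
  outside the relevant space of test functions, so that equality of distributions is equality
  in the logic and the linear operations are pointwise.
\<close>

abbreviation seg :: "real set" where
  "seg \<equiv> {-1<..<1}"

abbreviation ddx :: "(real \<Rightarrow> complex) \<Rightarrow> real \<Rightarrow> complex" where
  "ddx f \<equiv> \<lambda>x. vector_derivative f (at x)"

definition smooth :: "(real \<Rightarrow> complex) \<Rightarrow> bool" where
  "smooth f \<longleftrightarrow> (\<forall>k. (ddx ^^ k) f differentiable_on UNIV)"

definition test_functions :: "real set \<Rightarrow> (real \<Rightarrow> complex) set" where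
  "test_functions S = {\<phi>. smooth \<phi> \<and> (\<exists>K. compact K \<and> K \<subseteq> S \<and> (\<forall>x. x \<notin> K \<longrightarrow> \<phi> x = 0))}"

type_synonym distr = "(real \<Rightarrow> complex) \<Rightarrow> complex"

definition distr_of_fun :: "(real \<Rightarrow> complex) \<Rightarrow> distr" where
  "distr_of_fun f = (\<lambda>\<phi>. if \<phi> \<in> test_functions UNIV then (LINT x|lborel. f x * \<phi> x) else 0)"

definition restrict_distr :: "real set \<Rightarrow> distr \<Rightarrow> distr" where
  "restrict_distr S T = (\<lambda>\<phi>. if \<phi> \<in> test_functions S then T \<phi> else 0)"

definition bounded_operator ::
  "('i \<Rightarrow> complex) set \<Rightarrow> (('i \<Rightarrow> complex) \<Rightarrow> real) \<Rightarrow>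
   ('j \<Rightarrow> complex) set \<Rightarrow> (('j \<Rightarrow> complex) \<Rightarrow> real) \<Rightarrow>
   (('i \<Rightarrow> complex) \<Rightarrow> ('j \<Rightarrow> complex)) \<Rightarrow> bool" where
  "bounded_operator X norm_X Y norm_Y N \<longleftrightarrow>
     (\<forall>u\<in>X. N u \<in> Y) \<and>
     (\<forall>u\<in>X. \<forall>v\<in>X. N (\<lambda>i. u i + v i) = (\<lambda>j. N u j + N v j)) \<and>
     (\<forall>a. \<forall>u\<in>X. N (\<lambda>i. a * u i) = (\<lambda>j. a * N u j)) \<and>
     (\<exists>C. \<forall>u\<in>X. norm_Y (N u) \<le> C * norm_X u)"


section \<open>Sobolev spaces\<close>

definition fourier :: "(real \<Rightarrow> complex) \<Rightarrow> real \<Rightarrow> complex" where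
  "fourier \<phi> \<xi> = (LINT x|lborel. \<phi> x * cis (- (x * \<xi>)))"

text \<open>
  The distribution whose Fourier transform is the function \<open>g\<close>, written by means of
  \<open>\<langle>T, \<phi>\<rangle> = 1/(2\<pi>) \<integral> T\<^sup>^(\<xi>) \<phi>\<^sup>^(-\<xi>) d\<xi>\<close>.  A tempered distribution is determined by its values on
  compactly supported test functions, so these suffice.
\<close>

definition distr_with_fourier :: "(real \<Rightarrow> complex) \<Rightarrow> distr" where
  "distr_with_fourier g = (\<lambda>\<phi>. if \<phi> \<in> test_functions UNIV
     then 1 / (2 * of_real pi) * (LINT \<xi>|lborel. g \<xi> * fourier \<phi> (- \<xi>)) else 0)"

definition weighted_L2 :: "real \<Rightarrow> (real \<Rightarrow> complex) set" where
  "weighted_L2 s = {g \<in> borel_measurable lborel.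
     integrable lborel (\<lambda>\<xi>. (1 + \<xi>\<^sup>2) powr s * (cmod (g \<xi>))\<^sup>2)}"

definition weighted_L2_norm :: "real \<Rightarrow> (real \<Rightarrow> complex) \<Rightarrow> real" where
  "weighted_L2_norm s g = sqrt (LINT \<xi>|lborel. (1 + \<xi>\<^sup>2) powr s * (cmod (g \<xi>))\<^sup>2)"

definition sobolev :: "real \<Rightarrow> distr set" where
  "sobolev s = distr_with_fourier ` weighted_L2 s"

text \<open>The Fourier transform is unique almost everywhere: the infimum is over a single value.\<close>

definition sobolev_norm :: "real \<Rightarrow> distr \<Rightarrow> real" where
  "sobolev_norm s T = Inf (weighted_L2_norm s ` {g \<in> weighted_L2 s. distr_with_fourier g = T})"

definition sobolev_on :: "real \<Rightarrow> real set \<Rightarrow> distr set" where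
  "sobolev_on s S = restrict_distr S ` sobolev s"

definition sobolev_on_norm :: "real \<Rightarrow> real set \<Rightarrow> distr \<Rightarrow> real" where
  "sobolev_on_norm s S F = Inf (sobolev_norm s ` {T \<in> sobolev s. restrict_distr S T = F})"

definition sobolev_supported :: "real \<Rightarrow> real set \<Rightarrow> distr set" where
  "sobolev_supported s K = {T \<in> sobolev s. \<forall>\<phi>\<in>test_functions (- K). T \<phi> = 0}"

abbreviation Htilde_half :: "distr set" where
  "Htilde_half \<equiv> sobolev_supported (1/2) {-1..1}"

abbreviation H_minus_half :: "distr set" where
  "H_minus_half \<equiv> sobolev_on (-1/2) seg"


section \<open>The hypersingular operator\<close>

definition N0_form :: "(real \<Rightarrow> complex) \<Rightarrow> (real \<Rightarrow> complex) \<Rightarrow> complex" where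
  "N0_form \<phi> \<psi> = - (1 / (2 * of_real pi)) *
     (LINT z:seg \<times> seg|lborel \<Otimes>\<^sub>M lborel.
        of_real (ln \<bar>fst z - snd z\<bar>) * ddx \<phi> (fst z) * ddx \<psi> (snd z))"

definition N0_smooth :: "(real \<Rightarrow> complex) \<Rightarrow> distr" where
  "N0_smooth \<phi> = (\<lambda>\<psi>. if \<psi> \<in> test_functions seg then N0_form \<phi> \<psi> else 0)"

definition N0 :: "distr \<Rightarrow> distr" where
  "N0 = (THE N. N \<in> Htilde_half \<rightarrow>\<^sub>E H_minus_half \<and>
     bounded_operator Htilde_half (sobolev_norm (1/2))
       H_minus_half (sobolev_on_norm (-1/2) seg) N \<and>
     (\<forall>\<phi>\<in>test_functions seg. N (distr_of_fun \<phi>) = N0_smooth \<phi>))"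


section \<open>The scale of spaces built on the Chebyshev polynomials of the second kind\<close>

definition omega :: "real \<Rightarrow> real" where
  "omega x = sqrt (1 - x\<^sup>2)"

text \<open>Only the values on the open segment matter: at \<open>\<plusminus>1\<close> the quotient is 0 by convention.\<close>

definition chebU :: "nat \<Rightarrow> real \<Rightarrow> complex" where
  "chebU n x = of_real (sin (real (n + 1) * arccos x) / sqrt (1 - x\<^sup>2))"

definition L2_omega :: "(real \<Rightarrow> complex) set" where
  "L2_omega = {u. (\<forall>a b. -1 < a \<and> b < 1 \<longrightarrow> set_integrable lborel {a..b} u) \<and>
     set_integrable lborel seg (\<lambda>x. (cmod (u x))\<^sup>2 * omega x)}"

definition form_omega :: "(real \<Rightarrow> complex) \<Rightarrow> (real \<Rightarrow> complex) \<Rightarrow> complex" where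
  "form_omega u v = (LINT x:seg|lborel. u x * v x * of_real (omega x))"

definition cheb_coeff :: "(real \<Rightarrow> complex) \<Rightarrow> nat \<Rightarrow> complex" where
  "cheb_coeff u n = form_omega u (chebU n) / form_omega (chebU n) (chebU n)"

text \<open>
  An element of the scale is a formal series, that is, its sequence of coefficients.  For
  \<open>s \<ge> 0\<close> the series are those of actual functions; \<open>U_fun\<close> recovers the function (up to
  equality almost everywhere).
\<close>

definition U_summable :: "real \<Rightarrow> (nat \<Rightarrow> complex) \<Rightarrow> bool" where
  "U_summable s c \<longleftrightarrow> summable (\<lambda>n. (1 + (real n)\<^sup>2) powr s * (cmod (c n))\<^sup>2)"

definition U_space :: "real \<Rightarrow> (nat \<Rightarrow> complex) set" where
  "U_space s = (if s \<ge> 0 then cheb_coeff ` {u \<in> L2_omega. U_summable s (cheb_coeff u)}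
                else {c. U_summable s c})"

definition U_norm :: "real \<Rightarrow> (nat \<Rightarrow> complex) \<Rightarrow> real" where
  "U_norm s c = sqrt (1/2 * (\<Sum>n. (1 + (real (n + 1))\<^sup>2) powr s * (cmod (c n))\<^sup>2))"

definition U_minus_inf :: "(nat \<Rightarrow> complex) set" where
  "U_minus_inf = (\<Union>s. U_space s)"

definition U_fun :: "(nat \<Rightarrow> complex) \<Rightarrow> real \<Rightarrow> complex" where
  "U_fun c = (SOME u. u \<in> L2_omega \<and> cheb_coeff u = c)"

text \<open>The extension of \<open>form_omega\<close> to formal series, giving the duality between opposite orders.\<close>

definition U_pairing :: "(nat \<Rightarrow> complex) \<Rightarrow> (nat \<Rightarrow> complex) \<Rightarrow> complex" where
  "U_pairing c d = (\<Sum>n. c n * d n * form_omega (chebU n) (chebU n))"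

text \<open>
  The distribution on the segment defined by a series of order \<open>-1/2\<close>: as \<open>\<integral> u \<psi> dx\<close> is
  \<open>form_omega u (\<psi>/\<omega>)\<close>, it is \<open>\<psi> \<mapsto> \<langle>c, \<psi>/\<omega>\<rangle>\<close>.  This is the identification of the space of
  order \<open>-1/2\<close> with \<^term>\<open>H_minus_half\<close>, and \<open>series_of_distr\<close> is its inverse.
\<close>

definition distr_of_series :: "(nat \<Rightarrow> complex) \<Rightarrow> distr" where
  "distr_of_series c = (\<lambda>\<psi>. if \<psi> \<in> test_functions seg
     then U_pairing c (cheb_coeff (\<lambda>x. \<psi> x / of_real (omega x))) else 0)"

definition series_of_distr :: "distr \<Rightarrow> nat \<Rightarrow> complex" where
  "series_of_distr F = (THE c. c \<in> U_space (-1/2) \<and> distr_of_series c = F)"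

text \<open>
  The extension by continuity, to the whole scale, of an operator \<open>B\<close> given on the space of
  order \<open>s\<^sub>0\<close> and shifting the order by \<open>m\<close>.
\<close>

definition scale_extension ::
  "real \<Rightarrow> real \<Rightarrow> ((nat \<Rightarrow> complex) \<Rightarrow> nat \<Rightarrow> complex) \<Rightarrow> (nat \<Rightarrow> complex) \<Rightarrow> nat \<Rightarrow> complex" where
  "scale_extension s\<^sub>0 m B = (THE N. N \<in> U_minus_inf \<rightarrow>\<^sub>E U_minus_inf \<and>
     (\<forall>s. bounded_operator (U_space s) (U_norm s) (U_space (s + m)) (U_norm (s + m)) N) \<and>
     (\<forall>c\<in>U_space s\<^sub>0. N c = B c))"


section \<open>The weighted hypersingular operator\<close>

text \<open>Multiplication by \<open>\<omega>\<close>, with the product extended by zero outside the segment.\<close>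

definition times_omega :: "(nat \<Rightarrow> complex) \<Rightarrow> distr" where
  "times_omega c = distr_of_fun (\<lambda>x. indicator seg x * of_real (omega x) * U_fun c x)"

definition N0_omega :: "(nat \<Rightarrow> complex) \<Rightarrow> nat \<Rightarrow> complex" where
  "N0_omega = scale_extension (1/2) (-1) (\<lambda>c. series_of_distr (N0 (times_omega c)))"


section \<open>Powers of the differential operator\<close>

definition d_omega :: "(real \<Rightarrow> complex) \<Rightarrow> real \<Rightarrow> complex" where
  "d_omega f = ddx (\<lambda>x. of_real (omega x) * f x)"

definition eigenvalue :: "nat \<Rightarrow> real" where
  "eigenvalue n = (THE l. \<forall>x\<in>seg. - d_omega (d_omega (chebU n)) x = of_real l * chebU n x)"

text \<open>
  Functional calculus of the self-adjoint realization of \<open>-(\<partial>\<^sub>x\<omega>)\<^sup>2\<close> for which the complete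
  orthogonal family \<open>chebU\<close> consists of eigenfunctions.  Its spectral projections are those onto
  the lines spanned by the \<open>chebU n\<close>, whence \<open>f(A) u = \<Sum> f(\<lambda>\<^sub>n) u\<^sub>n chebU\<^sub>n\<close>.
\<close>

definition functional_calculus :: "(real \<Rightarrow> real) \<Rightarrow> (nat \<Rightarrow> complex) \<Rightarrow> nat \<Rightarrow> complex" where
  "functional_calculus f c = (\<lambda>n. of_real (f (eigenvalue n)) * c n)"

definition inv_sqrt_op :: "(nat \<Rightarrow> complex) \<Rightarrow> nat \<Rightarrow> complex" where
  "inv_sqrt_op = scale_extension 0 1 (functional_calculus (\<lambda>t. t powr (-1/2)))"

end

theory Submission
  imports Defs "HOL-Probability.Probability"
begin

text \<open>By the Fourier representation of the logarithm, \<open>N0\<close> is multiplication of the Fourier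
  transform by \<open>\<bar>\<xi>\<bar> / 2\<close>, followed by restriction to the segment.  The Fourier transform of
  \<open>\<omega> U\<^sub>n\<close> is \<open>(-\<i>)\<^sup>n \<pi> (n + 1) J\<^sub>n\<^sub>+\<^sub>1(\<xi>) / \<xi>\<close>, and the orthogonality of the functions
  \<open>J\<^sub>n\<^sub>+\<^sub>1(\<xi>) / \<xi>\<close> for the measure \<open>\<bar>\<xi>\<bar> d\<xi>\<close> shows that \<open>N0 \<omega>\<close> is diagonal on the \<open>U\<^sub>n\<close> with
  eigenvalues \<open>(n + 1) / 2\<close>, whereas \<open>-(\<partial>\<^sub>x\<omega>)\<^sup>2\<close> has the eigenvalues \<open>(n + 1)\<^sup>2\<close>.  Bessel's inequality,
  the density of the test functions in the space of order \<open>1/2\<close> and duality identify the two Sobolev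
  spaces with the sequence spaces of order \<open>1/2\<close> and \<open>-1/2\<close>.\<close>

subsection \<open>Square-integrable functions and orthogonal families\<close>

text \<open>\<open>N0\<close>, the extensions to the whole scale, the eigenvalues and the series of
  a distribution are all fixed by definite descriptions, so each of them needs a uniqueness proof
  besides a candidate. For \<open>N0\<close> and the extensions, uniqueness is continuation from a
  dense set: test functions in one case, finite sequences in the other. The transforms
  \<open>chebU_hat\<close> are not complete for the measure |xi| d xi; they only reach transforms of
  distributions supported in [-1, 1]. Completeness is therefore proved on the segment, by
  Weierstrass approximation, and carried to the Fourier side by test functions, whose Chebyshev
  coefficients decay fast enough. The weight |xi| also gives no control of low frequencies, which
  the norm of order 1/2 sees. There a pointwise bound on the transform, due to the bounded support,
  takes over. Finally 1/|xi|, the transform of the logarithm up to a factor, is integrable neither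
  at 0 nor at infinity, so it is truncated at both ends and the truncation is removed only after the
  two derivatives have supplied the factor xi^2.\<close>

definition square_integrable :: "'a measure \<Rightarrow> ('a \<Rightarrow> complex) \<Rightarrow> bool" where
  "square_integrable M f \<longleftrightarrow> f \<in> borel_measurable M \<and> integrable M (\<lambda>x. (cmod (f x))\<^sup>2)"

lemma square_integrableD:
  assumes "square_integrable M f"
  shows "f \<in> borel_measurable M" "integrable M (\<lambda>x. (cmod (f x))\<^sup>2)"
  using assms by (auto simp: square_integrable_def)

lemma cmod_add_square_le: "(cmod (a + b))\<^sup>2 \<le> 2 * (cmod a)\<^sup>2 + 2 * (cmod b)\<^sup>2"
proof -
  have "(cmod (a + b))\<^sup>2 \<le> (cmod a + cmod b)\<^sup>2" by (intro power_mono norm_triangle_ineq) simp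
  also have "\<dots> \<le> 2 * (cmod a)\<^sup>2 + 2 * (cmod b)\<^sup>2"
    using sum_squares_bound[of "cmod a" "cmod b"] by (simp add: power2_sum)
  finally show ?thesis .
qed

lemma square_integrable_add:
  assumes f: "square_integrable M f" and g: "square_integrable M g"
  shows "square_integrable M (\<lambda>x. f x + g x)"
    and "(LINT x|M. (cmod (f x + g x))\<^sup>2) \<le> 2 * (LINT x|M. (cmod (f x))\<^sup>2) + 2 * (LINT x|M. (cmod (g x))\<^sup>2)"
proof -
  note [measurable] = square_integrableD(1)[OF f] square_integrableD(1)[OF g]
  note i = square_integrableD(2)[OF f] square_integrableD(2)[OF g]
  have i1: "integrable M (\<lambda>x. 2 * (cmod (f x))\<^sup>2 + 2 * (cmod (g x))\<^sup>2)"
    using i by simp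
  have i2: "integrable M (\<lambda>x. (cmod (f x + g x))\<^sup>2)"
    by (rule Bochner_Integration.integrable_bound[OF i1])
       (auto intro!: AE_I2 order_trans[OF cmod_add_square_le])
  then show "square_integrable M (\<lambda>x. f x + g x)"
    unfolding square_integrable_def by simp
  have "(LINT x|M. (cmod (f x + g x))\<^sup>2) \<le> (LINT x|M. 2 * (cmod (f x))\<^sup>2 + 2 * (cmod (g x))\<^sup>2)"
    by (rule integral_mono[OF i2 i1 cmod_add_square_le])
  then show "(LINT x|M. (cmod (f x + g x))\<^sup>2) \<le> 2 * (LINT x|M. (cmod (f x))\<^sup>2) + 2 * (LINT x|M. (cmod (g x))\<^sup>2)"
    using i by simp
qed

lemma square_integrable_cmult:
  assumes "square_integrable M f" shows "square_integrable M (\<lambda>x. c * f x)"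
proof -
  note [measurable] = square_integrableD(1)[OF assms]
  show ?thesis using square_integrableD(2)[OF assms]
    by (simp add: square_integrable_def norm_mult power_mult_distrib)
qed

lemma square_integrable_cnj:
  assumes "square_integrable M f" shows "square_integrable M (\<lambda>x. cnj (f x))"
proof -
  have "cnj \<in> borel_measurable borel" by (intro borel_measurable_continuous_onI continuous_intros)
  from measurable_compose[OF square_integrableD(1)[OF assms] this] show ?thesis
    using square_integrableD(2)[OF assms] by (simp add: square_integrable_def)
qed

lemma square_integrable_diff:
  assumes f: "square_integrable M f" and g: "square_integrable M g"
  shows "square_integrable M (\<lambda>x. f x - g x)"
  using square_integrable_add(1)[OF f square_integrable_cmult[OF g, of "-1"]] by simp

lemma square_integrable_sum:
  assumes "\<And>i. i \<in> A \<Longrightarrow> square_integrable M (f i)"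
  shows "square_integrable M (\<lambda>x. \<Sum>i\<in>A. f i x)"
  using assms
proof (induction A rule: infinite_finite_induct)
  case (insert a A)
  then show ?case using square_integrable_add(1)[of M "f a" "\<lambda>x. \<Sum>i\<in>A. f i x"] by simp
qed (simp_all add: square_integrable_def)

lemma square_integrable_mult:
  assumes f: "square_integrable M f" and g: "square_integrable M g"
  shows "integrable M (\<lambda>x. f x * g x)"
proof -
  note [measurable] = square_integrableD(1)[OF f] square_integrableD(1)[OF g]
  note i = square_integrableD(2)[OF f] square_integrableD(2)[OF g]
  show ?thesis
  proof (rule Bochner_Integration.integrable_bound)
    show "integrable M (\<lambda>x. (cmod (f x))\<^sup>2 + (cmod (g x))\<^sup>2)" using i by simp
    show "AE x in M. norm (f x * g x) \<le> norm ((cmod (f x))\<^sup>2 + (cmod (g x))\<^sup>2)"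
    proof (intro AE_I2)
      fix x
      have "2 * (cmod (f x) * cmod (g x)) \<le> (cmod (f x))\<^sup>2 + (cmod (g x))\<^sup>2"
        using sum_squares_bound[of "cmod (f x)" "cmod (g x)"] by (simp add: mult.assoc)
      moreover have "0 \<le> cmod (f x) * cmod (g x)" by simp
      ultimately have "cmod (f x) * cmod (g x) \<le> (cmod (f x))\<^sup>2 + (cmod (g x))\<^sup>2"
        by linarith
      then show "norm (f x * g x) \<le> norm ((cmod (f x))\<^sup>2 + (cmod (g x))\<^sup>2)"
        by (simp add: norm_mult)
    qed
  qed measurable
qed

text \<open>The estimate is made for the integral of |f g|, from the nonnegative quadratic
  polynomial t -> integral of (t |f| - |g|)^2. No conjugation enters, in keeping with the bilinear
  pairings.\<close>

lemma Cauchy_Schwarz_integral: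
  assumes f: "square_integrable M f" and g: "square_integrable M g"
  shows "cmod (LINT x|M. f x * g x) \<le> sqrt (LINT x|M. (cmod (f x))\<^sup>2) * sqrt (LINT x|M. (cmod (g x))\<^sup>2)"
proof -
  note [measurable] = square_integrableD(1)[OF f] square_integrableD(1)[OF g]
  note i = square_integrableD(2)[OF f] square_integrableD(2)[OF g]
  let ?a = "LINT x|M. (cmod (f x))\<^sup>2" and ?c = "LINT x|M. (cmod (g x))\<^sup>2" and ?b = "LINT x|M. cmod (f x * g x)"
  have ib: "integrable M (\<lambda>x. cmod (f x * g x))" using square_integrable_mult[OF f g] by simp
  have quad: "0 \<le> t\<^sup>2 * ?a - 2 * t * ?b + ?c" for t
  proof -
    have "0 \<le> (LINT x|M. (t * cmod (f x) - cmod (g x))\<^sup>2)" by simp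
    also have "(\<lambda>x. (t * cmod (f x) - cmod (g x))\<^sup>2) =
       (\<lambda>x. t\<^sup>2 * (cmod (f x))\<^sup>2 - 2 * t * cmod (f x * g x) + (cmod (g x))\<^sup>2)"
      by (auto simp: fun_eq_iff power2_diff norm_mult power_mult_distrib algebra_simps)
    also have "(LINT x|M. \<dots> x) = t\<^sup>2 * ?a - 2 * t * ?b + ?c"
      using i ib by simp
    finally show ?thesis .
  qed
  have a0: "0 \<le> ?a" "0 \<le> ?b" "0 \<le> ?c" by simp_all
  have "?b\<^sup>2 \<le> ?a * ?c"
  proof (cases "?a = 0")
    case True
    have "?b = 0"
    proof (rule ccontr)
      assume "?b \<noteq> 0"
      \<comment> \<open>When \<open>?a\<close> vanishes the polynomial is affine; at this point it
        takes the value -1.\<close>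
      then show False using quad[of "(?c + 1) / (2 * ?b)"] True a0 by (simp add: field_simps)
    qed
    then show ?thesis using True by simp
  next
    case False
    then have "?a > 0" using a0(1) by linarith
    \<comment> \<open>The minimiser of the polynomial.\<close>
    then show ?thesis using quad[of "?b / ?a"] by (simp add: field_simps power2_eq_square)
  qed
  then have "?b \<le> sqrt (?a * ?c)" using real_le_rsqrt by blast
  moreover have "cmod (LINT x|M. f x * g x) \<le> ?b" by (rule integral_norm_bound)
  ultimately show ?thesis unfolding real_sqrt_mult by linarith
qed

text \<open>By Cauchy-Schwarz, pairing with a fixed \<open>g\<close> is continuous for convergence
  in the mean.\<close>

lemma integral_square_tendsto_mult:
  assumes f: "square_integrable M f" and s: "\<And>n. square_integrable M (s n)" and g: "square_integrable M g"
    and lim: "(\<lambda>n. LINT x|M. (cmod (f x - s n x))\<^sup>2) \<longlonglongrightarrow> 0"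
  shows "(\<lambda>n. LINT x|M. s n x * g x) \<longlonglongrightarrow> (LINT x|M. f x * g x)"
proof -
  have "(\<lambda>n. sqrt (LINT x|M. (cmod (f x - s n x))\<^sup>2) * sqrt (LINT x|M. (cmod (g x))\<^sup>2)) \<longlonglongrightarrow>
     sqrt 0 * sqrt (LINT x|M. (cmod (g x))\<^sup>2)"
    by (intro tendsto_intros lim)
  then have "(\<lambda>n. sqrt (LINT x|M. (cmod (f x - s n x))\<^sup>2) * sqrt (LINT x|M. (cmod (g x))\<^sup>2)) \<longlonglongrightarrow> 0"
    by simp
  then have "(\<lambda>n. (LINT x|M. f x * g x) - (LINT x|M. s n x * g x)) \<longlonglongrightarrow> 0"
  proof (rule Lim_null_comparison[rotated], intro always_eventually allI)
    fix n
    have "(LINT x|M. f x * g x) - (LINT x|M. s n x * g x) = (LINT x|M. (f x - s n x) * g x)"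
      using square_integrable_mult[OF f g] square_integrable_mult[OF s g] by (simp add: left_diff_distrib)
    then show "norm ((LINT x|M. f x * g x) - (LINT x|M. s n x * g x))
       \<le> sqrt (LINT x|M. (cmod (f x - s n x))\<^sup>2) * sqrt (LINT x|M. (cmod (g x))\<^sup>2)"
      using Cauchy_Schwarz_integral[OF square_integrable_diff[OF f s] g] by simp
  qed
  from tendsto_diff[OF tendsto_const[of "LINT x|M. f x * g x"] this] show ?thesis by simp
qed

text \<open>Two instances are made: the Chebyshev functions with the weight \<omega> on the segment,
  and their Fourier transforms with the weight |xi| on the line. The axioms stop short of
  completeness, which the second family does not have.\<close>

locale orthogonal_family =
  fixes M :: "'a measure" and e :: "nat \<Rightarrow> 'a \<Rightarrow> complex" and w :: "nat \<Rightarrow> real"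
  assumes e: "square_integrable M (e n)"
    and orth: "(LINT x|M. e n x * cnj (e m x)) = (if n = m then of_real (w n) else 0)"
    and w_pos: "w n > 0"
begin

definition psum :: "(nat \<Rightarrow> complex) \<Rightarrow> nat \<Rightarrow> 'a \<Rightarrow> complex" where
  "psum c N x = (\<Sum>n<N. c n * e n x)"

lemma square_integrable_psum: "square_integrable M (psum c N)"
  unfolding psum_def[abs_def] by (intro square_integrable_sum square_integrable_cmult e)

lemma integrable_e_cnj: "integrable M (\<lambda>x. e n x * cnj (e m x))"
  by (intro square_integrable_mult square_integrable_cnj e)

lemma integral_psum_e: "(LINT x|M. psum c N x * cnj (e m x)) = (if m < N then c m * of_real (w m) else 0)"
proof -
  have "(LINT x|M. psum c N x * cnj (e m x)) = (LINT x|M. (\<Sum>n<N. c n * (e n x * cnj (e m x))))"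
    by (simp add: psum_def sum_distrib_right mult.assoc)
  also have "\<dots> = (\<Sum>n<N. c n * (LINT x|M. e n x * cnj (e m x)))"
    using integrable_e_cnj by (subst Bochner_Integration.integral_sum) simp_all
  also have "\<dots> = (if m < N then c m * of_real (w m) else 0)"
    by (simp add: orth if_distrib[of "\<lambda>x. _ * x"] sum.delta cong: if_cong)
  finally show ?thesis .
qed

text \<open>Leading zero coefficients are provided for so that a difference of two partial sums,
  itself a partial sum, is covered as well.\<close>

lemma integral_psum_square_finite:
  assumes "\<And>n. n < K \<Longrightarrow> c n = 0" "K \<le> N"
  shows "(LINT x|M. (cmod (psum c N x))\<^sup>2) = (\<Sum>n=K..<N. w n * (cmod (c n))\<^sup>2)"
proof -
  have int: "integrable M (\<lambda>x. psum c N x * cnj (e m x))" for m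
    by (intro square_integrable_mult square_integrable_cnj e square_integrable_psum)
  have "complex_of_real (LINT x|M. (cmod (psum c N x))\<^sup>2) = (LINT x|M. of_real ((cmod (psum c N x))\<^sup>2))"
    by (rule integral_complex_of_real[symmetric])
  also have "\<dots> = (LINT x|M. psum c N x * cnj (psum c N x))"
    by (simp only: complex_norm_square)
  also have "\<dots> = (LINT x|M. (\<Sum>m<N. cnj (c m) * (psum c N x * cnj (e m x))))"
    by (rule Bochner_Integration.integral_cong[OF refl])
       (subst (2) psum_def, simp add: sum_distrib_left mult_ac)
  also have "\<dots> = (\<Sum>m<N. cnj (c m) * (LINT x|M. psum c N x * cnj (e m x)))"
    using int by (subst Bochner_Integration.integral_sum) simp_all
  also have "\<dots> = (\<Sum>m<N. of_real (w m * (cmod (c m))\<^sup>2))"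
  proof (intro sum.cong refl)
    fix m assume "m \<in> {..<N}"
    then have "cnj (c m) * (LINT x|M. psum c N x * cnj (e m x)) = cnj (c m) * (c m * of_real (w m))"
      by (simp add: integral_psum_e)
    then show "cnj (c m) * (LINT x|M. psum c N x * cnj (e m x)) = of_real (w m * (cmod (c m))\<^sup>2)"
      by (simp only: of_real_mult complex_norm_square mult_ac)
  qed
  also have "\<dots> = (\<Sum>m=K..<N. of_real (w m * (cmod (c m))\<^sup>2))"
    using assms by (intro sum.mono_neutral_right) auto
  finally show ?thesis by (simp flip: of_real_sum add: of_real_eq_iff del: of_real_mult of_real_power)
qed

lemma integral_psum_diff_square:
  assumes "K \<le> N"
  shows "(LINT x|M. (cmod (psum c N x - psum c K x))\<^sup>2) = (\<Sum>n=K..<N. w n * (cmod (c n))\<^sup>2)"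
proof -
  let ?d = "\<lambda>n. if n < K then 0 else c n"
  have "psum c N x - psum c K x = psum ?d N x" for x
  proof -
    have "psum c N x = (\<Sum>n<K. c n * e n x) + (\<Sum>n=K..<N. c n * e n x)"
      unfolding psum_def by (rule sum.atLeastLessThan_concat[of 0 K N, folded lessThan_atLeast0, symmetric]) (use assms in auto)
    moreover have "psum ?d N x = (\<Sum>n<K. ?d n * e n x) + (\<Sum>n=K..<N. ?d n * e n x)"
      unfolding psum_def by (rule sum.atLeastLessThan_concat[of 0 K N, folded lessThan_atLeast0, symmetric]) (use assms in auto)
    ultimately show ?thesis by (simp add: psum_def)
  qed
  then have "(LINT x|M. (cmod (psum c N x - psum c K x))\<^sup>2) = (\<Sum>n=K..<N. w n * (cmod (?d n))\<^sup>2)"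
    using integral_psum_square_finite[of K ?d N] assms by simp
  then show ?thesis by simp
qed

text \<open>Expand the nonnegative integral of |g - s|^2, where s is a partial sum of the series of
  \<open>g\<close>: the inner product of g and s and the squared norm of s are both equal to the
  partial sum of w n |c n|^2.\<close>

lemma Bessel_inequality:
  assumes g: "square_integrable M g"
  defines "c \<equiv> \<lambda>n. (LINT x|M. g x * cnj (e n x)) / of_real (w n)"
  shows "(\<Sum>n<N. w n * (cmod (c n))\<^sup>2) \<le> (LINT x|M. (cmod (g x))\<^sup>2)"
    and "summable (\<lambda>n. w n * (cmod (c n))\<^sup>2)"
    and "(\<Sum>n. w n * (cmod (c n))\<^sup>2) \<le> (LINT x|M. (cmod (g x))\<^sup>2)"
proof -
  have *: "(\<Sum>n<N. w n * (cmod (c n))\<^sup>2) \<le> (LINT x|M. (cmod (g x))\<^sup>2)" for N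
  proof -
    let ?s = "psum c N"
    have gs: "(LINT x|M. g x * cnj (?s x)) = of_real (\<Sum>n<N. w n * (cmod (c n))\<^sup>2)"
    proof -
      have "(LINT x|M. g x * cnj (?s x)) = (LINT x|M. (\<Sum>n<N. cnj (c n) * (g x * cnj (e n x))))"
        by (simp add: psum_def sum_distrib_left mult_ac)
      also have "\<dots> = (\<Sum>n<N. cnj (c n) * (LINT x|M. g x * cnj (e n x)))"
        using square_integrable_mult[OF g square_integrable_cnj[OF e]]
        by (subst Bochner_Integration.integral_sum) simp_all
      also have "\<dots> = (\<Sum>n<N. of_real (w n * (cmod (c n))\<^sup>2))"
      proof (intro sum.cong refl)
        fix n
        have "(LINT x|M. g x * cnj (e n x)) = c n * of_real (w n)"
          using w_pos[of n] by (simp add: c_def)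
        then show "cnj (c n) * (LINT x|M. g x * cnj (e n x)) = of_real (w n * (cmod (c n))\<^sup>2)"
          by (simp add: complex_norm_square mult_ac del: of_real_power)
      qed
      finally show ?thesis by simp
    qed
    have i1: "integrable M (\<lambda>x. (cmod (g x))\<^sup>2)" and i2: "integrable M (\<lambda>x. (cmod (?s x))\<^sup>2)"
      and i3: "integrable M (\<lambda>x. g x * cnj (?s x))"
      using g square_integrable_psum square_integrableD square_integrable_mult square_integrable_cnj by blast+
    have i4: "integrable M (\<lambda>x. Re (g x * cnj (?s x)))" using i3 by (rule integrable_Re)
    have "0 \<le> (LINT x|M. (cmod (g x - ?s x))\<^sup>2)" by simp
    also have "(\<lambda>x. (cmod (g x - ?s x))\<^sup>2) = (\<lambda>x. (cmod (g x))\<^sup>2 - 2 * Re (g x * cnj (?s x)) + (cmod (?s x))\<^sup>2)"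
      by (auto simp: fun_eq_iff cmod_power2) (auto simp: power2_eq_square algebra_simps)
    also have "(LINT x|M. \<dots> x) = (LINT x|M. (cmod (g x))\<^sup>2) - 2 * (LINT x|M. Re (g x * cnj (?s x))) + (LINT x|M. (cmod (?s x))\<^sup>2)"
    proof -
      have "(LINT x|M. (cmod (g x))\<^sup>2 - 2 * h x + (cmod (?s x))\<^sup>2)
         = (LINT x|M. (cmod (g x))\<^sup>2) - 2 * (LINT x|M. h x) + (LINT x|M. (cmod (?s x))\<^sup>2)"
        if "integrable M h" for h
        using i1 i2 that by simp
      from this[OF i4] show ?thesis .
    qed
    also have "(LINT x|M. Re (g x * cnj (?s x))) = Re (LINT x|M. g x * cnj (?s x))"
      using i3 by (rule integral_Re)
    also have "\<dots> = (\<Sum>n<N. w n * (cmod (c n))\<^sup>2)" unfolding gs by (rule Re_complex_of_real)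
    also have "(LINT x|M. (cmod (?s x))\<^sup>2) = (\<Sum>n<N. w n * (cmod (c n))\<^sup>2)"
      using integral_psum_square_finite[of 0 c N] by (simp add: lessThan_atLeast0)
    finally show ?thesis by simp
  qed
  then show "(\<Sum>n<N. w n * (cmod (c n))\<^sup>2) \<le> (LINT x|M. (cmod (g x))\<^sup>2)" .
  show s: "summable (\<lambda>n. w n * (cmod (c n))\<^sup>2)"
    by (rule summableI_nonneg_bounded[OF _ *]) (simp add: less_imp_le[OF w_pos])
  show "(\<Sum>n. w n * (cmod (c n))\<^sup>2) \<le> (LINT x|M. (cmod (g x))\<^sup>2)"
    by (rule suminf_le_const[OF s *])
qed

definition expands :: "(nat \<Rightarrow> complex) \<Rightarrow> ('a \<Rightarrow> complex) \<Rightarrow> bool" where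
  "expands c f \<longleftrightarrow> square_integrable M f \<and> (\<lambda>N. LINT x|M. (cmod (f x - psum c N x))\<^sup>2) \<longlonglongrightarrow> 0"

lemma tail_tendsto_0:
  assumes "summable (\<lambda>n. w n * (cmod (c n))\<^sup>2)"
  shows "(\<lambda>N. (\<Sum>n. w (n + N) * (cmod (c (n + N)))\<^sup>2)) \<longlonglongrightarrow> 0"
  by (rule suminf_exist_split2[OF assms])

lemma segment_le_tail:
  assumes "summable (\<lambda>n. w n * (cmod (c n))\<^sup>2)"
  shows "(\<Sum>n=K..<N. w n * (cmod (c n))\<^sup>2) \<le> (\<Sum>n. w (n + K) * (cmod (c (n + K)))\<^sup>2)"
proof -
  have "(\<Sum>n=K..<N. w n * (cmod (c n))\<^sup>2) = (\<Sum>n<N - K. w (n + K) * (cmod (c (n + K)))\<^sup>2)"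
    by (cases "K \<le> N")
       (auto simp: sum.atLeastLessThan_shift_0[of _ K] lessThan_atLeast0 add.commute)
  also have "\<dots> \<le> (\<Sum>n. w (n + K) * (cmod (c (n + K)))\<^sup>2)"
    by (rule sum_le_suminf)
       (use summable_ignore_initial_segment[OF assms, of K] less_imp_le[OF w_pos] in auto)
  finally show ?thesis .
qed

text \<open>Fatou's lemma turns pointwise convergence of a subsequence of the partial sums into
  convergence in the mean.\<close>

lemma expandsI_pointwise:
  assumes sm: "summable (\<lambda>n. w n * (cmod (c n))\<^sup>2)"
    and f[measurable]: "f \<in> borel_measurable M"
    and r: "filterlim r at_top sequentially"
    and lim: "AE x in M. (\<lambda>k. psum c (r k) x) \<longlonglongrightarrow> f x"
  shows "expands c f"
proof -
  note [measurable] = square_integrableD(1)[OF square_integrable_psum]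
  let ?t = "\<lambda>N. (\<Sum>n. w (n + N) * (cmod (c (n + N)))\<^sup>2)"
  have t0: "0 \<le> ?t N" for N
    using segment_le_tail[OF sm, of N N] by simp
  have bound: "(\<integral>\<^sup>+x. ennreal ((cmod (f x - psum c N x))\<^sup>2) \<partial>M) \<le> ennreal (?t N)" for N
  proof -
    have "(\<integral>\<^sup>+x. ennreal ((cmod (f x - psum c N x))\<^sup>2) \<partial>M)
       = (\<integral>\<^sup>+x. liminf (\<lambda>k. ennreal ((cmod (psum c (r k) x - psum c N x))\<^sup>2)) \<partial>M)"
    proof (rule nn_integral_cong_AE)
      show "AE x in M. ennreal ((cmod (f x - psum c N x))\<^sup>2) = liminf (\<lambda>k. ennreal ((cmod (psum c (r k) x - psum c N x))\<^sup>2))"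
        using lim
      proof eventually_elim
        case (elim x)
        then have "(\<lambda>k. ennreal ((cmod (psum c (r k) x - psum c N x))\<^sup>2)) \<longlonglongrightarrow> ennreal ((cmod (f x - psum c N x))\<^sup>2)"
          by (intro tendsto_intros)
        then show ?case by (rule lim_imp_Liminf[OF trivial_limit_sequentially, symmetric])
      qed
    qed
    also have "\<dots> \<le> liminf (\<lambda>k. \<integral>\<^sup>+x. ennreal ((cmod (psum c (r k) x - psum c N x))\<^sup>2) \<partial>M)"
      by (rule nn_integral_liminf) measurable
    also have "\<dots> \<le> ennreal (?t N)"
    proof (rule Liminf_le)
      show "\<forall>\<^sub>F k in sequentially. (\<integral>\<^sup>+x. ennreal ((cmod (psum c (r k) x - psum c N x))\<^sup>2) \<partial>M) \<le> ennreal (?t N)"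
        using filterlim_at_top[THEN iffD1, OF r, rule_format, of N]
      proof (eventually_elim)
        case (elim k)
        have "integrable M (\<lambda>x. (cmod (psum c (r k) x - psum c N x))\<^sup>2)"
          using square_integrable_diff[OF square_integrable_psum square_integrable_psum] square_integrableD by blast
        then have "(\<integral>\<^sup>+x. ennreal ((cmod (psum c (r k) x - psum c N x))\<^sup>2) \<partial>M)
           = ennreal (\<Sum>n=N..<r k. w n * (cmod (c n))\<^sup>2)"
          using integral_psum_diff_square[of N "r k" c] elim by (simp add: nn_integral_eq_integral)
        then show ?case using segment_le_tail[OF sm] by (simp add: ennreal_leI)
      qed
    qed simp
    finally show ?thesis .
  qed
  have sqd: "square_integrable M (\<lambda>x. f x - psum c N x)" for N
    unfolding square_integrable_def integrable_iff_bounded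
    using le_less_trans[OF bound[of N] ennreal_less_top] by simp
  \<comment> \<open>For N = 0 the partial sum vanishes, and the bound on the distance is a bound on
    \<open>f\<close> itself.\<close>
  have "square_integrable M f"
    using square_integrable_add(1)[OF sqd[of 0] square_integrable_psum[of c 0]] by simp
  moreover have "(LINT x|M. (cmod (f x - psum c N x))\<^sup>2) \<le> ?t N" for N
  proof -
    have "ennreal (LINT x|M. (cmod (f x - psum c N x))\<^sup>2) = (\<integral>\<^sup>+x. ennreal ((cmod (f x - psum c N x))\<^sup>2) \<partial>M)"
      using square_integrableD(2)[OF sqd] by (simp add: nn_integral_eq_integral)
    then have "ennreal (LINT x|M. (cmod (f x - psum c N x))\<^sup>2) \<le> ennreal (?t N)"
      using bound[of N] by simp
    then show ?thesis by (simp only: ennreal_le_iff[OF t0])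
  qed
  then have "(\<lambda>N. LINT x|M. (cmod (f x - psum c N x))\<^sup>2) \<longlonglongrightarrow> 0"
    by (intro tendsto_sandwich[OF _ _ tendsto_const tail_tendsto_0[OF sm]])
       (simp_all add: always_eventually)
  ultimately show ?thesis by (simp add: expands_def)
qed

lemma expands_sums:
  assumes "expands c f" "square_integrable M g"
  shows "(\<lambda>n. c n * (LINT x|M. e n x * g x)) sums (LINT x|M. f x * g x)"
proof -
  have "(\<lambda>N. LINT x|M. psum c N x * g x) \<longlonglongrightarrow> (LINT x|M. f x * g x)"
    using assms by (intro integral_square_tendsto_mult square_integrable_psum) (auto simp: expands_def)
  moreover have "(LINT x|M. psum c N x * g x) = (\<Sum>n<N. c n * (LINT x|M. e n x * g x))" for N
  proof -
    have "(LINT x|M. psum c N x * g x) = (LINT x|M. (\<Sum>n<N. c n * (e n x * g x)))"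
      by (simp add: psum_def sum_distrib_right mult.assoc)
    also have "\<dots> = (\<Sum>n<N. c n * (LINT x|M. e n x * g x))"
      using square_integrable_mult[OF e assms(2)] by (subst Bochner_Integration.integral_sum) simp_all
    finally show ?thesis .
  qed
  ultimately show ?thesis by (simp add: sums_def)
qed

lemma expands_coeff:
  assumes "expands c f"
  shows "(LINT x|M. f x * cnj (e n x)) = c n * of_real (w n)"
proof -
  have "(\<lambda>k. c k * (LINT x|M. e k x * cnj (e n x))) sums (LINT x|M. f x * cnj (e n x))"
    by (rule expands_sums[OF assms square_integrable_cnj[OF e]])
  moreover have "(\<lambda>k. c k * (LINT x|M. e k x * cnj (e n x))) = (\<lambda>k. if k = n then c n * of_real (w n) else 0)"
    by (auto simp: orth)
  ultimately show ?thesis using sums_unique2 sums_single[of n "\<lambda>k. c n * of_real (w n)"] by (metis (no_types, lifting))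
qed

lemma expands_Parseval:
  assumes "expands c f" "expands d g"
  shows "(\<lambda>n. of_real (w n) * (c n * cnj (d n))) sums (LINT x|M. f x * cnj (g x))"
proof -
  have g: "square_integrable M g" using assms by (simp add: expands_def)
  have "(LINT x|M. e n x * cnj (g x)) = cnj (d n) * of_real (w n)" for n
  proof -
    have "(LINT x|M. e n x * cnj (g x)) = (LINT x|M. cnj (g x * cnj (e n x)))" by (simp add: mult.commute)
    also have "\<dots> = cnj (LINT x|M. g x * cnj (e n x))" by (rule Bochner_Integration.integral_cnj)
    finally show ?thesis using expands_coeff[OF assms(2), of n] by simp
  qed
  then show ?thesis using expands_sums[OF assms(1) square_integrable_cnj[OF g]] by (simp add: mult_ac)
qed

lemma expands_norm:
  assumes "expands c f"
  shows "(\<lambda>n. w n * (cmod (c n))\<^sup>2) sums (LINT x|M. (cmod (f x))\<^sup>2)"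
proof -
  have "(\<lambda>n. of_real (w n * (cmod (c n))\<^sup>2)) sums (LINT x|M. complex_of_real ((cmod (f x))\<^sup>2))"
    using expands_Parseval[OF assms assms] by (simp only: complex_norm_square of_real_mult)
  then show ?thesis by (simp only: integral_complex_of_real sums_of_real_iff)
qed

text \<open>Along a subsequence with geometrically small increments the partial sums converge almost
  everywhere, and \<open>expandsI_pointwise\<close> upgrades the limit. Finiteness of the measure
  turns the L^2 bound on an increment into an L^1 bound.\<close>

lemma Riesz_Fischer:
  assumes fin: "finite_measure M" and sm: "summable (\<lambda>n. w n * (cmod (c n))\<^sup>2)"
  obtains f where "expands c f"
proof -
  interpret finite_measure M by fact
  note [measurable] = square_integrableD(1)[OF square_integrable_psum]
  let ?t = "\<lambda>N. (\<Sum>n. w (n + N) * (cmod (c (n + N)))\<^sup>2)"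
  \<comment> \<open>The square root of this bound is (1/2)^k, whose sum converges.\<close>
  have "\<exists>N. \<forall>m\<ge>N. ?t m < (1/4) ^ k" for k
    using order_tendstoD(2)[OF tail_tendsto_0[OF sm], of "(1/4) ^ k"] by (simp add: eventually_sequentially)
  \<comment> \<open>\<open>N0\<close> is here a local sequence of thresholds, unrelated to the
    operator.\<close>
  then obtain N0 where N0: "\<And>k m. m \<ge> N0 k \<Longrightarrow> ?t m < (1/4) ^ k" by metis
  \<comment> \<open>Summing the thresholds makes \<open>r\<close> monotone and at least
    \<open>N0 k\<close>; the added k makes it tend to infinity.\<close>
  define r where "r k = (\<Sum>i\<le>k. N0 i) + k" for k
  have r_ge: "r k \<ge> N0 k" for k
    unfolding r_def by (meson atMost_iff finite_atMost member_le_sum order_refl trans_le_add1 zero_le)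
  have r_mono: "r k \<le> r (Suc k)" for k by (simp add: r_def)
  have r_top: "filterlim r at_top sequentially"
    by (rule filterlim_at_top_mono[OF filterlim_ident]) (simp add: r_def)
  define d where "d k x = psum c (r (Suc k)) x - psum c (r k) x" for k x
  have sqd: "square_integrable M (d k)" for k
    unfolding d_def[abs_def] by (intro square_integrable_diff square_integrable_psum)
  note [measurable] = square_integrableD(1)[OF sqd]
  define m where "m = sqrt (measure M (space M))"
  have sq1: "square_integrable M (\<lambda>x. 1)" by (simp add: square_integrable_def)
  have intd: "integrable M (d k)" for k
    using square_integrable_mult[OF sqd sq1] by simp
  have d_small: "(LINT x|M. cmod (d k x)) \<le> (1/2) ^ k * m" for k
  proof -
    have sqa: "square_integrable M (\<lambda>x. of_real (cmod (d k x)))" using sqd[of k] by (simp add: square_integrable_def)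
    have "(LINT x|M. cmod (d k x)) = cmod (LINT x|M. of_real (cmod (d k x)) * 1)"
      by (simp add: abs_of_nonneg)
    also have "\<dots> \<le> sqrt (LINT x|M. (cmod (d k x))\<^sup>2) * m"
      using Cauchy_Schwarz_integral[OF sqa sq1] by (simp add: m_def)
    also have "(LINT x|M. (cmod (d k x))\<^sup>2) \<le> (1/4) ^ k"
      unfolding d_def integral_psum_diff_square[OF r_mono]
      using segment_le_tail[OF sm, of "r k" "r (Suc k)"] N0[OF r_ge[of k]] by simp
    then have "sqrt (LINT x|M. (cmod (d k x))\<^sup>2) \<le> sqrt ((1/4) ^ k)" by simp
    also have "sqrt ((1/4) ^ k) = (1/2) ^ k" by (simp add: real_sqrt_power real_sqrt_divide)
    finally show ?thesis by (simp add: m_def mult_right_mono)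
  qed
  have AEs: "AE x in M. summable (\<lambda>k. cmod (d k x))"
  proof -
    have "(\<integral>\<^sup>+x. (\<Sum>k. ennreal (cmod (d k x))) \<partial>M) = (\<Sum>k. \<integral>\<^sup>+x. ennreal (cmod (d k x)) \<partial>M)"
      by (rule nn_integral_suminf) measurable
    also have "\<dots> \<le> (\<Sum>k. ennreal ((1/2) ^ k * m))"
      using intd d_small
      by (intro suminf_le summableI) (simp add: nn_integral_eq_integral ennreal_leI)
    also have "\<dots> = ennreal (\<Sum>k. (1/2) ^ k * m)"
      by (rule suminf_ennreal2) (auto simp: m_def intro!: summable_mult2)
    also have "\<dots> < \<infinity>" by simp
    finally have "AE x in M. (\<Sum>k. ennreal (cmod (d k x))) \<noteq> \<infinity>"
      by (intro nn_integral_PInf_AE) auto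
    then show ?thesis by eventually_elim (auto intro!: summable_suminf_not_top)
  qed
  define f where "f x = psum c (r 0) x + (\<Sum>k. d k x)" for x
  have "expands c f"
  proof (rule expandsI_pointwise[OF sm _ r_top])
    show "f \<in> borel_measurable M" unfolding f_def[abs_def] by measurable
    show "AE x in M. (\<lambda>k. psum c (r k) x) \<longlonglongrightarrow> f x"
      using AEs
    proof eventually_elim
      case (elim x)
      then have "(\<lambda>k. \<Sum>i<k. d i x) \<longlonglongrightarrow> (\<Sum>k. d k x)"
        using summable_LIMSEQ[OF summable_norm_cancel[OF elim]] by simp
      then have "(\<lambda>k. psum c (r 0) x + (\<Sum>i<k. d i x)) \<longlonglongrightarrow> f x"
        unfolding f_def by (intro tendsto_intros)
      moreover have "psum c (r 0) x + (\<Sum>i<k. d i x) = psum c (r k) x" for k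
        by (simp add: d_def sum_lessThan_telescope[of "\<lambda>i. psum c (r i) x"])
      ultimately show ?case by simp
    qed
  qed
  then show ?thesis using that by blast
qed

end

subsection \<open>Bessel functions\<close>

text \<open>In the usual notation \<open>bes n\<close> is \<open>\<pi> J\<^sub>n\<close> and \<open>bes_div n x\<close> is \<open>\<pi> n J\<^sub>n(x) / x\<close>
  (see \<open>bes_recurrence\<close>), in a form that makes sense at \<open>x = 0\<close>.\<close>

definition bes :: "int \<Rightarrow> real \<Rightarrow> real" where
  "bes n x = integral {0..pi} (\<lambda>t. cos (of_int n * t) * cos (of_int n * pi / 2 - x * cos t))"

definition bes_div :: "int \<Rightarrow> real \<Rightarrow> real" where
  "bes_div n x = (bes (n - 1) x + bes (n + 1) x) / 2"

text \<open>Changing the order by one turns the phase by pi/2 and so exchanges cosine and sine.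
  Together with the addition formulas for the factor cos (n t) this yields both classical
  recurrences.\<close>

lemma bes_shift_minus: "cos (of_int (n - 1) * pi / 2 - y) = sin (of_int n * pi / 2 - y)"
proof -
  have "of_int (n - 1) * pi / 2 - y = (of_int n * pi / 2 - y) - pi / 2" by (simp add: field_simps)
  then show ?thesis by (simp only: cos_diff) simp
qed

lemma bes_shift_plus: "cos (of_int (n + 1) * pi / 2 - y) = - sin (of_int n * pi / 2 - y)"
proof -
  have "of_int (n + 1) * pi / 2 - y = (of_int n * pi / 2 - y) + pi / 2" by (simp add: field_simps)
  then show ?thesis by (simp only: cos_add) simp
qed

lemma bes_integrand_integrable:
  "(\<lambda>t. cos (of_int n * t) * cos (of_int m * pi / 2 - x * cos t)) integrable_on {0..pi}"
  by (intro integrable_continuous_interval continuous_intros)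

text \<open>Differentiation under the integral sign; this is the classical relation 2 J_n' = J_(n-1)
  - J_(n+1).\<close>

lemma bes_has_derivative:
  "(bes n has_real_derivative (bes (n - 1) x - bes (n + 1) x) / 2) (at x)"
proof -
  let ?y = "\<lambda>x t. of_int n * pi / 2 - x * cos t"
  have "((\<lambda>x. integral (cbox 0 pi) (\<lambda>t. cos (of_int n * t) * cos (?y x t)))
      has_field_derivative integral (cbox 0 pi) (\<lambda>t. cos (of_int n * t) * (cos t * sin (?y x t))))
      (at x within UNIV)"
  proof (rule leibniz_rule_field_derivative)
    fix x t :: real
    show "((\<lambda>x. cos (of_int n * t) * cos (?y x t)) has_field_derivative
        cos (of_int n * t) * (cos t * sin (?y x t))) (at x within UNIV)"
      by (auto intro!: derivative_eq_intros)
  qed (auto intro!: integrable_continuous_interval continuous_intros simp: split_beta)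
  moreover have "integral {0..pi} (\<lambda>t. cos (of_int n * t) * (cos t * sin (?y x t)))
      = (bes (n - 1) x - bes (n + 1) x) / 2"
  proof -
    have "cos (of_int n * t) * (cos t * sin (?y x t))
        = (cos (of_int (n - 1) * t) * cos (of_int (n - 1) * pi / 2 - x * cos t)
           - cos (of_int (n + 1) * t) * cos (of_int (n + 1) * pi / 2 - x * cos t)) / 2" for t
      by (simp only: bes_shift_minus bes_shift_plus) (simp add: algebra_simps cos_add cos_diff)
    then show ?thesis
      unfolding bes_def
      by (simp only: integral_divide)
         (subst Henstock_Kurzweil_Integration.integral_diff[OF bes_integrand_integrable bes_integrand_integrable], simp)
  qed
  ultimately show ?thesis unfolding bes_def by simp
qed

lemma continuous_on_bes [continuous_intros]: "continuous_on S (bes n)"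
  using bes_has_derivative DERIV_isCont continuous_at_imp_continuous_on by blast

lemma continuous_on_bes_div [continuous_intros]: "continuous_on S (bes_div n)"
  unfolding bes_div_def[abs_def] by (intro continuous_intros) auto

lemma sin_int_pi: "sin (of_int n * pi) = (0::real)"
  by (simp add: sin_zero_iff_int2)

lemma sin_pi_int: "sin (pi * of_int n) = (0::real)"
  by (metis sin_int_pi mult.commute)

text \<open>The t-derivative of sin (n t) cos (n pi / 2 - x cos t) is integrated over [0, pi], where
  the sine kills both boundary terms. This is 2 n J_n = x (J_(n-1) + J_(n+1)), and it justifies
  reading \<open>bes_div n x\<close> as a quotient by x without singularity at 0.\<close>

lemma bes_recurrence: "of_int n * bes n x = x * bes_div n x"
proof -
  let ?y = "\<lambda>t. of_int n * pi / 2 - x * cos t"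
  have "((\<lambda>t. of_int n * cos (of_int n * t) * cos (?y t) - x * (sin (of_int n * t) * sin t * sin (?y t)))
     has_integral sin (of_int n * pi) * cos (?y pi) - sin (of_int n * 0) * cos (?y 0)) {0..pi}"
    by (rule fundamental_theorem_of_calculus)
       (auto intro!: derivative_eq_intros simp flip: has_real_derivative_iff_has_vector_derivative
          simp: algebra_simps)
  then have "((\<lambda>t. of_int n * cos (of_int n * t) * cos (?y t) - x * (sin (of_int n * t) * sin t * sin (?y t)))
     has_integral 0) {0..pi}" by (simp add: sin_int_pi)
  moreover have "of_int n * cos (of_int n * t) * cos (?y t) - x * (sin (of_int n * t) * sin t * sin (?y t))
     = of_int n * (cos (of_int n * t) * cos (?y t)) - x / 2 *
        (cos (of_int (n - 1) * t) * cos (of_int (n - 1) * pi / 2 - x * cos t)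
           + cos (of_int (n + 1) * t) * cos (of_int (n + 1) * pi / 2 - x * cos t))" for t
    by (simp only: bes_shift_minus bes_shift_plus) (simp add: algebra_simps cos_add cos_diff)
  ultimately have "((\<lambda>t. of_int n * (cos (of_int n * t) * cos (?y t)) - x / 2 *
        (cos (of_int (n - 1) * t) * cos (of_int (n - 1) * pi / 2 - x * cos t)
           + cos (of_int (n + 1) * t) * cos (of_int (n + 1) * pi / 2 - x * cos t))) has_integral 0) {0..pi}"
    by simp
  moreover have "((\<lambda>t. of_int n * (cos (of_int n * t) * cos (?y t)) - x / 2 *
        (cos (of_int (n - 1) * t) * cos (of_int (n - 1) * pi / 2 - x * cos t)
           + cos (of_int (n + 1) * t) * cos (of_int (n + 1) * pi / 2 - x * cos t)))
      has_integral (of_int n * bes n x - x / 2 * (bes (n - 1) x + bes (n + 1) x))) {0..pi}"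
    unfolding bes_def
    by (intro has_integral_diff has_integral_mult_right has_integral_add integrable_integral
        bes_integrand_integrable)
  ultimately have "of_int n * bes n x - x / 2 * (bes (n - 1) x + bes (n + 1) x) = 0"
    by (rule has_integral_unique[symmetric])
  then show ?thesis by (simp add: bes_div_def)
qed

lemma bes_at_0: "bes n 0 = (if n = 0 then pi else 0)"
proof (cases "n = 0")
  case False
  have "((\<lambda>t. cos (of_int n * t)) has_integral
      (sin (of_int n * pi) / of_int n - sin (of_int n * 0) / of_int n)) {0..pi}"
    by (rule fundamental_theorem_of_calculus)
       (use False in \<open>auto intro!: derivative_eq_intros simp flip: has_real_derivative_iff_has_vector_derivative\<close>)
  then have "integral {0..pi} (\<lambda>t. cos (of_int n * t)) = 0"
    by (simp add: sin_int_pi integral_unique)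
  then show ?thesis using False unfolding bes_def by simp
qed (simp add: bes_def)

text \<open>The phase at -x is n pi minus the phase at x.\<close>

lemma bes_reflect: "bes n (- x) = (if even n then bes n x else - bes n x)"
proof -
  have "cos (of_int n * t) * cos (of_int n * pi / 2 - (- x) * cos t)
      = (if even n then 1 else -1) * (cos (of_int n * t) * cos (of_int n * pi / 2 - x * cos t))" for t
  proof -
    have "of_int n * pi / 2 - (- x) * cos t = of_int n * pi - (of_int n * pi / 2 - x * cos t)"
      by simp
    then have "cos (of_int n * pi / 2 - (- x) * cos t) =
       cos (of_int n * pi) * cos (of_int n * pi / 2 - x * cos t)"
      by (simp only: cos_diff[of "of_int n * pi"]) (simp add: sin_int_pi)
    moreover have "cos (of_int n * pi) = (if even n then 1 else -1 :: real)"
      using cos_npi_int[of n] by (simp add: mult.commute)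
    ultimately show ?thesis by simp
  qed
  then show ?thesis unfolding bes_def by (simp only: integral_mult_right) simp
qed

lemma bes_div_reflect: "bes_div n (- x) = (if even n then - bes_div n x else bes_div n x)"
  by (cases "even n") (simp_all add: bes_div_def bes_reflect field_simps)

text \<open>The recurrence for order 0 gives it after division by x, hence the separate case x =
  0.\<close>

lemma bes_minus_1: "bes (- 1) x = - bes 1 x"
proof (cases "x = 0")
  case False
  then show ?thesis using bes_recurrence[of 0 x] by (simp add: bes_div_def)
qed (simp add: bes_at_0)

text \<open>The quantity \<open>Q\<close> below is the energy of \<open>sqrt x * bes 0 x\<close>, which solves
  \<open>w'' + (1 + 1/(4x\<^sup>2)) w = 0\<close>; it is nonincreasing.\<close>

lemma bes_01_decay:
  obtains C where "\<And>x. x \<ge> 1 \<Longrightarrow> x * (bes 0 x)\<^sup>2 \<le> C" "\<And>x. x \<ge> 1 \<Longrightarrow> x * (bes 1 x)\<^sup>2 \<le> C"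
proof -
  define Q where "Q x = x * (bes 1 x)\<^sup>2 - bes 0 x * bes 1 x + (bes 0 x)\<^sup>2 / (2 * x) + x * (bes 0 x)\<^sup>2" for x
  have d0: "(bes 0 has_real_derivative - bes 1 x) (at x)" for x
    using bes_has_derivative[of 0 x] by (simp add: bes_minus_1)
  have d1: "(bes 1 has_real_derivative bes 0 x - bes 1 x / x) (at x)" if "x > 0" for x
  proof -
    have "bes 2 x = 2 * bes 1 x / x - bes 0 x"
      using bes_recurrence[of 1 x] that by (simp add: bes_div_def field_simps)
    then have eq: "(bes 0 x - bes 2 x) / 2 = bes 0 x - bes 1 x / x" by (simp add: field_simps)
    have "(bes 1 has_real_derivative (bes 0 x - bes 2 x) / 2) (at x)"
      using bes_has_derivative[of 1 x] by simp
    then show ?thesis by (simp only: eq)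
  qed
  have dQ: "(Q has_real_derivative - (bes 0 x)\<^sup>2 / (2 * x\<^sup>2)) (at x)" if "x > 0" for x
  proof -
    have "((\<lambda>x. x * (bes 1 x)\<^sup>2) has_real_derivative 1 * (bes 1 x)\<^sup>2 + 2 * (bes 0 x - bes 1 x / x) * bes 1 x * x) (at x)"
      using DERIV_mult[OF DERIV_ident DERIV_power[OF d1[OF that], of 2]] by (simp add: algebra_simps)
    moreover have "((\<lambda>x. bes 0 x * bes 1 x) has_real_derivative - bes 1 x * bes 1 x + (bes 0 x - bes 1 x / x) * bes 0 x) (at x)"
      by (rule DERIV_mult[OF d0 d1[OF that]])
    moreover have "((\<lambda>x. (bes 0 x)\<^sup>2 / (2 * x)) has_real_derivative - (bes 0 x * bes 1 x / x) - (bes 0 x)\<^sup>2 / (2 * x\<^sup>2)) (at x)"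
      by (rule DERIV_cong[OF DERIV_divide[OF DERIV_power[OF d0, of 2] DERIV_cmult_Id]])
         (use that in \<open>simp_all add: field_simps power2_eq_square\<close>)
    moreover have "((\<lambda>x. x * (bes 0 x)\<^sup>2) has_real_derivative 1 * (bes 0 x)\<^sup>2 + 2 * (- bes 1 x) * bes 0 x * x) (at x)"
      using DERIV_mult[OF DERIV_ident DERIV_power[OF d0, of 2]] by (simp add: algebra_simps)
    ultimately have "(Q has_real_derivative
        1 * (bes 1 x)\<^sup>2 + 2 * (bes 0 x - bes 1 x / x) * bes 1 x * x
        - (- bes 1 x * bes 1 x + (bes 0 x - bes 1 x / x) * bes 0 x)
        + (- (bes 0 x * bes 1 x / x) - (bes 0 x)\<^sup>2 / (2 * x\<^sup>2))
        + (1 * (bes 0 x)\<^sup>2 + 2 * (- bes 1 x) * bes 0 x * x)) (at x)"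
      unfolding Q_def by (intro DERIV_add DERIV_diff)
    then show ?thesis
      by (rule DERIV_cong) (use that in \<open>simp add: field_simps power2_eq_square\<close>)
  qed
  have Q: "Q x \<le> Q 1" if "x \<ge> 1" for x
  proof (rule DERIV_nonpos_imp_nonincreasing[OF that])
    fix t :: real assume "1 \<le> t"
    then show "\<exists>y. (Q has_real_derivative y) (at t) \<and> y \<le> 0"
      by (intro exI[of _ "- (bes 0 t)\<^sup>2 / (2 * t\<^sup>2)"] conjI dQ) simp_all
  qed
  \<comment> \<open>Completing the square in \<open>bes 1 x\<close> exhibits \<open>Q\<close> as a
    sum of nonnegative terms, so that a bound on \<open>Q\<close> bounds each of them.\<close>
  have Q_eq: "Q x = x * (bes 0 x)\<^sup>2 + (bes 0 x)\<^sup>2 / (4 * x) + x * (bes 1 x - bes 0 x / (2 * x))\<^sup>2" if "x > 0" for x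
    using that by (simp add: Q_def power2_eq_square field_simps)
  have 0: "x * (bes 0 x)\<^sup>2 \<le> Q 1" if "x \<ge> 1" for x
  proof -
    have "0 \<le> (bes 0 x)\<^sup>2 / (4 * x)" "0 \<le> x * (bes 1 x - bes 0 x / (2 * x))\<^sup>2" using that by simp_all
    then show ?thesis using Q[OF that] Q_eq[of x] that by linarith
  qed
  have 1: "x * (bes 1 x)\<^sup>2 \<le> 4 * Q 1" if x: "x \<ge> 1" for x
  proof -
    have a: "x * (bes 1 x - bes 0 x / (2 * x))\<^sup>2 \<le> Q 1"
    proof -
      have "0 \<le> (bes 0 x)\<^sup>2 / (4 * x)" "0 \<le> x * (bes 0 x)\<^sup>2" using that by simp_all
      then show ?thesis using Q[OF that] Q_eq[of x] that by linarith
    qed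
    have "(bes 1 x)\<^sup>2 \<le> 2 * (bes 1 x - bes 0 x / (2 * x))\<^sup>2 + 2 * (bes 0 x / (2 * x))\<^sup>2"
      using zero_le_power2[of "bes 1 x - bes 0 x / (2 * x) - bes 0 x / (2 * x)"]
      by (simp add: power2_eq_square algebra_simps)
    also have "(bes 0 x / (2 * x))\<^sup>2 \<le> (bes 0 x)\<^sup>2"
    proof -
      have "\<bar>bes 0 x / (2 * x)\<bar> \<le> \<bar>bes 0 x\<bar>"
        using x mult_left_mono[of 1 "2 * x" "\<bar>bes 0 x\<bar>"] by (simp add: abs_div divide_le_eq)
      then show ?thesis using abs_le_square_iff by blast
    qed
    finally have "x * (bes 1 x)\<^sup>2 \<le> x * (2 * (bes 1 x - bes 0 x / (2 * x))\<^sup>2 + 2 * (bes 0 x)\<^sup>2)"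
      using x by (simp add: mult_left_mono)
    then show ?thesis using a 0[OF x] by (simp add: algebra_simps)
  qed
  have "0 \<le> Q 1" using 0[of 1] zero_le_power2[of "bes 0 1"] by linarith
  then show ?thesis using 0 1 by (intro that[of "4 * Q 1"]) (force intro: order_trans)+
qed

lemma tendsto_0_of_sqrt_decay:
  fixes f :: "real \<Rightarrow> real"
  assumes "\<And>x. x \<ge> 1 \<Longrightarrow> x * (f x)\<^sup>2 \<le> C"
  shows "(f \<longlongrightarrow> 0) at_top"
proof -
  have "((\<lambda>x. C / x) \<longlongrightarrow> 0) at_top"
    by (intro tendsto_divide_0[OF tendsto_const] filterlim_at_top_imp_at_infinity filterlim_ident)
  then have "((\<lambda>x. (f x)\<^sup>2) \<longlongrightarrow> 0) at_top"
  proof (rule Lim_null_comparison[rotated])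
    show "\<forall>\<^sub>F x in at_top. norm ((f x)\<^sup>2) \<le> C / x"
      using eventually_ge_at_top[of 1] by eventually_elim (use assms in \<open>auto simp: field_simps\<close>)
  qed
  from tendsto_real_sqrt[OF this] show ?thesis by (simp add: tendsto_rabs_zero_iff)
qed

text \<open>The decay is known for orders 0 and 1; the three-term recurrence carries it upwards,
  which is why the induction treats two consecutive orders at once.\<close>

lemma bes_tendsto_0: "(bes (int n) \<longlongrightarrow> 0) at_top"
proof -
  obtain C where C: "\<And>x. x \<ge> 1 \<Longrightarrow> x * (bes 0 x)\<^sup>2 \<le> C" "\<And>x. x \<ge> 1 \<Longrightarrow> x * (bes 1 x)\<^sup>2 \<le> C"
    using bes_01_decay by blast
  have "(bes (int n) \<longlongrightarrow> 0) at_top \<and> (bes (int (Suc n)) \<longlongrightarrow> 0) at_top"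
  proof (induction n)
    case 0
    then show ?case using C tendsto_0_of_sqrt_decay by auto
  next
    case (Suc n)
    have "((\<lambda>x. 2 * of_int (int (Suc n)) * bes (int (Suc n)) x * (1 / x) - bes (int n) x)
        \<longlongrightarrow> 2 * of_int (int (Suc n)) * 0 * 0 - 0) at_top"
      using Suc
      by (intro tendsto_intros tendsto_divide_0[OF tendsto_const] filterlim_at_top_imp_at_infinity filterlim_ident) auto
    moreover have "\<forall>\<^sub>F x in at_top. 2 * of_int (int (Suc n)) * bes (int (Suc n)) x * (1 / x) - bes (int n) x
        = bes (int (Suc (Suc n))) x"
      using eventually_gt_at_top[of 0]
    proof eventually_elim
      case (elim x)
      then show ?case using bes_recurrence[of "int (Suc n)" x] by (simp add: bes_div_def field_simps)
    qed
    ultimately show ?case using Suc by (auto elim: Lim_transform_eventually)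
  qed
  then show ?thesis by simp
qed

section \<open>Truncated integrals of products of Bessel functions\<close>

definition bes_P :: "int \<Rightarrow> int \<Rightarrow> real \<Rightarrow> real" where
  "bes_P n m R = integral {0..R} (\<lambda>x. bes n x * bes m x)"

definition bes_D :: "int \<Rightarrow> int \<Rightarrow> real \<Rightarrow> real" where
  "bes_D n m R = integral {0..R} (\<lambda>x. x * bes_div n x * bes_div m x)"

lemma bes_P_commute: "bes_P n m = bes_P m n"
  by (simp add: bes_P_def fun_eq_iff mult.commute)

lemma bes_D_commute: "bes_D n m = bes_D m n"
  by (simp add: bes_D_def fun_eq_iff mult_ac)

lemma bes_P_integrable: "(\<lambda>x. bes n x * bes m x) integrable_on {0..R}"
  by (intro integrable_continuous_interval continuous_intros)

text \<open>The recurrence rewrites \<open>x * bes_div m x\<close> as a multiple of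
  \<open>bes m x\<close>, which reduces the quadratic integrals wanted to the simpler
  \<open>bes_P\<close>. The two indices enter differently, and \<open>bes_D_offdiag_eq\<close>
  exploits that they may be exchanged.\<close>

lemma bes_D_eq: "2 * bes_D n m R = of_int m * (bes_P (n - 1) m R + bes_P (n + 1) m R)"
proof -
  have "2 * (x * bes_div n x * bes_div m x) = of_int m * (bes (n - 1) x * bes m x + bes (n + 1) x * bes m x)" for x
  proof -
    have "2 * (x * bes_div n x * bes_div m x) = 2 * bes_div n x * (x * bes_div m x)" by simp
    also have "\<dots> = 2 * bes_div n x * (of_int m * bes m x)" by (simp add: bes_recurrence)
    finally show ?thesis by (simp add: bes_div_def algebra_simps)
  qed
  then have "2 * bes_D n m R = integral {0..R} (\<lambda>x. of_int m * (bes (n - 1) x * bes m x + bes (n + 1) x * bes m x))"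
    unfolding bes_D_def by (simp flip: integral_mult_right)
  also have "\<dots> = of_int m * (bes_P (n - 1) m R + bes_P (n + 1) m R)"
    unfolding bes_P_def by (simp add: Henstock_Kurzweil_Integration.integral_add bes_P_integrable)
  finally show ?thesis .
qed

text \<open>The product rule for \<open>bes n * bes m\<close>, integrated from 0 to R.\<close>

lemma bes_P_boundary:
  assumes "R \<ge> 0"
  shows "2 * (bes n R * bes m R - bes n 0 * bes m 0)
    = bes_P (n - 1) m R - bes_P (n + 1) m R + bes_P n (m - 1) R - bes_P n (m + 1) R"
proof -
  have "((\<lambda>x. (bes (n - 1) x - bes (n + 1) x) / 2 * bes m x + (bes (m - 1) x - bes (m + 1) x) / 2 * bes n x)
     has_integral bes n R * bes m R - bes n 0 * bes m 0) {0..R}"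
  proof (rule fundamental_theorem_of_calculus[OF assms])
    fix x
    show "((\<lambda>x. bes n x * bes m x) has_vector_derivative
        (bes (n - 1) x - bes (n + 1) x) / 2 * bes m x + (bes (m - 1) x - bes (m + 1) x) / 2 * bes n x)
        (at x within {0..R})"
      using has_vector_derivative_at_within[OF DERIV_mult[OF bes_has_derivative bes_has_derivative,
          unfolded has_real_derivative_iff_has_vector_derivative]] .
  qed
  then have "((\<lambda>x. 2 * ((bes (n - 1) x - bes (n + 1) x) / 2 * bes m x + (bes (m - 1) x - bes (m + 1) x) / 2 * bes n x))
     has_integral 2 * (bes n R * bes m R - bes n 0 * bes m 0)) {0..R}"
    by (rule has_integral_mult_right)
  moreover have "((\<lambda>x. bes (n - 1) x * bes m x - bes (n + 1) x * bes m x + bes n x * bes (m - 1) x - bes n x * bes (m + 1) x)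
    has_integral bes_P (n - 1) m R - bes_P (n + 1) m R + bes_P n (m - 1) R - bes_P n (m + 1) R) {0..R}"
    unfolding bes_P_def by (intro has_integral_diff has_integral_add integrable_integral bes_P_integrable)
  moreover have "2 * ((bes (n - 1) x - bes (n + 1) x) / 2 * bes m x + (bes (m - 1) x - bes (m + 1) x) / 2 * bes n x)
     = bes (n - 1) x * bes m x - bes (n + 1) x * bes m x + bes n x * bes (m - 1) x - bes n x * bes (m + 1) x" for x
    by (simp add: field_simps)
  ultimately show ?thesis
    by (simp only: has_integral_unique)
qed

text \<open>The integrand decays only like 1/x, with an oscillating factor, so the limit is
  improper. By \<open>bes_P_boundary\<close> the passage from n to n + 1 changes the value by a
  boundary term that tends to 0; the common limit is half the square of \<open>bes 0 0\<close>,
  which is pi.\<close>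

lemma bes_P_diag: "(bes_P (int n + 1) (int n) \<longlongrightarrow> pi\<^sup>2 / 2) at_top"
proof (induction n)
  case 0
  have "\<forall>\<^sub>F R in at_top. (pi\<^sup>2 - (bes 0 R)\<^sup>2) / 2 = bes_P 1 0 R"
    using eventually_ge_at_top[of 0]
  proof eventually_elim
    case (elim R)
    have "bes_P (-1) 0 R = - bes_P 1 0 R" unfolding bes_P_def by (simp add: bes_minus_1)
    then show ?case using bes_P_boundary[OF elim, of 0 0] bes_P_commute[of 0 1] bes_P_commute[of 0 "-1"]
      by (simp add: bes_at_0 power2_eq_square)
  qed
  moreover have "((\<lambda>R. (pi\<^sup>2 - (bes 0 R)\<^sup>2) / 2) \<longlongrightarrow> (pi\<^sup>2 - 0\<^sup>2) / 2) at_top"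
    using bes_tendsto_0[of 0] by (intro tendsto_intros) auto
  ultimately show ?case by (auto elim: Lim_transform_eventually)
next
  case (Suc n)
  have "\<forall>\<^sub>F R in at_top. bes_P (int n + 1) (int n) R - (bes (int (Suc n)) R)\<^sup>2 = bes_P (int (Suc n) + 1) (int (Suc n)) R"
    using eventually_ge_at_top[of 0]
  proof eventually_elim
    case (elim R)
    show ?case using bes_P_boundary[OF elim, of "int (Suc n)" "int (Suc n)"]
        bes_P_commute[of "int n" "int n + 1"] bes_P_commute[of "int n + 1" "int n + 2"]
      by (simp add: bes_at_0 power2_eq_square algebra_simps)
  qed
  moreover have "((\<lambda>R. bes_P (int n + 1) (int n) R - (bes (int (Suc n)) R)\<^sup>2) \<longlongrightarrow> pi\<^sup>2 / 2 - 0\<^sup>2) at_top"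
    using bes_tendsto_0[of "Suc n"] Suc by (intro tendsto_intros) auto
  ultimately show ?case by (auto elim: Lim_transform_eventually)
qed

lemma bes_D_diag: "n \<ge> 1 \<Longrightarrow> (bes_D (int n) (int n) \<longlongrightarrow> real n * pi\<^sup>2 / 2) at_top"
proof -
  assume "n \<ge> 1"
  then obtain k where k: "n = Suc k" by (cases n) auto
  have "bes_D (int n) (int n) = (\<lambda>R. real n / 2 * (bes_P (int k + 1) (int k) R + bes_P (int n + 1) (int n) R))"
    using bes_D_eq[of "int n" "int n"] bes_P_commute[of "int k" "int n"]
    by (auto simp: fun_eq_iff k field_simps)
  moreover have "((\<lambda>R. real n / 2 * (bes_P (int k + 1) (int k) R + bes_P (int n + 1) (int n) R))
     \<longlongrightarrow> real n / 2 * (pi\<^sup>2 / 2 + pi\<^sup>2 / 2)) at_top"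
    by (intro tendsto_intros bes_P_diag)
  ultimately show ?thesis by simp
qed

text \<open>\<open>bes_D_eq\<close> expresses the same integral through either index. Multiplying
  one expression by n, the other by m and subtracting isolates (n - m) times the integral;
  \<open>bes_P_boundary\<close> then removes two of the four integrals on the right.\<close>

lemma bes_D_offdiag_eq:
  assumes "R \<ge> 0" and nm: "n \<noteq> 0" "m \<noteq> 0" "n \<noteq> m"
  shows "bes_D n m R = of_int n * of_int m / of_int (n - m) *
    (bes_P (n - 1) m R - bes_P n (m + 1) R - bes n R * bes m R)"
proof -
  have z: "bes n 0 * bes m 0 = 0" using nm by (auto simp: bes_at_0)
  have 1: "2 * bes_D n m R = of_int m * (bes_P (n - 1) m R + bes_P (n + 1) m R)" by (rule bes_D_eq)
  have 2: "2 * bes_D n m R = of_int n * (bes_P n (m - 1) R + bes_P n (m + 1) R)"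
    using bes_D_eq[of m n R] by (simp add: bes_D_commute bes_P_commute)
  have "of_int (n - m) * (2 * bes_D n m R) = of_int n * of_int m * 2 *
      (bes_P (n - 1) m R - bes_P n (m + 1) R - bes n R * bes m R)"
  proof -
    have "of_int (n - m) * (2 * bes_D n m R) = of_int n * (2 * bes_D n m R) - of_int m * (2 * bes_D n m R)"
      by (simp add: algebra_simps)
    also have "\<dots> = of_int n * of_int m * ((bes_P (n - 1) m R + bes_P (n + 1) m R) - (bes_P n (m - 1) R + bes_P n (m + 1) R))"
      by (subst 1, subst 2) (simp add: algebra_simps)
    also have "(bes_P (n - 1) m R + bes_P (n + 1) m R) - (bes_P n (m - 1) R + bes_P n (m + 1) R)
       = 2 * (bes_P (n - 1) m R - bes_P n (m + 1) R - bes n R * bes m R)"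
      using bes_P_boundary[OF assms(1), of n m] z by simp
    finally show ?thesis by simp
  qed
  then show ?thesis using nm by (simp add: field_simps)
qed

text \<open>In the step, the two integrals in \<open>bes_D_offdiag_eq\<close> have index difference
  2 j + 1 and the same limit, so they cancel and \<open>bes_D\<close> tends to 0. Then
  \<open>bes_D_eq\<close> reverses the sign from one j to the next.\<close>

lemma bes_P_odd_diff: "(bes_P (int (m + 2 * j + 1)) (int m) \<longlongrightarrow> (-1) ^ j * pi\<^sup>2 / 2) at_top"
proof (induction j arbitrary: m)
  case 0
  show ?case using bes_P_diag[of m] by (simp add: add.commute)
next
  case (Suc j)
  let ?n = "int (m + 2 * j + 2)"
  have a: "(bes_P (?n - 1) (int m) \<longlongrightarrow> (-1) ^ j * pi\<^sup>2 / 2) at_top" using Suc[of m] by simp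
  have b: "(bes_P ?n (int m + 1) \<longlongrightarrow> (-1) ^ j * pi\<^sup>2 / 2) at_top"
    using Suc[of "m + 1"] by (simp add: algebra_simps)
  have c: "((\<lambda>R. bes ?n R * bes (int m) R) \<longlongrightarrow> 0 * 0) at_top" by (intro tendsto_intros bes_tendsto_0)
  have eq: "bes_P (?n + 1) (int m) R = bes_P ?n (int m - 1) R + bes_P (?n - 1) (int m) R - bes_P ?n (int m + 1) R
        - 2 * (bes ?n R * bes (int m) R)" if "R \<ge> 0" for R
    using bes_P_boundary[OF that, of ?n "int m"] by (simp add: bes_at_0)
  have nn: "int (m + 2 * Suc j + 1) = ?n + 1" by simp
  show ?case
  proof (cases "m = 0")
    \<comment> \<open>For m = 0 the formula for \<open>bes_D\<close> cannot be solved for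
      \<open>bes_P\<close>; the relation between the orders -1 and 1 takes its place.\<close>
    case True
    have "bes_P ?n (-1) R = - bes_P ?n 1 R" for R unfolding bes_P_def by (simp add: bes_minus_1)
    then have "\<forall>\<^sub>F R in at_top. bes_P (?n - 1) (int m) R - 2 * bes_P ?n (int m + 1) R - 2 * (bes ?n R * bes (int m) R)
       = bes_P (?n + 1) (int m) R"
      using eq True by (intro eventually_mono[OF eventually_ge_at_top[of 0]]) simp
    moreover have "((\<lambda>R. bes_P (?n - 1) (int m) R - 2 * bes_P ?n (int m + 1) R - 2 * (bes ?n R * bes (int m) R))
       \<longlongrightarrow> (-1) ^ j * pi\<^sup>2 / 2 - 2 * ((-1) ^ j * pi\<^sup>2 / 2) - 2 * (0 * 0)) at_top"
      by (intro tendsto_intros a b c)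
    ultimately show ?thesis unfolding nn by (auto elim: Lim_transform_eventually)
  next
    case False
    have "\<forall>\<^sub>F R in at_top. 2 / of_int (int m) * (of_int ?n * of_int (int m) / of_int (?n - int m) *
        (bes_P (?n - 1) (int m) R - bes_P ?n (int m + 1) R - bes ?n R * bes (int m) R)) - bes_P (?n - 1) (int m) R
       = bes_P (?n + 1) (int m) R"
      using eventually_ge_at_top[of 0]
    proof eventually_elim
      case (elim R)
      have "bes_P (?n + 1) (int m) R = 2 / of_int (int m) * bes_D ?n (int m) R - bes_P (?n - 1) (int m) R"
        using bes_D_eq[of ?n "int m" R] False by (simp add: field_simps)
      then show ?case using bes_D_offdiag_eq[OF elim, of ?n "int m"] False by simp
    qed
    moreover have "((\<lambda>R. 2 / of_int (int m) * (of_int ?n * of_int (int m) / of_int (?n - int m) *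
        (bes_P (?n - 1) (int m) R - bes_P ?n (int m + 1) R - bes ?n R * bes (int m) R)) - bes_P (?n - 1) (int m) R)
       \<longlongrightarrow> 2 / of_int (int m) * (of_int ?n * of_int (int m) / of_int (?n - int m) *
        ((-1) ^ j * pi\<^sup>2 / 2 - (-1) ^ j * pi\<^sup>2 / 2 - 0 * 0)) - (-1) ^ j * pi\<^sup>2 / 2) at_top"
      by (intro tendsto_intros a b c)
    ultimately show ?thesis unfolding nn by (auto elim: Lim_transform_eventually)
  qed
qed

text \<open>Both integrals in \<open>bes_D_offdiag_eq\<close> have index difference 2 j + 1, hence
  equal limits, and the boundary term vanishes at infinity.\<close>

lemma bes_D_offdiag:
  assumes "m \<ge> 1"
  shows "(bes_D (int (m + 2 * j + 2)) (int m) \<longlongrightarrow> 0) at_top"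
proof -
  let ?n = "int (m + 2 * j + 2)"
  have a: "(bes_P (?n - 1) (int m) \<longlongrightarrow> (-1) ^ j * pi\<^sup>2 / 2) at_top" using bes_P_odd_diff[of m j] by simp
  have b: "(bes_P ?n (int m + 1) \<longlongrightarrow> (-1) ^ j * pi\<^sup>2 / 2) at_top"
    using bes_P_odd_diff[of "m + 1" j] by (simp add: algebra_simps)
  have c: "((\<lambda>R. bes ?n R * bes (int m) R) \<longlongrightarrow> 0 * 0) at_top" by (intro tendsto_intros bes_tendsto_0)
  have "((\<lambda>R. of_int ?n * of_int (int m) / of_int (?n - int m) *
        (bes_P (?n - 1) (int m) R - bes_P ?n (int m + 1) R - bes ?n R * bes (int m) R))
       \<longlongrightarrow> of_int ?n * of_int (int m) / of_int (?n - int m) *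
        ((-1) ^ j * pi\<^sup>2 / 2 - (-1) ^ j * pi\<^sup>2 / 2 - 0 * 0)) at_top"
    by (intro tendsto_intros a b c)
  moreover have "\<forall>\<^sub>F R in at_top. of_int ?n * of_int (int m) / of_int (?n - int m) *
        (bes_P (?n - 1) (int m) R - bes_P ?n (int m + 1) R - bes ?n R * bes (int m) R) = bes_D ?n (int m) R"
    using eventually_ge_at_top[of 0]
    by eventually_elim (use bes_D_offdiag_eq assms in simp)
  ultimately show ?thesis by (auto elim: Lim_transform_eventually)
qed

section \<open>Bessel products as Lebesgue integrals\<close>

definition bes_half :: "nat \<Rightarrow> nat \<Rightarrow> real \<Rightarrow> real" where
  "bes_half n m x = indicator {0..} x * (x * bes_div (int n) x * bes_div (int m) x)"

lemma borel_measurable_bes_div [measurable]: "bes_div n \<in> borel_measurable borel"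
  by (intro borel_measurable_continuous_onI continuous_intros)

lemma borel_measurable_bes_half [measurable]: "bes_half n m \<in> borel_measurable borel"
  unfolding bes_half_def[abs_def] by measurable

lemma has_bochner_integral_bes_half_cutoff:
  "has_bochner_integral lborel (\<lambda>x. bes_half n m x * indicator {..R} x) (bes_D (int n) (int m) R)"
proof -
  have c: "continuous_on {0..R} (\<lambda>x. x * bes_div (int n) x * bes_div (int m) x)"
    by (intro continuous_intros)
  have "set_integrable lborel {0..R} (\<lambda>x. x * bes_div (int n) x * bes_div (int m) x)"
    by (rule borel_integrable_atLeastAtMost') (rule c)
  moreover from this have "(LINT x:{0..R}|lborel. x * bes_div (int n) x * bes_div (int m) x) = bes_D (int n) (int m) R"
    unfolding bes_D_def by (rule set_borel_integral_eq_integral)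
  moreover have "(\<lambda>x. bes_half n m x * indicator {..R} x)
      = (\<lambda>x. indicator {0..R} x *\<^sub>R (x * bes_div (int n) x * bes_div (int m) x))"
    by (auto simp: bes_half_def indicator_def fun_eq_iff)
  ultimately show ?thesis
    by (simp add: has_bochner_integral_iff set_integrable_def set_lebesgue_integral_def)
qed

text \<open>Monotone convergence settles the diagonal case, where the integrand is nonnegative and
  the truncated integrals converge; the mixed case is dominated by the sum of two diagonal
  ones.\<close>

lemma integrable_bes_half:
  assumes "n \<ge> 1" "m \<ge> 1"
  shows "integrable lborel (bes_half n m)"
proof -
  have diag: "integrable lborel (bes_half k k)" if "k \<ge> 1" for k
  proof (rule integrable_monotone_convergence_at_top)
    show "AE x in lborel. 0 \<le> bes_half k k x"
      by (auto simp: bes_half_def indicator_def mult.assoc)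
    show "integrable lborel (\<lambda>x. bes_half k k x * indicator {..y} x)" for y
      using has_bochner_integral_bes_half_cutoff has_bochner_integral_iff by blast
    have "(\<integral>x. bes_half k k x * indicator {..y} x \<partial>lborel) = bes_D (int k) (int k) y" for y
      using has_bochner_integral_bes_half_cutoff has_bochner_integral_iff by blast
    then show "((\<lambda>y. \<integral>x. bes_half k k x * indicator {..y} x \<partial>lborel) \<longlongrightarrow> real k * pi\<^sup>2 / 2) at_top"
      using bes_D_diag[OF that] by simp
  qed simp_all
  show ?thesis
  proof (rule Bochner_Integration.integrable_bound)
    show "integrable lborel (\<lambda>x. bes_half n n x + bes_half m m x)"
      using assms by (intro Bochner_Integration.integrable_add diag)
    show "AE x in lborel. norm (bes_half n m x) \<le> norm (bes_half n n x + bes_half m m x)"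
    proof (intro AE_I2)
      fix x
      let ?a = "bes_div (int n) x" and ?b = "bes_div (int m) x"
      have "\<bar>?a * ?b\<bar> \<le> ?a * ?a + ?b * ?b"
      proof -
        have "2 * (\<bar>?a\<bar> * \<bar>?b\<bar>) \<le> ?a * ?a + ?b * ?b"
          using sum_squares_bound[of "\<bar>?a\<bar>" "\<bar>?b\<bar>"] by (simp add: power2_eq_square mult.assoc)
        moreover have "0 \<le> \<bar>?a\<bar> * \<bar>?b\<bar>" by simp
        ultimately show ?thesis unfolding abs_mult by linarith
      qed
      then have "x * \<bar>?a * ?b\<bar> \<le> x * (?a * ?a + ?b * ?b)" if "x \<ge> 0"
        using that by (rule mult_left_mono)
      then show "norm (bes_half n m x) \<le> norm (bes_half n n x + bes_half m m x)"
        by (auto simp: bes_half_def indicator_def abs_mult algebra_simps)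
    qed
  qed simp
qed

lemma bes_half_limit:
  assumes "n \<ge> 1" "m \<ge> 1"
  shows "(bes_D (int n) (int m) \<longlongrightarrow> integral\<^sup>L lborel (bes_half n m)) at_top"
proof -
  have "((\<lambda>y. \<integral>x. indicator {..y} x *\<^sub>R bes_half n m x \<partial>lborel) \<longlongrightarrow> integral\<^sup>L lborel (bes_half n m)) at_top"
    by (rule tendsto_integral_at_top) (use integrable_bes_half[OF assms] in simp_all)
  moreover have "(\<integral>x. indicator {..y} x *\<^sub>R bes_half n m x \<partial>lborel) = bes_D (int n) (int m) y" for y
    using has_bochner_integral_bes_half_cutoff[of n m y] by (simp add: has_bochner_integral_iff mult.commute)
  ultimately show ?thesis by simp
qed

text \<open>Absolute integrability identifies the integral with the limit of the truncated ones.
  Orders of opposite parity are left to a symmetry argument on the whole line.\<close>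

lemma integral_bes_half:
  assumes "n \<ge> 1" "m \<ge> 1" "even (n + m)"
  shows "integral\<^sup>L lborel (bes_half n m) = (if n = m then real n * pi\<^sup>2 / 2 else 0)"
proof -
  have gt: "integral\<^sup>L lborel (bes_half n m) = 0" if "n > m" "m \<ge> 1" "even (n + m)" for n m
  proof -
    from that have "\<exists>j. n = m + 2 * j + 2" by presburger
    then obtain j where "n = m + 2 * j + 2" ..
    then have "(bes_D (int n) (int m) \<longlongrightarrow> 0) at_top" using bes_D_offdiag[OF that(2)] by simp
    then show ?thesis
      using that by (intro tendsto_unique[OF trivial_limit_at_top_linorder bes_half_limit]) auto
  qed
  have comm: "bes_half n m = bes_half m n" by (simp add: bes_half_def fun_eq_iff mult_ac)
  show ?thesis
  proof (cases n m rule: linorder_cases)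
    case equal
    then show ?thesis
      using tendsto_unique[OF trivial_limit_at_top_linorder bes_half_limit[OF assms(1,1)] bes_D_diag[OF assms(1)]] by simp
  next
    case less
    then show ?thesis unfolding comm using gt[OF less assms(1)] assms(3) by (simp add: add.commute)
  next
    case greater
    then show ?thesis using gt[OF greater assms(2,3)] by simp
  qed
qed

text \<open>By the parity of \<open>bes_div\<close> the negative half line contributes (-1)^(n + m)
  times the positive one: the integral doubles when n + m is even and cancels when it is
  odd.\<close>

lemma has_bochner_integral_bes_div:
  assumes "n \<ge> 1" "m \<ge> 1"
  shows "has_bochner_integral lborel (\<lambda>x. \<bar>x\<bar> * bes_div (int n) x * bes_div (int m) x)
           (if n = m then real n * pi\<^sup>2 else 0)"
proof -
  let ?h = "bes_half n m" and ?I = "integral\<^sup>L lborel (bes_half n m)" and ?s = "if even (n + m) then 1 else - 1 :: real"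
  have h: "has_bochner_integral lborel ?h ?I"
    using integrable_bes_half[OF assms] by (rule has_bochner_integral_integrable)
  then have "has_bochner_integral lborel (\<lambda>x. ?h (0 + (-1) * x)) (?I /\<^sub>R \<bar>-1\<bar>)"
    by (subst lborel_has_bochner_integral_real_affine_iff[symmetric]) simp_all
  then have "has_bochner_integral lborel (\<lambda>x. ?h x + ?s * ?h (- x)) (?I + ?s * ?I)"
    using h by (intro has_bochner_integral_add has_bochner_integral_mult_right) simp_all
  moreover have "?h x + ?s * ?h (- x) = \<bar>x\<bar> * bes_div (int n) x * bes_div (int m) x" for x
    by (cases "x = 0") (auto simp: bes_half_def indicator_def bes_div_reflect)
  ultimately show ?thesis
    using integral_bes_half[OF assms] by (auto split: if_splits)
qed

subsection \<open>Smooth functions and test functions\<close>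

lemma smooth_unfold: "smooth f \<longleftrightarrow> f differentiable_on UNIV \<and> smooth (ddx f)"
proof -
  have "(\<forall>k. (ddx ^^ k) f differentiable_on UNIV) \<longleftrightarrow>
      (ddx ^^ 0) f differentiable_on UNIV \<and> (\<forall>k. (ddx ^^ Suc k) f differentiable_on UNIV)"
    by (metis not0_implies_Suc)
  then show ?thesis unfolding smooth_def by (simp only: funpow_Suc_right o_apply funpow.simps(1) id_apply)
qed

text \<open>Coinduction for families closed under differentiation. It spares formulas for higher
  derivatives of bump functions, of inverse Fourier transforms and of functions composed with affine
  maps.\<close>

lemma smooth_coinduct:
  assumes "P f" and step: "\<And>f. P f \<Longrightarrow> f differentiable_on UNIV \<and> P (ddx f)"
  shows "smooth f"
proof -
  have P: "P ((ddx ^^ k) f)" for k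
  proof (induction k)
    case (Suc k)
    then show ?case using step[of "(ddx ^^ k) f"] by simp
  qed (use assms(1) in simp)
  show ?thesis unfolding smooth_def using step[OF P] by blast
qed

lemma smooth_ddx: "smooth f \<Longrightarrow> smooth (ddx f)"
  by (drule iffD1[OF smooth_unfold]) (erule conjunct2)

lemma smooth_has_vector_derivative:
  assumes "smooth f" shows "(f has_vector_derivative ddx f x) (at x)"
proof -
  have "f differentiable (at x)"
    using iffD1[OF smooth_unfold assms] by (simp add: differentiable_on_def)
  then show ?thesis by (simp only: vector_derivative_works)
qed

lemma ddx_eqI:
  assumes "\<And>x. (f has_vector_derivative f' x) (at x)"
  shows "ddx f = f'" "f differentiable_on UNIV"
  using vector_derivative_at[OF assms] assms
  by (auto simp: differentiable_on_def differentiable_def has_vector_derivative_def)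

lemma smooth_continuous_on: "smooth f \<Longrightarrow> continuous_on S f"
  by (intro continuous_at_imp_continuous_on ballI has_vector_derivative_continuous[OF smooth_has_vector_derivative])

lemma smooth_zero: "smooth (\<lambda>x. 0)"
proof (rule smooth_coinduct[of "\<lambda>f. f = (\<lambda>x. 0)"])
  fix f :: "real \<Rightarrow> complex" assume f: "f = (\<lambda>x. 0)"
  show "f differentiable_on UNIV \<and> ddx f = (\<lambda>x. 0)"
    using ddx_eqI[of f "\<lambda>x. 0"] by (auto simp: f)
qed simp

lemma smooth_lincomb_affine:
  assumes "smooth f" "smooth g"
  shows "smooth (\<lambda>x. a * f (b + c * x) + d * g x)"
\<comment> \<open>Differentiation multiplies the constant \<open>a\<close> by \<open>c\<close> while
  \<open>b\<close>, \<open>c\<close> and \<open>d\<close> stay, so \<open>a\<close> has to vary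
  within the family.\<close>
proof (rule smooth_coinduct[of "\<lambda>h. \<exists>f g a. smooth f \<and> smooth g \<and> h = (\<lambda>x. a * f (b + c * x) + d * g x)"])
  fix h assume "\<exists>f g a. smooth f \<and> smooth g \<and> h = (\<lambda>x. a * f (b + c * x) + d * g x)"
  then obtain f g a where fg: "smooth f" "smooth g" and h: "h = (\<lambda>x. a * f (b + c * x) + d * g x)" by blast
  have "(h has_vector_derivative (a * of_real c) * ddx f (b + c * x) + d * ddx g x) (at x)" for x
  proof -
    have "((\<lambda>x. b + c * x) has_vector_derivative c) (at x)"
      by (auto intro!: derivative_eq_intros simp flip: has_real_derivative_iff_has_vector_derivative)
    from vector_diff_chain_at[OF this smooth_has_vector_derivative[OF fg(1)]]
    have "((\<lambda>x. f (b + c * x)) has_vector_derivative c *\<^sub>R ddx f (b + c * x)) (at x)"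
      by (simp add: o_def)
    then have "((\<lambda>x. a * f (b + c * x)) has_vector_derivative a * (c *\<^sub>R ddx f (b + c * x))) (at x)"
      by (rule has_vector_derivative_mult_right)
    moreover have "((\<lambda>x. d * g x) has_vector_derivative d * ddx g x) (at x)"
      by (rule has_vector_derivative_mult_right[OF smooth_has_vector_derivative[OF fg(2)]])
    ultimately show ?thesis
      unfolding h by (auto simp: scaleR_conv_of_real mult.assoc intro: has_vector_derivative_add)
  qed
  from ddx_eqI[OF this] show "h differentiable_on UNIV \<and>
      (\<exists>f g a. smooth f \<and> smooth g \<and> ddx h = (\<lambda>x. a * f (b + c * x) + d * g x))"
    using fg smooth_ddx by blast
qed (use assms in blast)

section \<open>Closure properties and bounds of test functions\<close>

lemma test_functionsE:
  assumes "\<phi> \<in> test_functions S"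
  obtains K where "smooth \<phi>" "compact K" "K \<subseteq> S" "\<And>x. x \<notin> K \<Longrightarrow> \<phi> x = 0"
  using assms by (auto simp: test_functions_def)

lemma test_functionsI:
  assumes "smooth \<phi>" "compact K" "K \<subseteq> S" "\<And>x. x \<notin> K \<Longrightarrow> \<phi> x = 0"
  shows "\<phi> \<in> test_functions S"
  using assms by (auto simp: test_functions_def)

lemma test_functions_mono: "S \<subseteq> T \<Longrightarrow> \<phi> \<in> test_functions S \<Longrightarrow> \<phi> \<in> test_functions T"
  by (auto simp: test_functions_def)

lemma test_functions_UNIV: "\<phi> \<in> test_functions S \<Longrightarrow> \<phi> \<in> test_functions UNIV"
  by (rule test_functions_mono[of S]) auto

lemma test_smooth: "\<phi> \<in> test_functions S \<Longrightarrow> smooth \<phi>"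
  by (auto simp: test_functions_def)

lemma test_functions_ddx:
  assumes "\<phi> \<in> test_functions S" shows "ddx \<phi> \<in> test_functions S"
proof -
  obtain K where K: "smooth \<phi>" "compact K" "K \<subseteq> S" "\<And>x. x \<notin> K \<Longrightarrow> \<phi> x = 0"
    using assms unfolding test_functions_def by blast
  show ?thesis
  proof (rule test_functionsI[OF smooth_ddx[OF K(1)] K(2,3)])
    fix x assume x: "x \<notin> K"
    have "(\<phi> has_vector_derivative 0) (at x)"
    proof (rule has_vector_derivative_transform_within_open)
      show "((\<lambda>x. 0) has_vector_derivative 0) (at x)" by simp
      show "open (- K)" using compact_imp_closed[OF K(2)] by auto
    qed (use x K(4) in auto)
    then show "ddx \<phi> x = 0" by (rule vector_derivative_at)
  qed
qed

lemma test_functions_lincomb: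
  assumes "\<phi> \<in> test_functions S" "\<psi> \<in> test_functions S"
  shows "(\<lambda>x. a * \<phi> x + b * \<psi> x) \<in> test_functions S"
proof -
  obtain K L where K: "smooth \<phi>" "compact K" "K \<subseteq> S" "\<And>x. x \<notin> K \<Longrightarrow> \<phi> x = 0"
    and L: "smooth \<psi>" "compact L" "L \<subseteq> S" "\<And>x. x \<notin> L \<Longrightarrow> \<psi> x = 0"
    using assms by (meson test_functionsE)
  show ?thesis
    using smooth_lincomb_affine[OF K(1) L(1), of a 0 1 b] K L
    by (intro test_functionsI[of _ "K \<union> L"]) auto
qed

lemma test_functions_affine:
  assumes "\<phi> \<in> test_functions S" "c \<noteq> 0"
  shows "(\<lambda>x. a * \<phi> (b + c * x)) \<in> test_functions ((\<lambda>y. (y - b) / c) ` S)"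
proof -
  obtain K where K: "smooth \<phi>" "compact K" "K \<subseteq> S" "\<And>x. x \<notin> K \<Longrightarrow> \<phi> x = 0"
    using assms(1) unfolding test_functions_def by blast
  show ?thesis
  proof (rule test_functionsI)
    show "smooth (\<lambda>x. a * \<phi> (b + c * x))"
      using smooth_lincomb_affine[OF K(1) smooth_zero, of a b c 0] by simp
    show "compact ((\<lambda>y. (y - b) / c) ` K)"
      by (intro compact_continuous_image K(2) continuous_intros) (use assms in auto)
    show "(\<lambda>y. (y - b) / c) ` K \<subseteq> (\<lambda>y. (y - b) / c) ` S" using K(3) by blast
    fix x assume x: "x \<notin> (\<lambda>y. (y - b) / c) ` K"
    have "x = ((b + c * x) - b) / c" using assms by simp
    then have "b + c * x \<notin> K" using x by blast
    then show "a * \<phi> (b + c * x) = 0" using K(4) by simp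
  qed
qed

lemma test_bounded_support:
  assumes "\<phi> \<in> test_functions S"
  shows "\<exists>R>0. \<forall>x. \<bar>x\<bar> > R \<longrightarrow> \<phi> x = 0"
proof -
  have "\<exists>K. compact K \<and> (\<forall>x. x \<notin> K \<longrightarrow> \<phi> x = 0)"
    using assms by (auto simp: test_functions_def)
  then obtain K where K: "compact K" "\<And>x. x \<notin> K \<Longrightarrow> \<phi> x = 0" by auto
  obtain R where R: "R > 0" "\<forall>x\<in>K. norm x \<le> R"
    using compact_imp_bounded[OF K(1)] unfolding bounded_pos by blast
  have "\<phi> x = 0" if "R < \<bar>x\<bar>" for x
  proof -
    have "x \<notin> K" using R(2) that by force
    then show ?thesis by (rule K(2))
  qed
  then show ?thesis using R(1) by blast
qed

lemma test_continuous_on: "\<phi> \<in> test_functions S \<Longrightarrow> continuous_on T \<phi>"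
  using test_smooth smooth_continuous_on by blast

lemma test_measurable [measurable_dest]: "\<phi> \<in> test_functions S \<Longrightarrow> \<phi> \<in> borel_measurable borel"
  by (intro borel_measurable_continuous_onI test_continuous_on)

lemma test_mult_integrable:
  fixes g :: "real \<Rightarrow> complex"
  assumes "\<phi> \<in> test_functions S" "continuous_on UNIV g"
  shows "integrable lborel (\<lambda>x. \<phi> x * g x)"
proof -
  obtain R where R: "R > 0" "\<And>x. \<bar>x\<bar> > R \<Longrightarrow> \<phi> x = 0" using test_bounded_support[OF assms(1)] by blast
  have "set_integrable lborel {-R..R} (\<lambda>x. \<phi> x * g x)"
    by (intro borel_integrable_atLeastAtMost' continuous_intros test_continuous_on[OF assms(1)]
        continuous_on_subset[OF assms(2)]) auto
  moreover have "indicator {-R..R} x *\<^sub>R (\<phi> x * g x) = \<phi> x * g x" for x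
    using R(2)[of x] by (auto simp: indicator_def)
  ultimately show ?thesis by (simp add: set_integrable_def)
qed

lemma test_integrable: "\<phi> \<in> test_functions S \<Longrightarrow> integrable lborel \<phi>"
  using test_mult_integrable[of \<phi> S "\<lambda>x. 1"] by simp

lemma test_bounded:
  assumes "\<phi> \<in> test_functions S"
  shows "\<exists>C>0. \<forall>x. cmod (\<phi> x) \<le> C"
proof -
  have "\<exists>K. compact K \<and> (\<forall>x. x \<notin> K \<longrightarrow> \<phi> x = 0)"
    using assms by (auto simp: test_functions_def)
  then obtain K where K: "compact K" "\<And>x. x \<notin> K \<Longrightarrow> \<phi> x = 0" by auto
  have "bounded (\<phi> ` K)"
    by (intro compact_imp_bounded compact_continuous_image test_continuous_on[OF assms] K)
  then obtain C where C: "C > 0" "\<And>x. x \<in> K \<Longrightarrow> cmod (\<phi> x) \<le> C" by (auto simp: bounded_pos)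
  have "cmod (\<phi> x) \<le> C" for x using C K(2)[of x] by (cases "x \<in> K") auto
  then show ?thesis using C(1) by blast
qed

lemma integral_ddx_compact_support:
  fixes f f' :: "real \<Rightarrow> complex"
  assumes d: "\<And>x. (f has_vector_derivative f' x) (at x)" and c: "continuous_on UNIV f'"
    and R: "\<And>x. \<bar>x\<bar> > R \<Longrightarrow> f x = 0" "\<And>x. \<bar>x\<bar> > R \<Longrightarrow> f' x = 0" "R > 0"
  shows "(LINT x|lborel. f' x) = 0"
proof -
  \<comment> \<open>The function is known to vanish only for |x| > R, hence the margin of 1.\<close>
  let ?I = "{-(R + 1)..R + 1}"
  have "(f' has_integral f (R + 1) - f (-(R + 1))) ?I"
    by (rule fundamental_theorem_of_calculus) (use R has_vector_derivative_at_within[OF d] in auto)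
  then have "(f' has_integral 0) ?I" using R by simp
  moreover have "set_integrable lborel ?I f'"
    by (intro borel_integrable_atLeastAtMost' continuous_on_subset[OF c]) auto
  ultimately have "(LINT x:?I|lborel. f' x) = 0"
    using set_borel_integral_eq_integral(2) integral_unique by metis
  moreover have "indicator ?I x *\<^sub>R f' x = f' x" for x
    using R(2)[of x] by (auto simp: indicator_def)
  ultimately show ?thesis by (simp add: set_lebesgue_integral_def)
qed

subsection \<open>A bump function\<close>

text \<open>A family closed under differentiation that contains the standard bump function.\<close>

definition bump_gen :: "real poly \<Rightarrow> nat \<Rightarrow> real \<Rightarrow> real" where
  "bump_gen p k x = (if \<bar>x\<bar> < 1 then poly p x * inverse (1 - x\<^sup>2) ^ k * exp (- inverse (1 - x\<^sup>2)) else 0)"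

text \<open>With y = 1/(1 - x^2) one has y' = 2 x y^2. Bringing all terms of the derivative to the
  common factor y^(k + 2) leaves this numerator, in which \<open>[:1, 0, -1:]\<close> is the
  polynomial 1 - x^2.\<close>

definition bump_step :: "real poly \<Rightarrow> nat \<Rightarrow> real poly" where
  "bump_step p k = pderiv p * [:1, 0, -1:] ^ 2 + [:0, 2 * real k:] * p * [:1, 0, -1:] - [:0, 2:] * p"

text \<open>A single term of the exponential series is at most its sum.\<close>

lemma power_mult_exp_bounded:
  fixes y :: real assumes "y \<ge> 0" shows "y ^ n * exp (- y) \<le> fact n"
proof -
  have "(\<Sum>k\<in>{n}. y ^ k /\<^sub>R fact k) \<le> (\<Sum>k. y ^ k /\<^sub>R fact k)"
    by (rule sum_le_suminf) (use assms summable_exp_generic[of y] in auto)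
  then have "y ^ n \<le> fact n * exp y" by (simp add: exp_def field_simps)
  then show ?thesis by (simp add: exp_minus field_simps)
qed

text \<open>Quadratic vanishing at the end points is what makes the derivative there exist and equal
  0. The factor (1 - x^2)^2 is gained by two more powers of y = 1/(1 - x^2), and the exponential
  absorbs the total power k + 2.\<close>

lemma bump_gen_bound: "\<exists>C>0. \<forall>x. \<bar>bump_gen p k x\<bar> \<le> C * (1 - x\<^sup>2)\<^sup>2"
proof -
  have "bounded (poly p ` {-1..1})"
    by (intro compact_imp_bounded compact_continuous_image continuous_intros) auto
  then obtain B where B: "B > 0" "\<And>x. x \<in> {-1..1} \<Longrightarrow> \<bar>poly p x\<bar> \<le> B" by (auto simp: bounded_pos)
  have "\<bar>bump_gen p k x\<bar> \<le> (B * fact (k + 2)) * (1 - x\<^sup>2)\<^sup>2" for x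
  proof (cases "\<bar>x\<bar> < 1")
    case True
    then have pos: "0 < 1 - x\<^sup>2" by (simp add: abs_square_less_1)
    let ?y = "inverse (1 - x\<^sup>2)"
    have "(1 - x\<^sup>2)\<^sup>2 * ?y\<^sup>2 = 1" using pos by (simp flip: power_mult_distrib)
    then have "?y ^ k * exp (- ?y) = ((1 - x\<^sup>2)\<^sup>2 * ?y\<^sup>2) * (?y ^ k * exp (- ?y))" by simp
    also have "\<dots> = (1 - x\<^sup>2)\<^sup>2 * (?y ^ (k + 2) * exp (- ?y))" by (simp only: power_add mult_ac)
    finally have "?y ^ k * exp (- ?y) = (1 - x\<^sup>2)\<^sup>2 * (?y ^ (k + 2) * exp (- ?y))" .
    also have "\<dots> \<le> (1 - x\<^sup>2)\<^sup>2 * fact (k + 2)"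
      using pos by (intro mult_left_mono power_mult_exp_bounded) auto
    finally have E: "?y ^ k * exp (- ?y) \<le> (1 - x\<^sup>2)\<^sup>2 * fact (k + 2)" .
    have "\<bar>poly p x\<bar> * (?y ^ k * exp (- ?y)) \<le> B * ((1 - x\<^sup>2)\<^sup>2 * fact (k + 2))"
    proof (rule mult_mono)
      show "\<bar>poly p x\<bar> \<le> B" 
      proof -
        have "x \<in> {-1..1}" using True by auto
        then show ?thesis by (rule B(2))
      qed
    qed (use E B(1) pos in auto)
    then show ?thesis using True pos by (simp add: bump_gen_def abs_mult mult_ac)
  next
    case False
    then show ?thesis using B(1) by (simp add: bump_gen_def)
  qed
  then show ?thesis using B(1) by (intro exI[of _ "B * fact (k + 2)"]) auto
qed

lemma bump_gen_has_derivative: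
  "(bump_gen p k has_real_derivative bump_gen (bump_step p k) (k + 2) x) (at x)"
proof -
  consider "\<bar>x\<bar> < 1" | "\<bar>x\<bar> > 1" | "\<bar>x\<bar> = 1" by linarith
  then show ?thesis
  proof cases
    case 1
    then have pos: "1 - x\<^sup>2 > 0" by (simp add: abs_square_less_1)
    let ?y = "inverse (1 - x\<^sup>2)"
    have dy: "((\<lambda>x. inverse (1 - x\<^sup>2)) has_real_derivative 2 * x * ?y\<^sup>2) (at x)"
    proof -
      have "((\<lambda>x. 1 - x\<^sup>2) has_real_derivative - (2 * x)) (at x)"
        by (auto intro!: derivative_eq_intros)
      from DERIV_inverse'[OF this] have "((\<lambda>x. inverse (1 - x\<^sup>2)) has_real_derivative - (?y * - (2 * x) * ?y)) (at x)"
        using pos by simp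
      then show ?thesis by (rule DERIV_cong) (simp add: power2_eq_square)
    qed
    have "((\<lambda>x. poly p x * inverse (1 - x\<^sup>2) ^ k * exp (- inverse (1 - x\<^sup>2))) has_real_derivative
        (poly (pderiv p) x * ?y ^ k + real k * (2 * x * ?y\<^sup>2) * ?y ^ (k - 1) * poly p x) * exp (- ?y)
         + exp (- ?y) * (- (2 * x * ?y\<^sup>2)) * (poly p x * ?y ^ k)) (at x)"
      by (intro DERIV_mult poly_DERIV DERIV_chain2[OF DERIV_exp] DERIV_minus dy)
         (use DERIV_power[OF dy, of k] in \<open>simp add: mult_ac\<close>)
    moreover have "(poly (pderiv p) x * ?y ^ k + real k * (2 * x * ?y\<^sup>2) * ?y ^ (k - 1) * poly p x) * exp (- ?y)
         + exp (- ?y) * (- (2 * x * ?y\<^sup>2)) * (poly p x * ?y ^ k) = bump_gen (bump_step p k) (k + 2) x"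
    proof -
      have a: "real k * ?y ^ (k - 1) * ?y\<^sup>2 = real k * (1 - x\<^sup>2) * ?y ^ (k + 2)"
      proof (cases k)
        case (Suc j)
        have "?y ^ (k + 2) = ?y * (?y ^ j * ?y\<^sup>2)" by (simp add: Suc power2_eq_square mult_ac)
        then have "(1 - x\<^sup>2) * ?y ^ (k + 2) = ((1 - x\<^sup>2) * ?y) * (?y ^ j * ?y\<^sup>2)" by (simp only: mult.assoc)
        also have "(1 - x\<^sup>2) * ?y = 1" using pos by simp
        finally show ?thesis by (simp only: Suc diff_Suc_1 mult.assoc mult_1_left)
      qed simp
      have b: "?y ^ k = (1 - x\<^sup>2)\<^sup>2 * ?y ^ (k + 2)"
      proof -
        have "(1 - x\<^sup>2)\<^sup>2 * ?y\<^sup>2 = 1" using pos by (simp flip: power_mult_distrib)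
        then have "?y ^ k = ((1 - x\<^sup>2)\<^sup>2 * ?y\<^sup>2) * ?y ^ k" by simp
        then show ?thesis by (simp only: power_add mult_ac)
      qed
      have "(poly (pderiv p) x * ?y ^ k + real k * (2 * x * ?y\<^sup>2) * ?y ^ (k - 1) * poly p x) * exp (- ?y)
         + exp (- ?y) * (- (2 * x * ?y\<^sup>2)) * (poly p x * ?y ^ k)
        = (poly (pderiv p) x * ?y ^ k + 2 * x * poly p x * (real k * ?y ^ (k - 1) * ?y\<^sup>2)
            - 2 * x * poly p x * ?y ^ (k + 2)) * exp (- ?y)"
      proof -
        have "(P' * Y + K * (2 * x * Z) * Y' * P) * E + E * (- (2 * x * Z)) * (P * Y)
          = (P' * Y + 2 * x * P * (K * Y' * Z) - 2 * x * P * (Y * Z)) * E" for P' Y K Z Y' P E :: real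
          by (simp add: algebra_simps)
        then show ?thesis unfolding power_add by blast
      qed
      also have "\<dots> = (poly (pderiv p) x * ((1 - x\<^sup>2)\<^sup>2 * ?y ^ (k + 2)) + 2 * x * poly p x * (real k * (1 - x\<^sup>2) * ?y ^ (k + 2))
            - 2 * x * poly p x * ?y ^ (k + 2)) * exp (- ?y)"
        unfolding a by (subst b) simp
      also have "\<dots> = poly (bump_step p k) x * ?y ^ (k + 2) * exp (- ?y)"
      proof -
        have "poly (bump_step p k) x = poly (pderiv p) x * (1 - x\<^sup>2)\<^sup>2 + 2 * x * real k * poly p x * (1 - x\<^sup>2) - 2 * x * poly p x"
          by (simp add: bump_step_def power2_eq_square algebra_simps)
        moreover have "P' * (A * Y) + 2 * x * P * (K * B * Y) - 2 * x * P * Y = (P' * A + 2 * x * K * P * B - 2 * x * P) * Y"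
          for P' Y K A B P :: real
          by (simp add: algebra_simps)
        ultimately show ?thesis by (simp only:)
      qed
      finally show ?thesis using 1 by (simp add: bump_gen_def)
    qed
    ultimately have "((\<lambda>x. poly p x * inverse (1 - x\<^sup>2) ^ k * exp (- inverse (1 - x\<^sup>2))) has_real_derivative
        bump_gen (bump_step p k) (k + 2) x) (at x)" by simp
    then show ?thesis
      by (rule has_field_derivative_transform_within_open[of _ _ _ "{-1<..<1}"])
         (use 1 in \<open>auto simp: bump_gen_def\<close>)
  next
    case 2
    have "((\<lambda>x. 0) has_real_derivative 0) (at x)" by simp
    then have "(bump_gen p k has_real_derivative 0) (at x)"
      by (rule has_field_derivative_transform_within_open[of _ _ _ "- {-1..1}"])
         (use 2 in \<open>auto simp: bump_gen_def\<close>)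
    then show ?thesis using 2 by (simp add: bump_gen_def)
  next
    case 3
    obtain C where C: "C > 0" "\<And>x. \<bar>bump_gen p k x\<bar> \<le> C * (1 - x\<^sup>2)\<^sup>2" using bump_gen_bound by blast
    have z: "bump_gen p k x = 0" using 3 by (simp add: bump_gen_def)
    have x2: "x\<^sup>2 = 1" using 3 by (metis abs_1 power2_abs power_one)
    have lim: "((\<lambda>h. C * (\<bar>h\<bar> * (2 * x + h)\<^sup>2)) \<longlongrightarrow> C * (\<bar>0\<bar> * (2 * x + 0)\<^sup>2)) (at 0)"
      by (intro tendsto_intros)
    have "((\<lambda>h. (bump_gen p k (x + h) - bump_gen p k x) / h) \<longlongrightarrow> 0) (at 0)"
    proof (rule Lim_null_comparison)
      show "\<forall>\<^sub>F h in at 0. norm ((bump_gen p k (x + h) - bump_gen p k x) / h) \<le> C * (\<bar>h\<bar> * (2 * x + h)\<^sup>2)"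
        unfolding eventually_at_filter
      proof (intro always_eventually allI impI)
        fix h :: real assume h: "h \<noteq> 0"
        \<comment> \<open>As x^2 = 1, the bound of \<open>bump_gen_bound\<close> is of second order
          in h, and the difference quotient is of first order.\<close>
        have "1 - (x + h)\<^sup>2 = - h * (2 * x + h)" using x2 by (simp add: power2_eq_square algebra_simps)
        then have "\<bar>bump_gen p k (x + h)\<bar> \<le> C * (- h * (2 * x + h))\<^sup>2" using C(2)[of "x + h"] by simp
        also have "\<dots> = C * (\<bar>h\<bar> * (2 * x + h)\<^sup>2) * \<bar>h\<bar>"
          by (simp add: power_mult_distrib) (simp add: power2_eq_square)
        finally have "\<bar>bump_gen p k (x + h)\<bar> / \<bar>h\<bar> \<le> C * (\<bar>h\<bar> * (2 * x + h)\<^sup>2)"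
          using h by (intro pos_divide_le_eq[THEN iffD2]) auto
        then show "norm ((bump_gen p k (x + h) - bump_gen p k x) / h) \<le> C * (\<bar>h\<bar> * (2 * x + h)\<^sup>2)"
          by (simp add: z)
      qed
    qed (use lim in simp)
    moreover have "bump_gen (bump_step p k) (k + 2) x = 0" using 3 by (simp add: bump_gen_def)
    ultimately show ?thesis by (simp only: DERIV_def)
  qed
qed

lemma smooth_bump_gen: "smooth (\<lambda>x. of_real (bump_gen p k x))"
proof (rule smooth_coinduct[of "\<lambda>f. \<exists>p k. f = (\<lambda>x. of_real (bump_gen p k x))"])
  fix f :: "real \<Rightarrow> complex" assume "\<exists>p k. f = (\<lambda>x. of_real (bump_gen p k x))"
  then obtain p k where f: "f = (\<lambda>x. of_real (bump_gen p k x))" by blast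
  have "(f has_vector_derivative of_real (bump_gen (bump_step p k) (k + 2) x)) (at x)" for x
    unfolding f using has_vector_derivative_of_real[OF bump_gen_has_derivative] by blast
  from ddx_eqI[OF this] show "f differentiable_on UNIV \<and> (\<exists>p k. ddx f = (\<lambda>x. of_real (bump_gen p k x)))"
    by blast
qed blast

lemma bump_exists:
  obtains \<rho> where "\<rho> \<in> test_functions UNIV" "\<And>x. \<bar>x\<bar> \<ge> 1 \<Longrightarrow> \<rho> x = 0" "(LINT x|lborel. \<rho> x) = 1"
proof -
  let ?b = "bump_gen 1 0"
  have c: "isCont ?b x" for x using bump_gen_has_derivative DERIV_isCont by blast
  have bt: "(\<lambda>x. complex_of_real (?b x)) \<in> test_functions UNIV"
    by (rule test_functionsI[OF smooth_bump_gen, of "{-1..1}"]) (auto simp: bump_gen_def)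
  have nn: "0 \<le> ?b x" for x by (simp add: bump_gen_def)
  have "integrable lborel (\<lambda>x. complex_of_real (?b x))" using bt by (rule test_integrable)
  then have int: "integrable lborel ?b" by (simp only: complex_of_real_integrable_eq)
  have "(LINT x|lborel. ?b x) \<noteq> 0"
  proof
    assume "(LINT x|lborel. ?b x) = 0"
    then have "AE x in lborel. ?b x = 0"
      using integral_nonneg_eq_0_iff_AE[OF int] nn by simp
    \<comment> \<open>The bump is positive exactly on the open segment, which is not a null
      set.\<close>
    moreover have "{x \<in> space lborel. \<not> ?b x = 0} = {-1<..<1}" by (auto simp: bump_gen_def)
    ultimately have "emeasure lborel {-1<..<1::real} = 0"
      using AE_iff_measurable[of "{-1<..<1}" lborel "\<lambda>x. ?b x = 0"] by simp
    then show False by simp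
  qed
  then have "(LINT x|lborel. (1 / of_real (LINT x|lborel. ?b x)) * complex_of_real (?b x)) = 1"
    by simp
  moreover have "(\<lambda>x. (1 / of_real (LINT x|lborel. ?b x)) * complex_of_real (?b x)) \<in> test_functions UNIV"
    using test_functions_lincomb[OF bt bt, of "1 / of_real (LINT x|lborel. ?b x)" 0] by simp
  ultimately show ?thesis
    by (intro that[of "\<lambda>x. (1 / of_real (LINT x|lborel. ?b x)) * complex_of_real (?b x)"]) (auto simp: bump_gen_def)
qed

subsection \<open>The Fourier transform\<close>

text \<open>Kernel cis (x \<xi>) without the factor 1/(2 pi): it is symmetric in its two arguments,
  so \<open>integral_mult_ift\<close> needs no reflection, and \<open>fourier\<close> is its value
  at the opposite point.\<close>

definition ift :: "(real \<Rightarrow> complex) \<Rightarrow> real \<Rightarrow> complex" where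
  "ift g x = (LINT \<xi>|lborel. g \<xi> * cis (x * \<xi>))"

lemma fourier_ift: "fourier f \<xi> = ift f (- \<xi>)"
  by (simp add: fourier_def ift_def mult.commute)

lemma borel_measurable_cis [measurable]:
  "f \<in> borel_measurable M \<Longrightarrow> (\<lambda>x. cis (f x)) \<in> borel_measurable M"
proof -
  assume f: "f \<in> borel_measurable M"
  have "cis \<in> borel_measurable borel" by (intro borel_measurable_continuous_onI continuous_intros)
  from measurable_compose[OF f this] show ?thesis .
qed

lemma integrable_mult_cis:
  assumes "integrable M f" "g \<in> borel_measurable M"
  shows "integrable M (\<lambda>x. f x * cis (g x))"
  by (rule Bochner_Integration.integrable_bound[OF assms(1)])
     (use assms in \<open>auto simp: norm_mult\<close>)

lemma integrable_mult_cis_lborel: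
  "integrable lborel f \<Longrightarrow> integrable lborel (\<lambda>\<xi>. f \<xi> * cis (x * \<xi>))"
  by (intro integrable_mult_cis) auto

lemma norm_ift_le:
  assumes "integrable lborel g"
  shows "cmod (ift g x) \<le> (LINT \<xi>|lborel. cmod (g \<xi>))"
proof -
  have "cmod (ift g x) \<le> (LINT \<xi>|lborel. cmod (g \<xi> * cis (x * \<xi>)))"
    unfolding ift_def by (rule integral_norm_bound)
  then show ?thesis by (simp add: norm_mult)
qed

lemma borel_measurable_ift [measurable]:
  assumes [measurable]: "g \<in> borel_measurable borel"
  shows "ift g \<in> borel_measurable borel"
  unfolding ift_def[abs_def] by measurable

lemma borel_measurable_fourier [measurable]:
  assumes [measurable]: "g \<in> borel_measurable borel"
  shows "fourier g \<in> borel_measurable borel"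
  unfolding fourier_def[abs_def] by measurable

text \<open>Fubini, with a kernel symmetric in x and y. Inversion, Parseval's formula and the
  treatment of the logarithmic kernel all rest on this exchange.\<close>

lemma integral_mult_ift:
  assumes f: "integrable lborel f" and g: "integrable lborel g"
  shows "(LINT x|lborel. f x * ift g x) = (LINT y|lborel. g y * ift f y)"
proof -
  have [measurable]: "f \<in> borel_measurable borel" "g \<in> borel_measurable borel"
    using f g borel_measurable_integrable by auto
  have int: "integrable (lborel \<Otimes>\<^sub>M lborel) (\<lambda>(x, y). f x * (g y * cis (x * y)))"
  proof (rule lborel_pair.Fubini_integrable)
    have "(\<lambda>x. LINT y|lborel. norm (f x * (g y * cis (x * y)))) = (\<lambda>x. cmod (f x) * (LINT y|lborel. cmod (g y)))"
      by (simp add: norm_mult)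
    then show "integrable lborel (\<lambda>x. LINT y|lborel. norm (case (x, y) of (x, y) \<Rightarrow> f x * (g y * cis (x * y))))"
      using f by simp
    show "AE x in lborel. integrable lborel (\<lambda>y. case (x, y) of (x, y) \<Rightarrow> f x * (g y * cis (x * y)))"
      using integrable_mult_cis_lborel[OF g] by simp
  qed measurable
  have "(LINT x|lborel. f x * ift g x) = (LINT x|lborel. LINT y|lborel. f x * (g y * cis (x * y)))"
    by (simp add: ift_def)
  also have "\<dots> = (LINT y|lborel. LINT x|lborel. f x * (g y * cis (x * y)))"
    by (rule lborel_pair.Fubini_integral[OF int, symmetric])
  also have "\<dots> = (LINT y|lborel. g y * ift f y)"
  proof (rule Bochner_Integration.integral_cong[OF refl])
    fix y
    have "(LINT x|lborel. f x * (g y * cis (x * y))) = (LINT x|lborel. g y * (f x * cis (y * x)))"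
      by (simp add: mult_ac)
    then show "(LINT x|lborel. f x * (g y * cis (x * y))) = g y * ift f y"
      by (simp add: ift_def)
  qed
  finally show ?thesis .
qed

lemma ift_affine:
  assumes c: "c \<noteq> 0"
  shows "ift (\<lambda>z. f (b + c * z)) \<eta> = of_real (1 / \<bar>c\<bar>) * cis (- (b * \<eta> / c)) * ift f (\<eta> / c)"
proof -
  have "ift f (\<eta> / c) = \<bar>c\<bar> *\<^sub>R (LINT z|lborel. f (b + c * z) * cis (\<eta> / c * (b + c * z)))"
    unfolding ift_def by (rule lborel_integral_real_affine[OF c])
  also have "(\<lambda>z. f (b + c * z) * cis (\<eta> / c * (b + c * z))) = (\<lambda>z. cis (b * \<eta> / c) * (f (b + c * z) * cis (\<eta> * z)))"
    using c by (auto simp: fun_eq_iff cis_mult field_simps)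
  also have "(LINT z|lborel. \<dots> z) = cis (b * \<eta> / c) * ift (\<lambda>z. f (b + c * z)) \<eta>"
    by (simp add: ift_def)
  finally have "cis (- (b * \<eta> / c)) * ift f (\<eta> / c)
      = of_real \<bar>c\<bar> * ((cis (- (b * \<eta> / c)) * cis (b * \<eta> / c)) * ift (\<lambda>z. f (b + c * z)) \<eta>)"
    by (simp add: scaleR_conv_of_real mult_ac)
  then show ?thesis using c by (simp add: cis_mult field_simps)
qed

lemma norm_integral_le:
  fixes f :: "'a \<Rightarrow> 'b::{banach, second_countable_topology}"
  assumes "integrable M f" "integrable M g" "\<And>x. norm (f x) \<le> g x"
  shows "norm (integral\<^sup>L M f) \<le> integral\<^sup>L M g"
  using assms by (intro order_trans[OF integral_norm_bound integral_mono]) auto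

text \<open>A second-order remainder bound, uniform in y, is easily brought under an integral,
  unlike a limit of difference quotients.\<close>

lemma has_vector_derivative_quadratic:
  fixes f :: "real \<Rightarrow> 'a::real_normed_vector"
  assumes "\<And>y. norm (f y - f x - (y - x) *\<^sub>R D) \<le> C * (y - x)\<^sup>2"
  shows "(f has_vector_derivative D) (at x)"
  unfolding has_vector_derivative_def has_derivative_iff_norm
proof
  show "bounded_linear (\<lambda>h. h *\<^sub>R D)" by (rule bounded_linear_scaleR_left)
  have lim: "((\<lambda>y. C * \<bar>y - x\<bar>) \<longlongrightarrow> C * \<bar>x - x\<bar>) (at x)"
    by (intro tendsto_intros)
  show "((\<lambda>y. norm (f y - f x - (y - x) *\<^sub>R D) / norm (y - x)) \<longlongrightarrow> 0) (at x)"
  proof (rule Lim_null_comparison)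
    show "\<forall>\<^sub>F y in at x. norm (norm (f y - f x - (y - x) *\<^sub>R D) / norm (y - x)) \<le> C * \<bar>y - x\<bar>"
      unfolding eventually_at_filter
    proof (intro always_eventually allI impI)
      fix y assume "y \<noteq> x"
      have "norm (f y - f x - (y - x) *\<^sub>R D) \<le> (C * \<bar>y - x\<bar>) * \<bar>y - x\<bar>"
        using assms[of y] by (simp add: power2_eq_square mult.assoc)
      then show "norm (norm (f y - f x - (y - x) *\<^sub>R D) / norm (y - x)) \<le> C * \<bar>y - x\<bar>"
        using \<open>y \<noteq> x\<close> by (simp add: pos_divide_le_eq)
    qed
  qed (use lim in simp)
qed

text \<open>A class stable under multiplication by i \<xi>, which is differentiation of
  \<open>ift\<close>; it is made for the coinductive proof of smoothness.\<close>

definition all_moments :: "(real \<Rightarrow> complex) \<Rightarrow> bool" where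
  "all_moments g \<longleftrightarrow> (\<forall>k. integrable lborel (\<lambda>\<xi>. of_real \<xi> ^ k * g \<xi>))"

lemma all_moments_integrable: "all_moments g \<Longrightarrow> integrable lborel g"
  unfolding all_moments_def by (drule spec[of _ 0]) simp

lemma all_moments_mult: "all_moments g \<Longrightarrow> all_moments (\<lambda>\<xi>. \<i> * of_real \<xi> * g \<xi>)"
  unfolding all_moments_def
proof
  fix k assume "\<forall>k. integrable lborel (\<lambda>\<xi>. of_real \<xi> ^ k * g \<xi>)"
  then have "integrable lborel (\<lambda>\<xi>. \<i> * (of_real \<xi> ^ Suc k * g \<xi>))"
    by (intro Bochner_Integration.integrable_mult_right) blast
  then show "integrable lborel (\<lambda>\<xi>. of_real \<xi> ^ k * (\<i> * of_real \<xi> * g \<xi>))"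
    by (simp add: mult_ac)
qed

text \<open>The remainder of exp (i u) after its first two terms is at most u^2 / 2 in modulus, and
  the second moment of \<open>g\<close> makes this integrable.\<close>

lemma ift_has_vector_derivative:
  assumes "all_moments g"
  shows "(ift g has_vector_derivative ift (\<lambda>\<xi>. \<i> * of_real \<xi> * g \<xi>) x) (at x)"
proof (rule has_vector_derivative_quadratic)
  fix y
  have i0: "integrable lborel g" using assms by (rule all_moments_integrable)
  have i1: "integrable lborel (\<lambda>\<xi>. \<i> * of_real \<xi> * g \<xi>)"
    using all_moments_mult[OF assms] by (rule all_moments_integrable)
  have "integrable lborel (\<lambda>\<xi>. of_real \<xi> ^ 2 * g \<xi>)" using assms by (auto simp: all_moments_def)
  then have i2: "integrable lborel (\<lambda>\<xi>. \<xi>\<^sup>2 * cmod (g \<xi>))"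
    by (drule_tac integrable_norm) (simp add: norm_mult norm_power)
  have "ift g y - ift g x - (y - x) *\<^sub>R ift (\<lambda>\<xi>. \<i> * of_real \<xi> * g \<xi>) x
     = (LINT \<xi>|lborel. g \<xi> * cis (y * \<xi>) - g \<xi> * cis (x * \<xi>) - (y - x) *\<^sub>R (\<i> * of_real \<xi> * g \<xi> * cis (x * \<xi>)))"
    unfolding ift_def using integrable_mult_cis_lborel[OF i0] integrable_mult_cis_lborel[OF i1] by simp
  also have "cmod \<dots> \<le> (LINT \<xi>|lborel. (y - x)\<^sup>2 * (\<xi>\<^sup>2 * cmod (g \<xi>)))"
  proof (rule norm_integral_le)
    fix \<xi>
    have "g \<xi> * cis (y * \<xi>) - g \<xi> * cis (x * \<xi>) - (y - x) *\<^sub>R (\<i> * of_real \<xi> * g \<xi> * cis (x * \<xi>))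
       = g \<xi> * cis (x * \<xi>) * (cis ((y - x) * \<xi>) - 1 - \<i> * of_real ((y - x) * \<xi>))"
    proof -
      have "cis (y * \<xi>) = cis (x * \<xi>) * cis ((y - x) * \<xi>)" by (simp add: cis_mult algebra_simps)
      then show ?thesis by (simp add: scaleR_conv_of_real algebra_simps)
    qed
    then have "cmod (g \<xi> * cis (y * \<xi>) - g \<xi> * cis (x * \<xi>) - (y - x) *\<^sub>R (\<i> * of_real \<xi> * g \<xi> * cis (x * \<xi>)))
       = cmod (g \<xi>) * cmod (cis ((y - x) * \<xi>) - 1 - \<i> * of_real ((y - x) * \<xi>))"
      by (simp only: norm_mult norm_cis mult_1_right)
    also have "\<dots> \<le> cmod (g \<xi>) * ((y - x)\<^sup>2 * \<xi>\<^sup>2)"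
    proof (intro mult_left_mono)
      have "cmod (iexp ((y - x) * \<xi>) - (\<Sum>k\<le>1. (\<i> * of_real ((y - x) * \<xi>)) ^ k / fact k)) \<le> \<bar>(y - x) * \<xi>\<bar> ^ Suc 1 / fact (Suc 1)"
        by (rule iexp_approx1)
      then have "cmod (cis ((y - x) * \<xi>) - 1 - \<i> * of_real ((y - x) * \<xi>)) \<le> ((y - x) * \<xi>)\<^sup>2 / 2"
        by (simp add: cis_conv_exp algebra_simps power2_eq_square abs_mult)
      also have "\<dots> \<le> (y - x)\<^sup>2 * \<xi>\<^sup>2" by (simp add: power_mult_distrib)
      finally show "cmod (cis ((y - x) * \<xi>) - 1 - \<i> * of_real ((y - x) * \<xi>)) \<le> (y - x)\<^sup>2 * \<xi>\<^sup>2" .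
    qed simp
    finally show "cmod (g \<xi> * cis (y * \<xi>) - g \<xi> * cis (x * \<xi>) - (y - x) *\<^sub>R (\<i> * of_real \<xi> * g \<xi> * cis (x * \<xi>)))
       \<le> (y - x)\<^sup>2 * (\<xi>\<^sup>2 * cmod (g \<xi>))"
      by (simp only: mult_ac)
  next
    show "integrable lborel (\<lambda>\<xi>. g \<xi> * cis (y * \<xi>) - g \<xi> * cis (x * \<xi>) - (y - x) *\<^sub>R (\<i> * of_real \<xi> * g \<xi> * cis (x * \<xi>)))"
      using integrable_mult_cis_lborel[OF i0] integrable_mult_cis_lborel[OF i1] by simp
  qed (use i2 in simp)
  finally show "cmod (ift g y - ift g x - (y - x) *\<^sub>R ift (\<lambda>\<xi>. \<i> * of_real \<xi> * g \<xi>) x)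
     \<le> (LINT \<xi>|lborel. \<xi>\<^sup>2 * cmod (g \<xi>)) * (y - x)\<^sup>2"
    by (simp add: mult.commute)
qed

lemma smooth_ift:
  assumes "all_moments g" shows "smooth (ift g)"
proof (rule smooth_coinduct[of "\<lambda>f. \<exists>g. all_moments g \<and> f = ift g"])
  fix f assume "\<exists>g. all_moments g \<and> f = ift g"
  then obtain g where g: "all_moments g" "f = ift g" by blast
  show "f differentiable_on UNIV \<and> (\<exists>g. all_moments g \<and> ddx f = ift g)"
    using ddx_eqI[OF ift_has_vector_derivative[OF g(1)]] all_moments_mult[OF g(1)] g(2) by blast
qed (use assms in blast)

lemma test_all_moments:
  assumes "\<phi> \<in> test_functions S" shows "all_moments \<phi>"
  unfolding all_moments_def
proof
  fix k
  have "integrable lborel (\<lambda>\<xi>. \<phi> \<xi> * of_real \<xi> ^ k)"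
    by (rule test_mult_integrable[OF assms]) (intro continuous_intros)
  then show "integrable lborel (\<lambda>\<xi>. of_real \<xi> ^ k * \<phi> \<xi>)" by (simp add: mult.commute)
qed

lemma continuous_on_fourier:
  assumes "\<phi> \<in> test_functions S" shows "continuous_on T (fourier \<phi>)"
proof -
  have "continuous_on (uminus ` T) (ift \<phi>)"
    by (rule smooth_continuous_on[OF smooth_ift[OF test_all_moments[OF assms]]])
  then have "continuous_on T (\<lambda>\<xi>. ift \<phi> (- \<xi>))"
    by (rule continuous_on_compose2) (auto intro: continuous_intros)
  then show ?thesis by (simp add: fourier_ift[abs_def])
qed

text \<open>The product of \<phi> with the exponential has compact support, so its derivative
  integrates to 0.\<close>

lemma fourier_ddx:
  assumes "\<phi> \<in> test_functions S"
  shows "fourier (ddx \<phi>) \<xi> = \<i> * of_real \<xi> * fourier \<phi> \<xi>"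
proof -
  obtain R where R: "R > 0" "\<And>x. \<bar>x\<bar> > R \<Longrightarrow> \<phi> x = 0" using test_bounded_support[OF assms] by blast
  obtain R' where R': "R' > 0" "\<And>x. \<bar>x\<bar> > R' \<Longrightarrow> ddx \<phi> x = 0"
    using test_bounded_support[OF test_functions_ddx[OF assms]] by blast
  let ?e = "\<lambda>x. cis (- (x * \<xi>))"
  have de: "(?e has_vector_derivative - \<i> * of_real \<xi> * ?e x) (at x)" for x
    unfolding has_vector_derivative_def
    by (auto intro!: derivative_eq_intros simp: scaleR_conv_of_real algebra_simps)
  have "(LINT x|lborel. \<phi> x * (- \<i> * of_real \<xi> * ?e x) + ddx \<phi> x * ?e x) = 0"
  proof (rule integral_ddx_compact_support[where R = "max R R'"])
    fix x show "((\<lambda>x. \<phi> x * ?e x) has_vector_derivative \<phi> x * (- \<i> * of_real \<xi> * ?e x) + ddx \<phi> x * ?e x) (at x)"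
      by (rule has_vector_derivative_mult[OF smooth_has_vector_derivative[OF test_smooth[OF assms]] de])
  next
    show "continuous_on UNIV (\<lambda>x. \<phi> x * (- \<i> * of_real \<xi> * ?e x) + ddx \<phi> x * ?e x)"
      by (intro continuous_intros test_continuous_on[OF assms] test_continuous_on[OF test_functions_ddx[OF assms]])
  qed (use R R' in auto)
  moreover have "integrable lborel (\<lambda>x. \<phi> x * (- \<i> * of_real \<xi> * ?e x))"
    by (rule test_mult_integrable[OF assms]) (intro continuous_intros)
  moreover have "integrable lborel (\<lambda>x. ddx \<phi> x * ?e x)"
    by (rule test_mult_integrable[OF test_functions_ddx[OF assms]]) (intro continuous_intros)
  ultimately have "(LINT x|lborel. \<phi> x * (- \<i> * of_real \<xi> * ?e x)) + fourier (ddx \<phi>) \<xi> = 0"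
    by (simp add: fourier_def)
  moreover have "(LINT x|lborel. \<phi> x * (- \<i> * of_real \<xi> * ?e x)) = (- \<i> * of_real \<xi>) * (LINT x|lborel. \<phi> x * ?e x)"
    by (subst integral_mult_right_zero[symmetric]) (simp add: mult_ac)
  ultimately show ?thesis by (simp add: fourier_def algebra_simps)
qed

text \<open>Each power of \<xi> is exchanged for a derivative of the test function, which is again a
  test function; hence \<phi> is arbitrary in the induction.\<close>

lemma fourier_power_bounded:
  assumes "\<phi> \<in> test_functions S"
  shows "\<exists>C>0. \<forall>\<xi>. \<bar>\<xi>\<bar> ^ k * cmod (fourier \<phi> \<xi>) \<le> C"
  using assms
proof (induction k arbitrary: \<phi>)
  case 0
  have "cmod (fourier \<phi> \<xi>) \<le> (LINT x|lborel. cmod (\<phi> x)) + 1" for \<xi>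
    using norm_ift_le[OF test_integrable[OF 0]] by (simp add: fourier_ift add.commute add_increasing)
  then show ?case by (intro exI[of _ "(LINT x|lborel. cmod (\<phi> x)) + 1"]) (auto intro: add_nonneg_pos)
next
  case (Suc k)
  from Suc.IH[OF test_functions_ddx[OF Suc.prems]] show ?case
    by (simp add: fourier_ddx[OF Suc.prems] norm_mult mult_ac)
qed

text \<open>Adding the bounds for the exponents k and k + 2 gives an integrable majorant.\<close>

lemma fourier_decay:
  assumes "\<phi> \<in> test_functions S"
  shows "\<exists>C>0. \<forall>\<xi>. \<bar>\<xi>\<bar> ^ k * cmod (fourier \<phi> \<xi>) \<le> C / (1 + \<xi>\<^sup>2)"
proof -
  obtain C where C: "C > 0" "\<And>\<xi>. \<bar>\<xi>\<bar> ^ k * cmod (fourier \<phi> \<xi>) \<le> C"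
    using fourier_power_bounded[OF assms] by blast
  obtain D where D: "D > 0" "\<And>\<xi>. \<bar>\<xi>\<bar> ^ (k + 2) * cmod (fourier \<phi> \<xi>) \<le> D"
    using fourier_power_bounded[OF assms] by blast
  have "\<bar>\<xi>\<bar> ^ k * cmod (fourier \<phi> \<xi>) \<le> (C + D) / (1 + \<xi>\<^sup>2)" for \<xi>
  proof -
    have "(1 + \<xi>\<^sup>2) * (\<bar>\<xi>\<bar> ^ k * cmod (fourier \<phi> \<xi>)) \<le> C + D"
      using C(2)[of \<xi>] D(2)[of \<xi>] by (simp add: algebra_simps power2_eq_square)
    moreover have "1 + \<xi>\<^sup>2 > 0" by (simp add: add_pos_nonneg)
    ultimately show ?thesis by (simp add: pos_le_divide_eq mult.commute)
  qed
  then show ?thesis using C(1) D(1) by (intro exI[of _ "C + D"]) auto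
qed

lemma integrable_inverse_1_plus_square_lborel: "integrable lborel (\<lambda>x::real. inverse (1 + x\<^sup>2))"
  using integrable_inverse_1_plus_square by (simp add: set_integrable_def)

lemma fourier_test_all_moments:
  assumes "\<phi> \<in> test_functions S"
  shows "all_moments (fourier \<phi>)"
  unfolding all_moments_def
proof
  fix k
  have [measurable]: "\<phi> \<in> borel_measurable borel" using assms by (rule test_measurable)
  obtain C where C: "C > 0" "\<And>\<xi>. \<bar>\<xi>\<bar> ^ k * cmod (fourier \<phi> \<xi>) \<le> C / (1 + \<xi>\<^sup>2)"
    using fourier_decay[OF assms] by blast
  show "integrable lborel (\<lambda>\<xi>. of_real \<xi> ^ k * fourier \<phi> \<xi>)"
  proof (rule Bochner_Integration.integrable_bound)
    show "integrable lborel (\<lambda>\<xi>. C * inverse (1 + \<xi>\<^sup>2))"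
      using integrable_inverse_1_plus_square_lborel by (rule Bochner_Integration.integrable_mult_right)
    show "AE \<xi> in lborel. norm (of_real \<xi> ^ k * fourier \<phi> \<xi>) \<le> norm (C * inverse (1 + \<xi>\<^sup>2))"
      using C by (intro AE_I2) (auto simp: norm_mult norm_power divide_inverse intro: order_trans)
  qed measurable
qed

lemma fourier_test_integrable: "\<phi> \<in> test_functions S \<Longrightarrow> integrable lborel (fourier \<phi>)"
  by (intro all_moments_integrable fourier_test_all_moments)

subsection \<open>Uniqueness and inversion\<close>

text \<open>Positive and negative part, divided by their common mass, are densities of two
  probability measures with the same characteristic function; Levy's uniqueness theorem identifies
  them.\<close>

lemma ift_zero_imp_AE_zero_real:
  fixes h :: "real \<Rightarrow> real"
  assumes int: "integrable lborel h" and zero: "\<And>x. ift (\<lambda>\<xi>. of_real (h \<xi>)) x = 0"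
  shows "AE \<xi> in lborel. h \<xi> = 0"
proof -
  have [measurable]: "h \<in> borel_measurable borel" using int borel_measurable_integrable by auto
  define p where "p = (\<lambda>\<xi>. max (h \<xi>) 0)"
  define q where "q = (\<lambda>\<xi>. max (- h \<xi>) 0)"
  have [measurable]: "p \<in> borel_measurable borel" "q \<in> borel_measurable borel"
    unfolding p_def q_def by measurable
  have pq: "h \<xi> = p \<xi> - q \<xi>" "0 \<le> p \<xi>" "0 \<le> q \<xi>" for \<xi> by (auto simp: p_def q_def)
  have intp: "integrable lborel p" and intq: "integrable lborel q"
    unfolding p_def q_def using int by (auto intro!: Bochner_Integration.integrable_max)
  have ift_eq: "ift (\<lambda>\<xi>. of_real (p \<xi>)) x = ift (\<lambda>\<xi>. of_real (q \<xi>)) x" for x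
  proof -
    have "ift (\<lambda>\<xi>. of_real (h \<xi>)) x = (LINT \<xi>|lborel. of_real (p \<xi>) * cis (x * \<xi>) - of_real (q \<xi>) * cis (x * \<xi>))"
      by (simp add: ift_def pq(1) left_diff_distrib)
    also have "\<dots> = ift (\<lambda>\<xi>. of_real (p \<xi>)) x - ift (\<lambda>\<xi>. of_real (q \<xi>)) x"
      unfolding ift_def
      by (intro Bochner_Integration.integral_diff integrable_mult_cis_lborel integrable_of_real intp intq)
    finally show ?thesis using zero[of x] by simp
  qed
  define m where "m = (LINT \<xi>|lborel. p \<xi>)"
  \<comment> \<open>At x = 0 the two transforms are the masses of the two parts.\<close>
  have mq: "m = (LINT \<xi>|lborel. q \<xi>)"
    using ift_eq[of 0] by (simp add: ift_def m_def)
  show ?thesis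
  proof (cases "m = 0")
    case True
    then have "AE \<xi> in lborel. p \<xi> = 0" "AE \<xi> in lborel. q \<xi> = 0"
      using integral_nonneg_eq_0_iff_AE[OF intp] integral_nonneg_eq_0_iff_AE[OF intq] mq pq by (auto simp: m_def)
    then show ?thesis by eventually_elim (simp add: pq(1))
  next
    case False
    moreover have "m \<ge> 0" unfolding m_def using pq by simp
    ultimately have m: "m > 0" by simp
    have dist: "real_distribution (density lborel (\<lambda>\<xi>. ennreal (r \<xi> / m)))"
      and char: "char (density lborel (\<lambda>\<xi>. ennreal (r \<xi> / m))) x = ift (\<lambda>\<xi>. of_real (r \<xi>)) x / of_real m"
      if r: "integrable lborel r" "\<And>\<xi>. 0 \<le> r \<xi>" "(LINT \<xi>|lborel. r \<xi>) = m" for r x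
    proof -
      have [measurable]: "r \<in> borel_measurable borel" using r borel_measurable_integrable by auto
      have "prob_space (density lborel (\<lambda>\<xi>. ennreal (r \<xi> / m)))"
      proof (rule prob_spaceI)
        have "emeasure (density lborel (\<lambda>\<xi>. ennreal (r \<xi> / m))) (space (density lborel (\<lambda>\<xi>. ennreal (r \<xi> / m))))
            = (\<integral>\<^sup>+\<xi>. ennreal (r \<xi> / m) \<partial>lborel)"
          by (simp add: emeasure_density)
        also have "\<dots> = ennreal (LINT \<xi>|lborel. r \<xi> / m)"
          using r m by (intro nn_integral_eq_integral) auto
        also have "\<dots> = 1" using r m by simp
        finally show "emeasure (density lborel (\<lambda>\<xi>. ennreal (r \<xi> / m))) (space (density lborel (\<lambda>\<xi>. ennreal (r \<xi> / m)))) = 1" .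
      qed
      then show "real_distribution (density lborel (\<lambda>\<xi>. ennreal (r \<xi> / m)))"
        by (simp add: real_distribution_def real_distribution_axioms_def)
      have "char (density lborel (\<lambda>\<xi>. ennreal (r \<xi> / m))) x = (LINT \<xi>|lborel. (r \<xi> / m) *\<^sub>R iexp (x * \<xi>))"
        unfolding char_def using r m by (subst integral_density) auto
      also have "\<dots> = (LINT \<xi>|lborel. (of_real (r \<xi>) * cis (x * \<xi>)) / of_real m)"
        by (simp add: scaleR_conv_of_real cis_conv_exp)
      also have "\<dots> = ift (\<lambda>\<xi>. of_real (r \<xi>)) x / of_real m" by (simp add: ift_def)
      finally show "char (density lborel (\<lambda>\<xi>. ennreal (r \<xi> / m))) x = ift (\<lambda>\<xi>. of_real (r \<xi>)) x / of_real m" .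
    qed
    have "density lborel (\<lambda>\<xi>. ennreal (p \<xi> / m)) = density lborel (\<lambda>\<xi>. ennreal (q \<xi> / m))"
      by (rule Levy_uniqueness) (use dist char intp intq pq mq m_def ift_eq in \<open>auto simp: fun_eq_iff\<close>)
    then have "AE \<xi> in lborel. ennreal (p \<xi> / m) = ennreal (q \<xi> / m)"
      by (subst (asm) sigma_finite_measure.density_unique_iff[OF sigma_finite_lborel]) auto
    then show ?thesis
      by eventually_elim (use m pq in \<open>simp add: ennreal_inj\<close>)
  qed
qed

text \<open>The transform of the conjugate is the conjugate of the reflected transform, so the real
  and the imaginary part have vanishing transforms too.\<close>

lemma ift_zero_imp_AE_zero:
  assumes int: "integrable lborel H" and zero: "\<And>x. ift H x = 0"
  shows "AE \<xi> in lborel. H \<xi> = 0"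
proof -
  have cz: "ift (\<lambda>\<xi>. cnj (H \<xi>)) x = 0" for x
  proof -
    have "ift (\<lambda>\<xi>. cnj (H \<xi>)) x = (LINT \<xi>|lborel. cnj (H \<xi> * cis (- x * \<xi>)))"
      by (simp add: ift_def cis_cnj)
    also have "\<dots> = cnj (ift H (- x))" by (simp only: ift_def Bochner_Integration.integral_cnj)
    finally show ?thesis by (simp add: zero)
  qed
  have intc: "integrable lborel (\<lambda>\<xi>. cnj (H \<xi>))" using int by simp
  have sum: "ift (\<lambda>\<xi>. a * H \<xi> + b * cnj (H \<xi>)) x = 0" for a b x
  proof -
    have "ift (\<lambda>\<xi>. a * H \<xi> + b * cnj (H \<xi>)) x = (LINT \<xi>|lborel. a * (H \<xi> * cis (x * \<xi>)) + b * (cnj (H \<xi>) * cis (x * \<xi>)))"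
      by (simp add: ift_def algebra_simps)
    also have "\<dots> = a * ift H x + b * ift (\<lambda>\<xi>. cnj (H \<xi>)) x"
      using integrable_mult_cis_lborel[OF int] integrable_mult_cis_lborel[OF intc] by (simp add: ift_def)
    finally show ?thesis by (simp add: zero cz)
  qed
  have "(\<lambda>\<xi>. of_real (Re (H \<xi>))) = (\<lambda>\<xi>. 1/2 * H \<xi> + 1/2 * cnj (H \<xi>))"
    by (auto simp: fun_eq_iff complex_eq_iff)
  then have "AE \<xi> in lborel. Re (H \<xi>) = 0"
    using int by (intro ift_zero_imp_AE_zero_real integrable_Re) (simp_all only: sum)
  moreover have "(\<lambda>\<xi>. of_real (Im (H \<xi>))) = (\<lambda>\<xi>. - \<i>/2 * H \<xi> + \<i>/2 * cnj (H \<xi>))"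
    by (auto simp: fun_eq_iff complex_eq_iff)
  then have "AE \<xi> in lborel. Im (H \<xi>) = 0"
    using int by (intro ift_zero_imp_AE_zero_real integrable_Im) (simp_all only: sum)
  ultimately show ?thesis by eventually_elim (simp add: complex_eq_iff)
qed

text \<open>The Gaussian is, up to a factor, its own Fourier transform; by \<open>integral_mult_ift\<close> the
  mollification of \<open>\<phi>\<close> by a narrow Gaussian is thus a Gaussian mean of \<open>fourier \<phi>\<close>.\<close>

lemma ift_std_normal: "ift (\<lambda>z. of_real (std_normal_density z)) \<eta> = of_real (exp (- (\<eta>\<^sup>2) / 2))"
proof -
  have "char std_normal_distribution \<eta> = (LINT z|lborel. std_normal_density z *\<^sub>R iexp (\<eta> * z))"
    unfolding char_def by (subst integral_density) (auto simp: normal_density_nonneg)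
  then show ?thesis
    by (simp add: char_std_normal_distribution ift_def cis_conv_exp scaleR_conv_of_real)
qed

lemma ift_fourier:
  assumes "\<phi> \<in> test_functions S"
  shows "ift (fourier \<phi>) x = 2 * of_real pi * \<phi> x"
proof -
  have [measurable]: "\<phi> \<in> borel_measurable borel" using assms by (rule test_measurable)
  let ?n = "\<lambda>z. complex_of_real (std_normal_density z)"
  have intn: "integrable lborel ?n" by (simp add: integrable_of_real)
  \<comment> \<open>An identity at positive width \<sigma>; dominated convergence on both sides then
    lets \<sigma> tend to 0 along 1/(k + 1).\<close>
  have key: "of_real (sqrt (2 * pi)) * (LINT z|lborel. \<phi> (x + \<sigma> * z) * ?n z)
      = (LINT \<xi>|lborel. fourier \<phi> \<xi> * cis (x * \<xi>) * ?n (\<sigma> * \<xi>))" if \<sigma>: "\<sigma> > 0" for \<sigma>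
  proof -
    have "of_real (sqrt (2 * pi)) * ?n z = of_real (exp (- (z\<^sup>2) / 2))" for z
      by (simp add: normal_density_def)
    then have n_ift: "of_real (sqrt (2 * pi)) * ?n z = ift ?n z" for z by (simp add: ift_std_normal)
    have "of_real (sqrt (2 * pi)) * (LINT z|lborel. \<phi> (x + \<sigma> * z) * ?n z)
        = (LINT z|lborel. \<phi> (x + \<sigma> * z) * (of_real (sqrt (2 * pi)) * ?n z))"
      by (subst integral_mult_right_zero[symmetric]) (simp add: mult_ac)
    also have "\<dots> = (LINT z|lborel. \<phi> (x + \<sigma> * z) * ift ?n z)" by (simp only: n_ift)
    also have "\<dots> = (LINT \<eta>|lborel. ?n \<eta> * ift (\<lambda>z. \<phi> (x + \<sigma> * z)) \<eta>)"
      by (rule integral_mult_ift[OF lborel_integrable_real_affine[OF test_integrable[OF assms]] intn]) (use \<sigma> in simp)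
    also have "\<dots> = (LINT \<eta>|lborel. ?n \<eta> * (of_real (1 / \<bar>\<sigma>\<bar>) * cis (- (x * \<eta> / \<sigma>)) * ift \<phi> (\<eta> / \<sigma>)))"
      using \<sigma> by (simp add: ift_affine)
    \<comment> \<open>The substitution \<eta> = - \<sigma> \<xi>, rather than \<sigma> \<xi>, turns
      \<open>ift \<phi>\<close> into \<open>fourier \<phi>\<close>.\<close>
    also have "\<dots> = \<bar>- \<sigma>\<bar> *\<^sub>R (LINT \<xi>|lborel. ?n (0 + (- \<sigma>) * \<xi>) *
        (of_real (1 / \<bar>\<sigma>\<bar>) * cis (- (x * (0 + (- \<sigma>) * \<xi>) / \<sigma>)) * ift \<phi> ((0 + (- \<sigma>) * \<xi>) / \<sigma>)))"
      by (rule lborel_integral_real_affine) (use \<sigma> in simp)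
    also have "\<dots> = (LINT \<xi>|lborel. fourier \<phi> \<xi> * cis (x * \<xi>) * ?n (\<sigma> * \<xi>))"
    proof -
      have "?n (0 + (- \<sigma>) * \<xi>) * (of_real (1 / \<bar>\<sigma>\<bar>) * cis (- (x * (0 + (- \<sigma>) * \<xi>) / \<sigma>)) * ift \<phi> ((0 + (- \<sigma>) * \<xi>) / \<sigma>))
         = of_real (1 / \<sigma>) * (fourier \<phi> \<xi> * cis (x * \<xi>) * ?n (\<sigma> * \<xi>))" for \<xi>
        using \<sigma> by (simp add: fourier_ift normal_density_def mult_ac)
      then have "(LINT \<xi>|lborel. ?n (0 + (- \<sigma>) * \<xi>) *
          (of_real (1 / \<bar>\<sigma>\<bar>) * cis (- (x * (0 + (- \<sigma>) * \<xi>) / \<sigma>)) * ift \<phi> ((0 + (- \<sigma>) * \<xi>) / \<sigma>)))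
        = (LINT \<xi>|lborel. of_real (1 / \<sigma>) * (fourier \<phi> \<xi> * cis (x * \<xi>) * ?n (\<sigma> * \<xi>)))"
        by (simp only:)
      also have "\<dots> = of_real (1 / \<sigma>) * (LINT \<xi>|lborel. fourier \<phi> \<xi> * cis (x * \<xi>) * ?n (\<sigma> * \<xi>))"
        by (rule integral_mult_right_zero)
      finally show ?thesis using \<sigma> by (simp only: scaleR_conv_of_real) simp
    qed
    finally show ?thesis .
  qed
  obtain B where B: "B > 0" "\<And>x. cmod (\<phi> x) \<le> B" using test_bounded[OF assms] by blast
  let ?s = "\<lambda>k. 1 / real (Suc k)"
  have s0: "(\<lambda>k. ?s k) \<longlonglongrightarrow> 0" by (rule LIMSEQ_Suc[OF lim_1_over_n])
  have n_le: "std_normal_density z \<le> 1" for z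
  proof -
    have s: "1 \<le> sqrt (2 * pi)" using pi_gt3 by (simp add: real_le_rsqrt)
    have "exp (- (z\<^sup>2) / 2) \<le> 1" by simp
    then have "exp (- (z\<^sup>2) / 2) / sqrt (2 * pi) \<le> 1"
      using s by (subst pos_divide_le_eq) linarith+
    then show ?thesis by (simp add: normal_density_def)
  qed
  have A: "(\<lambda>k. LINT z|lborel. \<phi> (x + ?s k * z) * ?n z) \<longlonglongrightarrow> (LINT z|lborel. \<phi> x * ?n z)"
  proof (rule integral_dominated_convergence[where w = "\<lambda>z. B * std_normal_density z"])
    have ct: "isCont \<phi> x" using test_continuous_on[OF assms, of UNIV] by (simp add: continuous_on_eq_continuous_at)
    have "(\<lambda>k. x + ?s k * z) \<longlonglongrightarrow> x + 0 * z" for z by (intro tendsto_intros s0)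
    then have "(\<lambda>k. x + ?s k * z) \<longlonglongrightarrow> x" for z by (simp only: mult_zero_left add_0_right)
    note isCont_tendsto_compose[OF ct this]
    then show "AE z in lborel. (\<lambda>k. \<phi> (x + ?s k * z) * ?n z) \<longlonglongrightarrow> \<phi> x * ?n z"
      by (intro AE_I2 tendsto_intros)
    show "AE z in lborel. norm (\<phi> (x + ?s k * z) * ?n z) \<le> B * std_normal_density z" for k
      using B by (intro AE_I2) (simp add: norm_mult mult_right_mono)
  qed simp_all
  have Bl: "(\<lambda>k. LINT \<xi>|lborel. fourier \<phi> \<xi> * cis (x * \<xi>) * ?n (?s k * \<xi>))
      \<longlonglongrightarrow> (LINT \<xi>|lborel. fourier \<phi> \<xi> * cis (x * \<xi>) * ?n 0)"
  proof (rule integral_dominated_convergence[where w = "\<lambda>\<xi>. cmod (fourier \<phi> \<xi>)"])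
    have ct: "isCont std_normal_density 0" unfolding normal_density_def by (intro continuous_intros) auto
    have "(\<lambda>k. ?s k * \<xi>) \<longlonglongrightarrow> 0 * \<xi>" for \<xi> by (intro tendsto_intros s0)
    then have "(\<lambda>k. ?s k * \<xi>) \<longlonglongrightarrow> 0" for \<xi> by (simp only: mult_zero_left)
    note isCont_tendsto_compose[OF ct this]
    then show "AE \<xi> in lborel. (\<lambda>k. fourier \<phi> \<xi> * cis (x * \<xi>) * ?n (?s k * \<xi>)) \<longlonglongrightarrow> fourier \<phi> \<xi> * cis (x * \<xi>) * ?n 0"
      by (intro AE_I2 tendsto_intros)
    show "AE \<xi> in lborel. norm (fourier \<phi> \<xi> * cis (x * \<xi>) * ?n (?s k * \<xi>)) \<le> cmod (fourier \<phi> \<xi>)" for k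
      using n_le by (intro AE_I2) (simp add: norm_mult mult_left_le)
    show "integrable lborel (\<lambda>\<xi>. cmod (fourier \<phi> \<xi>))" using fourier_test_integrable[OF assms] by simp
  qed measurable
  have "of_real (sqrt (2 * pi)) * (LINT z|lborel. \<phi> x * ?n z) = (LINT \<xi>|lborel. fourier \<phi> \<xi> * cis (x * \<xi>) * ?n 0)"
  proof (rule LIMSEQ_unique)
    show "(\<lambda>k. of_real (sqrt (2 * pi)) * (LINT z|lborel. \<phi> (x + ?s k * z) * ?n z))
        \<longlonglongrightarrow> of_real (sqrt (2 * pi)) * (LINT z|lborel. \<phi> x * ?n z)"
      by (intro tendsto_intros A)
    show "(\<lambda>k. of_real (sqrt (2 * pi)) * (LINT z|lborel. \<phi> (x + ?s k * z) * ?n z))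
        \<longlonglongrightarrow> (LINT \<xi>|lborel. fourier \<phi> \<xi> * cis (x * \<xi>) * ?n 0)"
      using Bl by (subst key) simp_all
  qed
  moreover have "(LINT z|lborel. \<phi> x * ?n z) = \<phi> x"
    by simp
  moreover have "(LINT \<xi>|lborel. fourier \<phi> \<xi> * cis (x * \<xi>) * ?n 0) = ift (fourier \<phi>) x * ?n 0"
    by (simp add: ift_def)
  moreover have "?n 0 = 1 / of_real (sqrt (2 * pi))" by (simp add: normal_density_def)
  ultimately have "of_real (sqrt (2 * pi)) * \<phi> x = ift (fourier \<phi>) x / of_real (sqrt (2 * pi))" by simp
  moreover have "complex_of_real (sqrt (2 * pi)) * of_real (sqrt (2 * pi)) = 2 * of_real pi"
    by (subst of_real_mult[symmetric]) simp
  moreover have "complex_of_real (sqrt (2 * pi)) \<noteq> 0" by simp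
  moreover have "F = c * p" if "s * p = F / s" "s * s = c" "s \<noteq> 0" for s p F c :: complex
    using that by (metis mult.assoc mult.commute nonzero_eq_divide_eq)
  ultimately show ?thesis by blast
qed

text \<open>Parseval's formula in bilinear form. After a reflection, the exchange of transforms
  leaves \<open>ift (fourier \<phi>)\<close>, which the inversion formula evaluates;
  \<open>f\<close> itself is never inverted.\<close>

lemma integral_fourier_mult_fourier:
  assumes f: "integrable lborel f" and \<phi>: "\<phi> \<in> test_functions S"
  shows "(LINT \<xi>|lborel. fourier f \<xi> * fourier \<phi> (- \<xi>)) = 2 * of_real pi * (LINT x|lborel. f x * \<phi> x)"
proof -
  have "(LINT \<xi>|lborel. fourier f \<xi> * fourier \<phi> (- \<xi>)) = (LINT \<xi>|lborel. fourier f (0 + (-1) * \<xi>) * fourier \<phi> (- (0 + (-1) * \<xi>)))"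
    using lborel_integral_real_affine[of "-1" "\<lambda>\<xi>. fourier f \<xi> * fourier \<phi> (- \<xi>)" 0] by simp
  also have "\<dots> = (LINT \<xi>|lborel. fourier \<phi> \<xi> * ift f \<xi>)"
    by (simp add: fourier_ift[of f] mult.commute)
  also have "\<dots> = (LINT x|lborel. f x * ift (fourier \<phi>) x)"
    by (rule integral_mult_ift[OF fourier_test_integrable[OF \<phi>] f])
  also have "\<dots> = (LINT x|lborel. 2 * of_real pi * (f x * \<phi> x))"
    by (simp add: ift_fourier[OF \<phi>] mult_ac)
  finally show ?thesis by simp
qed

lemma distr_of_fun_fourier:
  assumes "integrable lborel f"
  shows "distr_of_fun f = distr_with_fourier (fourier f)"
  using integral_fourier_mult_fourier[OF assms]
  by (auto simp: distr_of_fun_def distr_with_fourier_def fun_eq_iff)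

subsection \<open>Sobolev spaces\<close>

text \<open>With the Sobolev weight taken as a measure, the lemmas on square-integrable functions
  apply to \<open>weighted_L2\<close> as they stand.\<close>

definition sobolev_measure :: "real \<Rightarrow> real measure" where
  "sobolev_measure s = density lborel (\<lambda>\<xi>. ennreal ((1 + \<xi>\<^sup>2) powr s))"

lemma one_plus_sq_pos: "1 + (x::real)\<^sup>2 > 0"
  by (simp add: add_pos_nonneg)

lemma one_plus_sq_nonzero: "1 + (x::real)\<^sup>2 \<noteq> 0"
  using one_plus_sq_pos[of x] by simp

lemma borel_measurable_powr_weight [measurable]:
  "(\<lambda>\<xi>::real. (1 + \<xi>\<^sup>2) powr s) \<in> borel_measurable borel"
  by (intro borel_measurable_continuous_onI continuous_intros) (simp add: one_plus_sq_nonzero)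

lemma measurable_sobolev_measure: "borel_measurable (sobolev_measure s) = borel_measurable borel"
  unfolding sobolev_measure_def by (rule measurable_cong_sets) auto

lemma integral_sobolev_measure:
  fixes f :: "real \<Rightarrow> 'a::{banach, second_countable_topology}"
  assumes "f \<in> borel_measurable borel"
  shows "(LINT \<xi>|sobolev_measure s. f \<xi>) = (LINT \<xi>|lborel. (1 + \<xi>\<^sup>2) powr s *\<^sub>R f \<xi>)"
  unfolding sobolev_measure_def using assms by (intro integral_density) auto

lemma integrable_sobolev_measure:
  fixes f :: "real \<Rightarrow> 'a::{banach, second_countable_topology}"
  assumes "f \<in> borel_measurable borel"
  shows "integrable (sobolev_measure s) f \<longleftrightarrow> integrable lborel (\<lambda>\<xi>. (1 + \<xi>\<^sup>2) powr s *\<^sub>R f \<xi>)"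
  unfolding sobolev_measure_def using assms by (intro integrable_density) auto

lemma weighted_L2_iff: "g \<in> weighted_L2 s \<longleftrightarrow> square_integrable (sobolev_measure s) g"
proof (cases "g \<in> borel_measurable borel")
  case True
  then show ?thesis by (simp add: weighted_L2_def square_integrable_def measurable_sobolev_measure integrable_sobolev_measure)
qed (simp add: weighted_L2_def square_integrable_def measurable_sobolev_measure)

lemma weighted_L2_measurable: "g \<in> weighted_L2 s \<Longrightarrow> g \<in> borel_measurable borel"
  by (simp add: weighted_L2_def)

lemma weighted_L2_norm_sobolev_measure:
  assumes "g \<in> borel_measurable borel"
  shows "weighted_L2_norm s g = sqrt (LINT \<xi>|sobolev_measure s. (cmod (g \<xi>))\<^sup>2)"
  using assms by (simp add: weighted_L2_norm_def integral_sobolev_measure)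

lemma weighted_L2_norm_nonneg: "weighted_L2_norm s g \<ge> 0"
  by (simp add: weighted_L2_norm_def)

lemma weighted_L2_lincomb:
  assumes "g \<in> weighted_L2 s" "h \<in> weighted_L2 s"
  shows "(\<lambda>\<xi>. a * g \<xi> + b * h \<xi>) \<in> weighted_L2 s"
  using assms unfolding weighted_L2_iff by (intro square_integrable_add square_integrable_cmult)

lemma weighted_L2_diff:
  assumes "g \<in> weighted_L2 s" "h \<in> weighted_L2 s"
  shows "(\<lambda>\<xi>. g \<xi> - h \<xi>) \<in> weighted_L2 s"
  using assms unfolding weighted_L2_iff by (rule square_integrable_diff)

text \<open>An isometry of \<open>weighted_L2 s\<close> into the unweighted space. The factors for s
  and -s cancel in a product, so the duality of opposite orders becomes the ordinary Cauchy-Schwarz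
  inequality.\<close>

definition wmult :: "real \<Rightarrow> (real \<Rightarrow> complex) \<Rightarrow> real \<Rightarrow> complex" where
  "wmult s g \<xi> = of_real ((1 + \<xi>\<^sup>2) powr (s / 2)) * g \<xi>"

lemma cmod_wmult: "(cmod (wmult s g \<xi>))\<^sup>2 = (1 + \<xi>\<^sup>2) powr s * (cmod (g \<xi>))\<^sup>2"
proof -
  have "((1 + \<xi>\<^sup>2) powr (s / 2))\<^sup>2 = (1 + \<xi>\<^sup>2) powr s"
    by (simp add: power2_eq_square flip: powr_add)
  then show ?thesis by (simp add: wmult_def norm_mult power_mult_distrib)
qed

lemma square_integrable_wmult:
  assumes "g \<in> weighted_L2 s" shows "square_integrable lborel (wmult s g)"
proof -
  have [measurable]: "g \<in> borel_measurable borel" using assms by (rule weighted_L2_measurable)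
  have "wmult s g \<in> borel_measurable borel" unfolding wmult_def[abs_def] by measurable
  then show ?thesis using assms by (simp add: square_integrable_def cmod_wmult weighted_L2_def)
qed

lemma weighted_L2_norm_wmult: "weighted_L2_norm s g = sqrt (LINT \<xi>|lborel. (cmod (wmult s g \<xi>))\<^sup>2)"
  by (simp add: weighted_L2_norm_def cmod_wmult)

lemma wmult_mult: "wmult s g \<xi> * wmult (- s) h \<xi> = g \<xi> * h \<xi>"
proof -
  have "complex_of_real ((1 + \<xi>\<^sup>2) powr (s / 2)) * of_real ((1 + \<xi>\<^sup>2) powr (- s / 2)) = 1"
    using one_plus_sq_nonzero[of \<xi>] by (simp flip: of_real_mult powr_add)
  then have "wmult s g \<xi> * wmult (- s) h \<xi> = 1 * (g \<xi> * h \<xi>)"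
    unfolding wmult_def by (metis (no_types, lifting) mult.assoc mult.left_commute)
  then show ?thesis by simp
qed

lemma weighted_L2_pairing:
  assumes "g \<in> weighted_L2 s" "h \<in> weighted_L2 (- s)"
  shows "integrable lborel (\<lambda>\<xi>. g \<xi> * h \<xi>)"
    and "cmod (LINT \<xi>|lborel. g \<xi> * h \<xi>) \<le> weighted_L2_norm s g * weighted_L2_norm (- s) h"
  using square_integrable_mult[OF square_integrable_wmult[OF assms(1)] square_integrable_wmult[OF assms(2)]]
    Cauchy_Schwarz_integral[OF square_integrable_wmult[OF assms(1)] square_integrable_wmult[OF assms(2)]]
  by (simp_all only: wmult_mult weighted_L2_norm_wmult)

lemma weighted_L2_reflect:
  assumes "h \<in> weighted_L2 s"
  shows "(\<lambda>\<xi>. h (- \<xi>)) \<in> weighted_L2 s" "weighted_L2_norm s (\<lambda>\<xi>. h (- \<xi>)) = weighted_L2_norm s h"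
proof -
  have [measurable]: "h \<in> borel_measurable borel" using assms by (rule weighted_L2_measurable)
  have "integrable lborel (\<lambda>\<xi>. (1 + (0 + (-1) * \<xi>)\<^sup>2) powr s * (cmod (h (0 + (-1) * \<xi>)))\<^sup>2)"
    using assms by (intro lborel_integrable_real_affine) (auto simp: weighted_L2_def)
  then show "(\<lambda>\<xi>. h (- \<xi>)) \<in> weighted_L2 s" by (simp add: weighted_L2_def)
  show "weighted_L2_norm s (\<lambda>\<xi>. h (- \<xi>)) = weighted_L2_norm s h"
    unfolding weighted_L2_norm_def
    using lborel_integral_real_affine[of "-1" "\<lambda>\<xi>. (1 + \<xi>\<^sup>2) powr s * (cmod (h \<xi>))\<^sup>2" 0] by simp
qed

text \<open>The squared decay (1 + xi^2)^(-2) outweighs a weight of order up to 1 and leaves the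
  integrable function 1 / (1 + xi^2).\<close>

lemma weighted_L2_decay:
  assumes [measurable]: "g \<in> borel_measurable borel" and "\<And>\<xi>. cmod (g \<xi>) \<le> C / (1 + \<xi>\<^sup>2)" "s \<le> 1"
  shows "g \<in> weighted_L2 s"
proof -
  have "integrable lborel (\<lambda>\<xi>. (1 + \<xi>\<^sup>2) powr s * (cmod (g \<xi>))\<^sup>2)"
  proof (rule Bochner_Integration.integrable_bound)
    show "integrable lborel (\<lambda>\<xi>. C\<^sup>2 * inverse (1 + \<xi>\<^sup>2))"
      using integrable_inverse_1_plus_square_lborel by (rule Bochner_Integration.integrable_mult_right)
    show "AE \<xi> in lborel. norm ((1 + \<xi>\<^sup>2) powr s * (cmod (g \<xi>))\<^sup>2) \<le> norm (C\<^sup>2 * inverse (1 + \<xi>\<^sup>2))"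
    proof (intro AE_I2)
      fix \<xi> :: real
      have p: "0 < 1 + \<xi>\<^sup>2" by (rule one_plus_sq_pos)
      have "(1 + \<xi>\<^sup>2) powr s \<le> (1 + \<xi>\<^sup>2) powr 1" using assms(3) by (intro powr_mono) auto
      moreover have "(cmod (g \<xi>))\<^sup>2 \<le> (C / (1 + \<xi>\<^sup>2))\<^sup>2" by (intro power_mono assms) simp
      ultimately have "(1 + \<xi>\<^sup>2) powr s * (cmod (g \<xi>))\<^sup>2 \<le> (1 + \<xi>\<^sup>2) * (C / (1 + \<xi>\<^sup>2))\<^sup>2"
        using p by (intro mult_mono) auto
      also have "y * (C / y)\<^sup>2 = C\<^sup>2 * inverse y" if "y > 0" for y :: real
        using that by (simp add: power2_eq_square field_simps)
      note this[OF p]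
      finally show "norm ((1 + \<xi>\<^sup>2) powr s * (cmod (g \<xi>))\<^sup>2) \<le> norm (C\<^sup>2 * inverse (1 + \<xi>\<^sup>2))"
        using p by simp
    qed
  qed measurable
  then show ?thesis by (simp add: weighted_L2_def)
qed

lemma fourier_weighted_L2:
  assumes "\<phi> \<in> test_functions S" "s \<le> 1"
  shows "fourier \<phi> \<in> weighted_L2 s"
proof -
  have [measurable]: "\<phi> \<in> borel_measurable borel" using assms(1) by (rule test_measurable)
  obtain C where "\<And>\<xi>. cmod (fourier \<phi> \<xi>) \<le> C / (1 + \<xi>\<^sup>2)"
    using fourier_decay[OF assms(1), of 0] by auto
  then show ?thesis using assms(2) by (intro weighted_L2_decay) auto
qed

lemma weighted_L2_mono:
  assumes "g \<in> weighted_L2 s" "t \<le> s" shows "g \<in> weighted_L2 t"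
proof -
  have [measurable]: "g \<in> borel_measurable borel" using assms(1) by (rule weighted_L2_measurable)
  have "integrable lborel (\<lambda>\<xi>. (1 + \<xi>\<^sup>2) powr t * (cmod (g \<xi>))\<^sup>2)"
  proof (rule Bochner_Integration.integrable_bound)
    show "integrable lborel (\<lambda>\<xi>. (1 + \<xi>\<^sup>2) powr s * (cmod (g \<xi>))\<^sup>2)" using assms(1) by (simp add: weighted_L2_def)
    show "AE \<xi> in lborel. norm ((1 + \<xi>\<^sup>2) powr t * (cmod (g \<xi>))\<^sup>2) \<le> norm ((1 + \<xi>\<^sup>2) powr s * (cmod (g \<xi>))\<^sup>2)"
      using assms(2) by (intro AE_I2) (auto intro!: mult_right_mono powr_mono)
  qed measurable
  then show ?thesis by (simp add: weighted_L2_def)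
qed

lemma square_integrable_of_weighted_L2:
  assumes "g \<in> weighted_L2 s" "s \<ge> 0" shows "square_integrable lborel g"
  using weighted_L2_mono[OF assms] by (simp add: weighted_L2_def square_integrable_def one_plus_sq_nonzero)

lemma distr_pairing_integrable:
  assumes "g \<in> weighted_L2 s" "\<bar>s\<bar> \<le> 1" "\<phi> \<in> test_functions S"
  shows "integrable lborel (\<lambda>\<xi>. g \<xi> * fourier \<phi> (- \<xi>))"
  using assms by (intro weighted_L2_pairing(1)[OF assms(1)] weighted_L2_reflect fourier_weighted_L2) auto

lemma distr_with_fourier_bound:
  assumes "g \<in> weighted_L2 s" "\<bar>s\<bar> \<le> 1" "\<phi> \<in> test_functions S"
  shows "cmod (distr_with_fourier g \<phi>) \<le> weighted_L2_norm s g * weighted_L2_norm (- s) (fourier \<phi>)"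
proof -
  have f: "fourier \<phi> \<in> weighted_L2 (- s)" using assms by (intro fourier_weighted_L2) auto
  have "cmod (LINT \<xi>|lborel. g \<xi> * fourier \<phi> (- \<xi>)) \<le> weighted_L2_norm s g * weighted_L2_norm (- s) (\<lambda>\<xi>. fourier \<phi> (- \<xi>))"
    by (rule weighted_L2_pairing(2)[OF assms(1) weighted_L2_reflect(1)[OF f]])
  also have "weighted_L2_norm (- s) (\<lambda>\<xi>. fourier \<phi> (- \<xi>)) = weighted_L2_norm (- s) (fourier \<phi>)"
    by (rule weighted_L2_reflect(2)[OF f])
  finally have *: "cmod (LINT \<xi>|lborel. g \<xi> * fourier \<phi> (- \<xi>)) \<le> weighted_L2_norm s g * weighted_L2_norm (- s) (fourier \<phi>)" .
  have "cmod (distr_with_fourier g \<phi>) = cmod (LINT \<xi>|lborel. g \<xi> * fourier \<phi> (- \<xi>)) / (2 * pi)"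
    using test_functions_UNIV[OF assms(3)] by (simp add: distr_with_fourier_def norm_mult norm_divide)
  also have "\<dots> \<le> cmod (LINT \<xi>|lborel. g \<xi> * fourier \<phi> (- \<xi>)) / 1"
    using pi_gt3 by (intro divide_left_mono) auto
  finally show ?thesis using * by simp
qed

lemma distr_with_fourier_lincomb:
  assumes "g \<in> weighted_L2 s" "h \<in> weighted_L2 s" "\<bar>s\<bar> \<le> 1"
  shows "distr_with_fourier (\<lambda>\<xi>. a * g \<xi> + b * h \<xi>) = (\<lambda>\<phi>. a * distr_with_fourier g \<phi> + b * distr_with_fourier h \<phi>)"
proof
  fix \<phi>
  show "distr_with_fourier (\<lambda>\<xi>. a * g \<xi> + b * h \<xi>) \<phi> = a * distr_with_fourier g \<phi> + b * distr_with_fourier h \<phi>"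
  proof (cases "\<phi> \<in> test_functions UNIV")
    case True
    have i: "integrable lborel (\<lambda>\<xi>. g \<xi> * fourier \<phi> (- \<xi>))" "integrable lborel (\<lambda>\<xi>. h \<xi> * fourier \<phi> (- \<xi>))"
      using assms True by (auto intro: distr_pairing_integrable)
    have "(LINT \<xi>|lborel. (a * g \<xi> + b * h \<xi>) * fourier \<phi> (- \<xi>)) =
       (LINT \<xi>|lborel. a * (g \<xi> * fourier \<phi> (- \<xi>)) + b * (h \<xi> * fourier \<phi> (- \<xi>)))"
      by (simp add: algebra_simps)
    also have "\<dots> = a * (LINT \<xi>|lborel. g \<xi> * fourier \<phi> (- \<xi>)) + b * (LINT \<xi>|lborel. h \<xi> * fourier \<phi> (- \<xi>))"
      using i by simp
    finally show ?thesis using True by (simp add: distr_with_fourier_def algebra_simps)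
  qed (simp add: distr_with_fourier_def)
qed

lemma distr_with_fourier_cong_AE:
  assumes "AE \<xi> in lborel. g \<xi> = h \<xi>" "g \<in> borel_measurable borel" "h \<in> borel_measurable borel"
  shows "distr_with_fourier g = distr_with_fourier h"
proof
  fix \<phi>
  show "distr_with_fourier g \<phi> = distr_with_fourier h \<phi>"
  proof (cases "\<phi> \<in> test_functions UNIV")
    case True
    have [measurable]: "\<phi> \<in> borel_measurable borel" "g \<in> borel_measurable borel" "h \<in> borel_measurable borel"
      using True test_measurable assms by auto
    have "(LINT \<xi>|lborel. g \<xi> * fourier \<phi> (- \<xi>)) = (LINT \<xi>|lborel. h \<xi> * fourier \<phi> (- \<xi>))"
      by (rule integral_cong_AE) (use assms(1) in auto)
    then show ?thesis by (simp add: distr_with_fourier_def)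
  qed (simp add: distr_with_fourier_def)
qed

section \<open>Norms of distributions\<close>

lemma sobolev_norm_le:
  assumes "g \<in> weighted_L2 s" shows "sobolev_norm s (distr_with_fourier g) \<le> weighted_L2_norm s g"
  unfolding sobolev_norm_def
  by (rule cInf_lower) (use assms weighted_L2_norm_nonneg in \<open>auto intro!: bdd_belowI[of _ 0]\<close>)

lemma sobolev_norm_ge:
  assumes "T \<in> sobolev s" "\<And>g. g \<in> weighted_L2 s \<Longrightarrow> distr_with_fourier g = T \<Longrightarrow> B \<le> weighted_L2_norm s g"
  shows "B \<le> sobolev_norm s T"
  unfolding sobolev_norm_def
  by (rule cInf_greatest) (use assms in \<open>auto simp: sobolev_def\<close>)

lemma sobolev_norm_nonneg: "T \<in> sobolev s \<Longrightarrow> 0 \<le> sobolev_norm s T"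
  by (rule sobolev_norm_ge) (auto intro: weighted_L2_norm_nonneg)

lemma sobolev_on_norm_le:
  assumes "g \<in> weighted_L2 s"
  shows "sobolev_on_norm s S (restrict_distr S (distr_with_fourier g)) \<le> weighted_L2_norm s g"
proof -
  have "sobolev_on_norm s S (restrict_distr S (distr_with_fourier g)) \<le> sobolev_norm s (distr_with_fourier g)"
    unfolding sobolev_on_norm_def
    by (rule cInf_lower) (use assms sobolev_norm_nonneg in \<open>auto intro!: bdd_belowI[of _ 0] simp: sobolev_def\<close>)
  then show ?thesis using sobolev_norm_le[OF assms] by simp
qed

text \<open>Evaluation at a fixed test function is continuous for the quotient norm, because the
  estimate holds for every extension of \<open>F\<close> and every transform of that
  extension.\<close>

lemma sobolev_on_norm_bound:
  assumes F: "F \<in> sobolev_on s S" and s: "\<bar>s\<bar> \<le> 1" and \<psi>: "\<psi> \<in> test_functions S"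
  shows "cmod (F \<psi>) \<le> (weighted_L2_norm (- s) (fourier \<psi>) + 1) * sobolev_on_norm s S F"
proof -
  \<comment> \<open>The added 1 keeps the constant positive; it is divided by before the infimum is
    taken.\<close>
  let ?C = "weighted_L2_norm (- s) (fourier \<psi>) + 1"
  have C: "?C > 0" using weighted_L2_norm_nonneg by (rule add_nonneg_pos) simp
  have "cmod (F \<psi>) / ?C \<le> sobolev_on_norm s S F"
    unfolding sobolev_on_norm_def
  proof (rule cInf_greatest)
    show "sobolev_norm s ` {T \<in> sobolev s. restrict_distr S T = F} \<noteq> {}"
      using F by (auto simp: sobolev_on_def)
    fix r assume "r \<in> sobolev_norm s ` {T \<in> sobolev s. restrict_distr S T = F}"
    then obtain T where T: "T \<in> sobolev s" "restrict_distr S T = F" "r = sobolev_norm s T" by auto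
    show "cmod (F \<psi>) / ?C \<le> r" unfolding T(3)
    proof (rule sobolev_norm_ge[OF T(1)])
      fix g assume g: "g \<in> weighted_L2 s" "distr_with_fourier g = T"
      have "F \<psi> = distr_with_fourier g \<psi>" using T(2) g(2) \<psi> by (auto simp: restrict_distr_def)
      then have "cmod (F \<psi>) \<le> weighted_L2_norm s g * weighted_L2_norm (- s) (fourier \<psi>)"
        using distr_with_fourier_bound[OF g(1) s \<psi>] by simp
      also have "\<dots> \<le> weighted_L2_norm s g * ?C"
        by (intro mult_left_mono weighted_L2_norm_nonneg) simp
      finally show "cmod (F \<psi>) / ?C \<le> weighted_L2_norm s g"
        using C by (simp add: pos_divide_le_eq)
    qed
  qed
  then show ?thesis using C by (simp add: pos_divide_le_eq mult.commute)
qed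

subsection \<open>Mollification\<close>

lemma square_integrable_bounded:
  assumes f: "integrable M f" and b: "\<And>x. cmod (f x) \<le> C"
  shows "square_integrable M f"
  unfolding square_integrable_def
proof
  have [measurable]: "f \<in> borel_measurable M" using f by (rule borel_measurable_integrable)
  then show "f \<in> borel_measurable M" .
  show "integrable M (\<lambda>x. (cmod (f x))\<^sup>2)"
  proof (rule Bochner_Integration.integrable_bound)
    show "integrable M (\<lambda>x. C * cmod (f x))" using f by simp
    show "AE x in M. norm ((cmod (f x))\<^sup>2) \<le> norm (C * cmod (f x))"
    proof (intro AE_I2)
      fix x
      have "cmod (f x) * cmod (f x) \<le> C * cmod (f x)" by (intro mult_right_mono b) simp
      then show "norm ((cmod (f x))\<^sup>2) \<le> norm (C * cmod (f x))" by (simp add: power2_eq_square)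
    qed
  qed measurable
qed

locale mollifier =
  fixes \<rho> :: "real \<Rightarrow> complex"
  assumes \<rho>: "\<rho> \<in> test_functions UNIV" and \<rho>_support: "\<And>x. \<bar>x\<bar> \<ge> 1 \<Longrightarrow> \<rho> x = 0"
    and \<rho>_integral: "(LINT x|lborel. \<rho> x) = 1"
begin

text \<open>Mollification as seen on the Fourier side, where it is multiplication by the transform
  of \<rho> at \<epsilon> \<xi>. No convolution is formed; \<open>mollify_eq\<close> recovers its
  values.\<close>

definition cut :: "real \<Rightarrow> (real \<Rightarrow> complex) \<Rightarrow> real \<Rightarrow> complex" where
  "cut \<epsilon> g \<xi> = g \<xi> * fourier \<rho> (\<epsilon> * \<xi>)"

definition mollify :: "real \<Rightarrow> (real \<Rightarrow> complex) \<Rightarrow> real \<Rightarrow> complex" where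
  "mollify \<epsilon> g x = 1 / (2 * of_real pi) * ift (cut \<epsilon> g) x"

lemma borel_measurable_fourier_\<rho> [measurable]: "fourier \<rho> \<in> borel_measurable borel"
  using borel_measurable_fourier[OF test_measurable[OF \<rho>]] .

text \<open>The rapid decay of \<open>fourier \<rho>\<close> absorbs the powers of \<xi>, at the
  cost of a factor \<epsilon>^(-k), and leaves a product of two square-integrable functions.\<close>

lemma cut_all_moments:
  assumes g: "square_integrable lborel g" and \<epsilon>: "\<epsilon> > 0"
  shows "all_moments (cut \<epsilon> g)"
  unfolding all_moments_def
proof
  fix k
  obtain C where C: "C > 0" "\<And>\<xi>. \<bar>\<xi>\<bar> ^ k * cmod (fourier \<rho> \<xi>) \<le> C"
    using fourier_power_bounded[OF \<rho>] by blast
  have "square_integrable lborel (\<lambda>\<xi>. of_real (0 + \<epsilon> * \<xi>) ^ k * fourier \<rho> (0 + \<epsilon> * \<xi>))"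
  proof (rule square_integrable_bounded)
    show "integrable lborel (\<lambda>\<xi>. of_real (0 + \<epsilon> * \<xi>) ^ k * fourier \<rho> (0 + \<epsilon> * \<xi>))"
      using fourier_test_all_moments[OF \<rho>] \<epsilon>
      by (intro lborel_integrable_real_affine[of "\<lambda>\<xi>. of_real \<xi> ^ k * fourier \<rho> \<xi>"]) (auto simp: all_moments_def)
    show "cmod (of_real (0 + \<epsilon> * \<xi>) ^ k * fourier \<rho> (0 + \<epsilon> * \<xi>)) \<le> C" for \<xi>
      using C(2)[of "\<epsilon> * \<xi>"] by (simp add: norm_mult norm_power abs_mult)
  qed
  then have "integrable lborel (\<lambda>\<xi>. g \<xi> * (of_real (0 + \<epsilon> * \<xi>) ^ k * fourier \<rho> (0 + \<epsilon> * \<xi>)))"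
    by (rule square_integrable_mult[OF g])
  then have "integrable lborel (\<lambda>\<xi>. (1 / of_real \<epsilon> ^ k) * (g \<xi> * (of_real (0 + \<epsilon> * \<xi>) ^ k * fourier \<rho> (0 + \<epsilon> * \<xi>))))"
    by (rule Bochner_Integration.integrable_mult_right)
  then show "integrable lborel (\<lambda>\<xi>. of_real \<xi> ^ k * cut \<epsilon> g \<xi>)"
    using \<epsilon> by (simp add: cut_def power_mult_distrib mult_ac)
qed

text \<open>The test function is y -> \<rho> ((x - y) / \<epsilon>) / \<epsilon>, so the value at x
  is the distribution tested near x. This is how the vanishing of a distribution on an open set
  passes to the smooth function.\<close>

lemma mollify_eq:
  assumes \<epsilon>: "\<epsilon> > 0"
  shows "(\<lambda>y. of_real (1 / \<epsilon>) * \<rho> (x / \<epsilon> + (- 1 / \<epsilon>) * y)) \<in> test_functions UNIV"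
    and "distr_with_fourier g (\<lambda>y. of_real (1 / \<epsilon>) * \<rho> (x / \<epsilon> + (- 1 / \<epsilon>) * y)) = mollify \<epsilon> g x"
proof -
  show t: "(\<lambda>y. of_real (1 / \<epsilon>) * \<rho> (x / \<epsilon> + (- 1 / \<epsilon>) * y)) \<in> test_functions UNIV"
    using test_functions_affine[OF \<rho>, of "- 1 / \<epsilon>" "of_real (1 / \<epsilon>)" "x / \<epsilon>"] \<epsilon> by (intro test_functions_UNIV) auto
  have "fourier (\<lambda>y. of_real (1 / \<epsilon>) * \<rho> (x / \<epsilon> + (- 1 / \<epsilon>) * y)) (- \<xi>) = fourier \<rho> (\<epsilon> * \<xi>) * cis (x * \<xi>)" for \<xi>
  proof -
    have "fourier (\<lambda>y. of_real (1 / \<epsilon>) * \<rho> (x / \<epsilon> + (- 1 / \<epsilon>) * y)) (- \<xi>)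
       = of_real (1 / \<epsilon>) * ift (\<lambda>y. \<rho> (x / \<epsilon> + (- 1 / \<epsilon>) * y)) \<xi>"
      by (simp add: fourier_ift ift_def mult.assoc)
    also have "\<dots> = of_real (1 / \<epsilon>) * (of_real (1 / \<bar>- 1 / \<epsilon>\<bar>) * cis (- (x / \<epsilon> * \<xi> / (- 1 / \<epsilon>))) * ift \<rho> (\<xi> / (- 1 / \<epsilon>)))"
      using \<epsilon> by (subst ift_affine) auto
    also have "\<dots> = fourier \<rho> (\<epsilon> * \<xi>) * cis (x * \<xi>)"
      using \<epsilon> by (simp add: fourier_ift mult_ac)
    finally show ?thesis .
  qed
  then show "distr_with_fourier g (\<lambda>y. of_real (1 / \<epsilon>) * \<rho> (x / \<epsilon> + (- 1 / \<epsilon>) * y)) = mollify \<epsilon> g x"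
    using t by (simp add: distr_with_fourier_def mollify_def ift_def cut_def mult.assoc)
qed

lemma cut_tendsto:
  assumes "e \<longlonglongrightarrow> 0"
  shows "(\<lambda>k. cut (e k) g \<xi>) \<longlonglongrightarrow> g \<xi>"
proof -
  have "isCont (fourier \<rho>) 0"
    using continuous_on_fourier[OF \<rho>, of UNIV] by (simp add: continuous_on_eq_continuous_at)
  moreover have "(\<lambda>k. e k * \<xi>) \<longlonglongrightarrow> 0"
    using tendsto_mult[OF assms tendsto_const[of \<xi>]] by simp
  ultimately have "(\<lambda>k. fourier \<rho> (e k * \<xi>)) \<longlonglongrightarrow> fourier \<rho> 0"
    by (rule isCont_tendsto_compose)
  then have "(\<lambda>k. g \<xi> * fourier \<rho> (e k * \<xi>)) \<longlonglongrightarrow> g \<xi> * fourier \<rho> 0"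
    by (intro tendsto_intros)
  moreover have "fourier \<rho> 0 = 1" using \<rho>_integral by (simp add: fourier_def)
  ultimately show ?thesis by (simp add: cut_def)
qed

text \<open>All mollifications vanish, hence so do the functions \<open>cut \<epsilon> g\<close> by
  uniqueness of the transform, and these tend to \<open>g\<close> pointwise. For s \<ge> 0 the
  function \<open>g\<close> is square integrable, as \<open>cut_all_moments\<close> demands.\<close>

lemma distr_with_fourier_zero_imp_AE:
  assumes g: "g \<in> weighted_L2 s" "s \<ge> 0" and zero: "\<And>\<phi>. distr_with_fourier g \<phi> = 0"
  shows "AE \<xi> in lborel. g \<xi> = 0"
proof -
  have sq: "square_integrable lborel g" using square_integrable_of_weighted_L2[OF g] .
  let ?e = "\<lambda>k. 1 / real (Suc k)"
  have "AE \<xi> in lborel. cut (?e k) g \<xi> = 0" for k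
  proof (rule ift_zero_imp_AE_zero)
    show "integrable lborel (cut (?e k) g)"
      by (rule all_moments_integrable[OF cut_all_moments[OF sq]]) simp
    show "ift (cut (?e k) g) x = 0" for x
      using mollify_eq(2)[of "?e k" g x] zero by (simp add: mollify_def)
  qed
  then have "AE \<xi> in lborel. \<forall>k. cut (?e k) g \<xi> = 0" by (simp add: AE_all_countable)
  then show ?thesis
  proof eventually_elim
    case (elim \<xi>)
    have "(\<lambda>k. cut (?e k) g \<xi>) \<longlonglongrightarrow> g \<xi>" by (rule cut_tendsto[OF LIMSEQ_Suc[OF lim_1_over_n]])
    then show ?case using elim by (simp add: LIMSEQ_const_iff)
  qed
qed

text \<open>A bump of radius \<epsilon> around a point at distance more than \<epsilon> from [-1, 1]
  does not meet that interval. The last claim compares two integrable functions with the same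
  \<open>ift\<close>, the one by inversion, the other by definition.\<close>

lemma mollify_test:
  assumes g: "g \<in> weighted_L2 s" "s \<ge> 0" and \<epsilon>: "\<epsilon> > 0"
    and supp: "\<And>\<phi>. \<phi> \<in> test_functions (- {-1..1}) \<Longrightarrow> distr_with_fourier g \<phi> = 0"
  shows "\<And>x. \<bar>x\<bar> > 1 + \<epsilon> \<Longrightarrow> mollify \<epsilon> g x = 0"
    and "mollify \<epsilon> g \<in> test_functions UNIV"
    and "AE \<xi> in lborel. fourier (mollify \<epsilon> g) \<xi> = cut \<epsilon> g \<xi>"
proof -
  have sq: "square_integrable lborel g" using square_integrable_of_weighted_L2[OF g] .
  note am = cut_all_moments[OF sq \<epsilon>]
  show z: "mollify \<epsilon> g x = 0" if "\<bar>x\<bar> > 1 + \<epsilon>" for x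
  proof -
    let ?r = "\<lambda>y. of_real (1 / \<epsilon>) * \<rho> (x / \<epsilon> + (- 1 / \<epsilon>) * y)"
    have "?r \<in> test_functions (- {-1..1})"
    proof (rule test_functionsI)
      show "smooth ?r" using mollify_eq(1)[OF \<epsilon>] by (rule test_smooth)
      show "compact {x - \<epsilon>..x + \<epsilon>}" by simp
      show "{x - \<epsilon>..x + \<epsilon>} \<subseteq> - {-1..1}" using that by auto
      fix y assume y: "y \<notin> {x - \<epsilon>..x + \<epsilon>}"
      have "\<bar>x / \<epsilon> + (- 1 / \<epsilon>) * y\<bar> = \<bar>x - y\<bar> / \<epsilon>" using \<epsilon> by (simp add: abs_divide diff_divide_distrib[symmetric])
      moreover have "\<bar>x - y\<bar> \<ge> \<epsilon>" using y by auto
      ultimately have "\<bar>x / \<epsilon> + (- 1 / \<epsilon>) * y\<bar> \<ge> 1" using \<epsilon> by simp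
      then show "?r y = 0" using \<rho>_support by simp
    qed
    from supp[OF this] show ?thesis using mollify_eq(2)[OF \<epsilon>] by simp
  qed
  show t: "mollify \<epsilon> g \<in> test_functions UNIV"
  proof (rule test_functionsI)
    have "smooth (\<lambda>x. 1 / (2 * of_real pi) * ift (cut \<epsilon> g) (0 + 1 * x) + 0 * ift (cut \<epsilon> g) x)"
      by (intro smooth_lincomb_affine smooth_ift am)
    then show "smooth (mollify \<epsilon> g)" by (simp add: mollify_def[abs_def])
    show "compact {- (1 + \<epsilon>)..1 + \<epsilon>}" by simp
  qed (use z in auto)
  have "AE \<xi> in lborel. fourier (mollify \<epsilon> g) \<xi> - cut \<epsilon> g \<xi> = 0"
  proof (rule ift_zero_imp_AE_zero)
    note i = fourier_test_integrable[OF t] all_moments_integrable[OF am]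
    show "integrable lborel (\<lambda>\<xi>. fourier (mollify \<epsilon> g) \<xi> - cut \<epsilon> g \<xi>)"
      using i by (rule Bochner_Integration.integrable_diff)
    fix x
    have "ift (\<lambda>\<xi>. fourier (mollify \<epsilon> g) \<xi> - cut \<epsilon> g \<xi>) x = ift (fourier (mollify \<epsilon> g)) x - ift (cut \<epsilon> g) x"
      unfolding ift_def using i[THEN integrable_mult_cis_lborel] by (simp add: left_diff_distrib)
    then show "ift (\<lambda>\<xi>. fourier (mollify \<epsilon> g) \<xi> - cut \<epsilon> g \<xi>) x = 0"
      by (simp add: ift_fourier[OF t] mollify_def)
  qed
  then show "AE \<xi> in lborel. fourier (mollify \<epsilon> g) \<xi> = cut \<epsilon> g \<xi>" by simp
qed

end

subsection \<open>Density of the test functions\<close>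

definition dilate :: "real \<Rightarrow> (real \<Rightarrow> complex) \<Rightarrow> real \<Rightarrow> complex" where
  "dilate l h \<xi> = of_real l * h (l * \<xi>)"

abbreviation half_norm2 :: "(real \<Rightarrow> complex) \<Rightarrow> real" where
  "half_norm2 h \<equiv> (LINT \<xi>|sobolev_measure (1/2). (cmod (h \<xi>))\<^sup>2)"

lemma half_norm2_eq:
  assumes "h \<in> borel_measurable borel"
  shows "half_norm2 h = (LINT \<xi>|lborel. (1 + \<xi>\<^sup>2) powr (1/2) * (cmod (h \<xi>))\<^sup>2)"
  using assms by (subst integral_sobolev_measure) auto

lemma fourier_dilate:
  assumes "l > 0"
  shows "fourier (\<lambda>x. \<Phi> (x / l)) = dilate l (fourier \<Phi>)"
proof
  fix \<xi>
  have "fourier (\<lambda>x. \<Phi> (x / l)) \<xi> = ift (\<lambda>x. \<Phi> (0 + (1 / l) * x)) (- \<xi>)" by (simp add: fourier_ift)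
  also have "\<dots> = of_real (1 / \<bar>1 / l\<bar>) * cis (- (0 * (- \<xi>) / (1 / l))) * ift \<Phi> ((- \<xi>) / (1 / l))"
    by (rule ift_affine) (use assms in simp)
  also have "\<dots> = dilate l (fourier \<Phi>) \<xi>" using assms by (simp add: dilate_def fourier_ift mult.commute)
  finally show "fourier (\<lambda>x. \<Phi> (x / l)) \<xi> = dilate l (fourier \<Phi>) \<xi>" .
qed

text \<open>The substitution \<eta> = l \<xi> reduces the estimate to (1 + (\<eta> / l)^2) l^2 \<le>
  1 + \<eta>^2. Its uniformity in l is used to dilate error terms without enlarging them.\<close>

lemma dilate_weighted_L2:
  assumes h: "h \<in> weighted_L2 (1/2)" and l: "0 < l" "l \<le> 1"
  shows "dilate l h \<in> weighted_L2 (1/2)" and "half_norm2 (dilate l h) \<le> half_norm2 h"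
proof -
  have hm [measurable]: "h \<in> borel_measurable borel" using h by (rule weighted_L2_measurable)
  have [measurable]: "dilate l h \<in> borel_measurable borel" unfolding dilate_def[abs_def] by measurable
  let ?W = "\<lambda>\<xi>::real. (1 + \<xi>\<^sup>2) powr (1/2)"
  let ?f = "\<lambda>\<eta>. ?W (\<eta> / l) * (l\<^sup>2 * (cmod (h \<eta>))\<^sup>2)"
  have ih: "integrable lborel (\<lambda>\<eta>. ?W \<eta> * (cmod (h \<eta>))\<^sup>2)" using h by (simp add: weighted_L2_def)
  have W: "?W (\<eta> / l) * l\<^sup>2 \<le> l * ?W \<eta>" for \<eta>
  proof -
    have "l\<^sup>2 \<le> 1" using l by (simp add: power_le_one)
    moreover have "(1 + (\<eta> / l)\<^sup>2) * l\<^sup>2 = l\<^sup>2 + \<eta>\<^sup>2" using l by (simp add: power_divide distrib_right)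
    ultimately have "(1 + (\<eta> / l)\<^sup>2) * l\<^sup>2 \<le> 1 + \<eta>\<^sup>2" by simp
    then have "((1 + (\<eta> / l)\<^sup>2) * l\<^sup>2) powr (1/2) \<le> ?W \<eta>" by (intro powr_mono2) auto
    moreover have "((1 + (\<eta> / l)\<^sup>2) * l\<^sup>2) powr (1/2) = ?W (\<eta> / l) * l"
      using l by (simp add: powr_mult powr_half_sqrt)
    ultimately have "?W (\<eta> / l) * l \<le> ?W \<eta>" by simp
    then have "(?W (\<eta> / l) * l) * l \<le> ?W \<eta> * l" using l by (intro mult_right_mono) auto
    then show ?thesis by (simp add: power2_eq_square mult_ac)
  qed
  have f_le: "?f \<eta> \<le> l * (?W \<eta> * (cmod (h \<eta>))\<^sup>2)" for \<eta>
    using mult_right_mono[OF W[of \<eta>], of "(cmod (h \<eta>))\<^sup>2"] by (simp add: mult.assoc)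
  have if': "integrable lborel ?f"
  proof (rule Bochner_Integration.integrable_bound)
    show "integrable lborel (\<lambda>\<eta>. l * (?W \<eta> * (cmod (h \<eta>))\<^sup>2))" using ih by simp
    show "AE \<eta> in lborel. norm (?f \<eta>) \<le> norm (l * (?W \<eta> * (cmod (h \<eta>))\<^sup>2))"
      using f_le l by (intro AE_I2) simp
  qed measurable
  have eq: "?f (0 + l * \<xi>) = ?W \<xi> * (cmod (dilate l h \<xi>))\<^sup>2" for \<xi>
    using l by (simp add: dilate_def norm_mult power_mult_distrib)
  have "integrable lborel (\<lambda>\<xi>. ?f (0 + l * \<xi>))"
    by (rule lborel_integrable_real_affine[OF if']) (use l in simp)
  then show d: "dilate l h \<in> weighted_L2 (1/2)" unfolding eq by (simp add: weighted_L2_def)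
  have "(LINT \<eta>|lborel. ?f \<eta>) = \<bar>l\<bar> *\<^sub>R (LINT \<xi>|lborel. ?f (0 + l * \<xi>))"
    by (rule lborel_integral_real_affine) (use l in simp)
  then have "l * half_norm2 (dilate l h) = (LINT \<eta>|lborel. ?f \<eta>)"
    unfolding eq using l by (simp add: half_norm2_eq)
  also have "\<dots> \<le> (LINT \<eta>|lborel. l * (?W \<eta> * (cmod (h \<eta>))\<^sup>2))"
    by (rule integral_mono[OF if' _ f_le]) (use ih in simp)
  also have "\<dots> = l * half_norm2 h" by (simp add: half_norm2_eq)
  finally show "half_norm2 (dilate l h) \<le> half_norm2 h" using l by simp
qed

text \<open>Dominated convergence, for one fixed test function. As l \<ge> 1/2, the dilated
  transform has a bound of the same shape with four times the constant, whence the factor 5.\<close>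

lemma dilate_fourier_tendsto:
  assumes \<Phi>: "\<Phi> \<in> test_functions S" and l: "\<And>k. 1/2 \<le> l k" "\<And>k. l k \<le> 1" "l \<longlonglongrightarrow> 1"
  shows "(\<lambda>k. half_norm2 (\<lambda>\<xi>. fourier \<Phi> \<xi> - dilate (l k) (fourier \<Phi>) \<xi>)) \<longlonglongrightarrow> 0"
proof -
  have [measurable]: "fourier \<Phi> \<in> borel_measurable borel"
    using borel_measurable_fourier[OF test_measurable[OF \<Phi>]] .
  have [measurable]: "dilate (l k) (fourier \<Phi>) \<in> borel_measurable borel" for k unfolding dilate_def[abs_def] by measurable
  obtain C where C: "C > 0" "\<And>\<xi>. cmod (fourier \<Phi> \<xi>) \<le> C / (1 + \<xi>\<^sup>2)"
    using fourier_decay[OF \<Phi>, of 0] by auto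
  have b: "cmod (fourier \<Phi> \<xi> - dilate (l k) (fourier \<Phi>) \<xi>) \<le> 5 * C / (1 + \<xi>\<^sup>2)" for k \<xi>
  proof -
    have "cmod (dilate (l k) (fourier \<Phi>) \<xi>) = l k * cmod (fourier \<Phi> (l k * \<xi>))"
      using l(1)[of k] by (simp add: dilate_def norm_mult)
    also have "\<dots> \<le> 1 * (C / (1 + (l k * \<xi>)\<^sup>2))"
      using l(1)[of k] l(2)[of k] C by (intro mult_mono) auto
    also have "\<dots> \<le> 4 * C / (1 + \<xi>\<^sup>2)"
    proof -
      have "(1/2)\<^sup>2 \<le> (l k)\<^sup>2" using l(1)[of k] by (intro power_mono) auto
      then have "(1/2)\<^sup>2 * \<xi>\<^sup>2 \<le> (l k)\<^sup>2 * \<xi>\<^sup>2" by (intro mult_right_mono) auto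
      then have "1 + \<xi>\<^sup>2 \<le> 4 * (1 + (l k * \<xi>)\<^sup>2)" by (simp add: power_mult_distrib power_divide)
      then have "C * (1 + \<xi>\<^sup>2) \<le> C * (4 * (1 + (l k * \<xi>)\<^sup>2))" using C(1) by (intro mult_left_mono) auto
      then show ?thesis using one_plus_sq_pos[of \<xi>] one_plus_sq_pos[of "l k * \<xi>"]
        by (simp add: divide_le_eq le_divide_eq mult_ac)
    qed
    finally have "cmod (dilate (l k) (fourier \<Phi>) \<xi>) \<le> 4 * C / (1 + \<xi>\<^sup>2)" .
    then have "cmod (fourier \<Phi> \<xi> - dilate (l k) (fourier \<Phi>) \<xi>) \<le> C / (1 + \<xi>\<^sup>2) + 4 * C / (1 + \<xi>\<^sup>2)"
      using C(2)[of \<xi>] norm_triangle_ineq4[of "fourier \<Phi> \<xi>" "dilate (l k) (fourier \<Phi>) \<xi>"] by linarith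
    then show ?thesis by (simp add: add_divide_distrib[symmetric])
  qed
  have "(\<lambda>k. LINT \<xi>|lborel. (1 + \<xi>\<^sup>2) powr (1/2) * (cmod (fourier \<Phi> \<xi> - dilate (l k) (fourier \<Phi>) \<xi>))\<^sup>2)
     \<longlonglongrightarrow> integral\<^sup>L lborel (\<lambda>\<xi>::real. 0 :: real)"
  proof (rule integral_dominated_convergence[where w = "\<lambda>\<xi>. (5 * C)\<^sup>2 * inverse (1 + \<xi>\<^sup>2)"])
    show "integrable lborel (\<lambda>\<xi>. (5 * C)\<^sup>2 * inverse (1 + \<xi>\<^sup>2))"
      using integrable_inverse_1_plus_square_lborel by (rule Bochner_Integration.integrable_mult_right)
    show "AE \<xi> in lborel. norm ((1 + \<xi>\<^sup>2) powr (1/2) * (cmod (fourier \<Phi> \<xi> - dilate (l k) (fourier \<Phi>) \<xi>))\<^sup>2)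
        \<le> (5 * C)\<^sup>2 * inverse (1 + \<xi>\<^sup>2)" for k
    proof (intro AE_I2)
      fix \<xi> :: real
      have p: "0 < 1 + \<xi>\<^sup>2" by (rule one_plus_sq_pos)
      have "(1 + \<xi>\<^sup>2) powr (1/2) \<le> (1 + \<xi>\<^sup>2) powr 1" by (intro powr_mono) auto
      then have "(1 + \<xi>\<^sup>2) powr (1/2) * (cmod (fourier \<Phi> \<xi> - dilate (l k) (fourier \<Phi>) \<xi>))\<^sup>2
          \<le> (1 + \<xi>\<^sup>2) * (5 * C / (1 + \<xi>\<^sup>2))\<^sup>2"
        using p by (intro mult_mono power_mono b) auto
      also have "y * (A / y)\<^sup>2 = A\<^sup>2 * inverse y" if "y > 0" for y A :: real
        using that by (simp add: power2_eq_square field_simps)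
      note this[OF p]
      finally show "norm ((1 + \<xi>\<^sup>2) powr (1/2) * (cmod (fourier \<Phi> \<xi> - dilate (l k) (fourier \<Phi>) \<xi>))\<^sup>2)
        \<le> (5 * C)\<^sup>2 * inverse (1 + \<xi>\<^sup>2)" by simp
    qed
    show "AE \<xi> in lborel. (\<lambda>k. (1 + \<xi>\<^sup>2) powr (1/2) * (cmod (fourier \<Phi> \<xi> - dilate (l k) (fourier \<Phi>) \<xi>))\<^sup>2) \<longlonglongrightarrow> 0"
    proof (intro AE_I2)
      fix \<xi>
      have c: "isCont (fourier \<Phi>) \<xi>"
        using continuous_on_fourier[OF \<Phi>, of UNIV] by (simp add: continuous_on_eq_continuous_at)
      have "(\<lambda>k. l k * \<xi>) \<longlonglongrightarrow> 1 * \<xi>" by (intro tendsto_intros l)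
      then have "(\<lambda>k. l k * \<xi>) \<longlonglongrightarrow> \<xi>" by simp
      from isCont_tendsto_compose[OF c this]
      have "(\<lambda>k. (1 + \<xi>\<^sup>2) powr (1/2) * (cmod (fourier \<Phi> \<xi> - of_real (l k) * fourier \<Phi> (l k * \<xi>)))\<^sup>2)
         \<longlonglongrightarrow> (1 + \<xi>\<^sup>2) powr (1/2) * (cmod (fourier \<Phi> \<xi> - of_real 1 * fourier \<Phi> \<xi>))\<^sup>2"
        by (intro tendsto_intros l(3))
      then show "(\<lambda>k. (1 + \<xi>\<^sup>2) powr (1/2) * (cmod (fourier \<Phi> \<xi> - dilate (l k) (fourier \<Phi>) \<xi>))\<^sup>2) \<longlonglongrightarrow> 0"
        by (simp add: dilate_def)
    qed
  qed measurable
  then show ?thesis by (simp add: half_norm2_eq)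
qed

lemma half_norm2_cong_AE:
  assumes "AE \<xi> in lborel. g \<xi> = h \<xi>" "g \<in> borel_measurable borel" "h \<in> borel_measurable borel"
  shows "half_norm2 g = half_norm2 h"
proof -
  note [measurable] = assms(2,3)
  show ?thesis by (simp add: half_norm2_eq) (rule integral_cong_AE, use assms(1) in auto)
qed

context mollifier
begin

lemma cut_half_norm2_tendsto:
  assumes g: "g \<in> weighted_L2 (1/2)" and e: "e \<longlonglongrightarrow> 0"
  shows "(\<lambda>k. half_norm2 (\<lambda>\<xi>. g \<xi> - cut (e k) g \<xi>)) \<longlonglongrightarrow> 0"
proof -
  have [measurable]: "g \<in> borel_measurable borel" using g by (rule weighted_L2_measurable)
  have [measurable]: "cut (e k) g \<in> borel_measurable borel" for k unfolding cut_def[abs_def] by measurable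
  obtain C where C: "C > 0" "\<And>\<xi>. cmod (fourier \<rho> \<xi>) \<le> C"
    using fourier_power_bounded[OF \<rho>, of 0] by auto
  have b: "cmod (g \<xi> - cut (e k) g \<xi>) \<le> (1 + C) * cmod (g \<xi>)" for \<xi> k
  proof -
    have "cmod (g \<xi> - cut (e k) g \<xi>) \<le> cmod (g \<xi>) + cmod (g \<xi>) * cmod (fourier \<rho> (e k * \<xi>))"
      unfolding cut_def norm_mult[symmetric] by (rule norm_triangle_ineq4)
    also have "\<dots> \<le> cmod (g \<xi>) + cmod (g \<xi>) * C" by (intro add_left_mono mult_left_mono C) simp
    finally show ?thesis by (simp add: algebra_simps)
  qed
  have "(\<lambda>k. LINT \<xi>|lborel. (1 + \<xi>\<^sup>2) powr (1/2) * (cmod (g \<xi> - cut (e k) g \<xi>))\<^sup>2)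
     \<longlonglongrightarrow> integral\<^sup>L lborel (\<lambda>\<xi>::real. 0 :: real)"
  proof (rule integral_dominated_convergence[where w = "\<lambda>\<xi>. (1 + C)\<^sup>2 * ((1 + \<xi>\<^sup>2) powr (1/2) * (cmod (g \<xi>))\<^sup>2)"])
    show "integrable lborel (\<lambda>\<xi>. (1 + C)\<^sup>2 * ((1 + \<xi>\<^sup>2) powr (1/2) * (cmod (g \<xi>))\<^sup>2))"
      using g by (simp add: weighted_L2_def)
    show "AE \<xi> in lborel. norm ((1 + \<xi>\<^sup>2) powr (1/2) * (cmod (g \<xi> - cut (e k) g \<xi>))\<^sup>2)
        \<le> (1 + C)\<^sup>2 * ((1 + \<xi>\<^sup>2) powr (1/2) * (cmod (g \<xi>))\<^sup>2)" for k
    proof (intro AE_I2)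
      fix \<xi> :: real
      have "(cmod (g \<xi> - cut (e k) g \<xi>))\<^sup>2 \<le> ((1 + C) * cmod (g \<xi>))\<^sup>2" by (intro power_mono b) simp
      then have "(1 + \<xi>\<^sup>2) powr (1/2) * (cmod (g \<xi> - cut (e k) g \<xi>))\<^sup>2 \<le> (1 + \<xi>\<^sup>2) powr (1/2) * ((1 + C) * cmod (g \<xi>))\<^sup>2"
        by (intro mult_left_mono) auto
      then show "norm ((1 + \<xi>\<^sup>2) powr (1/2) * (cmod (g \<xi> - cut (e k) g \<xi>))\<^sup>2)
        \<le> (1 + C)\<^sup>2 * ((1 + \<xi>\<^sup>2) powr (1/2) * (cmod (g \<xi>))\<^sup>2)"
        by (simp add: power_mult_distrib mult_ac)
    qed
    show "AE \<xi> in lborel. (\<lambda>k. (1 + \<xi>\<^sup>2) powr (1/2) * (cmod (g \<xi> - cut (e k) g \<xi>))\<^sup>2) \<longlonglongrightarrow> 0"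
    proof (intro AE_I2)
      fix \<xi>
      have "(\<lambda>k. (1 + \<xi>\<^sup>2) powr (1/2) * (cmod (g \<xi> - cut (e k) g \<xi>))\<^sup>2)
         \<longlonglongrightarrow> (1 + \<xi>\<^sup>2) powr (1/2) * (cmod (g \<xi> - g \<xi>))\<^sup>2"
        by (intro tendsto_intros cut_tendsto[OF e])
      then show "(\<lambda>k. (1 + \<xi>\<^sup>2) powr (1/2) * (cmod (g \<xi> - cut (e k) g \<xi>))\<^sup>2) \<longlonglongrightarrow> 0" by simp
    qed
  qed measurable
  then show ?thesis by (simp add: half_norm2_eq)
qed

text \<open>The mollified function is supported in \<open>[-1 - \<epsilon>, 1 + \<epsilon>]\<close>; dilating by \<open>1 / (1 + 2 \<epsilon>)\<close> moves its
  support into the open segment.\<close>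

lemma test_functions_dense:
  assumes g: "g \<in> weighted_L2 (1/2)"
    and supp: "\<And>\<phi>. \<phi> \<in> test_functions (- {-1..1}) \<Longrightarrow> distr_with_fourier g \<phi> = 0"
    and \<delta>: "\<delta> > 0"
  shows "\<exists>\<phi>\<in>test_functions seg. half_norm2 (\<lambda>\<xi>. g \<xi> - fourier \<phi> \<xi>) < \<delta>"
proof -
  have gm [measurable]: "g \<in> borel_measurable borel" using g by (rule weighted_L2_measurable)
  have omega_measure [measurable]: "cut e g \<in> borel_measurable borel" for e unfolding cut_def[abs_def] by measurable
  \<comment> \<open>Starting at 1/2 keeps the dilation factors \<open>l k\<close> at least
    1/2.\<close>
  define e where "e k = 1 / real (Suc (Suc k))" for k
  define l where "l k = 1 / (1 + 2 * e k)" for k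
  have e_pos: "e k > 0" for k by (simp add: e_def)
  have e_half: "e k \<le> 1/2" for k by (simp add: e_def field_simps)
  have e0: "e \<longlonglongrightarrow> 0" unfolding e_def by (intro LIMSEQ_Suc lim_1_over_n)
  have l1: "1/2 \<le> l k" "l k \<le> 1" for k
    using e_pos[of k] e_half[of k] by (auto simp: l_def field_simps)
  have "(\<lambda>k. 1 / (1 + 2 * e k)) \<longlonglongrightarrow> 1 / (1 + 2 * 0)" by (intro tendsto_intros e0) simp
  then have l_lim: "l \<longlonglongrightarrow> 1" by (simp add: l_def[abs_def])
  define \<Phi> where "\<Phi> k = mollify (e k) g" for k
  have \<Phi>_supp: "\<Phi> k x = 0" if "\<bar>x\<bar> > 1 + e k" for k x
    unfolding \<Phi>_def by (rule mollify_test(1)[OF g _ e_pos supp that]) simp_all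
  have \<Phi>_test: "\<Phi> k \<in> test_functions UNIV" for k
    unfolding \<Phi>_def by (rule mollify_test(2)[OF g _ e_pos supp]) simp_all
  have \<Phi>_AE: "AE \<xi> in lborel. fourier (\<Phi> k) \<xi> = cut (e k) g \<xi>" for k
    unfolding \<Phi>_def by (rule mollify_test(3)[OF g _ e_pos supp]) simp_all
  have \<Phi>_wL2: "fourier (\<Phi> k) \<in> weighted_L2 (1/2)" for k by (rule fourier_weighted_L2[OF \<Phi>_test]) simp
  have fm [measurable]: "fourier (\<Phi> k) \<in> borel_measurable borel" for k
    using borel_measurable_fourier[OF test_measurable[OF \<Phi>_test]] .
  have conv: "(\<lambda>k. half_norm2 (\<lambda>\<xi>. g \<xi> - fourier (\<Phi> k) \<xi>)) \<longlonglongrightarrow> 0"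
  proof -
    have "half_norm2 (\<lambda>\<xi>. g \<xi> - fourier (\<Phi> k) \<xi>) = half_norm2 (\<lambda>\<xi>. g \<xi> - cut (e k) g \<xi>)" for k
      by (rule half_norm2_cong_AE) (use \<Phi>_AE[of k] in auto)
    then show ?thesis using cut_half_norm2_tendsto[OF g e0] by simp
  qed
  have d: "\<delta> / 16 > 0" using \<delta> by simp
  \<comment> \<open>Convergence of dilations is known only for a fixed test function, so
    \<open>K\<close> is fixed before the index \<open>k\<close> of the actual approximation is
    chosen.\<close>
  obtain K where K: "half_norm2 (\<lambda>\<xi>. g \<xi> - fourier (\<Phi> K) \<xi>) < \<delta> / 16"
    using order_tendstoD(2)[OF conv d] by (auto simp: eventually_sequentially)
  have "\<forall>\<^sub>F k in sequentially. half_norm2 (\<lambda>\<xi>. g \<xi> - fourier (\<Phi> k) \<xi>) < \<delta> / 16 \<and>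
      half_norm2 (\<lambda>\<xi>. fourier (\<Phi> K) \<xi> - dilate (l k) (fourier (\<Phi> K)) \<xi>) < \<delta> / 16"
    by (intro eventually_conj order_tendstoD(2)[OF conv d]
        order_tendstoD(2)[OF dilate_fourier_tendsto[OF \<Phi>_test l1 l_lim] d])
  then obtain k where k: "half_norm2 (\<lambda>\<xi>. g \<xi> - fourier (\<Phi> k) \<xi>) < \<delta> / 16"
      "half_norm2 (\<lambda>\<xi>. fourier (\<Phi> K) \<xi> - dilate (l k) (fourier (\<Phi> K)) \<xi>) < \<delta> / 16"
    by (auto simp: eventually_sequentially)
  have l_pos: "l k > 0" using l1(1)[of k] by simp
  define \<phi> where "\<phi> = (\<lambda>x. \<Phi> k (x / l k))"
  have "\<phi> \<in> test_functions seg"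
  proof (rule test_functionsI)
    show "smooth \<phi>"
      using smooth_lincomb_affine[OF test_smooth[OF \<Phi>_test] smooth_zero, of 1 k 0 "1 / l k" 0] by (simp add: \<phi>_def)
    let ?r = "l k * (1 + e k)"
    \<comment> \<open>The value is (1 + e) / (1 + 2 e): the factor 2 in \<open>l\<close> leaves room
      inside the open segment.\<close>
    have r: "?r < 1" using e_pos[of k] by (simp add: l_def field_simps)
    show "compact {- ?r..?r}" by simp
    show "{- ?r..?r} \<subseteq> seg" using r by auto
    fix x assume "x \<notin> {- ?r..?r}"
    then have "\<bar>x\<bar> > l k * (1 + e k)" by auto
    then have "\<bar>x / l k\<bar> > 1 + e k" using l_pos by (simp add: abs_divide pos_less_divide_eq mult.commute)
    then show "\<phi> x = 0" unfolding \<phi>_def by (rule \<Phi>_supp)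
  qed
  moreover have "half_norm2 (\<lambda>\<xi>. g \<xi> - fourier \<phi> \<xi>) < \<delta>"
  proof -
    let ?A = "\<lambda>\<xi>. g \<xi> - fourier (\<Phi> K) \<xi>" and ?B = "\<lambda>\<xi>. fourier (\<Phi> K) \<xi> - dilate (l k) (fourier (\<Phi> K)) \<xi>"
    let ?E = "\<lambda>\<xi>. fourier (\<Phi> K) \<xi> - g \<xi>" and ?F = "\<lambda>\<xi>. g \<xi> - fourier (\<Phi> k) \<xi>"
    let ?C = "dilate (l k) ?E" and ?D = "dilate (l k) ?F"
    have A: "?A \<in> weighted_L2 (1/2)" by (rule weighted_L2_diff[OF g \<Phi>_wL2])
    have B: "?B \<in> weighted_L2 (1/2)" by (rule weighted_L2_diff[OF \<Phi>_wL2 dilate_weighted_L2(1)[OF \<Phi>_wL2 l_pos l1(2)]])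
    have C0: "?E \<in> weighted_L2 (1/2)" by (rule weighted_L2_diff[OF \<Phi>_wL2 g])
    have D0: "?F \<in> weighted_L2 (1/2)" by (rule weighted_L2_diff[OF g \<Phi>_wL2])
    note C = dilate_weighted_L2[OF C0 l_pos l1(2)] and D = dilate_weighted_L2[OF D0 l_pos l1(2)]
    have nC0: "half_norm2 ?E = half_norm2 ?A" by (simp only: norm_minus_commute)
    note sq = A[unfolded weighted_L2_iff] B[unfolded weighted_L2_iff] C(1)[unfolded weighted_L2_iff] D(1)[unfolded weighted_L2_iff]
    \<comment> \<open>The detour runs through the fixed \<open>\<Phi> K\<close> and its dilation.
      Two levels of \<open>square_integrable_add\<close> put a factor 4 on each of the four terms,
      whence \<delta> / 16.\<close>
    have "g \<xi> - fourier \<phi> \<xi> = (?A \<xi> + ?B \<xi>) + (?C \<xi> + ?D \<xi>)" for \<xi>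
      unfolding \<phi>_def fourier_dilate[OF l_pos] by (simp add: dilate_def algebra_simps)
    then have "half_norm2 (\<lambda>\<xi>. g \<xi> - fourier \<phi> \<xi>) = half_norm2 (\<lambda>\<xi>. (?A \<xi> + ?B \<xi>) + (?C \<xi> + ?D \<xi>))" by (simp only:)
    also have "\<dots> \<le> 2 * half_norm2 (\<lambda>\<xi>. ?A \<xi> + ?B \<xi>) + 2 * half_norm2 (\<lambda>\<xi>. ?C \<xi> + ?D \<xi>)"
      by (intro square_integrable_add(2) square_integrable_add(1) sq)
    also have "\<dots> \<le> 2 * (2 * half_norm2 ?A + 2 * half_norm2 ?B) + 2 * (2 * half_norm2 ?C + 2 * half_norm2 ?D)"
      by (intro add_mono mult_left_mono square_integrable_add(2) sq) simp_all
    also have "\<dots> \<le> 4 * half_norm2 ?A + 4 * half_norm2 ?B + 4 * half_norm2 ?E + 4 * half_norm2 ?F"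
      using C(2) D(2) by simp
    also have "\<dots> < \<delta>" using K k nC0 by simp
    finally show ?thesis .
  qed
  ultimately show ?thesis by blast
qed

end

subsection \<open>The weighted space on the segment\<close>

definition omega_measure :: "real measure" where
  "omega_measure = density lborel (\<lambda>x. ennreal (indicator seg x * omega x))"

lemma omega_pos: "x \<in> seg \<Longrightarrow> omega x > 0"
  by (auto simp: omega_def abs_square_less_1 abs_less_iff)

lemma omega_nonneg: "x \<in> seg \<Longrightarrow> omega x \<ge> 0"
  using omega_pos less_imp_le by blast

lemma omega_le_1: "x \<in> seg \<Longrightarrow> omega x \<le> 1"
  by (simp add: omega_def)

lemma continuous_on_omega [continuous_intros]: "continuous_on S omega"
  unfolding omega_def[abs_def] by (intro continuous_intros)

lemma borel_measurable_omega [measurable]: "omega \<in> borel_measurable borel"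
  by (intro borel_measurable_continuous_onI continuous_intros)

lemma measurable_omega_measure: "borel_measurable omega_measure = borel_measurable borel"
  unfolding omega_measure_def by (rule measurable_cong_sets) auto

lemma omega_measure_weight_nonneg: "0 \<le> indicator seg x * omega x"
  using omega_nonneg[of x] by (auto simp: indicator_def)

lemma integral_omega_measure:
  fixes f :: "real \<Rightarrow> 'a::{banach, second_countable_topology}"
  assumes "f \<in> borel_measurable borel"
  shows "(LINT x|omega_measure. f x) = (LINT x|lborel. (indicator seg x * omega x) *\<^sub>R f x)"
  unfolding omega_measure_def using assms omega_measure_weight_nonneg by (intro integral_density) auto

lemma integrable_omega_measure:
  fixes f :: "real \<Rightarrow> 'a::{banach, second_countable_topology}"
  assumes "f \<in> borel_measurable borel"
  shows "integrable omega_measure f \<longleftrightarrow> integrable lborel (\<lambda>x. (indicator seg x * omega x) *\<^sub>R f x)"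
  unfolding omega_measure_def using assms omega_measure_weight_nonneg by (intro integrable_density) auto

lemma finite_measure_omega_measure: "finite_measure omega_measure"
proof
  have "emeasure omega_measure (space omega_measure) = (\<integral>\<^sup>+x. ennreal (indicator seg x * omega x) \<partial>lborel)"
    unfolding omega_measure_def by (simp add: emeasure_density)
  also have "\<dots> \<le> (\<integral>\<^sup>+x. indicator seg x \<partial>lborel)"
    using omega_le_1 by (intro nn_integral_mono) (auto simp: indicator_def intro: ennreal_leI)
  also have "\<dots> < \<infinity>" by simp
  finally show "emeasure omega_measure (space omega_measure) \<noteq> \<infinity>" by simp
qed

text \<open>Membership in \<open>L2_omega\<close> constrains \<open>u\<close> only inside the
  segment, hence the indicator. The restriction is a pointwise limit of restrictions to compact
  subintervals, where integrability is part of the definition.\<close>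

lemma L2_omega_measurable:
  assumes "u \<in> L2_omega"
  shows "(\<lambda>x. indicator seg x *\<^sub>R u x) \<in> borel_measurable borel"
proof -
  define r where "r k = 1 - 1 / real (Suc (Suc k))" for k
  have r1: "r k < 1" for k by (simp add: r_def)
  show ?thesis
proof (rule borel_measurable_LIMSEQ_metric)
  show "(\<lambda>x. indicator {- r k..r k} x *\<^sub>R u x) \<in> borel_measurable borel" for k
  proof -
    have "set_integrable lborel {- r k..r k} u"
      using assms r1[of k] by (simp add: L2_omega_def)
    then show ?thesis unfolding set_integrable_def by (drule_tac borel_measurable_integrable) simp
  qed
  fix x :: real
  show "(\<lambda>k. indicator {- r k..r k} x *\<^sub>R u x) \<longlonglongrightarrow> indicator seg x *\<^sub>R u x"
  proof (cases "x \<in> seg")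
    case True
    then have "\<bar>x\<bar> < 1 - 0" by auto
    moreover have "r \<longlonglongrightarrow> 1 - 0"
      unfolding r_def by (intro tendsto_intros LIMSEQ_Suc lim_1_over_n)
    ultimately have "\<forall>\<^sub>F k in sequentially. \<bar>x\<bar> < r k" by (rule order_tendstoD(1)[rotated])
    then have "\<forall>\<^sub>F k in sequentially. indicator {- r k..r k} x *\<^sub>R u x = indicator seg x *\<^sub>R u x"
      by (rule eventually_mono) (use True in \<open>auto simp: indicator_def\<close>)
    then show ?thesis by (rule tendsto_eventually)
  next
    case False
    have "x \<notin> {- r k..r k}" for k
    proof
      assume "x \<in> {- r k..r k}"
      then show False using False r1[of k] by auto
    qed
    then have "(\<lambda>k. indicator {- r k..r k} x *\<^sub>R u x) = (\<lambda>k. 0)" by (auto simp: fun_eq_iff)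
    then show ?thesis using False by simp
  qed
qed
qed

lemma L2_omega_square_integrable:
  assumes "u \<in> L2_omega"
  shows "square_integrable omega_measure (\<lambda>x. indicator seg x *\<^sub>R u x)"
proof -
  note [measurable] = L2_omega_measurable[OF assms]
  have "integrable lborel (\<lambda>x. indicator seg x *\<^sub>R ((cmod (u x))\<^sup>2 * omega x))"
    using assms by (simp add: L2_omega_def set_integrable_def)
  moreover have "indicator seg x *\<^sub>R ((cmod (u x))\<^sup>2 * omega x) = (indicator seg x * omega x) *\<^sub>R (cmod (indicator seg x *\<^sub>R u x))\<^sup>2" for x
    by (auto simp: indicator_def)
  ultimately have i: "integrable lborel (\<lambda>x. (indicator seg x * omega x) *\<^sub>R (cmod (indicator seg x *\<^sub>R u x))\<^sup>2)"
    by (simp only:)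
  have m: "(\<lambda>x. (cmod (indicator seg x *\<^sub>R u x))\<^sup>2) \<in> borel_measurable borel" by measurable
  show ?thesis
    unfolding square_integrable_def measurable_omega_measure using L2_omega_measurable[OF assms] integrable_omega_measure[OF m] i by blast
qed

lemma square_integrable_L2_omega:
  assumes f: "square_integrable omega_measure f"
  shows "f \<in> L2_omega"
proof -
  have [measurable]: "f \<in> borel_measurable borel" using square_integrableD(1)[OF f] by (simp add: measurable_omega_measure)
  have i: "integrable lborel (\<lambda>x. (indicator seg x * omega x) * (cmod (f x))\<^sup>2)"
    using square_integrableD(2)[OF f] by (simp add: integrable_omega_measure)
  have "set_integrable lborel {a..b} f" if ab: "-1 < a" "b < 1" for a b
  proof (cases "a \<le> b")
    case True
    \<comment> \<open>On [a, b] the function \<omega> is smallest at an end point; this positive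
      lower bound removes the weight.\<close>
    define m where "m = min (omega a) (omega b)"
    have m: "m > 0" unfolding m_def using omega_pos[of a] omega_pos[of b] ab True by simp
    have "m \<le> omega x" if "x \<in> {a..b}" for x
    proof -
      have "x\<^sup>2 \<le> a\<^sup>2 \<or> x\<^sup>2 \<le> b\<^sup>2"
      proof (cases "x \<ge> 0")
        case True then show ?thesis using that power_mono[of x b 2] by auto
      next
        case False then show ?thesis using that power_mono[of "-x" "-a" 2] by auto
      qed
      then have "omega a \<le> omega x \<or> omega b \<le> omega x" by (auto simp: omega_def)
      then show ?thesis by (auto simp: m_def)
    qed
    then have bd: "indicator {a..b} x * cmod (f x) \<le> indicator {a..b} x + (1 / m) * ((indicator seg x * omega x) * (cmod (f x))\<^sup>2)" for x
    proof (cases "x \<in> {a..b}")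
      case True
      have "cmod (f x) \<le> 1 + (cmod (f x))\<^sup>2"
      proof -
        have "2 * cmod (f x) \<le> 1 + (cmod (f x))\<^sup>2" using sum_squares_bound[of 1 "cmod (f x)"] by simp
        moreover have "0 \<le> cmod (f x)" by simp
        ultimately show ?thesis by linarith
      qed
      moreover have "m * (cmod (f x))\<^sup>2 \<le> omega x * (cmod (f x))\<^sup>2"
        using \<open>\<And>x. x \<in> {a..b} \<Longrightarrow> m \<le> omega x\<close>[OF True] by (rule mult_right_mono) simp
      then have "(cmod (f x))\<^sup>2 \<le> (1 / m) * (omega x * (cmod (f x))\<^sup>2)"
        using m by (simp add: field_simps)
      moreover have "x \<in> seg" using True ab by auto
      ultimately show ?thesis using True by simp
    next
      case False
      then show ?thesis using m omega_measure_weight_nonneg[of x] by simp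
    qed
    show ?thesis unfolding set_integrable_def
    proof (rule Bochner_Integration.integrable_bound)
      show "integrable lborel (\<lambda>x. indicator {a..b} x + (1 / m) * ((indicator seg x * omega x) * (cmod (f x))\<^sup>2))"
        using i by (intro Bochner_Integration.integrable_add Bochner_Integration.integrable_mult_right integrable_real_indicator)
          (auto simp: emeasure_lborel_Icc_eq)
      show "AE x in lborel. norm (indicator {a..b} x *\<^sub>R f x) \<le> norm (indicator {a..b} x + (1 / m) * ((indicator seg x * omega x) * (cmod (f x))\<^sup>2))"
      proof (intro AE_I2)
        fix x
        have "norm (indicator {a..b} x *\<^sub>R f x) = indicator {a..b} x * cmod (f x)" by simp
        also note bd
        also have "r \<le> norm r" for r :: real by simp
        finally show "norm (indicator {a..b} x *\<^sub>R f x) \<le> norm (indicator {a..b} x + (1 / m) * ((indicator seg x * omega x) * (cmod (f x))\<^sup>2))" .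
      qed
    qed measurable
  qed (simp add: set_integrable_def)
  moreover have "set_integrable lborel seg (\<lambda>x. (cmod (f x))\<^sup>2 * omega x)"
    using i by (simp add: set_integrable_def mult_ac)
  ultimately show ?thesis by (simp add: L2_omega_def)
qed

lemma L2_omega_lincomb:
  assumes "u \<in> L2_omega" "v \<in> L2_omega"
  shows "(\<lambda>x. a * u x + b * v x) \<in> L2_omega"
proof -
  have "set_integrable lborel {p..q} (\<lambda>x. a * u x + b * v x)" if "-1 < p" "q < 1" for p q
    using assms that unfolding L2_omega_def by (intro set_integral_add(1) set_integrable_mult_right) auto
  moreover have "set_integrable lborel seg (\<lambda>x. (cmod (a * u x + b * v x))\<^sup>2 * omega x)"
  proof -
    have "square_integrable omega_measure (\<lambda>x. a * (indicator seg x *\<^sub>R u x) + b * (indicator seg x *\<^sub>R v x))"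
      by (intro square_integrable_add square_integrable_cmult L2_omega_square_integrable assms)
    from square_integrable_L2_omega[OF this]
    have "set_integrable lborel seg (\<lambda>x. (cmod (a * (indicator seg x *\<^sub>R u x) + b * (indicator seg x *\<^sub>R v x)))\<^sup>2 * omega x)"
      by (simp add: L2_omega_def)
    then show ?thesis
      unfolding set_integrable_def by (rule Bochner_Integration.integrable_cong[THEN iffD1, rotated 2]) (auto simp: indicator_def)
  qed
  ultimately show ?thesis by (simp add: L2_omega_def)
qed

text \<open>Extension by zero makes the product a function on the line, whose Fourier transform can
  be taken.\<close>

definition omega_mult :: "(real \<Rightarrow> complex) \<Rightarrow> real \<Rightarrow> complex" where
  "omega_mult u x = indicator seg x * of_real (omega x) * u x"

lemma omega_mult_integrable:
  assumes "u \<in> L2_omega" shows "integrable lborel (omega_mult u)"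
proof -
  interpret finite_measure omega_measure by (rule finite_measure_omega_measure)
  have "square_integrable omega_measure (\<lambda>x. 1)" by (simp add: square_integrable_def)
  from square_integrable_mult[OF L2_omega_square_integrable[OF assms] this]
  have "integrable omega_measure (\<lambda>x. indicator seg x *\<^sub>R u x)" by simp
  then have "integrable lborel (\<lambda>x. (indicator seg x * omega x) *\<^sub>R (indicator seg x *\<^sub>R u x))"
    using L2_omega_measurable[OF assms] by (simp add: integrable_omega_measure)
  moreover have "(indicator seg x * omega x) *\<^sub>R (indicator seg x *\<^sub>R u x) = omega_mult u x" for x
    by (auto simp: omega_mult_def indicator_def scaleR_conv_of_real)
  ultimately show ?thesis by simp
qed

lemma form_omega_eq: "form_omega u v = (LINT x|lborel. omega_mult u x * v x)"
  unfolding form_omega_def set_lebesgue_integral_def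
  by (rule Bochner_Integration.integral_cong) (auto simp: omega_mult_def indicator_def)

lemma omega_mult_mult_integrable:
  assumes u: "u \<in> L2_omega" and f: "continuous_on {-1..1} f"
  shows "integrable lborel (\<lambda>x. omega_mult u x * f x)"
proof -
  have "bounded (f ` {-1..1})" by (rule compact_imp_bounded[OF compact_continuous_image[OF f]]) simp
  then obtain B where B: "\<And>x. x \<in> {-1..1} \<Longrightarrow> cmod (f x) \<le> B" unfolding bounded_iff by blast
  note i = omega_mult_integrable[OF u]
  have [measurable]: "omega_mult u \<in> borel_measurable borel" using borel_measurable_integrable[OF i] by simp
  have [measurable]: "(\<lambda>x. indicator {-1..1} x *\<^sub>R f x) \<in> borel_measurable borel"
    by (rule borel_measurable_continuous_on_indicator) (use f in auto)
  have eq: "omega_mult u x * f x = omega_mult u x * (indicator {-1..1} x *\<^sub>R f x)" for x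
    by (auto simp: omega_mult_def indicator_def)
  show ?thesis unfolding eq
  proof (rule Bochner_Integration.integrable_bound)
    show "integrable lborel (\<lambda>x. B * cmod (omega_mult u x))" using i by simp
    show "AE x in lborel. norm (omega_mult u x * (indicator {-1..1} x *\<^sub>R f x)) \<le> norm (B * cmod (omega_mult u x))"
    proof (intro AE_I2)
      fix x
      show "norm (omega_mult u x * (indicator {-1..1} x *\<^sub>R f x)) \<le> norm (B * cmod (omega_mult u x))"
      proof (cases "x \<in> {-1..1}")
        case True
        then have "cmod (omega_mult u x) * cmod (f x) \<le> cmod (omega_mult u x) * \<bar>B\<bar>"
          using B[OF True] by (intro mult_left_mono) auto
        then show ?thesis using True by (simp add: norm_mult abs_mult mult.commute)
      qed simp
    qed
  qed measurable
qed

subsection \<open>Chebyshev polynomials of the second kind\<close>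

lemma sin_arccos_seg: "x \<in> seg \<Longrightarrow> sin (arccos x) = omega x"
  by (simp add: sin_arccos omega_def)

lemma omega_mult_chebU: "x \<in> seg \<Longrightarrow> of_real (omega x) * chebU n x = of_real (sin (real (n + 1) * arccos x))"
  using omega_pos[of x] by (simp add: chebU_def omega_def)

lemma abs_sin_mult_le: "\<bar>sin (real n * t)\<bar> \<le> real n * \<bar>sin t\<bar>"
proof (induction n)
  case (Suc n)
  have "sin (real (Suc n) * t) = sin (real n * t) * cos t + cos (real n * t) * sin t"
    by (simp add: distrib_right sin_add)
  also have "\<bar>\<dots>\<bar> \<le> \<bar>sin (real n * t)\<bar> * \<bar>cos t\<bar> + \<bar>cos (real n * t)\<bar> * \<bar>sin t\<bar>"
    unfolding abs_mult[symmetric] by (rule abs_triangle_ineq)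
  also have "\<dots> \<le> \<bar>sin (real n * t)\<bar> * 1 + 1 * \<bar>sin t\<bar>"
    by (intro add_mono mult_mono) auto
  also have "\<dots> \<le> real (Suc n) * \<bar>sin t\<bar>" using Suc by (simp add: algebra_simps)
  finally show ?case .
qed simp

lemma norm_chebU_le: "x \<in> seg \<Longrightarrow> cmod (chebU n x) \<le> real (n + 1)"
proof -
  assume x: "x \<in> seg"
  have "cmod (chebU n x) = \<bar>sin (real (n + 1) * arccos x)\<bar> / omega x"
    using omega_pos[OF x] by (simp add: chebU_def omega_def norm_divide del: of_nat_add)
  also have "\<dots> \<le> real (n + 1)"
    using abs_sin_mult_le[of "n + 1" "arccos x"] omega_pos[OF x] sin_arccos_seg[OF x]
    by (simp add: divide_le_eq del: of_nat_add)
  finally show ?thesis .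
qed

lemma chebU_0: "x \<in> seg \<Longrightarrow> chebU 0 x = 1"
  using omega_pos[of x] sin_arccos_seg[of x] by (simp add: chebU_def omega_def)

text \<open>The formula 2 cos t sin ((n + 1) t) = sin ((n + 2) t) + sin (n t) at t = arccos x. The
  case distinction expresses that the polynomial of index -1 is 0.\<close>

lemma chebU_mult_x:
  assumes x: "x \<in> seg"
  shows "of_real x * chebU n x = (chebU (Suc n) x + (if n = 0 then 0 else chebU (n - 1) x)) / 2"
proof -
  let ?t = "arccos x"
  have c: "cos ?t = x" using x by simp
  have "2 * x * sin (real (n + 1) * ?t) = sin (real (n + 2) * ?t) + sin (real n * ?t)"
  proof -
    have "real (n + 2) * ?t = real (n + 1) * ?t + ?t" "real n * ?t = real (n + 1) * ?t - ?t"
      by (simp_all add: algebra_simps)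
    then show ?thesis by (simp only: sin_add sin_diff c) simp
  qed
  then have "2 * x * sin (real (n + 1) * ?t) / omega x = (sin (real (n + 2) * ?t) + sin (real n * ?t)) / omega x" by simp
  then have "(2 * x * sin (real (n + 1) * ?t) / omega x) / 2 = (sin (real (n + 2) * ?t) / omega x + sin (real n * ?t) / omega x) / 2"
    by (simp only: add_divide_distrib)
  then have "x * (sin (real (n + 1) * ?t) / omega x) = (sin (real (n + 2) * ?t) / omega x + sin (real n * ?t) / omega x) / 2"
    by simp
  then have "of_real (x * (sin (real (n + 1) * ?t) / omega x)) =
     complex_of_real ((sin (real (n + 2) * ?t) / omega x + sin (real n * ?t) / omega x) / 2)" by (rule arg_cong)
  then show ?thesis by (cases n) (simp_all add: chebU_def omega_def add_ac)
qed

text \<open>The values of \<open>chebU\<close> off the segment carry no meaning; cutting them off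
  gives a Borel function on the line.\<close>

definition chebU_seg :: "nat \<Rightarrow> real \<Rightarrow> complex" where
  "chebU_seg n x = indicator seg x *\<^sub>R chebU n x"

lemma borel_measurable_chebU_seg [measurable]: "chebU_seg n \<in> borel_measurable borel"
  unfolding chebU_seg_def[abs_def] chebU_def
proof (rule borel_measurable_continuous_on_indicator)
  show "continuous_on seg (\<lambda>x. complex_of_real (sin (real (n + 1) * arccos x) / sqrt (1 - x\<^sup>2)))"
    using abs_square_less_1 by (intro continuous_intros) (auto simp: abs_square_eq_1)
qed simp

lemma square_integrable_chebU_seg: "square_integrable omega_measure (chebU_seg n)"
proof -
  interpret finite_measure omega_measure by (rule finite_measure_omega_measure)
  show ?thesis
    unfolding square_integrable_def
  proof
    show "integrable omega_measure (\<lambda>x. (cmod (chebU_seg n x))\<^sup>2)"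
    proof (rule integrable_const_bound)
      show "AE x in omega_measure. norm ((cmod (chebU_seg n x))\<^sup>2) \<le> (real (n + 1))\<^sup>2"
        using norm_chebU_le by (intro AE_I2) (auto simp: chebU_seg_def indicator_def intro!: power_mono)
    qed (simp add: measurable_omega_measure)
  qed (simp add: measurable_omega_measure)
qed

lemma arccos_has_derivative:
  assumes "x \<in> seg" shows "(arccos has_real_derivative - (1 / omega x)) (at x)"
  using DERIV_arccos[of x] assms by (simp add: omega_def inverse_eq_divide)

text \<open>An explicit antiderivative in arccos x replaces the substitution x = cos t; it is
  continuous up to the end points, where the integrand may be singular.\<close>

lemma integral_inverse_omega:
  "((\<lambda>x. cos (real_of_int k * arccos x) / omega x) has_integral (if k = 0 then pi else 0)) {-1..1}"
proof (cases "k = 0")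
  case True
  have "((\<lambda>x. 1 / omega x) has_integral (- arccos 1 - (- arccos (-1)))) {-1..1}"
  proof (rule fundamental_theorem_of_calculus_interior)
    show "continuous_on {-1..1} (\<lambda>x. - arccos x)" by (intro continuous_intros) auto
    show "((\<lambda>x. - arccos x) has_vector_derivative 1 / omega x) (at x)" if "x \<in> seg" for x
      using DERIV_minus[OF arccos_has_derivative[OF that]]
      by (simp add: has_real_derivative_iff_has_vector_derivative)
  qed simp
  then show ?thesis using True by simp
next
  case False
  have "((\<lambda>x. cos (real_of_int k * arccos x) / omega x) has_integral
     (- sin (real_of_int k * arccos 1) / k - (- sin (real_of_int k * arccos (-1)) / k))) {-1..1}"
  proof (rule fundamental_theorem_of_calculus_interior)
    show "continuous_on {-1..1} (\<lambda>x. - sin (real_of_int k * arccos x) / k)"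
      by (intro continuous_intros) (use False in auto)
    show "((\<lambda>x. - sin (real_of_int k * arccos x) / k) has_vector_derivative cos (real_of_int k * arccos x) / omega x) (at x)"
      if "x \<in> seg" for x
    proof -
      have "((\<lambda>x. - sin (real_of_int k * arccos x) / k) has_real_derivative
          - (cos (real_of_int k * arccos x) * (real_of_int k * - (1 / omega x))) / k) (at x)"
        by (intro DERIV_cdivide DERIV_minus DERIV_chain2[OF DERIV_sin] DERIV_cmult arccos_has_derivative that)
      then show ?thesis using False by (simp add: has_real_derivative_iff_has_vector_derivative)
    qed
  qed simp
  then show ?thesis using False by (simp add: sin_pi_int sin_int_pi)
qed

lemma has_integral_Lebesgue_seg:
  fixes f :: "real \<Rightarrow> real"
  assumes "(f has_integral I) {-1..1}" "set_integrable lborel seg f"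
  shows "(LINT x:seg|lborel. f x) = I"
proof -
  have "(f has_integral I) (box (-1) 1)" using assms(1) has_integral_open_interval by (metis box_real(2))
  then have "(f has_integral I) seg" by simp
  then show ?thesis using set_borel_integral_eq_integral(2)[OF assms(2)] integral_unique by metis
qed

lemma integral_sin_sin:
  "((\<lambda>x. sin (real (n + 1) * arccos x) * sin (real (m + 1) * arccos x) / omega x)
     has_integral (if n = m then pi / 2 else 0)) {-1..1}"
proof -
  have "((\<lambda>x. (cos (real_of_int (int n - int m) * arccos x) / omega x
        - cos (real_of_int (int n + int m + 2) * arccos x) / omega x) / 2)
     has_integral ((if int n - int m = 0 then pi else 0) - (if int n + int m + 2 = 0 then pi else 0)) / 2) {-1..1}"
    by (intro has_integral_divide has_integral_diff integral_inverse_omega)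
  moreover have "(cos (real_of_int (int n - int m) * t) / w - cos (real_of_int (int n + int m + 2) * t) / w) / 2
     = sin (real (n + 1) * t) * sin (real (m + 1) * t) / w" for t w :: real
  proof -
    have e: "real_of_int (int n - int m) * t = real (n + 1) * t - real (m + 1) * t"
      "real_of_int (int n + int m + 2) * t = real (n + 1) * t + real (m + 1) * t"
      by (simp_all add: algebra_simps)
    show ?thesis unfolding e cos_diff cos_add by (simp add: diff_divide_distrib add_divide_distrib)
  qed
  moreover have "((if int n - int m = 0 then pi else 0) - (if int n + int m + 2 = 0 then pi else 0)) / 2
     = (if n = m then pi / 2 else 0)" by auto
  ultimately show ?thesis by simp
qed

lemma integral_omega_measure_chebU_seg_mult: "(LINT x|omega_measure. chebU_seg n x * cnj (chebU_seg m x)) = (if n = m then of_real (pi / 2) else 0)"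
proof -
  have m: "(\<lambda>x. chebU_seg n x * cnj (chebU_seg m x)) \<in> borel_measurable borel"
    using square_integrableD(1)[OF square_integrable_cnj[OF square_integrable_chebU_seg[of m]]] by (simp add: measurable_omega_measure)
  let ?s = "\<lambda>x. sin (real (n + 1) * arccos x) * sin (real (m + 1) * arccos x) / omega x"
  have eq: "(indicator seg x * omega x) *\<^sub>R (chebU_seg n x * cnj (chebU_seg m x)) = of_real (indicator seg x *\<^sub>R ?s x)" for x
  proof (cases "x \<in> seg")
    case True
    then show ?thesis using omega_pos[of x]
      by (simp add: chebU_seg_def chebU_def omega_def[symmetric] scaleR_conv_of_real)
  qed simp
  \<comment> \<open>Absolute integrability comes from the square integrability of the factors; the
    existence of the gauge integral alone would not give it.\<close>
  have i: "integrable lborel (\<lambda>x. complex_of_real (indicator seg x *\<^sub>R ?s x))"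
    unfolding eq[symmetric]
    unfolding integrable_omega_measure[OF m, symmetric]
    by (intro square_integrable_mult square_integrable_cnj square_integrable_chebU_seg)
  then have "set_integrable lborel seg ?s"
    unfolding set_integrable_def by (simp only: complex_of_real_integrable_eq)
  then have "(LINT x:seg|lborel. ?s x) = (if n = m then pi / 2 else 0)"
    by (rule has_integral_Lebesgue_seg[OF integral_sin_sin])
  moreover have "(LINT x|omega_measure. chebU_seg n x * cnj (chebU_seg m x)) = of_real (LINT x:seg|lborel. ?s x)"
    unfolding integral_omega_measure[OF m] eq set_lebesgue_integral_def by (rule integral_complex_of_real)
  ultimately show ?thesis by simp
qed

interpretation chebU: orthogonal_family omega_measure chebU_seg "\<lambda>n. pi / 2"
  by standard (simp_all add: square_integrable_chebU_seg integral_omega_measure_chebU_seg_mult)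

lemma cnj_chebU_seg: "cnj (chebU_seg n x) = chebU_seg n x"
  by (simp add: chebU_seg_def chebU_def)

lemma form_omega_eq_omega_measure:
  assumes "u \<in> L2_omega"
  shows "form_omega u (chebU n) = (LINT x|omega_measure. (indicator seg x *\<^sub>R u x) * cnj (chebU_seg n x))"
proof -
  have m: "(\<lambda>x. (indicator seg x *\<^sub>R u x) * cnj (chebU_seg n x)) \<in> borel_measurable borel"
    unfolding cnj_chebU_seg by (intro borel_measurable_times L2_omega_measurable assms borel_measurable_chebU_seg)
  show ?thesis
    unfolding integral_omega_measure[OF m] form_omega_eq
    by (rule Bochner_Integration.integral_cong)
       (auto simp: omega_mult_def indicator_def cnj_chebU_seg scaleR_conv_of_real, auto simp: chebU_seg_def)
qed

lemma form_omega_chebU: "form_omega (chebU n) (chebU n) = of_real (pi / 2)"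
proof -
  have "form_omega (chebU n) (chebU n) = form_omega (chebU_seg n) (chebU n)"
    unfolding form_omega_eq
    by (rule Bochner_Integration.integral_cong) (auto simp: omega_mult_def chebU_seg_def indicator_def)
  also have "\<dots> = (LINT x|omega_measure. (indicator seg x *\<^sub>R chebU_seg n x) * cnj (chebU_seg n x))"
    by (rule form_omega_eq_omega_measure[OF square_integrable_L2_omega[OF square_integrable_chebU_seg]])
  also have "(\<lambda>x. (indicator seg x *\<^sub>R chebU_seg n x) * cnj (chebU_seg n x)) = (\<lambda>x. chebU_seg n x * cnj (chebU_seg n x))"
    by (auto simp: chebU_seg_def fun_eq_iff indicator_def)
  finally show ?thesis by (simp add: integral_omega_measure_chebU_seg_mult)
qed

lemma cheb_coeff_eq: "cheb_coeff u n = 2 / of_real pi * (LINT x|lborel. omega_mult u x * chebU n x)"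
  unfolding cheb_coeff_def form_omega_chebU by (simp add: form_omega_eq)

subsection \<open>Completeness\<close>

lemma omega_mult_chebU_integrable:
  assumes "u \<in> L2_omega" shows "integrable lborel (\<lambda>x. omega_mult u x * chebU n x)"
proof -
  have "integrable omega_measure (\<lambda>x. (indicator seg x *\<^sub>R u x) * chebU_seg n x)"
    by (rule square_integrable_mult[OF L2_omega_square_integrable[OF assms] square_integrable_chebU_seg])
  then have "integrable lborel (\<lambda>x. (indicator seg x * omega x) *\<^sub>R ((indicator seg x *\<^sub>R u x) * chebU_seg n x))"
    by (subst (asm) integrable_omega_measure) (intro borel_measurable_times L2_omega_measurable assms borel_measurable_chebU_seg)
  moreover have "(indicator seg x * omega x) *\<^sub>R ((indicator seg x *\<^sub>R u x) * chebU_seg n x) = omega_mult u x * chebU n x" for x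
    by (auto simp: omega_mult_def indicator_def chebU_seg_def scaleR_conv_of_real)
  ultimately show ?thesis by simp
qed

text \<open>The recurrence lowers the power of x at the cost of moving to neighbouring indices,
  which is why n is arbitrary in the induction.\<close>

lemma zero_coeff_orthogonal_power:
  assumes u: "u \<in> L2_omega" and z: "\<And>n. cheb_coeff u n = 0"
  shows "integrable lborel (\<lambda>x. omega_mult u x * (of_real x ^ k * chebU n x)) \<and>
    (LINT x|lborel. omega_mult u x * (of_real x ^ k * chebU n x)) = 0"
proof (induction k arbitrary: n)
  case 0
  then show ?case using z[of n] omega_mult_chebU_integrable[OF u, of n] by (simp add: cheb_coeff_eq)
next
  case (Suc k)
  have eq: "omega_mult u x * (of_real x ^ Suc k * chebU n x) =
      (1/2) * (omega_mult u x * (of_real x ^ k * chebU (Suc n) x))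
      + (if n = 0 then 0 else 1/2) * (omega_mult u x * (of_real x ^ k * chebU (n - 1) x))" for x
  proof (cases "x \<in> seg")
    case True
    have "of_real x ^ Suc k * chebU n x = of_real x ^ k * (of_real x * chebU n x)" by (simp add: mult_ac)
    then show ?thesis unfolding chebU_mult_x[OF True] by (simp add: algebra_simps add_divide_distrib)
  qed (simp add: omega_mult_def)
  show ?case unfolding eq using Suc.IH[of "Suc n"] Suc.IH[of "n - 1"] by simp
qed

text \<open>Powers of x are reached from index 0, where the polynomial is 1, and Weierstrass
  approximation does the rest; complex functions are split into real and imaginary part.\<close>

lemma zero_coeff_orthogonal_continuous:
  assumes u: "u \<in> L2_omega" and z: "\<And>n. cheb_coeff u n = 0" and f: "continuous_on {-1..1} f"
  shows "(LINT x|lborel. omega_mult u x * f x) = 0"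
proof -
  have real_case: "(LINT x|lborel. omega_mult u x * of_real (h x)) = 0" if h: "continuous_on {-1..1} h" for h :: "real \<Rightarrow> real"
  proof -
    have intc: "integrable lborel (\<lambda>x. omega_mult u x * of_real (h x))"
      by (intro omega_mult_mult_integrable u continuous_intros h)
    define B where "B = (LINT x|lborel. cmod (omega_mult u x))"
    have B: "B \<ge> 0" by (simp add: B_def)
    have small: "cmod (LINT x|lborel. omega_mult u x * of_real (h x)) \<le> e * B" if e: "e > 0" for e
    proof -
      obtain p where p: "real_polynomial_function p" "\<And>x. x \<in> {-1..1} \<Longrightarrow> \<bar>h x - p x\<bar> < e"
        using Stone_Weierstrass_real_polynomial_function[OF compact_Icc h e] by blast
      obtain a N where pa: "p = (\<lambda>x. \<Sum>i\<le>N. a i * x ^ i)" using p(1) by (auto simp: real_polynomial_function_iff_sum)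
      have ip: "integrable lborel (\<lambda>x. omega_mult u x * of_real (p x))"
        by (intro omega_mult_mult_integrable u) (auto simp: pa intro!: continuous_intros)
      have "omega_mult u x * of_real (p x) = (\<Sum>i\<le>N. of_real (a i) * (omega_mult u x * (of_real x ^ i * chebU 0 x)))" for x
      proof (cases "x \<in> seg")
        case True
        then show ?thesis by (simp add: pa chebU_0 sum_distrib_left mult_ac)
      qed (simp add: omega_mult_def)
      then have "(LINT x|lborel. omega_mult u x * of_real (p x)) = 0"
        using zero_coeff_orthogonal_power[OF u z] by (simp add: Bochner_Integration.integral_sum)
      then have "(LINT x|lborel. omega_mult u x * of_real (h x))
          = (LINT x|lborel. omega_mult u x * of_real (h x) - omega_mult u x * of_real (p x))"
        using intc ip by simp
      also have "cmod \<dots> \<le> (LINT x|lborel. cmod (omega_mult u x * of_real (h x) - omega_mult u x * of_real (p x)))"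
        by (rule integral_norm_bound)
      also have "\<dots> \<le> (LINT x|lborel. e * cmod (omega_mult u x))"
      proof (rule integral_mono)
        fix x
        show "cmod (omega_mult u x * of_real (h x) - omega_mult u x * of_real (p x)) \<le> e * cmod (omega_mult u x)"
        proof (cases "x \<in> seg")
          case True
          have "cmod (omega_mult u x * of_real (h x) - omega_mult u x * of_real (p x)) = cmod (omega_mult u x) * \<bar>h x - p x\<bar>"
            by (simp flip: right_diff_distrib of_real_diff add: norm_mult)
          also have "\<dots> \<le> cmod (omega_mult u x) * e"
            using True p(2)[of x] by (intro mult_left_mono) auto
          finally show ?thesis by (simp add: mult.commute)
        qed (use e in \<open>simp add: omega_mult_def\<close>)
      qed (use intc ip omega_mult_integrable[OF u] in simp_all)
      also have "\<dots> = e * B" by (simp add: B_def)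
      finally show ?thesis .
    qed
    have "cmod (LINT x|lborel. omega_mult u x * of_real (h x)) \<le> 0"
    proof (rule field_le_epsilon)
      fix e :: real assume "e > 0"
      then have "cmod (LINT x|lborel. omega_mult u x * of_real (h x)) \<le> e / (B + 1) * B"
        using B by (intro small) simp
      also have "\<dots> \<le> e" using B \<open>e > 0\<close> by (simp add: field_simps)
      finally show "cmod (LINT x|lborel. omega_mult u x * of_real (h x)) \<le> 0 + e" by simp
    qed
    then show ?thesis by simp
  qed
  have "omega_mult u x * f x = omega_mult u x * of_real (Re (f x)) + \<i> * (omega_mult u x * of_real (Im (f x)))" for x
    by (subst (1) complex_eq[of "f x"]) (simp add: algebra_simps)
  moreover have "continuous_on {-1..1} (\<lambda>x. Re (f x))" "continuous_on {-1..1} (\<lambda>x. Im (f x))"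
    by (intro continuous_intros f)+
  moreover have "integrable lborel (\<lambda>x. omega_mult u x * of_real (Re (f x)))" "integrable lborel (\<lambda>x. omega_mult u x * of_real (Im (f x)))"
    by (intro omega_mult_mult_integrable u continuous_intros f)+
  ultimately show ?thesis using real_case by simp
qed

text \<open>Riesz-Fischer produces the function and orthogonality its coefficients. All members of
  the family have squared norm pi / 2, so plain square summability is the right condition.\<close>

lemma U_expansion:
  assumes "summable (\<lambda>n. (cmod (c n))\<^sup>2)"
  obtains v where "v \<in> L2_omega" "cheb_coeff v = c" "chebU.expands c v"
proof -
  have "summable (\<lambda>n. pi / 2 * (cmod (c n))\<^sup>2)" using assms by (rule summable_mult)
  then obtain v where v: "chebU.expands c v" by (rule chebU.Riesz_Fischer[OF finite_measure_omega_measure])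
  have sq: "square_integrable omega_measure v" using v by (simp add: chebU.expands_def)
  have L2: "v \<in> L2_omega" by (rule square_integrable_L2_omega[OF sq])
  have "cheb_coeff v n = c n" for n
  proof -
    have "form_omega v (chebU n) = (LINT x|omega_measure. v x * cnj (chebU_seg n x))"
      unfolding form_omega_eq_omega_measure[OF L2]
      by (rule Bochner_Integration.integral_cong) (auto simp: chebU_seg_def indicator_def)
    then have "form_omega v (chebU n) = c n * of_real (pi / 2)"
      using chebU.expands_coeff[OF v] by simp
    then show ?thesis by (simp add: cheb_coeff_def form_omega_chebU)
  qed
  then show ?thesis using that L2 v by (simp add: fun_eq_iff)
qed

text \<open>The mean-square sum \<open>v\<close> of the series has the coefficients of
  \<open>u\<close>, so u - v is orthogonal to every continuous function. This is enough for the
  pairing; equality of \<open>u\<close> and \<open>v\<close> almost everywhere is never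
  claimed.\<close>

lemma L2_omega_expansion_sums:
  assumes u: "u \<in> L2_omega" and sm: "summable (\<lambda>n. (cmod (cheb_coeff u n))\<^sup>2)" and f: "continuous_on {-1..1} f"
  shows "(\<lambda>n. cheb_coeff u n * (LINT x|lborel. omega_mult (chebU n) x * f x)) sums (LINT x|lborel. omega_mult u x * f x)"
proof -
  obtain v where v: "v \<in> L2_omega" "cheb_coeff v = cheb_coeff u" "chebU.expands (cheb_coeff u) v"
    using U_expansion[OF sm] .
  have [measurable]: "v \<in> borel_measurable borel" using v(3) square_integrableD(1)[of omega_measure v] by (simp add: chebU.expands_def measurable_omega_measure)
  have [measurable]: "(\<lambda>x. indicator {-1..1} x *\<^sub>R f x) \<in> borel_measurable borel"
    by (rule borel_measurable_continuous_on_indicator) (use f in auto)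
  interpret finite_measure omega_measure by (rule finite_measure_omega_measure)
  have "bounded (f ` {-1..1})" by (rule compact_imp_bounded[OF compact_continuous_image[OF f]]) simp
  then obtain B where B: "\<And>x. x \<in> {-1..1} \<Longrightarrow> cmod (f x) \<le> B" unfolding bounded_iff by blast
  have sqf: "square_integrable omega_measure (\<lambda>x. indicator {-1..1} x *\<^sub>R f x)"
    unfolding square_integrable_def
  proof
    show "integrable omega_measure (\<lambda>x. (cmod (indicator {-1..1} x *\<^sub>R f x))\<^sup>2)"
    proof (rule integrable_const_bound)
      show "AE x in omega_measure. norm ((cmod (indicator {-1..1} x *\<^sub>R f x))\<^sup>2) \<le> B\<^sup>2"
        using B by (intro AE_I2) (auto simp: indicator_def intro!: power_mono)
    next
      have "(\<lambda>x. (cmod (indicator {-1..1} x *\<^sub>R f x))\<^sup>2) \<in> borel_measurable borel" by measurable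
      then show "(\<lambda>x. (cmod (indicator {-1..1} x *\<^sub>R f x))\<^sup>2) \<in> borel_measurable omega_measure" by (simp only: measurable_omega_measure)
    qed
  next
    show "(\<lambda>x. indicator {-1..1} x *\<^sub>R f x) \<in> borel_measurable omega_measure" unfolding measurable_omega_measure by measurable
  qed
  have conv: "(LINT x|omega_measure. h x * (indicator {-1..1} x *\<^sub>R f x)) = (LINT x|lborel. omega_mult h x * f x)"
    if [measurable]: "h \<in> borel_measurable borel" for h
  proof -
    have m: "(\<lambda>x. h x * (indicator {-1..1} x *\<^sub>R f x)) \<in> borel_measurable borel" by measurable
    show ?thesis
      unfolding integral_omega_measure[OF m]
      by (rule Bochner_Integration.integral_cong) (auto simp: omega_mult_def indicator_def scaleR_conv_of_real)
  qed
  have eUf: "(LINT x|omega_measure. chebU_seg n x * (indicator {-1..1} x *\<^sub>R f x)) = (LINT x|lborel. omega_mult (chebU n) x * f x)" for n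
  proof -
    have "omega_mult (chebU_seg n) = omega_mult (chebU n)" by (auto simp: omega_mult_def chebU_seg_def indicator_def fun_eq_iff)
    then show ?thesis using conv[of "chebU_seg n"] by simp
  qed
  have s: "(\<lambda>n. cheb_coeff u n * (LINT x|lborel. omega_mult (chebU n) x * f x)) sums (LINT x|lborel. omega_mult v x * f x)"
    using chebU.expands_sums[OF v(3) sqf] by (simp only: eUf conv[OF \<open>v \<in> borel_measurable borel\<close>])
  define d where "d = (\<lambda>x. 1 * u x + (-1) * v x)"
  have d: "d \<in> L2_omega" unfolding d_def by (rule L2_omega_lincomb[OF u v(1)])
  have dm: "omega_mult d x * g x = omega_mult u x * g x - omega_mult v x * g x" for g x
    by (simp add: d_def omega_mult_def algebra_simps)
  have "cheb_coeff d n = 0" for n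
  proof -
    have "cheb_coeff d n = cheb_coeff u n - cheb_coeff v n"
      unfolding cheb_coeff_eq dm
      using omega_mult_chebU_integrable[OF u] omega_mult_chebU_integrable[OF v(1)] by (simp add: algebra_simps)
    then show ?thesis using v(2) by simp
  qed
  then have "(LINT x|lborel. omega_mult d x * f x) = 0" by (rule zero_coeff_orthogonal_continuous[OF d _ f])
  then have "(LINT x|lborel. omega_mult u x * f x) = (LINT x|lborel. omega_mult v x * f x)"
    unfolding dm using omega_mult_mult_integrable[OF u f] omega_mult_mult_integrable[OF v(1) f] by simp
  then show ?thesis using s by simp
qed

lemma U_fun:
  assumes "summable (\<lambda>n. (cmod (c n))\<^sup>2)"
  shows "U_fun c \<in> L2_omega" "cheb_coeff (U_fun c) = c"
proof -
  obtain v where "v \<in> L2_omega \<and> cheb_coeff v = c" using U_expansion[OF assms] by metis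
  then have "U_fun c \<in> L2_omega \<and> cheb_coeff (U_fun c) = c" unfolding U_fun_def by (rule someI[of "\<lambda>u. u \<in> L2_omega \<and> cheb_coeff u = c"])
  then show "U_fun c \<in> L2_omega" "cheb_coeff (U_fun c) = c" by auto
qed

subsection \<open>The Fourier transforms of the weighted Chebyshev polynomials\<close>

definition chebU_hat :: "nat \<Rightarrow> real \<Rightarrow> complex" where
  "chebU_hat n = fourier (omega_mult (chebU n))"

lemma continuous_seg_integral:
  fixes f :: "real \<Rightarrow> real"
  assumes "continuous_on {-1..1} f"
  shows "set_integrable lborel seg f" "(LINT x:seg|lborel. f x) = integral {-1..1} f"
proof -
  have "set_integrable lborel {-1..1} f" by (rule borel_integrable_atLeastAtMost') (rule assms)
  then show s: "set_integrable lborel seg f" by (rule set_integrable_subset) auto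
  have "(f has_integral integral {-1..1} f) {-1..1}"
    using integrable_continuous_interval[OF assms] by (rule integrable_integral)
  then show "(LINT x:seg|lborel. f x) = integral {-1..1} f" by (rule has_integral_Lebesgue_seg[OF _ s])
qed

text \<open>After the substitution x = cos t, the terms of order n and n + 2 have phases differing
  by pi, so up to a common factor their sum is cos (n t) - cos ((n + 2) t) = 2 sin ((n + 1) t) sin
  t.\<close>

lemma bes_div_eq_integral:
  "bes_div (int n + 1) \<xi> = integral {-1..1} (\<lambda>x. sin (real (n + 1) * arccos x) * cos (real n * pi / 2 - \<xi> * x))"
proof -
  let ?f = "\<lambda>x. sin (real (n + 1) * arccos x) * cos (real n * pi / 2 - \<xi> * x)"
  \<comment> \<open>The substitution is decreasing; the difference of the two integrals is the
    oriented one.\<close>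
  have "((\<lambda>t. (- sin t) *\<^sub>R ?f (cos t)) has_integral (integral {cos 0..cos pi} ?f - integral {cos pi..cos 0} ?f)) {0..pi}"
  proof (rule has_integral_substitution_general[where c = "-1" and d = 1 and s = "{}"])
    show "continuous_on {-1..1} ?f" by (intro continuous_intros) auto
    show "(cos has_real_derivative - sin x) (at x within {0..pi})" for x
      by (auto intro!: derivative_eq_intros)
  qed (auto intro!: continuous_intros)
  then have "((\<lambda>t. (- sin t) *\<^sub>R ?f (cos t)) has_integral (- integral {-1..1} ?f)) {0..pi}" by simp
  then have "((\<lambda>t. - ((- sin t) *\<^sub>R ?f (cos t))) has_integral (- (- integral {-1..1} ?f))) {0..pi}"
    by (rule has_integral_neg)
  then have 1: "integral {0..pi} (\<lambda>t. sin t * ?f (cos t)) = integral {-1..1} ?f"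
    by (simp add: integral_unique)
  have e: "(cos (real_of_int (int n) * t) * cos (real_of_int (int n) * pi / 2 - \<xi> * cos t)
      + cos (real_of_int (int n + 2) * t) * cos (real_of_int (int n + 2) * pi / 2 - \<xi> * cos t)) / 2 = sin t * ?f (cos t)"
    if "t \<in> {0..pi}" for t
  proof -
    let ?y = "real n * pi / 2 - \<xi> * cos t"
    have a: "arccos (cos t) = t" using that by (simp add: arccos_cos)
    have b: "real_of_int (int n + 2) * pi / 2 - \<xi> * cos t = ?y + pi" by (simp add: field_simps)
    have c: "real_of_int (int n + 2) * t = real (n + 1) * t + t" "real_of_int (int n) * t = real (n + 1) * t - t"
      by (simp_all add: algebra_simps)
    show ?thesis unfolding a b c cos_add cos_diff by (simp add: algebra_simps)
  qed
  have "bes_div (int n + 1) \<xi> = (bes (int n) \<xi> + bes (int n + 2) \<xi>) / 2" by (simp add: bes_div_def add.assoc)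
  also have "\<dots> = integral {0..pi} (\<lambda>t. (cos (real_of_int (int n) * t) * cos (real_of_int (int n) * pi / 2 - \<xi> * cos t)
      + cos (real_of_int (int n + 2) * t) * cos (real_of_int (int n + 2) * pi / 2 - \<xi> * cos t)) / 2)"
    unfolding bes_def integral_divide
    by (subst Henstock_Kurzweil_Integration.integral_add[OF bes_integrand_integrable bes_integrand_integrable]) simp
  also have "\<dots> = integral {0..pi} (\<lambda>t. sin t * ?f (cos t))"
    by (rule Henstock_Kurzweil_Integration.integral_cong) (rule e)
  finally show ?thesis using 1 by simp
qed

text \<open>Under x -> -x the first factor picks up the sign (-1)^n and the second factor the
  opposite one.\<close>

lemma integral_odd_part_zero:
  "integral {-1..1} (\<lambda>x. sin (real (n + 1) * arccos x) * sin (real n * pi / 2 - \<xi> * x)) = 0"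
proof -
  let ?h = "\<lambda>x. sin (real (n + 1) * arccos x) * sin (real n * pi / 2 - \<xi> * x)"
  have "?h (- x) = - ?h x" if "x \<in> {-1..1}" for x
  proof -
    have c: "cos (real n * pi) = (-1) ^ n" by (rule cos_npi)
    have 1: "sin (real (n + 1) * arccos (- x)) = (-1) ^ n * sin (real (n + 1) * arccos x)"
    proof -
      have "real (n + 1) * arccos (- x) = real (n + 1) * pi - real (n + 1) * arccos x"
        using that by (simp add: arccos_minus right_diff_distrib)
      then have "sin (real (n + 1) * arccos (- x)) = sin (real (n + 1) * pi) * cos (real (n + 1) * arccos x)
          - cos (real (n + 1) * pi) * sin (real (n + 1) * arccos x)" by (simp only: sin_diff)
      then show ?thesis by (simp only: sin_npi cos_npi) simp
    qed
    have 2: "sin (real n * pi / 2 - \<xi> * (- x)) = - ((-1) ^ n) * sin (real n * pi / 2 - \<xi> * x)"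
    proof -
      have "real n * pi / 2 - \<xi> * (- x) = real n * pi - (real n * pi / 2 - \<xi> * x)" by (simp add: field_simps)
      then have "sin (real n * pi / 2 - \<xi> * (- x)) = sin (real n * pi) * cos (real n * pi / 2 - \<xi> * x)
          - cos (real n * pi) * sin (real n * pi / 2 - \<xi> * x)" by (simp only: sin_diff)
      then show ?thesis by (simp only: sin_npi cos_npi)
    qed
    have "(-1 :: real) ^ n * (-1) ^ n = 1" by (simp flip: power_mult_distrib)
    then show ?thesis unfolding 1 2 by (simp add: mult_ac)
  qed
  then have "integral {-1..1} (\<lambda>x. ?h (- x)) = integral {-1..1} (\<lambda>x. - ?h x)"
    by (intro Henstock_Kurzweil_Integration.integral_cong) auto
  moreover have "integral {-1..1} (\<lambda>x. ?h (- x)) = integral {-1..1} ?h"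
    using Henstock_Kurzweil_Integration.integral_reflect_real[of 1 "-1" ?h] by simp
  ultimately show ?thesis by simp
qed

text \<open>Pulling out the phase (-i)^n = cis (- n pi / 2) leaves a real integral and the integral
  of an odd function.\<close>

lemma chebU_hat_eq: "chebU_hat n \<xi> = (- \<i>) ^ n * of_real (bes_div (int n + 1) \<xi>)"
proof -
  let ?s = "\<lambda>x. sin (real (n + 1) * arccos x)" and ?y = "\<lambda>x. real n * pi / 2 - \<xi> * x"
  have c1: "continuous_on {-1..1} (\<lambda>x. ?s x * cos (?y x))" and c2: "continuous_on {-1..1} (\<lambda>x. ?s x * sin (?y x))"
    by (intro continuous_intros; auto)+
  have m: "(- \<i>) ^ n = cis (- (real n * pi / 2))"
  proof -
    have "(- \<i>) ^ n = cis (- (pi / 2)) ^ n" by (simp only: cis_minus_pi_half)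
    also have "\<dots> = cis (real n * (- (pi / 2)))" by (rule Complex.DeMoivre)
    finally show ?thesis by (simp only: mult_minus_right times_divide_eq_right)
  qed
  have "omega_mult (chebU n) x * cis (- (x * \<xi>))
     = (- \<i>) ^ n * (of_real (indicator seg x *\<^sub>R (?s x * cos (?y x))) + \<i> * of_real (indicator seg x *\<^sub>R (?s x * sin (?y x))))" for x
  proof (cases "x \<in> seg")
    case True
    have "cis (- (x * \<xi>)) = (- \<i>) ^ n * cis (?y x)"
      unfolding m by (simp add: cis_mult algebra_simps)
    moreover have "cis (?y x) = of_real (cos (?y x)) + \<i> * of_real (sin (?y x))" by (simp add: complex_eq_iff)
    moreover have "omega_mult (chebU n) x = of_real (?s x)"
      using True omega_mult_chebU[OF True, of n] by (simp add: omega_mult_def)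
    ultimately show ?thesis using True by (simp add: algebra_simps)
  qed (simp add: omega_mult_def)
  then have "chebU_hat n \<xi> = (LINT x|lborel. (- \<i>) ^ n * (of_real (indicator seg x *\<^sub>R (?s x * cos (?y x))) + \<i> * of_real (indicator seg x *\<^sub>R (?s x * sin (?y x)))))"
    by (simp only: chebU_hat_def fourier_def)
  also have "\<dots> = (- \<i>) ^ n * (of_real (LINT x:seg|lborel. ?s x * cos (?y x)) + \<i> * of_real (LINT x:seg|lborel. ?s x * sin (?y x)))"
  proof -
    have i: "integrable lborel (\<lambda>x. complex_of_real (indicator seg x *\<^sub>R (?s x * cos (?y x))))"
      "integrable lborel (\<lambda>x. complex_of_real (indicator seg x *\<^sub>R (?s x * sin (?y x))))"
      using continuous_seg_integral(1)[OF c1] continuous_seg_integral(1)[OF c2] unfolding set_integrable_def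
      by (simp_all only: complex_of_real_integrable_eq)
    show ?thesis
      unfolding set_lebesgue_integral_def integral_complex_of_real[symmetric] integral_mult_right_zero[symmetric]
      using i by (subst Bochner_Integration.integral_add[symmetric]) (simp_all only: Bochner_Integration.integrable_mult_right integral_mult_right_zero)
  qed
  also have "\<dots> = (- \<i>) ^ n * of_real (bes_div (int n + 1) \<xi>)"
    unfolding continuous_seg_integral(2)[OF c1] continuous_seg_integral(2)[OF c2]
      integral_odd_part_zero bes_div_eq_integral by simp
  finally show ?thesis .
qed

text \<open>The weighted polynomials are real. Bilinear pairings at opposite frequencies thereby
  become hermitian inner products, for which \<open>orthogonal_family\<close> is made.\<close>

lemma chebU_hat_reflect: "chebU_hat n (- \<xi>) = cnj (chebU_hat n \<xi>)"
proof -
  have "bes_div (int n + 1) (- \<xi>) = (if even n then bes_div (int n + 1) \<xi> else - bes_div (int n + 1) \<xi>)"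
    by (simp add: bes_div_reflect)
  moreover have "cnj ((- \<i>) ^ n) = (if even n then (- \<i>) ^ n else - ((- \<i>) ^ n))"
    by (simp add: power_minus_even power_minus_odd)
  ultimately show ?thesis
    unfolding chebU_hat_eq complex_cnj_mult complex_cnj_complex_of_real by (cases "even n") (simp_all only: if_True if_False of_real_minus mult_minus_left mult_minus_right simp_thms)
qed

text \<open>The weight |xi| is, up to a factor, the symbol of the hypersingular operator. Near 0 it
  is weaker than the Sobolev weight of order 1/2, so low frequencies need a separate
  estimate.\<close>

definition abs_measure :: "real measure" where
  "abs_measure = density lborel (\<lambda>\<xi>. ennreal \<bar>\<xi>\<bar>)"

lemma measurable_abs_measure: "borel_measurable abs_measure = borel_measurable borel"
  unfolding abs_measure_def by (rule measurable_cong_sets) auto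

lemma integral_abs_measure:
  fixes f :: "real \<Rightarrow> 'a::{banach, second_countable_topology}"
  assumes "f \<in> borel_measurable borel"
  shows "(LINT \<xi>|abs_measure. f \<xi>) = (LINT \<xi>|lborel. \<bar>\<xi>\<bar> *\<^sub>R f \<xi>)"
  unfolding abs_measure_def using assms by (intro integral_density) auto

lemma integrable_abs_measure:
  fixes f :: "real \<Rightarrow> 'a::{banach, second_countable_topology}"
  assumes "f \<in> borel_measurable borel"
  shows "integrable abs_measure f \<longleftrightarrow> integrable lborel (\<lambda>\<xi>. \<bar>\<xi>\<bar> *\<^sub>R f \<xi>)"
  unfolding abs_measure_def using assms by (intro integrable_density) auto

lemma borel_measurable_chebU_hat [measurable]: "chebU_hat n \<in> borel_measurable borel"
proof -
  have "(\<lambda>\<xi>. (- \<i>) ^ n * complex_of_real (bes_div (int n + 1) \<xi>)) \<in> borel_measurable borel" by measurable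
  then show ?thesis by (simp add: chebU_hat_eq[abs_def])
qed

lemma chebU_hat_mult_cnj: "\<bar>\<xi>\<bar> *\<^sub>R (chebU_hat n \<xi> * cnj (chebU_hat m \<xi>))
    = ((- \<i>) ^ n * cnj ((- \<i>) ^ m)) * of_real (\<bar>\<xi>\<bar> * bes_div (int (Suc n)) \<xi> * bes_div (int (Suc m)) \<xi>)"
  by (simp add: chebU_hat_eq scaleR_conv_of_real add.commute mult_ac)

text \<open>The index n of the family belongs to the Bessel order n + 1, whence the norm. The phases
  only multiply the inner products, and they cancel on the diagonal.\<close>

lemma orthogonal_family_chebU_hat: "orthogonal_family abs_measure chebU_hat (\<lambda>n. pi\<^sup>2 * real (n + 1))"
proof
  have hb: "has_bochner_integral lborel (\<lambda>\<xi>. \<bar>\<xi>\<bar> * bes_div (int (Suc n)) \<xi> * bes_div (int (Suc m)) \<xi>)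
      (if n = m then real (Suc n) * pi\<^sup>2 else 0)" for n m
    using has_bochner_integral_bes_div[of "Suc n" "Suc m"] by simp
  fix n m
  show "square_integrable abs_measure (chebU_hat n)"
  proof -
    have "(cmod (chebU_hat n \<xi>))\<^sup>2 = (bes_div (int (Suc n)) \<xi>)\<^sup>2" for \<xi>
      by (simp add: chebU_hat_eq norm_mult norm_power add.commute)
    then have "\<bar>\<xi>\<bar> *\<^sub>R (cmod (chebU_hat n \<xi>))\<^sup>2 = \<bar>\<xi>\<bar> * bes_div (int (Suc n)) \<xi> * bes_div (int (Suc n)) \<xi>" for \<xi>
      by (simp only: real_scaleR_def power2_eq_square mult.assoc)
    then have "integrable lborel (\<lambda>\<xi>. \<bar>\<xi>\<bar> *\<^sub>R (cmod (chebU_hat n \<xi>))\<^sup>2)"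
      using hb[of n n] by (simp only: has_bochner_integral_iff)
    moreover have "(\<lambda>\<xi>. (cmod (chebU_hat n \<xi>))\<^sup>2) \<in> borel_measurable borel" by measurable
    ultimately show ?thesis
      unfolding square_integrable_def measurable_abs_measure using integrable_abs_measure borel_measurable_chebU_hat by blast
  qed
  have m: "(\<lambda>\<xi>. chebU_hat n \<xi> * cnj (chebU_hat m \<xi>)) \<in> borel_measurable borel"
    unfolding chebU_hat_reflect[symmetric] by measurable
  have "(LINT \<xi>|abs_measure. chebU_hat n \<xi> * cnj (chebU_hat m \<xi>)) = ((- \<i>) ^ n * cnj ((- \<i>) ^ m)) *
      of_real (LINT \<xi>|lborel. \<bar>\<xi>\<bar> * bes_div (int (Suc n)) \<xi> * bes_div (int (Suc m)) \<xi>)"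
    unfolding integral_abs_measure[OF m] chebU_hat_mult_cnj integral_mult_right_zero integral_complex_of_real ..
  also have "\<dots> = ((- \<i>) ^ n * cnj ((- \<i>) ^ m)) * of_real (if n = m then real (Suc n) * pi\<^sup>2 else 0)"
    using hb[of n m] by (simp only: has_bochner_integral_iff)
  also have "\<dots> = (if n = m then of_real (pi\<^sup>2 * real (n + 1)) else 0)"
  proof -
    have k: "(- \<i>) ^ n * cnj ((- \<i>) ^ n) = 1"
      by (simp add: complex_norm_square[symmetric] norm_power del: complex_cnj_power)
    show ?thesis
    proof (cases "n = m")
      case True
      then show ?thesis using k by (simp only: mult_1_left if_True) (simp add: mult.commute)
    qed simp
  qed
  finally show "(LINT \<xi>|abs_measure. chebU_hat n \<xi> * cnj (chebU_hat m \<xi>)) = (if n = m then of_real (pi\<^sup>2 * real (n + 1)) else 0)" .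
  show "0 < pi\<^sup>2 * real (n + 1)" by simp
qed

interpretation chebU_hat: orthogonal_family abs_measure chebU_hat "\<lambda>n. pi\<^sup>2 * real (n + 1)"
  by (rule orthogonal_family_chebU_hat)

text \<open>The weight n + 1 is the one produced by the norms of \<open>chebU_hat\<close>;
  \<open>half_summable_iff\<close> identifies it with order 1/2 of the scale.\<close>

definition half_summable :: "(nat \<Rightarrow> complex) \<Rightarrow> bool" where
  "half_summable c \<longleftrightarrow> summable (\<lambda>n. real (n + 1) * (cmod (c n))\<^sup>2)"

lemma half_summable_square:
  assumes "half_summable c"
  shows "summable (\<lambda>n. (cmod (c n))\<^sup>2)" "(\<Sum>n. (cmod (c n))\<^sup>2) \<le> (\<Sum>n. real (n + 1) * (cmod (c n))\<^sup>2)"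
proof -
  have le: "(cmod (c n))\<^sup>2 \<le> real (n + 1) * (cmod (c n))\<^sup>2" for n
    using mult_right_mono[of 1 "real (n + 1)" "(cmod (c n))\<^sup>2"] by simp
  show s: "summable (\<lambda>n. (cmod (c n))\<^sup>2)"
    by (rule summable_comparison_test'[of "\<lambda>n. real (n + 1) * (cmod (c n))\<^sup>2" 0])
       (use assms le in \<open>auto simp: half_summable_def\<close>)
  show "(\<Sum>n. (cmod (c n))\<^sup>2) \<le> (\<Sum>n. real (n + 1) * (cmod (c n))\<^sup>2)"
    by (rule suminf_le[OF le s]) (use assms in \<open>simp add: half_summable_def\<close>)
qed

section \<open>Fourier transforms of Chebyshev series\<close>

definition series_hat :: "(nat \<Rightarrow> complex) \<Rightarrow> real \<Rightarrow> complex" where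
  "series_hat c = fourier (omega_mult (U_fun c))"

lemma times_omega_eq: "times_omega c = distr_of_fun (omega_mult (U_fun c))"
  by (simp add: times_omega_def omega_mult_def[abs_def])

lemma L2_omega_fourier_sums:
  assumes "u \<in> L2_omega" "summable (\<lambda>n. (cmod (cheb_coeff u n))\<^sup>2)"
  shows "(\<lambda>n. cheb_coeff u n * chebU_hat n \<xi>) sums fourier (omega_mult u) \<xi>"
  unfolding chebU_hat_def fourier_def
  by (rule L2_omega_expansion_sums[OF assms]) (intro continuous_intros)

text \<open>The series of the transform converges pointwise and depends on the coefficients only, so
  the choice made by \<open>U_fun\<close> does not matter.\<close>

lemma fourier_omega_mult_unique:
  assumes "u \<in> L2_omega" "cheb_coeff u = c" "summable (\<lambda>n. (cmod (c n))\<^sup>2)"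
  shows "fourier (omega_mult u) = series_hat c"
proof
  fix \<xi>
  show "fourier (omega_mult u) \<xi> = series_hat c \<xi>"
    using L2_omega_fourier_sums[OF assms(1), of \<xi>] L2_omega_fourier_sums[OF U_fun(1)[OF assms(3)], of \<xi>]
      U_fun(2)[OF assms(3)] assms(2,3) sums_unique2 by (simp add: series_hat_def) blast
qed

lemma series_hat_measurable:
  assumes "summable (\<lambda>n. (cmod (c n))\<^sup>2)" shows "series_hat c \<in> borel_measurable borel"
  unfolding series_hat_def using omega_mult_integrable[OF U_fun(1)[OF assms]] borel_measurable_integrable
  by (intro borel_measurable_fourier) auto

lemma times_omega_fourier:
  assumes "summable (\<lambda>n. (cmod (c n))\<^sup>2)"
  shows "times_omega c = distr_with_fourier (series_hat c)"
  unfolding times_omega_eq series_hat_def by (rule distr_of_fun_fourier[OF omega_mult_integrable[OF U_fun(1)[OF assms]]])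

lemma series_hat_sums:
  assumes "summable (\<lambda>n. (cmod (c n))\<^sup>2)"
  shows "(\<lambda>n. c n * chebU_hat n \<xi>) sums series_hat c \<xi>"
  using L2_omega_fourier_sums[OF U_fun(1)[OF assms]] assms unfolding U_fun(2)[OF assms] series_hat_def by blast

text \<open>Convergence at every frequency is inherited from the expansion on the segment;
  summability with the weight n + 1 turns it into convergence in the mean for |xi| d xi.\<close>

lemma series_hat_expands:
  assumes "half_summable c" shows "chebU_hat.expands c (series_hat c)"
proof (rule chebU_hat.expandsI_pointwise[where r = "\<lambda>n. n"])
  note s = half_summable_square(1)[OF assms]
  show "summable (\<lambda>n. pi\<^sup>2 * real (n + 1) * (cmod (c n))\<^sup>2)"
    using summable_mult[of _ "pi\<^sup>2"] assms by (simp add: half_summable_def mult.assoc)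
  show "series_hat c \<in> borel_measurable abs_measure" using series_hat_measurable[OF s] by (simp add: measurable_abs_measure)
  show "AE \<xi> in abs_measure. (\<lambda>k. chebU_hat.psum c k \<xi>) \<longlonglongrightarrow> series_hat c \<xi>"
    using series_hat_sums[OF s] by (intro AE_I2) (simp add: sums_def chebU_hat.psum_def)
qed (rule filterlim_ident)

text \<open>Cauchy-Schwarz on the segment, against an exponential of modulus 1. The integral of
  \<omega> is estimated by 2 and the polynomials have squared norm pi / 2, which gives the factor
  pi. The bound serves for low frequencies.\<close>

lemma series_hat_bounded:
  assumes s: "summable (\<lambda>n. (cmod (c n))\<^sup>2)"
  shows "(cmod (series_hat c \<xi>))\<^sup>2 \<le> pi * (\<Sum>n. (cmod (c n))\<^sup>2)"
proof -
  obtain v where v: "v \<in> L2_omega" "cheb_coeff v = c" "chebU.expands c v" using U_expansion[OF s] .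
  have sv: "square_integrable omega_measure v" using v(3) by (simp add: chebU.expands_def)
  have [measurable]: "v \<in> borel_measurable borel" using square_integrableD(1)[OF sv] by (simp add: measurable_omega_measure)
  interpret finite_measure omega_measure by (rule finite_measure_omega_measure)
  have bc: "(\<lambda>x. cis (- (x * \<xi>))) \<in> borel_measurable borel" by measurable
  have sc: "square_integrable omega_measure (\<lambda>x. cis (- (x * \<xi>)))"
    using bc by (simp add: square_integrable_def measurable_omega_measure)
  have vol: "(LINT x|omega_measure. (cmod (cis (- (x * \<xi>))))\<^sup>2) \<le> 2"
  proof -
    have m1: "(\<lambda>x::real. 1::real) \<in> borel_measurable borel" by simp
    have i1: "integrable lborel (\<lambda>x. indicator seg x * omega x)"
      using integrable_omega_measure[OF m1] by simp
    have "(LINT x|omega_measure. (cmod (cis (- (x * \<xi>))))\<^sup>2) = (LINT x|lborel. indicator seg x * omega x)"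
      using integral_omega_measure[OF m1] by simp
    also have "\<dots> \<le> (LINT x|lborel. indicator seg x)"
      using omega_le_1 by (intro integral_mono i1 integrable_real_indicator) (auto simp: indicator_def)
    also have "\<dots> = 2" by simp
    finally show ?thesis .
  qed
  have "series_hat c \<xi> = (LINT x|omega_measure. v x * cis (- (x * \<xi>)))"
  proof -
    have m: "(\<lambda>x. v x * cis (- (x * \<xi>))) \<in> borel_measurable borel" by measurable
    have "series_hat c \<xi> = fourier (omega_mult v) \<xi>" using fourier_omega_mult_unique[OF v(1,2) s] by simp
    also have "\<dots> = (LINT x|omega_measure. v x * cis (- (x * \<xi>)))"
      unfolding fourier_def integral_omega_measure[OF m]
      by (rule Bochner_Integration.integral_cong) (auto simp: omega_mult_def scaleR_conv_of_real indicator_def)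
    finally show ?thesis .
  qed
  then have "cmod (series_hat c \<xi>) \<le> sqrt (LINT x|omega_measure. (cmod (v x))\<^sup>2) * sqrt (LINT x|omega_measure. (cmod (cis (- (x * \<xi>))))\<^sup>2)"
    using Cauchy_Schwarz_integral[OF sv sc] by simp
  also have "\<dots> \<le> sqrt (LINT x|omega_measure. (cmod (v x))\<^sup>2) * sqrt 2"
    using vol by (intro mult_left_mono real_sqrt_le_mono) auto
  finally have "(cmod (series_hat c \<xi>))\<^sup>2 \<le> (sqrt (LINT x|omega_measure. (cmod (v x))\<^sup>2) * sqrt 2)\<^sup>2" by (intro power_mono) auto
  also have "\<dots> = 2 * (LINT x|omega_measure. (cmod (v x))\<^sup>2)" by (simp add: power_mult_distrib)
  also have "(LINT x|omega_measure. (cmod (v x))\<^sup>2) = pi / 2 * (\<Sum>n. (cmod (c n))\<^sup>2)"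
    using sums_unique[OF chebU.expands_norm[OF v(3)]] suminf_mult[OF s, of "pi / 2"] by simp
  finally show ?thesis by simp
qed

text \<open>For |xi| \<le> 1 the pointwise bound is used; beyond that, (1 + xi^2)^(1/2) \<le> 2 |xi|
  brings in the norm for |xi| d xi.\<close>

lemma series_hat_weighted_L2:
  assumes "half_summable c"
  shows "series_hat c \<in> weighted_L2 (1/2)" "half_norm2 (series_hat c) \<le> 64 * (\<Sum>n. real (n + 1) * (cmod (c n))\<^sup>2)"
proof -
  note s = half_summable_square[OF assms]
  note um [measurable] = series_hat_measurable[OF s(1)]
  let ?S = "\<Sum>n. real (n + 1) * (cmod (c n))\<^sup>2" and ?T = "\<Sum>n. (cmod (c n))\<^sup>2"
  have e: "square_integrable abs_measure (series_hat c)" using series_hat_expands[OF assms] by (simp add: chebU_hat.expands_def)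
  have m2: "(\<lambda>\<xi>. (cmod (series_hat c \<xi>))\<^sup>2) \<in> borel_measurable borel" by measurable
  have i: "integrable lborel (\<lambda>\<xi>. \<bar>\<xi>\<bar> * (cmod (series_hat c \<xi>))\<^sup>2)"
    using square_integrableD(2)[OF e] integrable_abs_measure[OF m2] by simp
  have n: "(LINT \<xi>|lborel. \<bar>\<xi>\<bar> * (cmod (series_hat c \<xi>))\<^sup>2) = pi\<^sup>2 * ?S"
    using sums_unique[OF chebU_hat.expands_norm[OF series_hat_expands[OF assms]]] integral_abs_measure[OF m2]
      suminf_mult[of "\<lambda>n. real (n + 1) * (cmod (c n))\<^sup>2" "pi\<^sup>2"] assms
    by (simp add: half_summable_def mult.assoc)
  let ?B = "\<lambda>\<xi>. (2 * pi * ?T) * indicator {-1..1} \<xi> + 2 * (\<bar>\<xi>\<bar> * (cmod (series_hat c \<xi>))\<^sup>2)"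
  have iB: "integrable lborel ?B"
    using i by (intro Bochner_Integration.integrable_add Bochner_Integration.integrable_mult_right integrable_real_indicator) auto
  have T0: "?T \<ge> 0" using s(1) by (simp add: suminf_nonneg)
  have le: "(1 + \<xi>\<^sup>2) powr (1/2) * (cmod (series_hat c \<xi>))\<^sup>2 \<le> ?B \<xi>" for \<xi>
  proof (cases "\<xi> \<in> {-1..1}")
    case True
    then have "\<xi>\<^sup>2 \<le> 1" by (simp add: abs_square_le_1 abs_le_iff)
    then have "(1 + \<xi>\<^sup>2) powr (1/2) \<le> 2 powr (1/2)" by (intro powr_mono2) auto
    also have "\<dots> \<le> 2 powr 1" by (intro powr_mono) auto
    finally have "(1 + \<xi>\<^sup>2) powr (1/2) * (cmod (series_hat c \<xi>))\<^sup>2 \<le> 2 * (pi * ?T)"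
      by (intro mult_mono series_hat_bounded s(1)) auto
    then show ?thesis using True by (simp add: add_increasing2)
  next
    case False
    then have "1 \<le> \<bar>\<xi>\<bar>" by auto
    then have "1\<^sup>2 \<le> \<bar>\<xi>\<bar>\<^sup>2" by (intro power_mono) auto
    then have "1 + \<xi>\<^sup>2 \<le> (2 * \<bar>\<xi>\<bar>)\<^sup>2" by (simp add: power_mult_distrib)
    then have "(1 + \<xi>\<^sup>2) powr (1/2) \<le> ((2 * \<bar>\<xi>\<bar>)\<^sup>2) powr (1/2)" by (intro powr_mono2) auto
    also have "\<dots> = sqrt ((2 * \<bar>\<xi>\<bar>)\<^sup>2)" by (rule powr_half_sqrt) simp
    also have "\<dots> = 2 * \<bar>\<xi>\<bar>" unfolding real_sqrt_abs by simp
    finally have "(1 + \<xi>\<^sup>2) powr (1/2) * (cmod (series_hat c \<xi>))\<^sup>2 \<le> 2 * \<bar>\<xi>\<bar> * (cmod (series_hat c \<xi>))\<^sup>2"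
      by (intro mult_right_mono) auto
    then show ?thesis using False by simp
  qed
  have i2: "integrable lborel (\<lambda>\<xi>. (1 + \<xi>\<^sup>2) powr (1/2) * (cmod (series_hat c \<xi>))\<^sup>2)"
  proof (rule Bochner_Integration.integrable_bound[OF iB])
    show "AE \<xi> in lborel. norm ((1 + \<xi>\<^sup>2) powr (1/2) * (cmod (series_hat c \<xi>))\<^sup>2) \<le> norm (?B \<xi>)"
    proof (intro AE_I2)
      fix \<xi>
      have "norm ((1 + \<xi>\<^sup>2) powr (1/2) * (cmod (series_hat c \<xi>))\<^sup>2) = (1 + \<xi>\<^sup>2) powr (1/2) * (cmod (series_hat c \<xi>))\<^sup>2" by simp
      also note le[of \<xi>]
      also have "?B \<xi> \<le> norm (?B \<xi>)" by simp
      finally show "norm ((1 + \<xi>\<^sup>2) powr (1/2) * (cmod (series_hat c \<xi>))\<^sup>2) \<le> norm (?B \<xi>)" .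
    qed
  qed measurable
  then show "series_hat c \<in> weighted_L2 (1/2)" by (simp add: weighted_L2_def um)
  have "half_norm2 (series_hat c) \<le> (LINT \<xi>|lborel. ?B \<xi>)"
    unfolding half_norm2_eq[OF um] by (rule integral_mono[OF i2 iB le])
  also have "\<dots> = 4 * pi * ?T + 2 * (pi\<^sup>2 * ?S)"
    using i n by (subst Bochner_Integration.integral_add) (auto intro!: integrable_real_indicator Bochner_Integration.integrable_mult_right)
  also have "\<dots> \<le> 4 * pi * ?S + 2 * (pi\<^sup>2 * ?S)" using s(2) by (intro add_right_mono mult_left_mono) auto
  also have "\<dots> = (4 * pi + 2 * pi\<^sup>2) * ?S" by (simp add: algebra_simps)
  \<comment> \<open>A convenient perfect square above 4 pi + 2 pi^2; its root 8 reappears in the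
    duality argument.\<close>
  also have "\<dots> \<le> 64 * ?S"
  proof (intro mult_right_mono)
    have "pi\<^sup>2 \<le> 4\<^sup>2" using pi_less_4 by (intro power_mono) auto
    then show "4 * pi + 2 * pi\<^sup>2 \<le> 64" using pi_less_4 by simp
    show "?S \<ge> 0" using s(2) T0 by simp
  qed
  finally show "half_norm2 (series_hat c) \<le> 64 * ?S" .
qed

subsection \<open>The logarithm as a limit of Fourier integrals\<close>

text \<open>As \<open>R\<close> tends to infinity, \<open>cos_integral R t\<close> is \<open>- ln t\<close> up to a constant depending on \<open>R\<close>;
  the constant is invisible in the pairing of two derivatives, which have mean zero.\<close>

definition cos_integral :: "real \<Rightarrow> real \<Rightarrow> real" where
  "cos_integral R t = integral {1/R..R} (\<lambda>\<xi>. cos (\<xi> * t) / \<xi>)"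

text \<open>Differentiation cancels the factor 1 / \<xi> and leaves an elementary integral; the
  comparisons of \<open>cos_integral\<close> with the logarithm are drawn from this
  derivative.\<close>

lemma cos_integral_has_derivative:
  assumes R: "R \<ge> 1" and t: "t \<noteq> 0"
  shows "(cos_integral R has_real_derivative (cos (R * t) - cos (t / R)) / t) (at t)"
proof -
  have "((\<lambda>t. integral (cbox (1/R) R) (\<lambda>\<xi>. cos (\<xi> * t) / \<xi>)) has_field_derivative
     integral (cbox (1/R) R) (\<lambda>\<xi>. - sin (\<xi> * t))) (at t within UNIV)"
  proof (rule leibniz_rule_field_derivative)
    fix x \<xi> :: real assume "\<xi> \<in> cbox (1/R) R"
    then have "1 / R \<le> \<xi>" by simp
    moreover have "0 < 1 / R" using R by simp
    ultimately have "\<xi> \<noteq> 0" by linarith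
    then show "((\<lambda>x. cos (\<xi> * x) / \<xi>) has_field_derivative - sin (\<xi> * x)) (at x within UNIV)"
      by (auto intro!: derivative_eq_intros)
  next
    fix x :: real
    have "\<xi> \<noteq> 0" if "\<xi> \<in> {1/R..R}" for \<xi> using that R by auto
    then show "(\<lambda>\<xi>. cos (\<xi> * x) / \<xi>) integrable_on cbox (1/R) R"
      by (simp, intro integrable_continuous_interval continuous_intros) auto
  qed (auto intro!: continuous_intros simp: split_beta)
  moreover have "integral {1/R..R} (\<lambda>\<xi>. - sin (\<xi> * t)) = (cos (R * t) - cos (t / R)) / t"
  proof -
    have "((\<lambda>\<xi>. - sin (\<xi> * t)) has_integral (cos (R * t) / t - cos (1/R * t) / t)) {1/R..R}"
    proof (rule fundamental_theorem_of_calculus)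
      have "1 / R \<le> 1" using R by simp
      then show "1 / R \<le> R" using R by linarith
      show "((\<lambda>\<xi>. cos (\<xi> * t) / t) has_vector_derivative - sin (\<xi> * t)) (at \<xi> within {1/R..R})" for \<xi>
        unfolding has_real_derivative_iff_has_vector_derivative[symmetric]
        using t by (auto intro!: derivative_eq_intros)
    qed
    moreover have "cos (1/R * t) = cos (t / R)" by simp
    ultimately show ?thesis by (simp only: integral_unique diff_divide_distrib)
  qed
  ultimately show ?thesis by (simp add: cos_integral_def[abs_def])
qed

lemma cos_integral_minus: "cos_integral R (- t) = cos_integral R t"
  by (simp add: cos_integral_def)

lemma cos_integral_abs: "cos_integral R \<bar>t\<bar> = cos_integral R t"
  by (simp add: abs_if cos_integral_minus)

text \<open>Whatever R is, the derivative is at most 2 / t in modulus, so 2 ln t plus or minus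
  \<open>cos_integral R t\<close> is monotone. The bound is the majorant for dominated
  convergence.\<close>

lemma cos_integral_diff_le:
  assumes R: "R \<ge> 1" and t: "t > 0"
  shows "\<bar>cos_integral R t - cos_integral R 1\<bar> \<le> 2 * \<bar>ln t\<bar>"
proof -
  have up: "\<exists>y. ((\<lambda>t. 2 * ln t + cos_integral R t) has_real_derivative y) (at s) \<and> 0 \<le> y"
    and dn: "\<exists>y. ((\<lambda>t. 2 * ln t - cos_integral R t) has_real_derivative y) (at s) \<and> 0 \<le> y" if s: "s > 0" for s
  proof -
    have d: "(cos_integral R has_real_derivative (cos (R * s) - cos (s / R)) / s) (at s)"
      using cos_integral_has_derivative[OF R] s by simp
    have l: "((\<lambda>t. 2 * ln t) has_real_derivative 2 / s) (at s)"
      using DERIV_cmult[OF DERIV_ln_divide[OF s], of 2] by simp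
    have "2 / s + (cos (R * s) - cos (s / R)) / s = (2 + (cos (R * s) - cos (s / R))) / s"
      by (simp add: add_divide_distrib)
    moreover have "0 \<le> 2 + (cos (R * s) - cos (s / R))"
      using cos_ge_minus_one[of "R * s"] cos_le_one[of "s / R"] by linarith
    ultimately have "0 \<le> 2 / s + (cos (R * s) - cos (s / R)) / s" using s by simp
    then show "\<exists>y. ((\<lambda>t. 2 * ln t + cos_integral R t) has_real_derivative y) (at s) \<and> 0 \<le> y"
      using DERIV_add[OF l d] by blast
    have "2 / s - (cos (R * s) - cos (s / R)) / s = (2 - (cos (R * s) - cos (s / R))) / s"
      by (simp add: diff_divide_distrib)
    moreover have "0 \<le> 2 - (cos (R * s) - cos (s / R))"
      using cos_ge_minus_one[of "s / R"] cos_le_one[of "R * s"] by linarith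
    ultimately have "0 \<le> 2 / s - (cos (R * s) - cos (s / R)) / s" using s by simp
    then show "\<exists>y. ((\<lambda>t. 2 * ln t - cos_integral R t) has_real_derivative y) (at s) \<and> 0 \<le> y"
      using DERIV_diff[OF l d] by blast
  qed
  show ?thesis
  proof (cases "t \<le> 1")
    case True
    have "2 * ln t + cos_integral R t \<le> 2 * ln 1 + cos_integral R 1"
      by (rule DERIV_nonneg_imp_nondecreasing[OF True]) (use up t in auto)
    moreover have "2 * ln t - cos_integral R t \<le> 2 * ln 1 - cos_integral R 1"
      by (rule DERIV_nonneg_imp_nondecreasing[OF True]) (use dn t in auto)
    moreover have "ln t \<le> 0" using True t by simp
    ultimately show ?thesis by simp
  next
    case False
    have "2 * ln 1 + cos_integral R 1 \<le> 2 * ln t + cos_integral R t"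
      by (rule DERIV_nonneg_imp_nondecreasing) (use up False in auto)
    moreover have "2 * ln 1 - cos_integral R 1 \<le> 2 * ln t - cos_integral R t"
      by (rule DERIV_nonneg_imp_nondecreasing) (use dn False in auto)
    moreover have "ln t \<ge> 0" using False by simp
    ultimately show ?thesis by simp
  qed
qed

text \<open>Subtracting \<open>sin (R t) / (R t)\<close> removes the oscillating part of the derivative.\<close>

lemma cos_integral_error:
  assumes R: "R \<ge> 1" and t: "t > 0"
  shows "\<bar>cos_integral R t - cos_integral R 1 + ln t\<bar> \<le> (1 / R) * ((2 + 1 / t\<^sup>2) * \<bar>t - 1\<bar> + 1 / t + 1)"
proof -
  let ?E = "\<lambda>t. cos_integral R t + ln t - sin (R * t) / (R * t)"
  let ?S = "{min t 1..max t 1}"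
  have "norm (?E t - ?E 1) \<le> ((1 / R) * (2 + 1 / t\<^sup>2)) * norm (t - 1)"
  \<comment> \<open>The derivative of the corrected function is of size 1 / R between t and 1: the
    first term because 1 - cos u \<le> u for u > 0, the second by its explicit factor.\<close>
  proof (rule field_differentiable_bound[of ?S ?E "\<lambda>s. (1 - cos (s / R)) / s + sin (R * s) / (R * s\<^sup>2)"])
    fix s assume s: "s \<in> ?S"
    then have s0: "s > 0" using t by auto
    have d1: "(cos_integral R has_real_derivative (cos (R * s) - cos (s / R)) / s) (at s)"
      using cos_integral_has_derivative[OF R] s0 by simp
    have d2: "((\<lambda>t. sin (R * t) / (R * t)) has_real_derivative cos (R * s) / s - sin (R * s) / (R * s\<^sup>2)) (at s)"
    proof -
      have "((\<lambda>t. sin (R * t)) has_real_derivative cos (R * s) * (R * 1)) (at s)"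
        by (intro DERIV_chain2[OF DERIV_sin] DERIV_cmult DERIV_ident)
      from DERIV_divide[OF this DERIV_cmult_Id[of R]] show ?thesis
        by (rule DERIV_cong) (use s0 R in \<open>simp_all add: field_simps power2_eq_square\<close>)
    qed
    have "(?E has_real_derivative (cos (R * s) - cos (s / R)) / s + 1 / s - (cos (R * s) / s - sin (R * s) / (R * s\<^sup>2))) (at s)"
      by (intro DERIV_diff DERIV_add d1 d2 DERIV_ln_divide s0)
    then have "(?E has_real_derivative (1 - cos (s / R)) / s + sin (R * s) / (R * s\<^sup>2)) (at s)"
      by (rule DERIV_cong) (simp add: diff_divide_distrib)
    then show "(?E has_field_derivative (1 - cos (s / R)) / s + sin (R * s) / (R * s\<^sup>2)) (at s within ?S)"
      by (rule has_field_derivative_at_within)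
    have "\<bar>(1 - cos (s / R)) / s\<bar> \<le> 1 / R"
    proof -
      have "1 - cos (s / R) = 2 * (sin (s / R / 2))\<^sup>2" using cos_double_sin[of "s / R / 2"] by simp
      also have "\<dots> \<le> 2 * (\<bar>sin (s / R / 2)\<bar> * 1)"
        unfolding power2_eq_square abs_mult_self_eq[of "sin (s / R / 2)", symmetric]
        by (intro mult_left_mono) auto
      also have "\<dots> \<le> 2 * \<bar>s / R / 2\<bar>" using abs_sin_x_le_abs_x[of "s / R / 2"] by simp
      also have "\<dots> = s / R" using s0 R by simp
      finally have "1 - cos (s / R) \<le> s / R" .
      moreover have "0 \<le> 1 - cos (s / R)" by simp
      ultimately show ?thesis using s0 by (simp add: divide_le_eq)
    qed
    moreover have "\<bar>sin (R * s) / (R * s\<^sup>2)\<bar> \<le> (1 / R) * (1 + 1 / t\<^sup>2)"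
    proof -
      have "1 / s\<^sup>2 \<le> 1 + 1 / t\<^sup>2"
      proof (cases "t \<le> 1")
        case True
        then have "t \<le> s" using s by auto
        then have "t\<^sup>2 \<le> s\<^sup>2" using t by (intro power_mono) auto
        then have "1 / s\<^sup>2 \<le> 1 / t\<^sup>2" using t by (intro frac_le) auto
        then show ?thesis by simp
      next
        case False
        then have "1 \<le> s" using s by auto
        then have "1 / s\<^sup>2 \<le> 1" by simp
        then show ?thesis by (simp add: add_increasing2)
      qed
      then have "(1 / R) * (\<bar>sin (R * s)\<bar> * (1 / s\<^sup>2)) \<le> (1 / R) * (1 * (1 + 1 / t\<^sup>2))"
        using R by (intro mult_left_mono mult_mono) auto
      moreover have "\<bar>sin (R * s) / (R * s\<^sup>2)\<bar> = (1 / R) * (\<bar>sin (R * s)\<bar> * (1 / s\<^sup>2))"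
      proof -
        have "\<bar>R * s\<^sup>2\<bar> = R * s\<^sup>2" using R by (intro abs_of_nonneg) simp
        then show ?thesis by (simp add: abs_divide)
      qed
      ultimately show ?thesis by (simp only: mult_1_left)
    qed
    ultimately have "\<bar>(1 - cos (s / R)) / s + sin (R * s) / (R * s\<^sup>2)\<bar> \<le> 1 / R + (1 / R) * (1 + 1 / t\<^sup>2)"
      by linarith
    also have "\<dots> = (1 / R) * (2 + 1 / t\<^sup>2)" by (simp add: algebra_simps)
    finally show "norm ((1 - cos (s / R)) / s + sin (R * s) / (R * s\<^sup>2)) \<le> (1 / R) * (2 + 1 / t\<^sup>2)" by simp
  qed auto
  then have 1: "\<bar>?E t - ?E 1\<bar> \<le> (1 / R) * ((2 + 1 / t\<^sup>2) * \<bar>t - 1\<bar>)" by (simp add: mult.assoc)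
  have 2: "\<bar>sin (R * t) / (R * t)\<bar> \<le> (1 / R) * (1 / t)"
    using R t by (simp add: abs_divide divide_right_mono)
  have 3: "\<bar>sin (R * 1) / (R * 1)\<bar> \<le> (1 / R) * 1"
    using R by (simp add: abs_divide divide_right_mono)
  have "cos_integral R t - cos_integral R 1 + ln t = (?E t - ?E 1) + sin (R * t) / (R * t) - sin (R * 1) / (R * 1)" by simp
  then have "\<bar>cos_integral R t - cos_integral R 1 + ln t\<bar> \<le> (1 / R) * ((2 + 1 / t\<^sup>2) * \<bar>t - 1\<bar>) + (1 / R) * (1 / t) + (1 / R) * 1"
    using 1 2 3 by linarith
  then show ?thesis by (simp add: algebra_simps)
qed

lemma cos_integral_tendsto:
  assumes t: "t > 0"
  shows "(\<lambda>n. cos_integral (real (Suc n)) t - cos_integral (real (Suc n)) 1) \<longlonglongrightarrow> - ln t"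
proof -
  have "(\<lambda>n. (1 / real (Suc n)) * ((2 + 1 / t\<^sup>2) * \<bar>t - 1\<bar> + 1 / t + 1)) \<longlonglongrightarrow> 0 * ((2 + 1 / t\<^sup>2) * \<bar>t - 1\<bar> + 1 / t + 1)"
    by (intro tendsto_intros LIMSEQ_Suc[OF lim_1_over_n])
  then have "(\<lambda>n. (1 / real (Suc n)) * ((2 + 1 / t\<^sup>2) * \<bar>t - 1\<bar> + 1 / t + 1)) \<longlonglongrightarrow> 0" by simp
  then have "(\<lambda>n. cos_integral (real (Suc n)) t - cos_integral (real (Suc n)) 1 + ln t) \<longlonglongrightarrow> 0"
    by (rule Lim_null_comparison[rotated]) (use cos_integral_error[OF _ t] in \<open>auto intro!: always_eventually simp del: of_nat_Suc\<close>)
  from tendsto_diff[OF this tendsto_const[of "ln t"]] show ?thesis by simp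
qed

text \<open>The function 1 / |xi|, cut at both ends by one parameter because it is integrable
  neither at 0 nor at infinity.\<close>

definition hump :: "real \<Rightarrow> real \<Rightarrow> complex" where
  "hump R \<xi> = of_real (indicator {\<xi>. 1 / R \<le> \<bar>\<xi>\<bar> \<and> \<bar>\<xi>\<bar> \<le> R} \<xi> / \<bar>\<xi>\<bar>)"

lemma borel_measurable_hump [measurable]: "hump R \<in> borel_measurable borel"
  unfolding hump_def[abs_def] by measurable

lemma hump_integrable:
  assumes R: "R \<ge> 1" shows "integrable lborel (hump R)"
proof (rule Bochner_Integration.integrable_bound)
  show "integrable lborel (\<lambda>\<xi>. R * indicator {-R..R} \<xi> :: real)"
    by (intro Bochner_Integration.integrable_mult_right integrable_real_indicator) (auto simp: emeasure_lborel_Icc_eq)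
  show "AE \<xi> in lborel. norm (hump R \<xi>) \<le> norm (R * indicator {-R..R} \<xi>)"
  proof (intro AE_I2)
    fix \<xi>
    show "norm (hump R \<xi>) \<le> norm (R * indicator {-R..R} \<xi>)"
    proof (cases "1 / R \<le> \<bar>\<xi>\<bar> \<and> \<bar>\<xi>\<bar> \<le> R")
      case True
      moreover have "0 < 1 / R" using R by simp
      ultimately have "0 < \<bar>\<xi>\<bar>" by linarith
      then have "1 / \<bar>\<xi>\<bar> \<le> R" using True R by (simp add: field_simps)
      then show ?thesis using True R by (simp add: hump_def norm_divide abs_le_iff)
    qed (simp add: hump_def)
  qed
qed measurable

text \<open>The two half lines contribute conjugate exponentials, which add up to twice a
  cosine.\<close>

lemma ift_hump:
  assumes R: "R \<ge> 1"
  shows "ift (hump R) t = of_real (2 * cos_integral R t)"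
proof -
  let ?I = "{1/R..R}"
  have pos: "\<xi> > 0" if "\<xi> \<in> ?I" for \<xi>
  proof -
    have "0 < 1 / R" using R by simp
    moreover have "1 / R \<le> \<xi>" using that by simp
    ultimately show ?thesis by linarith
  qed
  have c: "continuous_on ?I (\<lambda>\<xi>. cos (\<xi> * t) / \<xi>)"
    using pos by (intro continuous_intros) force
  let ?h = "\<lambda>\<xi>. complex_of_real (indicator ?I \<xi> / \<xi>) * cis (t * \<xi>)"
  have split: "hump R \<xi> * cis (t * \<xi>) = ?h \<xi> + complex_of_real (indicator ?I (- \<xi>) / (- \<xi>)) * cis (t * \<xi>)" for \<xi>
    using pos[of \<xi>] pos[of "- \<xi>"] by (auto simp: hump_def indicator_def abs_if)
  have ih: "integrable lborel ?h"
  proof -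
    have "integrable lborel (\<lambda>\<xi>. complex_of_real (indicator ?I \<xi> / \<xi>))"
    proof (rule Bochner_Integration.integrable_bound[OF hump_integrable[OF R]])
      show "AE \<xi> in lborel. norm (complex_of_real (indicator ?I \<xi> / \<xi>)) \<le> norm (hump R \<xi>)"
      proof (intro AE_I2)
        fix \<xi>
        show "norm (complex_of_real (indicator ?I \<xi> / \<xi>)) \<le> norm (hump R \<xi>)"
        proof (cases "\<xi> \<in> ?I")
          case True
          then have "1 / R \<le> \<bar>\<xi>\<bar> \<and> \<bar>\<xi>\<bar> \<le> R" using pos[OF True] by simp
          then show ?thesis using True by (simp add: hump_def norm_divide)
        qed simp
      qed
    qed measurable
    then show ?thesis by (rule integrable_mult_cis_lborel)
  qed
  have refl': "complex_of_real (indicator ?I (- \<xi>) / (- \<xi>)) * cis (t * \<xi>) = complex_of_real (indicator ?I (0 + (-1) * \<xi>) / (0 + (-1) * \<xi>)) * cis (- t * (0 + (-1) * \<xi>))" for \<xi>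
    by simp
  let ?h' = "\<lambda>\<xi>. complex_of_real (indicator ?I \<xi> / \<xi>) * cis (- t * \<xi>)"
  have ih': "integrable lborel ?h'"
    using ih by (drule_tac integrable_cnj) (simp add: cis_cnj)
  have "ift (hump R) t = (LINT \<xi>|lborel. ?h \<xi>) + (LINT \<xi>|lborel. ?h' (0 + (-1) * \<xi>))"
    unfolding ift_def split refl'
    by (intro Bochner_Integration.integral_add ih lborel_integrable_real_affine ih') simp
  also have "(LINT \<xi>|lborel. ?h' (0 + (-1) * \<xi>)) = (LINT \<xi>|lborel. ?h' \<xi>)"
    using lborel_integral_real_affine[of "-1" ?h' 0] by simp
  also have "(LINT \<xi>|lborel. ?h \<xi>) + (LINT \<xi>|lborel. ?h' \<xi>) = (LINT \<xi>|lborel. ?h \<xi> + ?h' \<xi>)"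
    by (rule Bochner_Integration.integral_add[symmetric, OF ih ih'])
  also have "\<dots> = (LINT \<xi>|lborel. of_real (2 * (indicator ?I \<xi> *\<^sub>R (cos (\<xi> * t) / \<xi>))))"
  proof (rule Bochner_Integration.integral_cong[OF refl])
    fix \<xi>
    have "cis (t * \<xi>) + cis (- t * \<xi>) = of_real (2 * cos (\<xi> * t))" by (simp add: complex_eq_iff mult.commute)
    then have "?h \<xi> + ?h' \<xi> = complex_of_real (indicator ?I \<xi> / \<xi>) * of_real (2 * cos (\<xi> * t))"
      by (simp only: distrib_left[symmetric])
    then show "?h \<xi> + ?h' \<xi> = of_real (2 * (indicator ?I \<xi> *\<^sub>R (cos (\<xi> * t) / \<xi>)))"
      by (simp add: mult_ac)
  qed
  also have "\<dots> = of_real (2 * (LINT \<xi>:?I|lborel. cos (\<xi> * t) / \<xi>))"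
    unfolding set_lebesgue_integral_def integral_complex_of_real integral_mult_right_zero ..
  also have "(LINT \<xi>:?I|lborel. cos (\<xi> * t) / \<xi>) = cos_integral R t"
    unfolding cos_integral_def by (rule set_borel_integral_eq_integral(2)[OF borel_integrable_atLeastAtMost'[OF c]])
  finally show ?thesis .
qed

subsection \<open>The logarithmic kernel\<close>

text \<open>Up to a factor, a majorant of the logarithm on [-2, 2], which contains all differences
  of points of the segment.\<close>

definition ln_dom :: "real \<Rightarrow> real" where
  "ln_dom t = indicator {0..2} t * (t powr (-1/2)) + indicator {0..2} (- t) * ((- t) powr (-1/2))"

lemma ln_dom_nonneg: "0 \<le> ln_dom t"
  by (simp add: ln_dom_def)

lemma borel_measurable_ln_dom [measurable]: "ln_dom \<in> borel_measurable borel"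
  unfolding ln_dom_def[abs_def] by measurable

lemma ln_dom_integrable: "integrable lborel ln_dom"
proof -
  let ?p = "\<lambda>t::real. indicator {0..2} t * (t powr (-1/2))"
  have "((\<lambda>x. x powr (-1/2)) has_integral (2 powr (-1/2 + 1) / (-1/2 + 1))) {0..2::real}"
    by (rule has_integral_powr_from_0) auto
  then have "integral\<^sup>N lborel ?p = ennreal (2 powr (-1/2 + 1) / (-1/2 + 1))"
    by (rule nn_integral_has_integral_lebesgue[rotated]) simp
  then have "(\<integral>\<^sup>+t. ennreal (norm (?p t)) \<partial>lborel) < \<infinity>" by (simp add: abs_mult)
  then have p: "integrable lborel ?p" by (intro integrableI_bounded) auto
  then have "integrable lborel (\<lambda>t. ?p (0 + (-1) * t))" by (intro lborel_integrable_real_affine) auto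
  then have "integrable lborel (\<lambda>t. ?p (- t))" by simp
  from Bochner_Integration.integrable_add[OF p this] show ?thesis by (simp add: ln_dom_def[abs_def])
qed

lemma abs_ln_le_ln_dom:
  assumes "0 < \<bar>t\<bar>" "\<bar>t\<bar> \<le> 2" shows "\<bar>ln \<bar>t\<bar>\<bar> \<le> 2 * ln_dom t"
proof -
  have *: "\<bar>ln s\<bar> \<le> 2 * s powr (-1/2)" if s: "0 < s" "s \<le> 2" for s :: real
  proof (cases "s \<le> 1")
    case True
    \<comment> \<open>The inequality ln r \<le> r - 1 is applied at r = s^(-1/2), which brings in
      the integrable power.\<close>
    have "ln (s powr (-1/2)) \<le> s powr (-1/2) - 1" using s by (intro ln_le_minus_one) simp
    then have "- ln s \<le> 2 * s powr (-1/2) - 2" using s by (simp add: ln_powr)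
    moreover have "ln s \<le> 0" using True s by simp
    ultimately show ?thesis by linarith
  next
    case False
    have "ln s \<le> s - 1" using s by (intro ln_le_minus_one) simp
    then have "\<bar>ln s\<bar> \<le> 1" using False s by simp
    \<comment> \<open>Here s lies in (1, 2], where |ln s| \<le> 1 and 2 s^(-1/2) \<ge> 1.\<close>
    moreover have "2 powr (-1/2) \<le> s powr (-1/2)" using s by (intro powr_mono2') auto
    moreover have "2 powr (-1) \<le> (2::real) powr (-1/2)" by (intro powr_mono) auto
    moreover have "(2::real) powr (-1) = 1/2" by (simp add: powr_minus_divide)
    ultimately show ?thesis by linarith
  qed
  show ?thesis
  proof (cases "t > 0")
    case True
    then show ?thesis using *[of t] assms by (simp add: ln_dom_def)
  next
    case False
    then show ?thesis using *[of "- t"] assms by (simp add: ln_dom_def)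
  qed
qed

text \<open>Integration in y gives a constant, by translation and reflection; the cut-off in x makes
  that constant integrable.\<close>

lemma ln_dom_product_integrable:
  "integrable (lborel \<Otimes>\<^sub>M lborel) (\<lambda>(x, y). indicator seg x * ln_dom (x - y))"
proof (rule lborel_pair.Fubini_integrable)
  have "(LINT y|lborel. ln_dom (x - y)) = (LINT t|lborel. ln_dom t)" for x
    using lborel_integral_real_affine[of "-1" ln_dom x] by simp
  then have "(\<lambda>x. LINT y|lborel. norm (case (x, y) of (x, y) \<Rightarrow> indicator seg x * ln_dom (x - y))) = (\<lambda>x. indicator seg x * (LINT t|lborel. ln_dom t))"
    using ln_dom_nonneg by (simp add: abs_mult)
  then show "integrable lborel (\<lambda>x. LINT y|lborel. norm (case (x, y) of (x, y) \<Rightarrow> indicator seg x * ln_dom (x - y)))"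
    by (simp only:) (intro Bochner_Integration.integrable_mult_left integrable_real_indicator, auto)
  show "AE x in lborel. integrable lborel (\<lambda>y. case (x, y) of (x, y) \<Rightarrow> indicator seg x * ln_dom (x - y))"
    using lborel_integrable_real_affine[OF ln_dom_integrable, of "-1"] by (intro AE_I2) simp
qed measurable

text \<open>On the diagonal the logarithm has a merely conventional value, which the limit arguments
  must avoid.\<close>

lemma AE_pair_neq: "AE z in lborel \<Otimes>\<^sub>M lborel. fst z \<noteq> (snd z :: real)"
proof (rule lborel_pair.AE_pair_measure)
  show "{z \<in> space (lborel \<Otimes>\<^sub>M lborel). fst z \<noteq> (snd z :: real)} \<in> sets (lborel \<Otimes>\<^sub>M lborel)" by measurable
  have "AE y in lborel. x \<noteq> (y::real)" for x
    using AE_lborel_singleton[of x] by eventually_elim auto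
  then show "AE x in lborel. AE y in lborel. fst (x, y) \<noteq> (snd (x, y) :: real)" by simp
qed

lemma test_seg_zero: "f \<in> test_functions seg \<Longrightarrow> x \<notin> seg \<Longrightarrow> f x = 0"
  by (auto simp: test_functions_def)

context
  fixes f g :: "real \<Rightarrow> complex"
  assumes f: "f \<in> test_functions seg" and g: "g \<in> test_functions seg"
begin

lemma fg_measurable [measurable]: "f \<in> borel_measurable borel" "g \<in> borel_measurable borel"
  using f g test_measurable by auto

lemma ln_kernel_bound:
  "\<exists>B\<ge>0. \<forall>z. cmod (f (fst z) * g (snd z)) * (2 * \<bar>ln \<bar>fst z - snd z\<bar>\<bar>) \<le> B * (indicator seg (fst z) * ln_dom (fst z - snd z))"
proof -
  obtain A where A: "A > 0" "\<And>x. cmod (f x) \<le> A" using test_bounded[OF f] by blast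
  obtain B where B: "B > 0" "\<And>x. cmod (g x) \<le> B" using test_bounded[OF g] by blast
  have "cmod (f (fst z) * g (snd z)) * (2 * \<bar>ln \<bar>fst z - snd z\<bar>\<bar>) \<le> (A * B * 4) * (indicator seg (fst z) * ln_dom (fst z - snd z))" for z
  proof (cases "fst z \<in> seg \<and> snd z \<in> seg \<and> fst z \<noteq> snd z")
    case True
    then have "0 < \<bar>fst z - snd z\<bar>" "\<bar>fst z - snd z\<bar> \<le> 2" by auto
    from abs_ln_le_ln_dom[OF this] have "cmod (f (fst z) * g (snd z)) * (2 * \<bar>ln \<bar>fst z - snd z\<bar>\<bar>) \<le> (A * B) * (2 * (2 * ln_dom (fst z - snd z)))"
      unfolding norm_mult using A B by (intro mult_mono) auto
    then show ?thesis using True by simp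
  next
    case False
    then have "cmod (f (fst z) * g (snd z)) * (2 * \<bar>ln \<bar>fst z - snd z\<bar>\<bar>) = 0"
      using test_seg_zero[OF f, of "fst z"] test_seg_zero[OF g, of "snd z"] by auto
    moreover have "0 \<le> (A * B * 4) * (indicator seg (fst z) * ln_dom (fst z - snd z))"
      using A(1) B(1) ln_dom_nonneg by simp
    ultimately show ?thesis by linarith
  qed
  then show ?thesis using A(1) B(1) by (intro exI[of _ "A * B * 4"]) auto
qed

lemma fg_integrable: "integrable (lborel \<Otimes>\<^sub>M lborel) (\<lambda>z. f (fst z) * g (snd z))"
proof -
  have "integrable (lborel \<Otimes>\<^sub>M lborel) (\<lambda>(x, y). f x * g y)"
  proof (rule lborel_pair.Fubini_integrable)
    show "integrable lborel (\<lambda>x. LINT y|lborel. norm (case (x, y) of (x, y) \<Rightarrow> f x * g y))"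
      using test_integrable[OF f] by (simp add: norm_mult)
    show "AE x in lborel. integrable lborel (\<lambda>y. case (x, y) of (x, y) \<Rightarrow> f x * g y)"
      using test_integrable[OF g] by simp
  qed measurable
  then show ?thesis by (simp only: split_beta')
qed

text \<open>Continuity is read off from \<open>ift_hump\<close>, since \<open>hump\<close> has
  bounded support and hence all moments.\<close>

lemma continuous_on_cos_integral: assumes "R \<ge> 1" shows "continuous_on UNIV (cos_integral R)"
proof -
  have am: "all_moments (hump R)"
    unfolding all_moments_def
  proof
    fix k
    show "integrable lborel (\<lambda>\<xi>. of_real \<xi> ^ k * hump R \<xi>)"
    proof (rule Bochner_Integration.integrable_bound)
      show "integrable lborel (\<lambda>\<xi>. R ^ k * cmod (hump R \<xi>))" using hump_integrable[OF assms] by simp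
      show "AE \<xi> in lborel. norm (of_real \<xi> ^ k * hump R \<xi>) \<le> norm (R ^ k * cmod (hump R \<xi>))"
      proof (intro AE_I2)
        fix \<xi>
        show "norm (of_real \<xi> ^ k * hump R \<xi>) \<le> norm (R ^ k * cmod (hump R \<xi>))"
        proof (cases "\<bar>\<xi>\<bar> \<le> R")
          case True
          then have "\<bar>\<xi>\<bar> ^ k * cmod (hump R \<xi>) \<le> R ^ k * cmod (hump R \<xi>)" by (intro mult_right_mono power_mono) auto
          then show ?thesis using assms by (simp add: norm_mult norm_power)
        qed (simp add: hump_def)
      qed
    qed measurable
  qed
  have "continuous_on UNIV (\<lambda>t. Re (ift (hump R) t) / 2)"
    by (intro continuous_intros smooth_continuous_on smooth_ift am) auto
  then show ?thesis by (simp add: ift_hump[OF assms])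
qed

lemma borel_measurable_cos_integral: "R \<ge> 1 \<Longrightarrow> cos_integral R \<in> borel_measurable borel"
  by (intro borel_measurable_continuous_onI continuous_on_cos_integral)

lemma cos_integral_kernel_integrable:
  assumes R: "R \<ge> 1"
  shows "integrable (lborel \<Otimes>\<^sub>M lborel) (\<lambda>z. of_real (cos_integral R (fst z - snd z)) * (f (fst z) * g (snd z)))"
proof -
  note [measurable] = borel_measurable_cos_integral[OF R]
  have b: "\<bar>cos_integral R t\<bar> \<le> (LINT \<xi>|lborel. cmod (hump R \<xi>))" for t
    using norm_ift_le[OF hump_integrable[OF R], of t] by (simp add: ift_hump[OF R] abs_mult)
  show ?thesis
  proof (rule Bochner_Integration.integrable_bound)
    show "integrable (lborel \<Otimes>\<^sub>M lborel) (\<lambda>z. (LINT \<xi>|lborel. cmod (hump R \<xi>)) * cmod (f (fst z) * g (snd z)))"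
      using fg_integrable by simp
    show "AE z in lborel \<Otimes>\<^sub>M lborel. norm (of_real (cos_integral R (fst z - snd z)) * (f (fst z) * g (snd z)))
        \<le> norm ((LINT \<xi>|lborel. cmod (hump R \<xi>)) * cmod (f (fst z) * g (snd z)))"
    proof (intro AE_I2)
      fix z :: "real \<times> real"
      have "\<bar>cos_integral R (fst z - snd z)\<bar> * cmod (f (fst z) * g (snd z)) \<le> (LINT \<xi>|lborel. cmod (hump R \<xi>)) * cmod (f (fst z) * g (snd z))"
        by (intro mult_right_mono b) simp
      then show "norm (of_real (cos_integral R (fst z - snd z)) * (f (fst z) * g (snd z)))
        \<le> norm ((LINT \<xi>|lborel. cmod (hump R \<xi>)) * cmod (f (fst z) * g (snd z)))"
        by (simp add: norm_mult)
    qed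
  qed measurable
qed

text \<open>The kernel is half the transform of \<open>hump\<close>, so two exchanges by
  \<open>integral_mult_ift\<close> move the double integral to the frequency side.\<close>

lemma cos_integral_kernel_integral:
  assumes R: "R \<ge> 1"
  shows "(LINT z|(lborel \<Otimes>\<^sub>M lborel). of_real (cos_integral R (fst z - snd z)) * (f (fst z) * g (snd z)))
     = 1/2 * (LINT \<xi>|lborel. hump R \<xi> * (fourier f (- \<xi>) * fourier g \<xi>))"
proof -
  have ig: "integrable lborel g" and if': "integrable lborel f" using test_integrable f g by auto
  have iW: "integrable lborel (\<lambda>\<xi>. hump R \<xi> * fourier g \<xi>)"
  proof -
    have "cmod (fourier g \<xi>) \<le> (LINT x|lborel. cmod (g x))" for \<xi>
      using norm_ift_le[OF ig] by (simp add: fourier_ift)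
    then have b: "cmod (hump R \<xi> * fourier g \<xi>) \<le> (LINT x|lborel. cmod (g x)) * cmod (hump R \<xi>)" for \<xi>
      unfolding norm_mult by (metis mult.commute mult_right_mono norm_ge_zero)
    show ?thesis
    proof (rule Bochner_Integration.integrable_bound)
      show "integrable lborel (\<lambda>\<xi>. (LINT x|lborel. cmod (g x)) * cmod (hump R \<xi>))" using hump_integrable[OF R] by simp
      show "AE \<xi> in lborel. norm (hump R \<xi> * fourier g \<xi>) \<le> norm ((LINT x|lborel. cmod (g x)) * cmod (hump R \<xi>))"
        using b by (intro AE_I2) (auto intro: order_trans)
    qed measurable
  qed
  have inner: "(LINT y|lborel. of_real (cos_integral R (x - y)) * (f x * g y)) = 1/2 * (f x * ift (\<lambda>\<xi>. hump R \<xi> * fourier g \<xi>) x)" for x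
  proof -
    have iWx: "integrable lborel (\<lambda>\<xi>. hump R (- \<xi>) * cis (- (x * \<xi>)))"
    proof -
      have "integrable lborel (\<lambda>\<xi>. hump R (0 + (-1) * \<xi>))"
        by (intro lborel_integrable_real_affine hump_integrable R) simp
      from integrable_mult_cis_lborel[OF this, of "- x"] show ?thesis by simp
    qed
    have h: "of_real (cos_integral R (x - y)) = 1/2 * ift (\<lambda>\<xi>. hump R (- \<xi>) * cis (- (x * \<xi>))) y" for y
    proof -
      have "hump R (- \<xi>) * cis (- (x * \<xi>)) * cis (y * \<xi>) = hump R (0 + (-1) * \<xi>) * cis ((x - y) * (0 + (-1) * \<xi>))" for \<xi>
        by (simp add: mult.assoc cis_mult algebra_simps)
      then have "ift (\<lambda>\<xi>. hump R (- \<xi>) * cis (- (x * \<xi>))) y = (LINT \<xi>|lborel. hump R (0 + (-1) * \<xi>) * cis ((x - y) * (0 + (-1) * \<xi>)))"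
        unfolding ift_def by (simp only:)
      also have "\<dots> = ift (hump R) (x - y)"
        unfolding ift_def using lborel_integral_real_affine[of "-1" "\<lambda>\<xi>. hump R \<xi> * cis ((x - y) * \<xi>)" 0] by simp
      finally show ?thesis by (simp add: ift_hump[OF R])
    qed
    have "(LINT y|lborel. of_real (cos_integral R (x - y)) * (f x * g y))
       = (LINT y|lborel. (1/2 * f x) * (g y * ift (\<lambda>\<xi>. hump R (- \<xi>) * cis (- (x * \<xi>))) y))"
      unfolding h by (simp add: mult_ac)
    also have "\<dots> = (1/2 * f x) * (LINT y|lborel. g y * ift (\<lambda>\<xi>. hump R (- \<xi>) * cis (- (x * \<xi>))) y)"
      by (rule integral_mult_right_zero)
    also have "(LINT y|lborel. g y * ift (\<lambda>\<xi>. hump R (- \<xi>) * cis (- (x * \<xi>))) y)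
       = (LINT \<xi>|lborel. hump R (- \<xi>) * cis (- (x * \<xi>)) * ift g \<xi>)"
      by (rule integral_mult_ift[OF ig iWx])
    also have "\<dots> = (LINT \<xi>|lborel. hump R (0 + (-1) * \<xi>) * cis (x * (0 + (-1) * \<xi>)) * fourier g (0 + (-1) * \<xi>))"
      by (simp add: fourier_ift)
    also have "\<dots> = ift (\<lambda>\<xi>. hump R \<xi> * fourier g \<xi>) x"
      unfolding ift_def using lborel_integral_real_affine[of "-1" "\<lambda>\<xi>. hump R \<xi> * cis (x * \<xi>) * fourier g \<xi>" 0]
      by (simp add: mult_ac)
    finally show ?thesis by simp
  qed
  have "(LINT z|(lborel \<Otimes>\<^sub>M lborel). of_real (cos_integral R (fst z - snd z)) * (f (fst z) * g (snd z)))
     = (LINT x|lborel. LINT y|lborel. of_real (cos_integral R (x - y)) * (f x * g y))"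
    using lborel_pair.integral_fst'[OF cos_integral_kernel_integrable[OF R]] by simp
  also have "\<dots> = (LINT x|lborel. 1/2 * (f x * ift (\<lambda>\<xi>. hump R \<xi> * fourier g \<xi>) x))"
    by (simp only: inner)
  also have "\<dots> = 1/2 * (LINT x|lborel. f x * ift (\<lambda>\<xi>. hump R \<xi> * fourier g \<xi>) x)"
    by (rule integral_mult_right_zero)
  also have "(LINT x|lborel. f x * ift (\<lambda>\<xi>. hump R \<xi> * fourier g \<xi>) x) = (LINT \<xi>|lborel. hump R \<xi> * fourier g \<xi> * ift f \<xi>)"
    by (rule integral_mult_ift[OF if' iW])
  finally show ?thesis by (simp add: fourier_ift[of f] mult_ac)
qed

text \<open>As \<open>f\<close> has mean zero, subtracting the constant
  \<open>cos_integral R 1\<close> from the kernel does not change the integral, while it makes the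
  kernel converge; \<open>cos_integral_diff_le\<close> supplies the majorant.\<close>

lemma ln_kernel_limit:
  assumes f0: "(LINT x|lborel. f x) = 0"
  shows "(\<lambda>n. 1/2 * (LINT \<xi>|lborel. hump (real (Suc n)) \<xi> * (fourier f (- \<xi>) * fourier g \<xi>)))
     \<longlonglongrightarrow> - (LINT z|(lborel \<Otimes>\<^sub>M lborel). of_real (ln \<bar>fst z - snd z\<bar>) * (f (fst z) * g (snd z)))"
proof -
  have R: "real (Suc n) \<ge> 1" for n by simp
  note [measurable] = borel_measurable_cos_integral[OF R]
  obtain B where B: "B \<ge> 0" "\<And>z. cmod (f (fst z) * g (snd z)) * (2 * \<bar>ln \<bar>fst z - snd z\<bar>\<bar>) \<le> B * (indicator seg (fst z) * ln_dom (fst z - snd z))"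
    using ln_kernel_bound by blast
  let ?s = "\<lambda>n z. of_real (cos_integral (real (Suc n)) (fst z - snd z) - cos_integral (real (Suc n)) 1) * (f (fst z) * g (snd z))"
  have zero: "(LINT z|(lborel \<Otimes>\<^sub>M lborel). f (fst z) * g (snd z)) = 0"
    using lborel_pair.integral_fst'[OF fg_integrable] f0 by simp
  have "(LINT z|(lborel \<Otimes>\<^sub>M lborel). ?s n z) = 1/2 * (LINT \<xi>|lborel. hump (real (Suc n)) \<xi> * (fourier f (- \<xi>) * fourier g \<xi>))" for n
  proof -
    have "(LINT z|(lborel \<Otimes>\<^sub>M lborel). ?s n z) = (LINT z|(lborel \<Otimes>\<^sub>M lborel). of_real (cos_integral (real (Suc n)) (fst z - snd z)) * (f (fst z) * g (snd z))
        - of_real (cos_integral (real (Suc n)) 1) * (f (fst z) * g (snd z)))"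
      by (simp only: of_real_diff left_diff_distrib)
    also have "\<dots> = (LINT z|(lborel \<Otimes>\<^sub>M lborel). of_real (cos_integral (real (Suc n)) (fst z - snd z)) * (f (fst z) * g (snd z)))
        - (LINT z|(lborel \<Otimes>\<^sub>M lborel). of_real (cos_integral (real (Suc n)) 1) * (f (fst z) * g (snd z)))"
      by (intro Bochner_Integration.integral_diff cos_integral_kernel_integrable R Bochner_Integration.integrable_mult_right fg_integrable)
    also have "(LINT z|(lborel \<Otimes>\<^sub>M lborel). of_real (cos_integral (real (Suc n)) 1) * (f (fst z) * g (snd z))) = 0"
      unfolding integral_mult_right_zero zero by simp
    finally show ?thesis using cos_integral_kernel_integral[OF R] by simp
  qed
  moreover have "(\<lambda>n. LINT z|(lborel \<Otimes>\<^sub>M lborel). ?s n z)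
     \<longlonglongrightarrow> (LINT z|(lborel \<Otimes>\<^sub>M lborel). - (of_real (ln \<bar>fst z - snd z\<bar>) * (f (fst z) * g (snd z))))"
  proof (rule integral_dominated_convergence[where w = "\<lambda>z. B * (indicator seg (fst z) * ln_dom (fst z - snd z))"])
    show "integrable (lborel \<Otimes>\<^sub>M lborel) (\<lambda>z. B * (indicator seg (fst z) * ln_dom (fst z - snd z)))"
      using ln_dom_product_integrable by (intro Bochner_Integration.integrable_mult_right) (simp only: split_beta')
    show "AE z in lborel \<Otimes>\<^sub>M lborel. (\<lambda>n. ?s n z) \<longlonglongrightarrow> - (of_real (ln \<bar>fst z - snd z\<bar>) * (f (fst z) * g (snd z)))"
      using AE_pair_neq
    proof eventually_elim
      case (elim z)
      then have "0 < \<bar>fst z - snd z\<bar>" by simp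
      from cos_integral_tendsto[OF this] have "(\<lambda>n. cos_integral (real (Suc n)) (fst z - snd z) - cos_integral (real (Suc n)) 1) \<longlonglongrightarrow> - ln \<bar>fst z - snd z\<bar>"
        by (simp only: cos_integral_abs)
      then have "(\<lambda>n. ?s n z) \<longlonglongrightarrow> of_real (- ln \<bar>fst z - snd z\<bar>) * (f (fst z) * g (snd z))"
        by (intro tendsto_intros)
      then show ?case by simp
    qed
    show "AE z in lborel \<Otimes>\<^sub>M lborel. norm (?s n z) \<le> B * (indicator seg (fst z) * ln_dom (fst z - snd z))" for n
      using AE_pair_neq
    proof eventually_elim
      case (elim z)
      then have t: "0 < \<bar>fst z - snd z\<bar>" by simp
      have "norm (?s n z) = cmod (f (fst z) * g (snd z)) * \<bar>cos_integral (real (Suc n)) \<bar>fst z - snd z\<bar> - cos_integral (real (Suc n)) 1\<bar>"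
        by (simp only: cos_integral_abs norm_mult norm_of_real mult.commute)
      also have "\<dots> \<le> cmod (f (fst z) * g (snd z)) * (2 * \<bar>ln \<bar>fst z - snd z\<bar>\<bar>)"
        by (intro mult_left_mono cos_integral_diff_le R t) simp
      also note B(2)
      finally show ?case .
    qed
  qed measurable
  ultimately show ?thesis by (simp only: Bochner_Integration.integral_minus)
qed

end

text \<open>The two derivatives contribute xi^2, which together with 1 / |xi| leaves |xi|; this is
  integrable against transforms of test functions, so the truncation can be removed. The mean of
  \<phi>' vanishes because its transform does at frequency 0.\<close>

lemma N0_form_fourier:
  assumes \<phi>: "\<phi> \<in> test_functions seg" and \<psi>: "\<psi> \<in> test_functions seg"
  shows "N0_form \<phi> \<psi> = 1 / (4 * of_real pi) * (LINT \<xi>|lborel. of_real \<bar>\<xi>\<bar> * (fourier \<phi> \<xi> * fourier \<psi> (- \<xi>)))"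
    and "integrable lborel (\<lambda>\<xi>. of_real \<bar>\<xi>\<bar> * (fourier \<phi> \<xi> * fourier \<psi> (- \<xi>)))"
proof -
  note f = test_functions_ddx[OF \<phi>] and g = test_functions_ddx[OF \<psi>]
  have [measurable]: "fourier \<phi> \<in> borel_measurable borel" "fourier \<psi> \<in> borel_measurable borel"
    using \<phi> \<psi> test_measurable borel_measurable_fourier by blast+
  have f0: "(LINT x|lborel. ddx \<phi> x) = 0"
    using fourier_ddx[OF \<phi>, of 0] by (simp add: fourier_def)
  let ?G = "\<lambda>\<xi>. of_real \<bar>\<xi>\<bar> * (fourier \<phi> (- \<xi>) * fourier \<psi> \<xi>)"
  have iG: "integrable lborel ?G"
  proof -
    have "integrable lborel (\<lambda>\<xi>. of_real \<xi> ^ 1 * fourier \<psi> \<xi>)"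
      using fourier_test_all_moments[OF \<psi>] unfolding all_moments_def by blast
    then have i1: "integrable lborel (\<lambda>\<xi>. cmod (of_real \<xi> ^ 1 * fourier \<psi> \<xi>))" by simp
    obtain C where C: "C > 0" "\<And>\<xi>. \<bar>\<xi>\<bar> ^ 0 * cmod (fourier \<phi> \<xi>) \<le> C"
      using fourier_power_bounded[OF \<phi>] by blast
    show ?thesis
    proof (rule Bochner_Integration.integrable_bound)
      show "integrable lborel (\<lambda>\<xi>. C * cmod (of_real \<xi> ^ 1 * fourier \<psi> \<xi>))" using i1 by simp
      show "AE \<xi> in lborel. norm (?G \<xi>) \<le> norm (C * cmod (of_real \<xi> ^ 1 * fourier \<psi> \<xi>))"
      proof (intro AE_I2)
        fix \<xi>
        have "cmod (fourier \<phi> (- \<xi>)) * (\<bar>\<xi>\<bar> * cmod (fourier \<psi> \<xi>)) \<le> C * (\<bar>\<xi>\<bar> * cmod (fourier \<psi> \<xi>))"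
          using C(2)[of "- \<xi>"] by (intro mult_right_mono) auto
        then show "norm (?G \<xi>) \<le> norm (C * cmod (of_real \<xi> ^ 1 * fourier \<psi> \<xi>))"
          using C(1) by (simp add: norm_mult mult_ac)
      qed
    qed measurable
  qed
  have eq: "hump R \<xi> * (fourier (ddx \<phi>) (- \<xi>) * fourier (ddx \<psi>) \<xi>)
      = of_real (indicator {\<xi>. 1 / R \<le> \<bar>\<xi>\<bar> \<and> \<bar>\<xi>\<bar> \<le> R} \<xi>) * ?G \<xi>" if R: "R \<ge> 1" for R \<xi>
  proof (cases "\<xi> = 0")
    case False
    have "of_real (\<xi> * \<xi>) = complex_of_real \<bar>\<xi>\<bar> * of_real \<bar>\<xi>\<bar>" by (simp flip: of_real_mult)
    then have "fourier (ddx \<phi>) (- \<xi>) * fourier (ddx \<psi>) \<xi> = of_real \<bar>\<xi>\<bar> * ?G \<xi>"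
      unfolding fourier_ddx[OF \<phi>] fourier_ddx[OF \<psi>] by (simp add: algebra_simps)
    then show ?thesis using False by (simp add: hump_def)
  next
    case True
    have "\<not> 1 / R \<le> \<bar>\<xi>\<bar>" using R True by simp
    then show ?thesis by (simp add: hump_def)
  qed
  have lim: "(\<lambda>n. LINT \<xi>|lborel. hump (real (Suc n)) \<xi> * (fourier (ddx \<phi>) (- \<xi>) * fourier (ddx \<psi>) \<xi>)) \<longlonglongrightarrow> (LINT \<xi>|lborel. ?G \<xi>)"
  proof -
    have "(\<lambda>n. LINT \<xi>|lborel. of_real (indicator {\<xi>. 1 / real (Suc n) \<le> \<bar>\<xi>\<bar> \<and> \<bar>\<xi>\<bar> \<le> real (Suc n)} \<xi>) * ?G \<xi>) \<longlonglongrightarrow> (LINT \<xi>|lborel. ?G \<xi>)"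
    proof (rule integral_dominated_convergence[where w = "\<lambda>\<xi>. cmod (?G \<xi>)"])
      show "AE \<xi> in lborel. norm (of_real (indicator {\<xi>. 1 / real (Suc n) \<le> \<bar>\<xi>\<bar> \<and> \<bar>\<xi>\<bar> \<le> real (Suc n)} \<xi>) * ?G \<xi>) \<le> cmod (?G \<xi>)" for n
        by (intro AE_I2) (auto simp: indicator_def)
      show "AE \<xi> in lborel. (\<lambda>n. of_real (indicator {\<xi>. 1 / real (Suc n) \<le> \<bar>\<xi>\<bar> \<and> \<bar>\<xi>\<bar> \<le> real (Suc n)} \<xi>) * ?G \<xi>) \<longlonglongrightarrow> ?G \<xi>"
      proof (intro AE_I2)
        fix \<xi> :: real
        show "(\<lambda>n. of_real (indicator {\<xi>. 1 / real (Suc n) \<le> \<bar>\<xi>\<bar> \<and> \<bar>\<xi>\<bar> \<le> real (Suc n)} \<xi>) * ?G \<xi>) \<longlonglongrightarrow> ?G \<xi>"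
        proof (cases "\<xi> = 0")
          case False
          have "\<forall>\<^sub>F n in sequentially. 1 / real (Suc n) < \<bar>\<xi>\<bar>"
            using order_tendstoD(2)[OF LIMSEQ_Suc[OF lim_1_over_n], of "\<bar>\<xi>\<bar>"] False by simp
          moreover have "\<forall>\<^sub>F n in sequentially. \<bar>\<xi>\<bar> \<le> real (Suc n)"
            using eventually_ge_at_top[of "nat \<lceil>\<bar>\<xi>\<bar>\<rceil>"] by (rule eventually_mono) linarith
          ultimately have "\<forall>\<^sub>F n in sequentially. of_real (indicator {\<xi>. 1 / real (Suc n) \<le> \<bar>\<xi>\<bar> \<and> \<bar>\<xi>\<bar> \<le> real (Suc n)} \<xi>) * ?G \<xi> = ?G \<xi>"
            by eventually_elim simp
          then show ?thesis by (rule tendsto_eventually)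
        qed simp
      qed
      show "integrable lborel (\<lambda>\<xi>. cmod (?G \<xi>))" using iG by simp
    qed measurable
    then show ?thesis using eq by simp
  qed
  have "- (LINT z|(lborel \<Otimes>\<^sub>M lborel). of_real (ln \<bar>fst z - snd z\<bar>) * (ddx \<phi> (fst z) * ddx \<psi> (snd z))) = 1/2 * (LINT \<xi>|lborel. ?G \<xi>)"
    by (rule LIMSEQ_unique[OF ln_kernel_limit[OF f g f0]]) (intro tendsto_intros lim)
  moreover have "(LINT z:seg \<times> seg|lborel \<Otimes>\<^sub>M lborel. of_real (ln \<bar>fst z - snd z\<bar>) * ddx \<phi> (fst z) * ddx \<psi> (snd z))
     = (LINT z|(lborel \<Otimes>\<^sub>M lborel). of_real (ln \<bar>fst z - snd z\<bar>) * (ddx \<phi> (fst z) * ddx \<psi> (snd z)))"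
    unfolding set_lebesgue_integral_def
  proof (rule Bochner_Integration.integral_cong[OF refl])
    fix z
    show "indicator (seg \<times> seg) z *\<^sub>R (of_real (ln \<bar>fst z - snd z\<bar>) * ddx \<phi> (fst z) * ddx \<psi> (snd z))
       = of_real (ln \<bar>fst z - snd z\<bar>) * (ddx \<phi> (fst z) * ddx \<psi> (snd z))"
    proof (cases "fst z \<in> seg \<and> snd z \<in> seg")
      case True
      then have "z \<in> seg \<times> seg" by (simp add: mem_Times_iff)
      then show ?thesis by (simp add: mult.assoc)
    next
      case False
      then have "ddx \<phi> (fst z) = 0 \<or> ddx \<psi> (snd z) = 0" using test_seg_zero[OF f] test_seg_zero[OF g] by blast
      then show ?thesis by auto
    qed
  qed
  ultimately have N: "N0_form \<phi> \<psi> = 1 / (4 * of_real pi) * (LINT \<xi>|lborel. ?G \<xi>)"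
  proof -
    have "- (1 / (2 * p)) * X = 1 / (4 * p) * Y" if "- X = 1/2 * Y" "p \<noteq> 0" for X Y p :: complex
    proof -
      have "X = - (1/2 * Y)" using that(1) by (metis minus_minus)
      then show ?thesis using that(2) by (simp add: field_simps)
    qed
    from this[OF \<open>- _ = 1/2 * _\<close>] show ?thesis
      unfolding N0_form_def \<open>set_lebesgue_integral _ _ _ = _\<close> by simp
  qed
  \<comment> \<open>The kernel computation produces the transforms at -\<xi> and \<xi>; a reflection
    brings them to the convention of \<open>distr_with_fourier\<close>.\<close>
  have r: "(\<lambda>\<xi>. ?G (0 + (-1) * \<xi>)) = (\<lambda>\<xi>. of_real \<bar>\<xi>\<bar> * (fourier \<phi> \<xi> * fourier \<psi> (- \<xi>)))" by simp
  show "integrable lborel (\<lambda>\<xi>. of_real \<bar>\<xi>\<bar> * (fourier \<phi> \<xi> * fourier \<psi> (- \<xi>)))"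
    unfolding r[symmetric] by (rule lborel_integrable_real_affine[OF iG]) simp
  have "(LINT \<xi>|lborel. ?G \<xi>) = (LINT \<xi>|lborel. of_real \<bar>\<xi>\<bar> * (fourier \<phi> \<xi> * fourier \<psi> (- \<xi>)))"
    unfolding r[symmetric] using lborel_integral_real_affine[of "-1" ?G 0] by simp
  then show "N0_form \<phi> \<psi> = 1 / (4 * of_real pi) * (LINT \<xi>|lborel. of_real \<bar>\<xi>\<bar> * (fourier \<phi> \<xi> * fourier \<psi> (- \<xi>)))"
    using N by simp
qed

subsection \<open>The scale of sequence spaces\<close>

abbreviation uw :: "nat \<Rightarrow> real" where
  "uw n \<equiv> 1 + (real (n + 1))\<^sup>2"

lemma uw_pos: "uw n > 0"
  by (rule one_plus_sq_pos)

text \<open>Comparable bases have comparable powers; for negative s monotonicity is reversed, and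
  the absolute value in the exponent of K covers both signs.\<close>

lemma powr_comparable:
  fixes a b :: real
  assumes "0 < a" "a \<le> b" "b \<le> K * a" "1 \<le> K"
  shows "b powr s \<le> K powr \<bar>s\<bar> * a powr s" "a powr s \<le> K powr \<bar>s\<bar> * b powr s"
proof -
  have K: "1 \<le> K powr \<bar>s\<bar>" using assms(4) by (simp add: ge_one_powr_ge_zero)
  have "b powr s \<le> K powr \<bar>s\<bar> * a powr s \<and> a powr s \<le> K powr \<bar>s\<bar> * b powr s"
  proof (cases "s \<ge> 0")
    case True
    have "b powr s \<le> (K * a) powr s" using assms True by (intro powr_mono2) auto
    moreover have "(K * a) powr s = K powr \<bar>s\<bar> * a powr s" using assms True by (simp add: powr_mult)
    moreover have "a powr s \<le> b powr s" using assms True by (intro powr_mono2) auto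
    moreover have "1 * b powr s \<le> K powr \<bar>s\<bar> * b powr s" using K by (intro mult_right_mono) auto
    ultimately show ?thesis by simp
  next
    case False
    have "b powr s \<le> a powr s" using assms False by (intro powr_mono2') auto
    moreover have "1 * a powr s \<le> K powr \<bar>s\<bar> * a powr s" using K by (intro mult_right_mono) auto
    moreover have "(K * a) powr s \<le> b powr s" using assms False by (intro powr_mono2') auto
    moreover have "a powr s = K powr \<bar>s\<bar> * (K * a) powr s"
      using assms False by (simp add: powr_mult powr_minus field_simps)
    moreover have "K powr \<bar>s\<bar> * (K * a) powr s \<le> K powr \<bar>s\<bar> * b powr s"
      using \<open>(K * a) powr s \<le> b powr s\<close> by (intro mult_left_mono) auto
    ultimately show ?thesis by simp
  qed
  then show "b powr s \<le> K powr \<bar>s\<bar> * a powr s" "a powr s \<le> K powr \<bar>s\<bar> * b powr s" by auto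
qed

lemma summable_nonneg_le:
  fixes f g :: "nat \<Rightarrow> real"
  assumes "summable g" "\<And>n. 0 \<le> f n" "\<And>n. f n \<le> C * g n"
  shows "summable f"
  by (rule summable_comparison_test'[OF summable_mult[OF assms(1), of C], of 0]) (use assms(2,3) in auto)

lemma summable_comparable:
  fixes f g :: "nat \<Rightarrow> real"
  assumes "\<And>n. 0 \<le> f n" "\<And>n. 0 \<le> g n" "\<And>n. f n \<le> C * g n" "\<And>n. g n \<le> D * f n"
  shows "summable f \<longleftrightarrow> summable g"
proof
  show "summable f" if "summable g" by (rule summable_nonneg_le[OF that assms(1,3)])
  show "summable g" if "summable f" by (rule summable_nonneg_le[OF that assms(2,4)])
qed

text \<open>Summability is defined with the weight 1 + n^2 but the norm with 1 + (n + 1)^2; the two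
  differ by a factor of at most 4.\<close>

lemma U_summable_shift: "U_summable s c \<longleftrightarrow> summable (\<lambda>n. uw n powr s * (cmod (c n))\<^sup>2)"
proof -
  have 1: "1 + (real n)\<^sup>2 \<le> uw n" for n by (simp add: power2_eq_square algebra_simps)
  have 2: "uw n \<le> 4 * (1 + (real n)\<^sup>2)" for n
  proof -
    have "1 + (x + 1)\<^sup>2 \<le> 4 * (1 + x\<^sup>2)" for x :: real
    proof -
      have "4 * (1 + x\<^sup>2) = 1 + (x + 1)\<^sup>2 + ((x - 1)\<^sup>2 + 2 * x\<^sup>2 + 1)" by (simp add: power2_eq_square algebra_simps)
      moreover have "0 \<le> (x - 1)\<^sup>2 + 2 * x\<^sup>2 + 1" by (intro add_nonneg_nonneg) auto
      ultimately show ?thesis by linarith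
    qed
    from this[of "real n"] show ?thesis by (simp add: add.commute)
  qed
  have "uw n powr s * (cmod (c n))\<^sup>2 \<le> 4 powr \<bar>s\<bar> * ((1 + (real n)\<^sup>2) powr s * (cmod (c n))\<^sup>2)" for n
    using mult_right_mono[OF powr_comparable(1)[OF one_plus_sq_pos 1 2, of n s], of "(cmod (c n))\<^sup>2"] by (simp add: mult.assoc)
  moreover have "(1 + (real n)\<^sup>2) powr s * (cmod (c n))\<^sup>2 \<le> 4 powr \<bar>s\<bar> * (uw n powr s * (cmod (c n))\<^sup>2)" for n
    using mult_right_mono[OF powr_comparable(2)[OF one_plus_sq_pos 1 2, of n s], of "(cmod (c n))\<^sup>2"] by (simp add: mult.assoc)
  ultimately show ?thesis
    unfolding U_summable_def
    by (intro summable_comparable[of _ _ "4 powr \<bar>s\<bar>" "4 powr \<bar>s\<bar>"]) (simp_all only: mult_nonneg_nonneg zero_le_power2 powr_ge_zero)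
qed

lemma half_summable_iff: "half_summable c \<longleftrightarrow> U_summable (1/2) c"
proof -
  have a: "real (n + 1) \<le> uw n powr (1/2)" for n
  proof -
    have "real (n + 1) = sqrt ((real (n + 1))\<^sup>2)" by simp
    also have "\<dots> \<le> sqrt (uw n)" by (intro real_sqrt_le_mono) simp
    also have "\<dots> = uw n powr (1/2)" by (rule powr_half_sqrt[symmetric]) simp
    finally show ?thesis .
  qed
  have b: "uw n powr (1/2) \<le> 2 * real (n + 1)" for n
  proof -
    have "uw n powr (1/2) = sqrt (uw n)" by (rule powr_half_sqrt) simp
    also have "\<dots> \<le> sqrt ((2 * real (n + 1))\<^sup>2)"
      by (intro real_sqrt_le_mono) (simp add: power2_eq_square algebra_simps)
    also have "\<dots> = 2 * real (n + 1)" by simp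
    finally show ?thesis .
  qed
  have "real (n + 1) * (cmod (c n))\<^sup>2 \<le> 1 * (uw n powr (1/2) * (cmod (c n))\<^sup>2)" for n
    using mult_right_mono[OF a[of n], of "(cmod (c n))\<^sup>2"] by simp
  moreover have "uw n powr (1/2) * (cmod (c n))\<^sup>2 \<le> 2 * (real (n + 1) * (cmod (c n))\<^sup>2)" for n
    using mult_right_mono[OF b[of n], of "(cmod (c n))\<^sup>2"] by (simp only: mult.assoc) simp
  ultimately show ?thesis
    unfolding half_summable_def U_summable_shift by (intro summable_comparable[of _ _ 1 2]) (simp_all only: mult_nonneg_nonneg of_nat_0_le_iff zero_le_power2 powr_ge_zero)
qed

text \<open>For s \<ge> 0 the definition asks for an actual function with the given coefficients,
  and \<open>U_fun\<close> provides it. All orders can then be handled as sequence spaces.\<close>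

lemma U_space_eq: "U_space s = {c. U_summable s c}"
proof (cases "s \<ge> 0")
  case True
  have "c \<in> U_space s" if c: "U_summable s c" for c
  proof -
    have "1 * (cmod (c n))\<^sup>2 \<le> (1 + (real n)\<^sup>2) powr s * (cmod (c n))\<^sup>2" for n
      using True by (intro mult_right_mono ge_one_powr_ge_zero) auto
    then have s: "summable (\<lambda>n. (cmod (c n))\<^sup>2)"
      by (intro summable_nonneg_le[OF c[unfolded U_summable_def], where C = 1]) simp_all
    have "U_fun c \<in> {u \<in> L2_omega. U_summable s (cheb_coeff u)}" using U_fun[OF s] c by simp
    from imageI[OF this, of cheb_coeff] show ?thesis using U_fun(2)[OF s] True by (simp add: U_space_def)
  qed
  then show ?thesis using True by (auto simp: U_space_def)
qed (simp add: U_space_def)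

lemma U_space_subset: "U_space s \<subseteq> U_minus_inf"
  by (auto simp: U_minus_inf_def)

definition diag :: "(nat \<Rightarrow> real) \<Rightarrow> (nat \<Rightarrow> complex) \<Rightarrow> nat \<Rightarrow> complex" where
  "diag a c n = of_real (a n) * c n"

lemma diag_U_space:
  assumes a: "\<And>n. (a n)\<^sup>2 \<le> K * uw n powr (- m)" and c: "U_summable s c"
  shows "U_summable (s + m) (diag a c)" "U_norm (s + m) (diag a c) \<le> sqrt K * U_norm s c"
proof -
  have le: "uw n powr (s + m) * (cmod (diag a c n))\<^sup>2 \<le> K * (uw n powr s * (cmod (c n))\<^sup>2)" for n
  proof -
    have "uw n powr (s + m) * (cmod (diag a c n))\<^sup>2 = (a n)\<^sup>2 * (uw n powr (s + m) * (cmod (c n))\<^sup>2)"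
      by (simp add: diag_def norm_mult power_mult_distrib mult_ac)
    also have "\<dots> \<le> (K * uw n powr (- m)) * (uw n powr (s + m) * (cmod (c n))\<^sup>2)"
      by (intro mult_right_mono a) simp
    also have "\<dots> = K * ((uw n powr (- m) * uw n powr (s + m)) * (cmod (c n))\<^sup>2)" by (simp only: mult.assoc)
    also have "uw n powr (- m) * uw n powr (s + m) = uw n powr s" unfolding powr_add[symmetric] by simp
    finally show ?thesis .
  qed
  have sc: "summable (\<lambda>n. uw n powr s * (cmod (c n))\<^sup>2)" using c by (simp only: U_summable_shift)
  show s: "U_summable (s + m) (diag a c)"
    unfolding U_summable_shift by (rule summable_nonneg_le[OF sc _ le]) simp
  have "(\<Sum>n. uw n powr (s + m) * (cmod (diag a c n))\<^sup>2) \<le> (\<Sum>n. K * (uw n powr s * (cmod (c n))\<^sup>2))"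
    using s sc unfolding U_summable_shift by (intro suminf_le le summable_mult)
  also have "\<dots> = K * (\<Sum>n. uw n powr s * (cmod (c n))\<^sup>2)" by (rule suminf_mult[OF sc])
  finally have "U_norm (s + m) (diag a c) \<le> sqrt (1/2 * (K * (\<Sum>n. uw n powr s * (cmod (c n))\<^sup>2)))"
    unfolding U_norm_def by (intro real_sqrt_le_mono mult_left_mono) auto
  also have "\<dots> = sqrt K * U_norm s c"
    unfolding U_norm_def by (simp only: real_sqrt_mult mult_ac)
  finally show "U_norm (s + m) (diag a c) \<le> sqrt K * U_norm s c" .
qed

lemma U_summable_add: "U_summable s c \<Longrightarrow> U_summable s d \<Longrightarrow> U_summable s (\<lambda>n. c n + d n)"
proof -
  assume "U_summable s c" "U_summable s d"
  then have s: "summable (\<lambda>n. uw n powr s * (cmod (c n))\<^sup>2 + uw n powr s * (cmod (d n))\<^sup>2)"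
    unfolding U_summable_shift by (rule summable_add)
  have "uw n powr s * (cmod (c n + d n))\<^sup>2 \<le> 2 * (uw n powr s * (cmod (c n))\<^sup>2 + uw n powr s * (cmod (d n))\<^sup>2)" for n
    using mult_left_mono[OF cmod_add_square_le[of "c n" "d n"], of "uw n powr s"] by (simp add: algebra_simps)
  then show ?thesis
    unfolding U_summable_shift by (rule summable_nonneg_le[OF s, rotated, where C = 2]) simp
qed

lemma U_summable_cmult: "U_summable s c \<Longrightarrow> U_summable s (\<lambda>n. a * c n)"
proof -
  assume c: "U_summable s c"
  show ?thesis
    unfolding U_summable_shift
    by (rule summable_nonneg_le[OF c[unfolded U_summable_shift], where C = "(cmod a)\<^sup>2"])
       (simp_all add: norm_mult power_mult_distrib)
qed

lemma U_summable_finite: "U_summable s (\<lambda>n. if n < k then c n else 0)"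
  unfolding U_summable_def by (rule summable_finite[of "{..<k}"]) auto

lemma U_coeff_le:
  assumes "U_summable s d"
  shows "cmod (d j) \<le> sqrt (2 / uw j powr s) * U_norm s d"
proof -
  have s: "summable (\<lambda>n. uw n powr s * (cmod (d n))\<^sup>2)" using assms by (simp only: U_summable_shift)
  have "(\<Sum>n\<in>{j}. uw n powr s * (cmod (d n))\<^sup>2) \<le> (\<Sum>n. uw n powr s * (cmod (d n))\<^sup>2)"
    by (rule sum_le_suminf[OF s]) auto
  then have "(cmod (d j))\<^sup>2 \<le> (2 / uw j powr s) * (1/2 * (\<Sum>n. uw n powr s * (cmod (d n))\<^sup>2))"
    using uw_pos[of j] by (simp add: field_simps)
  then have "sqrt ((cmod (d j))\<^sup>2) \<le> sqrt ((2 / uw j powr s) * (1/2 * (\<Sum>n. uw n powr s * (cmod (d n))\<^sup>2)))"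
    by (rule real_sqrt_le_mono)
  then show ?thesis unfolding real_sqrt_mult U_norm_def by simp
qed

lemma U_norm_tail_tendsto:
  assumes "U_summable s c"
  shows "(\<lambda>k. U_norm s (\<lambda>n. if n < k then 0 else c n)) \<longlonglongrightarrow> 0"
proof -
  let ?f = "\<lambda>n. uw n powr s * (cmod (c n))\<^sup>2"
  have s: "summable ?f" using assms by (simp only: U_summable_shift)
  have eq: "(\<Sum>n. uw n powr s * (cmod (if n < k then 0 else c n))\<^sup>2) = (\<Sum>n. ?f (n + k))" for k
  proof -
    have "summable (\<lambda>n. uw n powr s * (cmod (if n < k then 0 else c n))\<^sup>2)"
      by (rule summable_nonneg_le[OF s, where C = 1]) auto
    from suminf_split_initial_segment[OF this, of k] show ?thesis by simp
  qed
  have "(\<lambda>k. sqrt (1/2 * (\<Sum>n. ?f (n + k)))) \<longlonglongrightarrow> sqrt (1/2 * 0)"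
    by (intro tendsto_intros suminf_exist_split2[OF s])
  then show ?thesis unfolding U_norm_def eq by simp
qed

text \<open>Finite sequences belong to every order, in particular to \<open>s\<^sub>0\<close>, so
  any extension acts on them as \<open>diag a\<close>. For a general sequence the tails tend to 0 in
  norm and each single coefficient is continuous, which determines the extension.\<close>

lemma scale_extension_diag:
  assumes a: "\<And>n. (a n)\<^sup>2 \<le> K * uw n powr (- m)" and B: "\<And>c. c \<in> U_space s\<^sub>0 \<Longrightarrow> B c = diag a c"
    and c: "c \<in> U_minus_inf"
  shows "scale_extension s\<^sub>0 m B c = diag a c"
proof -
  define N where "N = restrict (diag a) U_minus_inf"
  have N_eq: "N u = diag a u" if "u \<in> U_space s" for s u
    using that U_space_subset by (auto simp: N_def)
  have memN: "diag a u \<in> U_space (s + m)" if "u \<in> U_space s" for s u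
    using that diag_U_space(1)[OF a] by (simp add: U_space_eq)
  have N1: "N \<in> U_minus_inf \<rightarrow>\<^sub>E U_minus_inf"
    unfolding N_def using memN by (fastforce simp: U_minus_inf_def)
  have N2: "bounded_operator (U_space s) (U_norm s) (U_space (s + m)) (U_norm (s + m)) N" for s
    unfolding bounded_operator_def
  proof (intro conjI ballI allI)
    fix u v assume uv: "u \<in> U_space s" "v \<in> U_space s"
    then have "(\<lambda>i. u i + v i) \<in> U_space s" by (simp add: U_space_eq U_summable_add)
    then show "N (\<lambda>i. u i + v i) = (\<lambda>j. N u j + N v j)"
      using uv by (simp add: N_eq fun_eq_iff diag_def algebra_simps)
  next
    fix b u assume u: "u \<in> U_space s"
    then have "(\<lambda>i. b * u i) \<in> U_space s" by (simp add: U_space_eq U_summable_cmult)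
    then show "N (\<lambda>i. b * u i) = (\<lambda>j. b * N u j)"
      using u by (simp add: N_eq fun_eq_iff diag_def)
  next
    show "\<exists>C. \<forall>u\<in>U_space s. U_norm (s + m) (N u) \<le> C * U_norm s u"
      using N_eq diag_U_space(2)[OF a] by (intro exI[of _ "sqrt K"]) (simp add: U_space_eq)
  qed (use memN N_eq in simp)
  have "scale_extension s\<^sub>0 m B = N"
    unfolding scale_extension_def
  proof (rule the_equality)
    show "N \<in> U_minus_inf \<rightarrow>\<^sub>E U_minus_inf \<and>
        (\<forall>s. bounded_operator (U_space s) (U_norm s) (U_space (s + m)) (U_norm (s + m)) N) \<and> (\<forall>c\<in>U_space s\<^sub>0. N c = B c)"
      using N1 N2 N_eq B by simp
  next
    fix N' assume N': "N' \<in> U_minus_inf \<rightarrow>\<^sub>E U_minus_inf \<and>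
        (\<forall>s. bounded_operator (U_space s) (U_norm s) (U_space (s + m)) (U_norm (s + m)) N') \<and> (\<forall>c\<in>U_space s\<^sub>0. N' c = B c)"
    show "N' = N"
    proof (rule PiE_ext[of N' U_minus_inf "\<lambda>_. U_minus_inf"])
      fix u assume "u \<in> U_minus_inf"
      then obtain s where u: "u \<in> U_space s" by (auto simp: U_minus_inf_def)
      have su: "U_summable s u" using u by (simp add: U_space_eq)
      have bo: "bounded_operator (U_space s) (U_norm s) (U_space (s + m)) (U_norm (s + m)) N'" using N' by blast
      obtain C where C: "\<And>v. v \<in> U_space s \<Longrightarrow> U_norm (s + m) (N' v) \<le> C * U_norm s v"
        using bo unfolding bounded_operator_def by blast
      let ?h = "\<lambda>k n. if n < k then u n else 0" and ?t = "\<lambda>k n. if n < k then 0 else u n"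
      have h: "?h k \<in> U_space s'" for k s' by (simp add: U_space_eq U_summable_finite)
      have t: "?t k \<in> U_space s" for k
      proof -
        have "U_summable s (\<lambda>n. u n + (-1) * ?h k n)"
          by (intro U_summable_add su U_summable_cmult U_summable_finite)
        moreover have "(\<lambda>n. u n + (-1) * ?h k n) = ?t k" by (auto simp: fun_eq_iff)
        ultimately show ?thesis by (simp add: U_space_eq)
      qed
      show "N' u = N u"
      proof
        fix j
        let ?D = "sqrt (2 / uw j powr (s + m))"
        \<comment> \<open>For k beyond j, the finite head already has the full coefficient of index
          j.\<close>
        have split: "N' u j - diag a u j = N' (?t k) j" if "k > j" for k
        proof -
          have "N' (\<lambda>n. ?h k n + ?t k n) = (\<lambda>j. N' (?h k) j + N' (?t k) j)"
          proof -
            have "\<forall>u\<in>U_space s. \<forall>v\<in>U_space s. N' (\<lambda>i. u i + v i) = (\<lambda>j. N' u j + N' v j)"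
              using bo unfolding bounded_operator_def by (elim conjE)
            from bspec[OF bspec[OF this h[of k]] t[of k]] show ?thesis .
          qed
          moreover have "(\<lambda>n. ?h k n + ?t k n) = u" by (auto simp: fun_eq_iff)
          moreover have "N' (?h k) = diag a (?h k)" using N' B h by metis
          ultimately have "N' u j = diag a (?h k) j + N' (?t k) j" by metis
          then show ?thesis using that by (simp add: diag_def)
        qed
        have bd: "cmod (N' (?t k) j) \<le> ?D * (C * U_norm s (?t k))" for k
        proof -
          have "N' (?t k) \<in> U_space (s + m)" using bo t unfolding bounded_operator_def by blast
          then have "cmod (N' (?t k) j) \<le> ?D * U_norm (s + m) (N' (?t k))"
            by (intro U_coeff_le) (simp add: U_space_eq)
          also have "\<dots> \<le> ?D * (C * U_norm s (?t k))"
            by (intro mult_left_mono C t) simp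
          finally show ?thesis .
        qed
        have "(\<lambda>k. ?D * (C * U_norm s (?t k))) \<longlonglongrightarrow> ?D * (C * 0)"
          by (intro tendsto_intros U_norm_tail_tendsto su)
        moreover have "\<forall>\<^sub>F k in sequentially. cmod (N' u j - diag a u j) \<le> ?D * (C * U_norm s (?t k))"
          using eventually_gt_at_top[of j] by eventually_elim (simp only: split bd)
        ultimately have "cmod (N' u j - diag a u j) \<le> ?D * (C * 0)"
          by (intro tendsto_lowerbound[of _ _ sequentially]) auto
        then have "N' u j = diag a u j" by simp
        then show "N' u j = N u j" using N_eq[OF u] by simp
      qed
    qed (use N' N1 in auto)
  qed
  then show ?thesis using c by (simp add: N_def)
qed

subsection \<open>The eigenvalues\<close>

lemma d_omega_chebU:
  assumes x: "x \<in> seg"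
  shows "d_omega (chebU n) x = of_real (- real (n + 1) * cos (real (n + 1) * arccos x) / omega x)"
proof -
  have "((\<lambda>x. sin (real (n + 1) * arccos x)) has_real_derivative cos (real (n + 1) * arccos x) * (real (n + 1) * - (1 / omega x))) (at x)"
    by (intro DERIV_chain2[OF DERIV_sin] DERIV_cmult arccos_has_derivative x)
  then have "((\<lambda>x. complex_of_real (sin (real (n + 1) * arccos x))) has_vector_derivative
      of_real (cos (real (n + 1) * arccos x) * (real (n + 1) * - (1 / omega x)))) (at x)"
    by (rule has_vector_derivative_of_real)
  then have "((\<lambda>x. of_real (omega x) * chebU n x) has_vector_derivative
      of_real (cos (real (n + 1) * arccos x) * (real (n + 1) * - (1 / omega x)))) (at x)"
    by (rule has_vector_derivative_transform_within_open[OF _ open_greaterThanLessThan x]) (rule omega_mult_chebU[symmetric])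
  then have "d_omega (chebU n) x = of_real (cos (real (n + 1) * arccos x) * (real (n + 1) * - (1 / omega x)))"
    unfolding d_omega_def by (rule vector_derivative_at)
  moreover have "cos (real (n + 1) * arccos x) * (real (n + 1) * - (1 / omega x)) = - real (n + 1) * cos (real (n + 1) * arccos x) / omega x"
  proof -
    have "g * (k * - (1 / w)) = - k * g / w" for g k w :: real by simp
    then show ?thesis .
  qed
  ultimately show ?thesis by (simp only:)
qed

text \<open>In the variable t = arccos x the operator \<omega> d/dx is -d/dt, and \<omega> U_n is
  sin ((n + 1) t); two derivatives produce the factor (n + 1)^2.\<close>

lemma d_omega_d_omega_chebU:
  assumes x: "x \<in> seg"
  shows "- d_omega (d_omega (chebU n)) x = of_real ((real (n + 1))\<^sup>2) * chebU n x"
proof -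
  have eq: "complex_of_real (- real (n + 1) * cos (real (n + 1) * arccos y)) = of_real (omega y) * d_omega (chebU n) y" if "y \<in> seg" for y
  proof -
    have "- real (n + 1) * cos (real (n + 1) * arccos y) = omega y * (- real (n + 1) * cos (real (n + 1) * arccos y) / omega y)"
      using omega_pos[OF that] by simp
    then show ?thesis unfolding d_omega_chebU[OF that] of_real_mult[symmetric] by (rule arg_cong)
  qed
  have "((\<lambda>x. - real (n + 1) * cos (real (n + 1) * arccos x)) has_real_derivative
      - real (n + 1) * (- sin (real (n + 1) * arccos x) * (real (n + 1) * - (1 / omega x)))) (at x)"
    by (intro DERIV_cmult DERIV_chain2[OF DERIV_cos] arccos_has_derivative x)
  then have "((\<lambda>x. complex_of_real (- real (n + 1) * cos (real (n + 1) * arccos x))) has_vector_derivative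
      of_real (- real (n + 1) * (- sin (real (n + 1) * arccos x) * (real (n + 1) * - (1 / omega x))))) (at x)"
    by (rule has_vector_derivative_of_real)
  then have "((\<lambda>x. of_real (omega x) * d_omega (chebU n) x) has_vector_derivative
      of_real (- real (n + 1) * (- sin (real (n + 1) * arccos x) * (real (n + 1) * - (1 / omega x))))) (at x)"
    by (rule has_vector_derivative_transform_within_open[OF _ open_greaterThanLessThan x]) (rule eq)
  then have "d_omega (d_omega (chebU n)) x = of_real (- real (n + 1) * (- sin (real (n + 1) * arccos x) * (real (n + 1) * - (1 / omega x))))"
    unfolding d_omega_def[of "d_omega (chebU n)"] by (rule vector_derivative_at)
  moreover have "chebU n x = of_real (sin (real (n + 1) * arccos x) / omega x)" by (simp add: chebU_def omega_def)
  moreover have "- (- real (n + 1) * (- sin (real (n + 1) * arccos x) * (real (n + 1) * - (1 / omega x))))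
      = (real (n + 1))\<^sup>2 * (sin (real (n + 1) * arccos x) / omega x)"
  proof -
    have "- (- k * (- h * (k * - (1 / w)))) = k\<^sup>2 * (h / w)" for h k w :: real by (simp add: power2_eq_square)
    then show ?thesis .
  qed
  ultimately show ?thesis by (simp only: of_real_minus[symmetric] of_real_mult[symmetric])
qed

lemma eigenvalue_eq: "eigenvalue n = (real (n + 1))\<^sup>2"
  unfolding eigenvalue_def
proof (rule the_equality)
  show "\<forall>x\<in>seg. - d_omega (d_omega (chebU n)) x = complex_of_real ((real (n + 1))\<^sup>2) * chebU n x"
    using d_omega_d_omega_chebU by blast
  fix l assume l: "\<forall>x\<in>seg. - d_omega (d_omega (chebU n)) x = complex_of_real l * chebU n x"
  \<comment> \<open>At this angle sin ((n + 1) t) = 1, so the eigenfunction does not vanish there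
    and its eigenvalue is determined.\<close>
  let ?t = "pi / (2 * real (n + 1))"
  have t: "0 < ?t" "?t < pi" by (auto simp: divide_less_eq)
  have "cos ?t < cos 0" using t by (intro cos_monotone_0_pi) auto
  moreover have "cos pi < cos ?t" using t by (intro cos_monotone_0_pi) auto
  ultimately have x: "cos ?t \<in> seg" by simp
  have "arccos (cos ?t) = ?t" using t by (intro arccos_cos) auto
  then have "real (n + 1) * arccos (cos ?t) = pi / 2" by (simp add: field_simps)
  then have "chebU n (cos ?t) = of_real (sin (pi / 2) / omega (cos ?t))" unfolding chebU_def omega_def by (simp only:)
  then have "chebU n (cos ?t) \<noteq> 0" using omega_pos[OF x] by simp
  moreover have "complex_of_real l * chebU n (cos ?t) = of_real ((real (n + 1))\<^sup>2) * chebU n (cos ?t)"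
    using l x d_omega_d_omega_chebU[OF x] by metis
  ultimately have "complex_of_real l = of_real ((real (n + 1))\<^sup>2)" by (simp only: mult_cancel_right) simp
  then show "l = (real (n + 1))\<^sup>2" by (simp only: of_real_eq_iff)
qed

text \<open>The power -1/2 of the eigenvalue (n + 1)^2 is 1 / (n + 1); the constant 2 comes from 1 +
  (n + 1)^2 \<le> 2 (n + 1)^2.\<close>

lemma inv_sqrt_op_eq:
  assumes "c \<in> U_minus_inf"
  shows "inv_sqrt_op c = diag (\<lambda>n. 1 / real (n + 1)) c"
  unfolding inv_sqrt_op_def
proof (rule scale_extension_diag[where K = 2, OF _ _ assms])
  fix n
  have p: "uw n powr - 1 = 1 / uw n" using uw_pos[of n] by (simp add: powr_minus_divide)
  have "1 \<le> (real (n + 1))\<^sup>2" by (simp add: one_le_power)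
  then have "uw n \<le> 2 * (real (n + 1))\<^sup>2" by simp
  then have "1 / (real (n + 1))\<^sup>2 \<le> 2 / uw n" using uw_pos[of n] by (simp add: field_simps)
  then show "(1 / real (n + 1))\<^sup>2 \<le> 2 * uw n powr - 1" unfolding p by (simp add: power_divide)
next
  fix c :: "nat \<Rightarrow> complex"
  have "((real (n + 1))\<^sup>2) powr (- 1 / 2) = 1 / real (n + 1)" for n
  proof -
    have "((real (n + 1))\<^sup>2) powr (- 1 / 2) = 1 / (((real (n + 1))\<^sup>2) powr (1 / 2))"
      by (simp add: powr_minus_divide)
    also have "((real (n + 1))\<^sup>2) powr (1 / 2) = sqrt ((real (n + 1))\<^sup>2)" by (rule powr_half_sqrt) simp
    finally show ?thesis by simp
  qed
  then show "functional_calculus (\<lambda>t. t powr (- 1 / 2)) c = diag (\<lambda>n. 1 / real (n + 1)) c"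
    by (simp only: functional_calculus_def eigenvalue_eq diag_def[abs_def])
qed

subsection \<open>Chebyshev coefficients of test functions\<close>

lemma test_seg_radius:
  assumes "\<phi> \<in> test_functions seg"
  shows "\<exists>r. 0 < r \<and> r < 1 \<and> (\<forall>x. \<bar>x\<bar> \<ge> r \<longrightarrow> \<phi> x = 0)"
proof -
  have "\<exists>K. compact K \<and> K \<subseteq> seg \<and> (\<forall>x. x \<notin> K \<longrightarrow> \<phi> x = 0)" using assms by (auto simp: test_functions_def)
  then obtain K where K: "compact K" "K \<subseteq> seg" "\<And>x. x \<notin> K \<Longrightarrow> \<phi> x = 0" by auto
  show ?thesis
  proof (cases "K = {}")
    case True
    then show ?thesis using K(3) by (intro exI[of _ "1/2"]) auto
  next
    case False
    have "compact (abs ` K)" by (intro compact_continuous_image K continuous_intros)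
    then obtain y where y: "y \<in> abs ` K" "\<And>z. z \<in> abs ` K \<Longrightarrow> z \<le> y"
      using compact_attains_sup[of "abs ` K"] False by blast
    have "y < 1"
    proof -
      obtain x where "x \<in> K" "y = \<bar>x\<bar>" using y(1) by blast
      then have "x \<in> seg" using K(2) by blast
      then show ?thesis using \<open>y = \<bar>x\<bar>\<close> by (auto simp: abs_less_iff)
    qed
    \<comment> \<open>Strictly between y and 1, so that \<phi> vanishes already where |x| =
      r.\<close>
    define r where "r = (y + 1) / 2"
    have "y \<ge> 0" using y(1) by auto
    then have "0 < r" "r < 1" "y < r" using \<open>y < 1\<close> by (auto simp: r_def)
    moreover have "\<phi> x = 0" if "\<bar>x\<bar> \<ge> r" for x
      using y(2)[of "\<bar>x\<bar>"] that \<open>y < r\<close> by (intro K(3)) auto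
    ultimately show ?thesis by blast
  qed
qed

text \<open>The support of \<phi> keeps away from the zeros of \<omega>, so the quotient is
  bounded.\<close>

lemma test_div_omega:
  assumes \<phi>: "\<phi> \<in> test_functions seg"
  shows "(\<lambda>x. \<phi> x / of_real (omega x)) \<in> L2_omega" "omega_mult (\<lambda>x. \<phi> x / of_real (omega x)) = \<phi>"
proof -
  obtain r where r: "0 < r" "r < 1" "\<And>x. \<bar>x\<bar> \<ge> r \<Longrightarrow> \<phi> x = 0" using test_seg_radius[OF \<phi>] by blast
  obtain B where B: "B > 0" "\<And>x. cmod (\<phi> x) \<le> B" using test_bounded[OF \<phi>] by blast
  have [measurable]: "\<phi> \<in> borel_measurable borel" using \<phi> by (rule test_measurable)
  interpret finite_measure omega_measure by (rule finite_measure_omega_measure)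
  let ?u = "\<lambda>x. \<phi> x / of_real (omega x)"
  have um: "?u \<in> borel_measurable borel" by measurable
  have um2: "(\<lambda>x. (cmod (?u x))\<^sup>2) \<in> borel_measurable borel" by measurable
  have ub: "cmod (?u x) \<le> B / omega r" for x
  proof (cases "\<bar>x\<bar> < r")
    case True
    have "x\<^sup>2 \<le> r\<^sup>2" using True r(1) by (metis abs_le_square_iff abs_of_pos less_imp_le)
    then have "omega r \<le> omega x" by (simp add: omega_def)
    moreover have "0 < omega r" using r by (intro omega_pos) simp
    ultimately show ?thesis using B(1) B(2)[of x] by (simp add: norm_divide frac_le)
  next
    case False
    then show ?thesis using r(3)[of x] B(1) r omega_pos[of r] by simp
  qed
  have "integrable omega_measure (\<lambda>x. (cmod (?u x))\<^sup>2)"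
  proof (rule integrable_const_bound)
    show "AE x in omega_measure. norm ((cmod (?u x))\<^sup>2) \<le> (B / omega r)\<^sup>2"
    proof (intro AE_I2)
      fix x
      have "(cmod (?u x))\<^sup>2 \<le> (B / omega r)\<^sup>2" by (intro power_mono ub) simp
      then show "norm ((cmod (?u x))\<^sup>2) \<le> (B / omega r)\<^sup>2" by simp
    qed
  qed (use um2 in \<open>simp only: measurable_omega_measure\<close>)
  then show "?u \<in> L2_omega"
    by (intro square_integrable_L2_omega) (use um in \<open>simp only: square_integrable_def measurable_omega_measure simp_thms\<close>)
  show "omega_mult ?u = \<phi>"
  proof
    fix x
    show "omega_mult ?u x = \<phi> x"
    proof (cases "x \<in> seg")
      case True
      then show ?thesis using omega_pos[OF True] by (simp add: omega_mult_def)
    next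
      case False
      then have "r \<le> \<bar>x\<bar>" using r(2) by auto
      then show ?thesis using False r(3) by (simp add: omega_mult_def)
    qed
  qed
qed

lemma omega_has_derivative:
  assumes "x \<in> seg" shows "(omega has_real_derivative - (x / omega x)) (at x)"
proof -
  have "1 - x\<^sup>2 > 0" using omega_pos[OF assms] by (simp add: omega_def)
  then show ?thesis
    unfolding omega_def[abs_def] by (auto intro!: derivative_eq_intros simp: field_simps)
qed

text \<open>Two integrations by parts in \<open>arccos x\<close> are performed at once, by means of the explicit
  antiderivative \<open>A\<close>.\<close>

lemma test_chebU_integral_decay:
  assumes \<phi>: "\<phi> \<in> test_functions seg"
  shows "\<exists>C. \<forall>n. cmod (LINT x|lborel. \<phi> x * chebU n x) \<le> C / (real (n + 1))\<^sup>2"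
proof -
  obtain r where r: "0 < r" "r < 1" "\<And>x. \<bar>x\<bar> \<ge> r \<Longrightarrow> \<phi> x = 0" using test_seg_radius[OF \<phi>] by blast
  let ?I = "{-r..r}"
  have seg: "x \<in> seg" if "x \<in> ?I" for x using that r by auto
  have seg_nz: "omega x \<noteq> 0" if "x \<in> ?I" for x using omega_pos[OF seg[OF that]] by simp
  have dr: "ddx \<phi> x = 0" if "\<bar>x\<bar> > r" for x
  proof -
    have "(\<phi> has_vector_derivative 0) (at x)"
    proof (rule has_vector_derivative_transform_within_open)
      show "((\<lambda>x. 0) has_vector_derivative 0) (at x)" by simp
      show "open (- ?I)" by auto
      show "x \<in> - ?I" using that by auto
      show "0 = \<phi> y" if "y \<in> - ?I" for y using that r(3)[of y] by auto
    qed
    then show ?thesis by (rule vector_derivative_at)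
  qed
  note \<phi>' = test_functions_ddx[OF \<phi>] and \<phi>'' = test_functions_ddx[OF test_functions_ddx[OF \<phi>]]
  \<comment> \<open>The support condition gives \<phi>' = 0 only for |x| > r; continuity adds the
    end points, where the boundary terms are evaluated.\<close>
  have dr': "ddx \<phi> r = 0" "ddx \<phi> (- r) = 0"
  proof -
    have "isCont (ddx \<phi>) y" for y using test_continuous_on[OF \<phi>', of UNIV] by (simp add: continuous_on_eq_continuous_at)
    then have c: "(ddx \<phi> \<longlongrightarrow> ddx \<phi> y) (at y)" for y by (simp add: isCont_def)
    have "(ddx \<phi> \<longlongrightarrow> 0) (at_right r)"
      by (rule tendsto_eventually) (use dr r(1) in \<open>auto simp: eventually_at_right_field intro!: exI[of _ "r + 1"]\<close>)
    moreover have "(ddx \<phi> \<longlongrightarrow> ddx \<phi> r) (at_right r)" using c by (rule filterlim_mono) (auto simp: at_le)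
    ultimately show "ddx \<phi> r = 0" using tendsto_unique[OF trivial_limit_at_right_real] by blast
    have "(ddx \<phi> \<longlongrightarrow> 0) (at_left (- r))"
      by (rule tendsto_eventually) (use dr r(1) in \<open>auto simp: eventually_at_left_field intro!: exI[of _ "- r - 1"]\<close>)
    moreover have "(ddx \<phi> \<longlongrightarrow> ddx \<phi> (- r)) (at_left (- r))" using c by (rule filterlim_mono) (auto simp: at_le)
    ultimately show "ddx \<phi> (- r) = 0" using tendsto_unique[OF trivial_limit_at_left_real] by blast
  qed
  \<comment> \<open>The derivative of \<phi>' \<omega>. Its bound on [-r, r] gives the constant, r <
    1 keeping \<omega> away from 0.\<close>
  define p where "p x = ddx (ddx \<phi>) x * of_real (omega x) - ddx \<phi> x * of_real (x / omega x)" for x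
  have pc: "continuous_on ?I p"
    unfolding p_def
    by (intro continuous_intros test_continuous_on[OF \<phi>'] test_continuous_on[OF \<phi>'']) (use seg_nz in auto)
  have "bounded (p ` ?I)" by (rule compact_imp_bounded[OF compact_continuous_image[OF pc]]) simp
  then obtain M where M: "\<And>x. x \<in> ?I \<Longrightarrow> cmod (p x) \<le> M" unfolding bounded_iff by blast
  have "cmod (LINT x|lborel. \<phi> x * chebU n x) \<le> (M * (2 * r)) / (real (n + 1))\<^sup>2" for n
  proof -
    let ?k = "real (n + 1)"
    let ?g = "\<lambda>x. cos (?k * arccos x)" and ?h = "\<lambda>x. sin (?k * arccos x)"
    define A where "A x = \<phi> x * of_real (?g x / ?k) + (ddx \<phi> x * of_real (omega x)) * of_real (?h x / ?k\<^sup>2)" for x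
    have k: "?k > 0" by simp
    have hasA: "(A has_vector_derivative \<phi> x * of_real (?h x / omega x) + p x * of_real (?h x / ?k\<^sup>2)) (at x)" if x: "x \<in> ?I" for x
    proof -
      note xs = seg[OF x]
      have g: "((\<lambda>x. complex_of_real (?g x / ?k)) has_vector_derivative of_real (?h x / omega x)) (at x)"
      proof -
        have "((\<lambda>x. ?g x / ?k) has_real_derivative (- ?h x * (?k * - (1 / omega x))) / ?k) (at x)"
          by (intro DERIV_cdivide DERIV_chain2[OF DERIV_cos] DERIV_cmult arccos_has_derivative xs)
        moreover have "(- ?h x * (?k * - (1 / omega x))) / ?k = ?h x / omega x" by simp
        ultimately show ?thesis using has_vector_derivative_of_real by metis
      qed
      have h: "((\<lambda>x. complex_of_real (?h x / ?k\<^sup>2)) has_vector_derivative of_real (- ?g x / (?k * omega x))) (at x)"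
      proof -
        have "((\<lambda>x. ?h x / ?k\<^sup>2) has_real_derivative (?g x * (?k * - (1 / omega x))) / ?k\<^sup>2) (at x)"
          by (intro DERIV_cdivide DERIV_chain2[OF DERIV_sin] DERIV_cmult arccos_has_derivative xs)
        moreover have "(?g x * (?k * - (1 / omega x))) / ?k\<^sup>2 = - ?g x / (?k * omega x)"
          by (simp add: power2_eq_square)
        ultimately show ?thesis using has_vector_derivative_of_real by metis
      qed
      have w: "((\<lambda>x. complex_of_real (omega x)) has_vector_derivative of_real (- (x / omega x))) (at x)"
        by (rule has_vector_derivative_of_real[OF omega_has_derivative[OF xs]])
      note d0 = smooth_has_vector_derivative[OF test_smooth[OF \<phi>], of x]
      note d1 = smooth_has_vector_derivative[OF test_smooth[OF \<phi>'], of x]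
      have w0: "complex_of_real (omega x) \<noteq> 0" using seg_nz[OF x] by simp
      have "(A has_vector_derivative (\<phi> x * of_real (?h x / omega x) + ddx \<phi> x * of_real (?g x / ?k))
          + ((ddx \<phi> x * of_real (omega x)) * of_real (- ?g x / (?k * omega x))
            + (ddx \<phi> x * of_real (- (x / omega x)) + ddx (ddx \<phi>) x * of_real (omega x)) * of_real (?h x / ?k\<^sup>2))) (at x)"
        unfolding A_def
        by (intro has_vector_derivative_add has_vector_derivative_mult d0 d1 g h w)
      \<comment> \<open>This cancels the term with \<phi>' that comes from differentiating the first
        summand of \<open>A\<close>.\<close>
      moreover have "(ddx \<phi> x * of_real (omega x)) * of_real (- ?g x / (?k * omega x)) = - (ddx \<phi> x * of_real (?g x / ?k))"
      proof -
        have "w * (- g / (k * w)) = - (g / k)" if "w \<noteq> 0" for w g k :: real using that by simp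
        from this[OF seg_nz[OF x], of "?g x" ?k] show ?thesis
          by (simp only: mult.assoc of_real_mult[symmetric]) (simp only: of_real_minus mult_minus_right)
      qed
      moreover have "ddx \<phi> x * of_real (- (x / omega x)) + ddx (ddx \<phi>) x * of_real (omega x) = p x"
        by (simp add: p_def)
      ultimately show ?thesis by (simp add: add.assoc)
    qed
    have "((\<lambda>x. \<phi> x * of_real (?h x / omega x) + p x * of_real (?h x / ?k\<^sup>2)) has_integral A r - A (- r)) ?I"
      by (rule fundamental_theorem_of_calculus) (use r(1) has_vector_derivative_at_within[OF hasA] in auto)
    moreover have "A r = 0" "A (- r) = 0" using dr' r by (simp_all add: A_def)
    ultimately have i0: "((\<lambda>x. \<phi> x * of_real (?h x / omega x) + p x * of_real (?h x / ?k\<^sup>2)) has_integral 0) ?I" by simp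
    have ch: "continuous_on ?I ?h" using r by (intro continuous_intros) auto
    have c1: "continuous_on ?I (\<lambda>x. \<phi> x * of_real (?h x / omega x))"
      by (intro continuous_intros test_continuous_on[OF \<phi>] ch) (use seg_nz in auto)
    have c2: "continuous_on ?I (\<lambda>x. p x * of_real (?h x / ?k\<^sup>2))"
      by (intro continuous_intros pc ch) auto
    have "((\<lambda>x. \<phi> x * of_real (?h x / omega x)) has_integral integral ?I (\<lambda>x. \<phi> x * of_real (?h x / omega x))) ?I"
      using integrable_continuous_interval[OF c1] by (rule integrable_integral)
    from has_integral_diff[OF i0 this]
    have "integral ?I (\<lambda>x. p x * of_real (?h x / ?k\<^sup>2)) = - integral ?I (\<lambda>x. \<phi> x * of_real (?h x / omega x))"
      by (intro integral_unique) (simp only: add_diff_cancel_left' diff_0)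
    then have "cmod (integral ?I (\<lambda>x. \<phi> x * of_real (?h x / omega x))) = cmod (integral ?I (\<lambda>x. p x * of_real (?h x / ?k\<^sup>2)))" by simp
    also have "\<dots> \<le> (M / ?k\<^sup>2) * (r - (- r))"
    proof (rule integral_bound)
      fix x assume x: "x \<in> ?I"
      have "cmod (p x) * (\<bar>?h x\<bar> / ?k\<^sup>2) \<le> M * (1 / ?k\<^sup>2)"
        using M[OF x] k by (intro mult_mono divide_right_mono) (auto intro: order_trans[OF norm_ge_zero])
      then show "cmod (p x * of_real (?h x / ?k\<^sup>2)) \<le> M / ?k\<^sup>2"
        unfolding norm_mult norm_of_real abs_divide by simp
    qed (use r c2 in auto)
    also have "\<dots> = (M * (2 * r)) / ?k\<^sup>2" by simp
    also have "integral ?I (\<lambda>x. \<phi> x * of_real (?h x / omega x)) = (LINT x|lborel. \<phi> x * chebU n x)"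
    proof -
      have "(LINT x:?I|lborel. \<phi> x * of_real (?h x / omega x)) = integral ?I (\<lambda>x. \<phi> x * of_real (?h x / omega x))"
        by (rule set_borel_integral_eq_integral(2)[OF borel_integrable_atLeastAtMost'[OF c1]])
      moreover have "indicator ?I x *\<^sub>R (\<phi> x * of_real (?h x / omega x)) = \<phi> x * chebU n x" for x
      proof (cases "x \<in> ?I")
        case False
        then have "\<phi> x = 0" by (intro r(3)) auto
        then show ?thesis by simp
      qed (simp add: chebU_def omega_def)
      ultimately show ?thesis by (simp add: set_lebesgue_integral_def)
    qed
    finally show ?thesis .
  qed
  then show ?thesis by blast
qed

text \<open>Coefficients of size 1 / (n + 1)^2 give, weight included, terms of size 1 / (n +
  1)^3.\<close>

lemma test_coeff_half_summable:
  assumes \<phi>: "\<phi> \<in> test_functions seg"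
  shows "half_summable (cheb_coeff (\<lambda>x. \<phi> x / of_real (omega x)))"
proof -
  obtain C where C: "\<And>n. cmod (LINT x|lborel. \<phi> x * chebU n x) \<le> C / (real (n + 1))\<^sup>2"
    using test_chebU_integral_decay[OF \<phi>] by blast
  let ?d = "cheb_coeff (\<lambda>x. \<phi> x / of_real (omega x))"
  have d: "cmod (?d n) \<le> C / (real (n + 1))\<^sup>2" for n
  proof -
    have "cmod (?d n) = 2 / pi * cmod (LINT x|lborel. \<phi> x * chebU n x)"
      unfolding cheb_coeff_eq test_div_omega(2)[OF \<phi>] by (simp add: norm_mult norm_divide)
    also have "\<dots> \<le> 1 * cmod (LINT x|lborel. \<phi> x * chebU n x)"
      using pi_gt3 by (intro mult_right_mono) auto
    finally show ?thesis using C[of n] by simp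
  qed
  have s: "summable (\<lambda>n. 1 / (real (n + 1))\<^sup>2)"
    using summable_ignore_initial_segment[OF inverse_power_summable[of 2, where 'a = real], of 1] by (simp add: inverse_eq_divide)
  show ?thesis
    unfolding half_summable_def
  proof (rule summable_nonneg_le[OF s])
    fix n
    let ?k = "real (n + 1)"
    have k: "?k \<ge> 1" by simp
    have "(cmod (?d n))\<^sup>2 \<le> (C / ?k\<^sup>2)\<^sup>2" by (intro power_mono d) simp
    then have "?k * (cmod (?d n))\<^sup>2 \<le> ?k * (C / ?k\<^sup>2)\<^sup>2" using k by (intro mult_left_mono) auto
    also have "\<dots> = C\<^sup>2 * (1 / ?k ^ 3)"
    proof -
      have "k * (C / k\<^sup>2)\<^sup>2 = C\<^sup>2 * (1 / k ^ 3)" if "k \<ge> 1" for k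
        using that by (simp add: power2_eq_square power3_eq_cube field_simps)
      from this[OF k] show ?thesis .
    qed
    also have "\<dots> \<le> C\<^sup>2 * (1 / ?k\<^sup>2)"
      using power_increasing[of 2 3 ?k] k by (intro mult_left_mono frac_le) auto
    finally show "?k * (cmod (?d n))\<^sup>2 \<le> C\<^sup>2 * (1 / ?k\<^sup>2)" .
  qed simp
qed

lemma fourier_test_eq_series_hat:
  assumes "\<phi> \<in> test_functions seg"
  shows "fourier \<phi> = series_hat (cheb_coeff (\<lambda>x. \<phi> x / of_real (omega x)))"
  using fourier_omega_mult_unique[OF test_div_omega(1)[OF assms] refl half_summable_square(1)[OF test_coeff_half_summable[OF assms]]]
  unfolding test_div_omega(2)[OF assms] .

subsection \<open>Parseval identity for the pairing\<close>

lemma half_summable_lincomb: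
  assumes "half_summable c" "half_summable d"
  shows "half_summable (\<lambda>n. a * c n + b * d n)"
  using assms unfolding half_summable_iff by (intro U_summable_add U_summable_cmult)

lemma half_summable_cnj: "half_summable c \<Longrightarrow> half_summable (\<lambda>n. cnj (c n))"
  by (simp add: half_summable_def)

lemma series_hat_lincomb:
  assumes c: "half_summable c" and d: "half_summable d"
  shows "series_hat (\<lambda>n. a * c n + b * d n) = (\<lambda>\<xi>. a * series_hat c \<xi> + b * series_hat d \<xi>)"
proof
  fix \<xi>
  have "(\<lambda>n. a * (c n * chebU_hat n \<xi>) + b * (d n * chebU_hat n \<xi>)) sums (a * series_hat c \<xi> + b * series_hat d \<xi>)"
    by (intro sums_add sums_mult series_hat_sums half_summable_square(1)[OF c] half_summable_square(1)[OF d])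
  moreover have "(\<lambda>n. (a * c n + b * d n) * chebU_hat n \<xi>) sums series_hat (\<lambda>n. a * c n + b * d n) \<xi>"
    by (intro series_hat_sums half_summable_square(1)[OF half_summable_lincomb[OF c d]])
  ultimately show "series_hat (\<lambda>n. a * c n + b * d n) \<xi> = a * series_hat c \<xi> + b * series_hat d \<xi>"
    by (simp add: algebra_simps sums_unique2)
qed

lemma series_hat_reflect:
  assumes "half_summable c"
  shows "series_hat c (- \<xi>) = cnj (series_hat (\<lambda>n. cnj (c n)) \<xi>)"
proof -
  have "(\<lambda>n. cnj (cnj (c n) * chebU_hat n \<xi>)) sums cnj (series_hat (\<lambda>n. cnj (c n)) \<xi>)"
    unfolding sums_cnj by (intro series_hat_sums half_summable_square(1)[OF half_summable_cnj[OF assms]])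
  moreover have "(\<lambda>n. c n * chebU_hat n (- \<xi>)) sums series_hat c (- \<xi>)"
    by (intro series_hat_sums half_summable_square(1)[OF assms])
  ultimately show ?thesis by (simp add: chebU_hat_reflect sums_unique2)
qed

text \<open>Parseval's identity is hermitian; applied to the conjugate of \<open>d\<close> and
  rewritten by \<open>series_hat_reflect\<close> it becomes bilinear.\<close>

lemma series_hat_pairing:
  assumes c: "half_summable c" and d: "half_summable d"
  shows "(\<lambda>n. of_real (pi\<^sup>2 * real (n + 1)) * (c n * d n)) sums
    (LINT \<xi>|lborel. of_real \<bar>\<xi>\<bar> * (series_hat c \<xi> * series_hat d (- \<xi>)))"
proof -
  have [measurable]: "series_hat c \<in> borel_measurable borel" "series_hat d \<in> borel_measurable borel"
    using series_hat_measurable half_summable_square(1) c d by blast+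
  have m: "(\<lambda>\<xi>. series_hat c \<xi> * series_hat d (- \<xi>)) \<in> borel_measurable borel" by measurable
  have "(\<lambda>n. of_real (pi\<^sup>2 * real (n + 1)) * (c n * cnj (cnj (d n)))) sums
      (LINT \<xi>|abs_measure. series_hat c \<xi> * cnj (series_hat (\<lambda>n. cnj (d n)) \<xi>))"
    by (rule chebU_hat.expands_Parseval[OF series_hat_expands[OF c] series_hat_expands[OF half_summable_cnj[OF d]]])
  then show ?thesis
    unfolding series_hat_reflect[OF d, symmetric] integral_abs_measure[OF m] complex_cnj_cnj by (simp only: scaleR_conv_of_real)
qed

subsection \<open>Bounded functionals\<close>

abbreviation half_sum :: "(nat \<Rightarrow> complex) \<Rightarrow> real" where
  "half_sum c \<equiv> (\<Sum>n. real (n + 1) * (cmod (c n))\<^sup>2)"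

lemma half_summable_finite: "half_summable (\<lambda>n. if n < k then c n else 0)"
  unfolding half_summable_iff by (rule U_summable_finite)

text \<open>Riesz representation in a weighted sequence space: \<open>l n\<close> is the value on
  the n-th unit sequence. Its summability with weight 1 / (n + 1) follows by testing on extremal
  finite sequences.\<close>

lemma half_functional:
  fixes L :: "(nat \<Rightarrow> complex) \<Rightarrow> complex"
  assumes lin: "\<And>a b c d. half_summable c \<Longrightarrow> half_summable d \<Longrightarrow> L (\<lambda>n. a * c n + b * d n) = a * L c + b * L d"
    and bound: "\<And>c. half_summable c \<Longrightarrow> cmod (L c) \<le> K * sqrt (half_sum c)" and K: "K \<ge> 0"
  shows "\<exists>l. (\<forall>c. half_summable c \<longrightarrow> (\<lambda>n. l n * c n) sums L c) \<and> summable (\<lambda>n. (cmod (l n))\<^sup>2 / real (n + 1))"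
proof -
  define u :: "nat \<Rightarrow> nat \<Rightarrow> complex" where "u k n = (if n = k then 1 else 0)" for k n
  have us: "half_summable (u k)" for k
    unfolding half_summable_def by (rule summable_finite[of "{k}"]) (auto simp: u_def)
  have L0: "L (\<lambda>n. 0) = 0"
    using lin[OF us us, of 0 0 0 0] by simp
  have fin: "L (\<lambda>n. if n < N then c n else 0) = (\<Sum>n<N. L (u n) * c n)" for c N
  proof (induction N)
    case 0
    then show ?case by (simp add: L0)
  next
    case (Suc N)
    have "(\<lambda>n. if n < Suc N then c n else 0) = (\<lambda>n. 1 * (if n < N then c n else 0) + c N * u N n)"
      by (auto simp: fun_eq_iff u_def less_Suc_eq)
    then show ?case using lin[OF half_summable_finite us, of 1 N c "c N" N] Suc by (simp add: mult.commute)
  qed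
  have s1: "(\<lambda>n. L (u n) * c n) sums L c" if c: "half_summable c" for c
  proof -
    let ?h = "\<lambda>N n. if n < N then c n else 0" and ?t = "\<lambda>N n. if n < N then 0 else c n"
    let ?f = "\<lambda>n. real (n + 1) * (cmod (c n))\<^sup>2"
    have sf: "summable ?f" using c by (simp only: half_summable_def)
    have t_eq: "?t N = (\<lambda>n. 1 * c n + (-1) * ?h N n)" for N by (auto simp: fun_eq_iff)
    have t: "half_summable (?t N)" for N
      unfolding t_eq by (rule half_summable_lincomb[OF c half_summable_finite])
    have "L (?t N) = L c - (\<Sum>n<N. L (u n) * c n)" for N
      unfolding t_eq using lin[OF c half_summable_finite[of N c], of 1 "-1"] fin[of N c] by simp
    moreover have "half_sum (?t N) = (\<Sum>n. ?f (n + N))" for N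
      using suminf_split_initial_segment[OF t[of N, unfolded half_summable_def], of N] by simp
    ultimately have b: "cmod (L c - (\<Sum>n<N. L (u n) * c n)) \<le> K * sqrt (\<Sum>n. ?f (n + N))" for N
      using bound[OF t[of N]] by simp
    have "(\<lambda>N. K * sqrt (\<Sum>n. ?f (n + N))) \<longlonglongrightarrow> K * sqrt 0"
      by (intro tendsto_intros suminf_exist_split2[OF sf])
    then have "(\<lambda>N. L c - (\<Sum>n<N. L (u n) * c n)) \<longlonglongrightarrow> 0"
      by (intro Lim_null_comparison[OF always_eventually[OF allI[OF b]]]) simp
    then have "(\<lambda>N. L c - (L c - (\<Sum>n<N. L (u n) * c n))) \<longlonglongrightarrow> L c - 0"
      by (intro tendsto_intros)
    then show ?thesis by (simp add: sums_def)
  qed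
  have s2: "(\<Sum>n<N. (cmod (L (u n)))\<^sup>2 / real (n + 1)) \<le> K\<^sup>2" for N
  proof -
    let ?S = "\<Sum>n<N. (cmod (L (u n)))\<^sup>2 / real (n + 1)"
    \<comment> \<open>On the head of this sequence, \<open>L\<close> and \<open>half_sum\<close>
      take the same value \<open>?S\<close>, so that the bound reads S \<le> K sqrt S.\<close>
    let ?c = "\<lambda>n. cnj (L (u n)) / of_nat (n + 1)"
    let ?h = "\<lambda>n. if n < N then ?c n else 0"
    have S0: "?S \<ge> 0" by (intro sum_nonneg) simp
    have "L ?h = (\<Sum>n<N. L (u n) * ?c n)" by (rule fin)
    also have "\<dots> = of_real ?S"
      unfolding of_real_sum by (intro sum.cong refl) (simp add: complex_norm_square del: of_real_power)
    finally have "?S = cmod (L ?h)" using S0 by (simp only: norm_of_real abs_of_nonneg)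
    also have "\<dots> \<le> K * sqrt (half_sum ?h)" by (rule bound[OF half_summable_finite])
    also have "half_sum ?h = (\<Sum>n<N. real (n + 1) * (cmod (?h n))\<^sup>2)" by (rule suminf_finite) auto
    also have "\<dots> = ?S"
    proof (intro sum.cong refl)
      fix n assume "n \<in> {..<N}"
      moreover have "k * (x / k)\<^sup>2 = x\<^sup>2 / k" if "k > 0" for k x :: real
        using that by (simp add: power2_eq_square)
      from this[of "real (n + 1)" "cmod (L (u n))"]
      have "real (n + 1) * (cmod (?c n))\<^sup>2 = (cmod (L (u n)))\<^sup>2 / real (n + 1)"
        unfolding norm_divide norm_of_nat complex_mod_cnj by simp
      ultimately show "real (n + 1) * (cmod (?h n))\<^sup>2 = (cmod (L (u n)))\<^sup>2 / real (n + 1)" by simp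
    qed
    finally have "?S \<le> K * sqrt ?S" .
    then have le: "sqrt ?S * sqrt ?S \<le> K * sqrt ?S" using S0 by simp
    have "r \<le> K" if "r * r \<le> K * r" "r \<ge> 0" for r
      using that K by (cases "r = 0") auto
    from this[OF le] have "sqrt ?S \<le> K" using S0 by (simp only: real_sqrt_ge_zero)
    then have "(sqrt ?S)\<^sup>2 \<le> K\<^sup>2" by (intro power_mono) (use S0 in auto)
    then show ?thesis using S0 by simp
  qed
  have "summable (\<lambda>n. (cmod (L (u n)))\<^sup>2 / real (n + 1))"
    by (rule summableI_nonneg_bounded[OF _ s2]) simp
  with s1 show ?thesis by (intro exI[of _ "\<lambda>n. L (u n)"] conjI allI impI)
qed

subsection \<open>The space \<open>H\<close> of order one half\<close>

lemma weighted_L2_half_abs_measure: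
  assumes h: "h \<in> weighted_L2 (1/2)"
  shows "square_integrable abs_measure h" "(LINT \<xi>|abs_measure. (cmod (h \<xi>))\<^sup>2) \<le> half_norm2 h"
proof -
  have hm[measurable]: "h \<in> borel_measurable borel" by (rule weighted_L2_measurable[OF h])
  have m2: "(\<lambda>\<xi>. (cmod (h \<xi>))\<^sup>2) \<in> borel_measurable borel" by measurable
  have i: "integrable lborel (\<lambda>\<xi>. (1 + \<xi>\<^sup>2) powr (1/2) * (cmod (h \<xi>))\<^sup>2)" using h by (simp add: weighted_L2_def)
  have le: "\<bar>\<xi>\<bar> * (cmod (h \<xi>))\<^sup>2 \<le> (1 + \<xi>\<^sup>2) powr (1/2) * (cmod (h \<xi>))\<^sup>2" for \<xi>
  proof (intro mult_right_mono)
    have "\<bar>\<xi>\<bar> = sqrt (\<xi>\<^sup>2)" by simp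
    also have "\<dots> \<le> sqrt (1 + \<xi>\<^sup>2)" by (intro real_sqrt_le_mono) simp
    also have "\<dots> = (1 + \<xi>\<^sup>2) powr (1/2)" by (rule powr_half_sqrt[symmetric]) simp
    finally show "\<bar>\<xi>\<bar> \<le> (1 + \<xi>\<^sup>2) powr (1/2)" .
  qed simp
  have i2: "integrable lborel (\<lambda>\<xi>. \<bar>\<xi>\<bar> * (cmod (h \<xi>))\<^sup>2)"
  proof (rule Bochner_Integration.integrable_bound[OF i])
    show "AE \<xi> in lborel. norm (\<bar>\<xi>\<bar> * (cmod (h \<xi>))\<^sup>2) \<le> norm ((1 + \<xi>\<^sup>2) powr (1/2) * (cmod (h \<xi>))\<^sup>2)"
      using le by (intro AE_I2) simp
  qed measurable
  show "square_integrable abs_measure h"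
    unfolding square_integrable_def measurable_abs_measure integrable_abs_measure[OF m2] using i2 hm by simp
  show "(LINT \<xi>|abs_measure. (cmod (h \<xi>))\<^sup>2) \<le> half_norm2 h"
    unfolding integral_abs_measure[OF m2] half_norm2_eq[OF hm] using integral_mono[OF i2 i le] by simp
qed

lemma half_norm2_nonneg: "half_norm2 h \<ge> 0"
  by simp

lemma half_norm2_zero_AE:
  assumes h: "h \<in> weighted_L2 (1/2)" and z: "half_norm2 h = 0"
  shows "AE \<xi> in lborel. h \<xi> = 0"
proof -
  have i: "integrable lborel (\<lambda>\<xi>. (1 + \<xi>\<^sup>2) powr (1/2) * (cmod (h \<xi>))\<^sup>2)" using h by (simp add: weighted_L2_def)
  have "AE \<xi> in lborel. (1 + \<xi>\<^sup>2) powr (1/2) * (cmod (h \<xi>))\<^sup>2 = 0"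
    using z unfolding half_norm2_eq[OF weighted_L2_measurable[OF h]]
    by (subst (asm) integral_nonneg_eq_0_iff_AE[OF i]) auto
  then show ?thesis
  proof eventually_elim
    case (elim \<xi>)
    then show ?case using one_plus_sq_nonzero[of \<xi>] by simp
  qed
qed

lemma mollifier_exists: "\<exists>\<rho>. mollifier \<rho>"
proof -
  show ?thesis by (rule bump_exists) (blast intro: mollifier.intro)
qed

lemma distr_with_fourier_unique:
  assumes "g \<in> weighted_L2 (1/2)" "h \<in> weighted_L2 (1/2)" "distr_with_fourier g = distr_with_fourier h"
  shows "AE \<xi> in lborel. g \<xi> = h \<xi>"
proof -
  obtain \<rho> where "mollifier \<rho>" using mollifier_exists by blast
  then interpret mollifier \<rho> .
  have "distr_with_fourier (\<lambda>\<xi>. 1 * g \<xi> + (-1) * h \<xi>) \<phi> = 0" for \<phi>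
    using distr_with_fourier_lincomb[OF assms(1,2), of 1 "-1"] assms(3) by simp
  from distr_with_fourier_zero_imp_AE[OF weighted_L2_lincomb[OF assms(1,2)] _ this]
  have "AE \<xi> in lborel. 1 * g \<xi> + (-1) * h \<xi> = 0" by simp
  then show ?thesis by eventually_elim simp
qed

lemma times_omega_lincomb:
  assumes "half_summable c" "half_summable d"
  shows "times_omega (\<lambda>n. a * c n + b * d n) = (\<lambda>\<phi>. a * times_omega c \<phi> + b * times_omega d \<phi>)"
proof -
  note s = half_summable_square(1)
  show ?thesis
    unfolding times_omega_fourier[OF s[OF half_summable_lincomb[OF assms]]] times_omega_fourier[OF s[OF assms(1)]]
      times_omega_fourier[OF s[OF assms(2)]] series_hat_lincomb[OF assms]
    by (rule distr_with_fourier_lincomb) (use series_hat_weighted_L2(1) assms in auto)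
qed

lemma times_omega_half: "half_summable c \<Longrightarrow> times_omega c = distr_with_fourier (series_hat c)"
  by (rule times_omega_fourier[OF half_summable_square(1)])

lemma times_omega_outside:
  assumes c: "half_summable c" and \<phi>: "\<phi> \<in> test_functions (- {-1..1})"
  shows "times_omega c \<phi> = 0"
proof -
  obtain K where K: "K \<subseteq> - {-1..1}" "\<And>x. x \<notin> K \<Longrightarrow> \<phi> x = 0" using test_functionsE[OF \<phi>] by metis
  have "omega_mult (U_fun c) x * \<phi> x = 0" for x
  proof (cases "x \<in> seg")
    case True
    then have "x \<notin> K" using K(1) by auto
    then show ?thesis using K(2) by simp
  qed (simp add: omega_mult_def)
  then have "(LINT x|lborel. omega_mult (U_fun c) x * \<phi> x) = 0" by (simp only: integral_zero)
  then show ?thesis by (simp add: times_omega_eq distr_of_fun_def)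
qed

lemma times_omega_mem: "half_summable c \<Longrightarrow> times_omega c \<in> Htilde_half"
  using times_omega_outside series_hat_weighted_L2(1)
  by (auto simp: sobolev_supported_def sobolev_def times_omega_half)

text \<open>Orthogonality recovers the coefficients from the transform, which vanishes almost
  everywhere for a difference with the same image.\<close>

lemma times_omega_inj: "inj_on times_omega {c. half_summable c}"
proof (rule inj_onI, clarify)
  fix c d assume cd: "half_summable c" "half_summable d" "times_omega c = times_omega d"
  let ?e = "\<lambda>n. 1 * c n + (-1) * d n"
  have e: "half_summable ?e" by (rule half_summable_lincomb[OF cd(1,2)])
  have "AE \<xi> in lborel. series_hat c \<xi> = series_hat d \<xi>"
    using cd by (intro distr_with_fourier_unique series_hat_weighted_L2(1)) (simp_all add: times_omega_half)
  then have ae: "AE \<xi> in lborel. series_hat ?e \<xi> = 0"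
    unfolding series_hat_lincomb[OF cd(1,2)] by eventually_elim simp
  show "c = d"
  proof
    fix n
    have [measurable]: "series_hat ?e \<in> borel_measurable borel" by (rule series_hat_measurable[OF half_summable_square(1)[OF e]])
    have m: "(\<lambda>\<xi>. series_hat ?e \<xi> * cnj (chebU_hat n \<xi>)) \<in> borel_measurable borel" unfolding chebU_hat_reflect[symmetric] by measurable
    have "(LINT \<xi>|abs_measure. series_hat ?e \<xi> * cnj (chebU_hat n \<xi>)) = 0"
      unfolding integral_abs_measure[OF m]
    proof (rule integral_eq_zero_AE)
      show "AE \<xi> in lborel. \<bar>\<xi>\<bar> *\<^sub>R (series_hat ?e \<xi> * cnj (chebU_hat n \<xi>)) = 0" using ae by eventually_elim simp
    qed
    then have "?e n * of_real (pi\<^sup>2 * real (n + 1)) = 0"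
      using chebU_hat.expands_coeff[OF series_hat_expands[OF e], of n] by simp
    moreover have "complex_of_real (pi\<^sup>2 * real (n + 1)) \<noteq> 0" unfolding of_real_eq_0_iff by simp
    ultimately have "?e n = 0" by (simp only: mult_eq_0_iff simp_thms)
    then show "c n = d n" by simp
  qed
qed

lemma test_eq_times_omega:
  assumes \<phi>: "\<phi> \<in> test_functions seg"
  shows "distr_of_fun \<phi> = times_omega (cheb_coeff (\<lambda>x. \<phi> x / of_real (omega x)))"
  unfolding distr_of_fun_fourier[OF test_integrable[OF \<phi>]] times_omega_half[OF test_coeff_half_summable[OF \<phi>]]
    fourier_test_eq_series_hat[OF \<phi>] ..

text \<open>The Bessel coefficients of a transform \<open>g\<close> define a series, and the passage
  from \<open>g\<close> to the transform of that series is bounded for order 1/2. It fixes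
  transforms of test functions, which are dense among the \<open>g\<close> with the given support;
  hence it fixes all of them.\<close>

lemma Htilde_representation:
  assumes "T \<in> Htilde_half" shows "\<exists>c. half_summable c \<and> T = times_omega c"
proof -
  obtain g where g: "g \<in> weighted_L2 (1/2)" and T: "T = distr_with_fourier g"
    using assms by (auto simp: sobolev_supported_def sobolev_def)
  have supp: "distr_with_fourier g \<phi> = 0" if "\<phi> \<in> test_functions (- {-1..1})" for \<phi>
    using assms that T by (auto simp: sobolev_supported_def)
  have bessel: "half_summable (\<lambda>n. (LINT \<xi>|abs_measure. h \<xi> * cnj (chebU_hat n \<xi>)) / of_real (pi\<^sup>2 * real (n + 1)))"
    "half_norm2 (series_hat (\<lambda>n. (LINT \<xi>|abs_measure. h \<xi> * cnj (chebU_hat n \<xi>)) / of_real (pi\<^sup>2 * real (n + 1)))) \<le> 64 * half_norm2 h"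
    if h: "h \<in> weighted_L2 (1/2)" for h
  proof -
    let ?c = "\<lambda>n. (LINT \<xi>|abs_measure. h \<xi> * cnj (chebU_hat n \<xi>)) / of_real (pi\<^sup>2 * real (n + 1))"
    note hw = weighted_L2_half_abs_measure[OF h]
    have b: "summable (\<lambda>n. pi\<^sup>2 * real (n + 1) * (cmod (?c n))\<^sup>2)" by (rule chebU_hat.Bessel_inequality(2)[OF hw(1)])
    then have "summable (\<lambda>n. (1 / pi\<^sup>2) * (pi\<^sup>2 * real (n + 1) * (cmod (?c n))\<^sup>2))" by (rule summable_mult)
    moreover have "(1 / pi\<^sup>2) * (pi\<^sup>2 * real (n + 1) * (cmod (?c n))\<^sup>2) = real (n + 1) * (cmod (?c n))\<^sup>2" for n
      by (simp only: mult.assoc[symmetric]) simp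
    ultimately show hs: "half_summable ?c" unfolding half_summable_def by (simp only:)
    have "half_sum ?c \<le> (\<Sum>n. pi\<^sup>2 * real (n + 1) * (cmod (?c n))\<^sup>2)"
    proof (rule suminf_le[OF _ hs[unfolded half_summable_def] b])
      fix n
      have "1 \<le> pi\<^sup>2" using pi_gt3 by (intro one_le_power) simp
      then have "1 * (real (n + 1) * (cmod (?c n))\<^sup>2) \<le> pi\<^sup>2 * (real (n + 1) * (cmod (?c n))\<^sup>2)"
        by (rule mult_right_mono) simp
      then show "real (n + 1) * (cmod (?c n))\<^sup>2 \<le> pi\<^sup>2 * real (n + 1) * (cmod (?c n))\<^sup>2"
        by (simp only: mult.assoc mult_1_left)
    qed
    also have "\<dots> \<le> (LINT \<xi>|abs_measure. (cmod (h \<xi>))\<^sup>2)" by (rule chebU_hat.Bessel_inequality(3)[OF hw(1)])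
    also have "\<dots> \<le> half_norm2 h" by (rule hw(2))
    finally have "64 * half_sum ?c \<le> 64 * half_norm2 h" by simp
    then show "half_norm2 (series_hat ?c) \<le> 64 * half_norm2 h" using series_hat_weighted_L2(2)[OF hs] by (rule order_trans[rotated])
  qed
  let ?c = "\<lambda>n. (LINT \<xi>|abs_measure. g \<xi> * cnj (chebU_hat n \<xi>)) / of_real (pi\<^sup>2 * real (n + 1))"
  have c: "half_summable ?c" by (rule bessel(1)[OF g])
  have wc: "series_hat ?c \<in> weighted_L2 (1/2)" by (rule series_hat_weighted_L2(1)[OF c])
  \<comment> \<open>The constant is 2 + 2 * 64: splitting at a test function near \<open>g\<close>
    doubles both terms, and the second one costs the factor 64 of \<open>bessel\<close>.\<close>
  have small: "half_norm2 (\<lambda>\<xi>. g \<xi> - series_hat ?c \<xi>) \<le> 130 * \<delta>" if \<delta>: "\<delta> > 0" for \<delta>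
  proof -
    obtain \<phi> where \<phi>: "\<phi> \<in> test_functions seg" "half_norm2 (\<lambda>\<xi>. g \<xi> - fourier \<phi> \<xi>) < \<delta>"
    proof -
      obtain \<rho> where "mollifier \<rho>" using mollifier_exists by blast
      then interpret mollifier \<rho> .
      show ?thesis using test_functions_dense[OF g supp \<delta>] that by blast
    qed
    obtain d where d: "half_summable d" "fourier \<phi> = series_hat d"
      using test_coeff_half_summable[OF \<phi>(1)] fourier_test_eq_series_hat[OF \<phi>(1)] by (rule that)
    have wd: "series_hat d \<in> weighted_L2 (1/2)" by (rule series_hat_weighted_L2(1)[OF d(1)])
    let ?h = "\<lambda>\<xi>. g \<xi> - series_hat d \<xi>"
    have h: "?h \<in> weighted_L2 (1/2)" by (rule weighted_L2_diff[OF g wd])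
    have e: "(LINT \<xi>|abs_measure. ?h \<xi> * cnj (chebU_hat n \<xi>)) / of_real (pi\<^sup>2 * real (n + 1)) = 1 * ?c n + (-1) * d n" for n
    proof -
      have i: "integrable abs_measure (\<lambda>\<xi>. g \<xi> * cnj (chebU_hat n \<xi>))" "integrable abs_measure (\<lambda>\<xi>. series_hat d \<xi> * cnj (chebU_hat n \<xi>))"
        using weighted_L2_half_abs_measure(1)[OF g] weighted_L2_half_abs_measure(1)[OF wd] square_integrable_mult square_integrable_cnj[OF chebU_hat.e] by blast+
      have "(LINT \<xi>|abs_measure. ?h \<xi> * cnj (chebU_hat n \<xi>)) = (LINT \<xi>|abs_measure. g \<xi> * cnj (chebU_hat n \<xi>)) - (LINT \<xi>|abs_measure. series_hat d \<xi> * cnj (chebU_hat n \<xi>))"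
        unfolding left_diff_distrib by (rule Bochner_Integration.integral_diff[OF i])
      also have "(LINT \<xi>|abs_measure. series_hat d \<xi> * cnj (chebU_hat n \<xi>)) = d n * of_real (pi\<^sup>2 * real (n + 1))"
        by (rule chebU_hat.expands_coeff[OF series_hat_expands[OF d(1)]])
      finally have "(LINT \<xi>|abs_measure. ?h \<xi> * cnj (chebU_hat n \<xi>)) / of_real (pi\<^sup>2 * real (n + 1))
          = ?c n - d n * of_real (pi\<^sup>2 * real (n + 1)) / of_real (pi\<^sup>2 * real (n + 1))"
        by (simp only: diff_divide_distrib)
      moreover have "complex_of_real (pi\<^sup>2 * real (n + 1)) \<noteq> 0" unfolding of_real_eq_0_iff by simp
      ultimately show ?thesis by (simp only: nonzero_mult_div_cancel_right mult_1_left) simp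
    qed
    have "half_norm2 (\<lambda>\<xi>. 1 * series_hat ?c \<xi> + (-1) * series_hat d \<xi>) \<le> 64 * half_norm2 ?h"
      using bessel(2)[OF h] unfolding e series_hat_lincomb[OF c d(1)] .
    moreover have "half_norm2 (\<lambda>\<xi>. g \<xi> - series_hat ?c \<xi>) \<le> 2 * half_norm2 ?h + 2 * half_norm2 (\<lambda>\<xi>. 1 * series_hat ?c \<xi> + (-1) * series_hat d \<xi>)"
    proof -
      have "half_norm2 (\<lambda>\<xi>. ?h \<xi> + ((-1) * series_hat ?c \<xi> + 1 * series_hat d \<xi>)) \<le> 2 * half_norm2 ?h + 2 * half_norm2 (\<lambda>\<xi>. (-1) * series_hat ?c \<xi> + 1 * series_hat d \<xi>)"
        by (intro square_integrable_add(2)) (simp_all only: weighted_L2_iff[symmetric] h weighted_L2_lincomb[OF wc wd])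
      moreover have "?h \<xi> + ((-1) * series_hat ?c \<xi> + 1 * series_hat d \<xi>) = g \<xi> - series_hat ?c \<xi>" for \<xi> by simp
      moreover have "cmod ((-1) * series_hat ?c \<xi> + 1 * series_hat d \<xi>) = cmod (1 * series_hat ?c \<xi> + (-1) * series_hat d \<xi>)" for \<xi>
        by (simp add: norm_minus_commute)
      ultimately show ?thesis by (simp only:)
    qed
    ultimately show ?thesis using \<phi>(2) unfolding d(2) by linarith
  qed
  have "half_norm2 (\<lambda>\<xi>. g \<xi> - series_hat ?c \<xi>) = 0"
  proof (rule antisym[OF field_le_epsilon])
    show "half_norm2 (\<lambda>\<xi>. g \<xi> - series_hat ?c \<xi>) \<le> 0 + \<epsilon>" if "\<epsilon> > 0" for \<epsilon> using small[of "\<epsilon> / 130"] that by simp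
  qed (rule half_norm2_nonneg)
  then have "AE \<xi> in lborel. g \<xi> - series_hat ?c \<xi> = 0"
    by (rule half_norm2_zero_AE[OF weighted_L2_diff[OF g wc]])
  then have "AE \<xi> in lborel. g \<xi> = series_hat ?c \<xi>" by eventually_elim simp
  then have "distr_with_fourier g = distr_with_fourier (series_hat ?c)"
    by (rule distr_with_fourier_cong_AE) (use g wc weighted_L2_measurable in auto)
  then show ?thesis using c T times_omega_half[OF c] by (intro exI[of _ ?c]) simp
qed

lemma times_omega_bij: "bij_betw times_omega {c. half_summable c} Htilde_half"
  unfolding bij_betw_def
proof
  show "times_omega ` {c. half_summable c} = Htilde_half"
    using times_omega_mem Htilde_representation by blast
qed (rule times_omega_inj)

lemma test_functions_dense_series_hat:
  assumes c: "half_summable c" and \<delta>: "\<delta> > 0"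
  shows "\<exists>\<phi>\<in>test_functions seg. half_norm2 (\<lambda>\<xi>. series_hat c \<xi> - fourier \<phi> \<xi>) < \<delta>"
proof -
  obtain \<rho> where "mollifier \<rho>" using mollifier_exists by blast
  then interpret mollifier \<rho> .
  show ?thesis
  proof (rule test_functions_dense[OF series_hat_weighted_L2(1)[OF c] _ \<delta>])
    show "distr_with_fourier (series_hat c) \<phi> = 0" if "\<phi> \<in> test_functions (- {-1..1})" for \<phi>
      using times_omega_outside[OF c that] by (simp add: times_omega_half[OF c])
  qed
qed

lemma sobolev_norm_times_omega:
  assumes c: "half_summable c"
  shows "weighted_L2_norm (1/2) (series_hat c) \<le> sobolev_norm (1/2) (times_omega c)"
proof (rule sobolev_norm_ge)
  show "times_omega c \<in> sobolev (1/2)" using times_omega_mem[OF c] by (simp add: sobolev_supported_def)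
  fix g assume g: "g \<in> weighted_L2 (1/2)" "distr_with_fourier g = times_omega c"
  note m = weighted_L2_measurable[OF g(1)] weighted_L2_measurable[OF series_hat_weighted_L2(1)[OF c]]
  have "AE \<xi> in lborel. g \<xi> = series_hat c \<xi>"
    using g times_omega_half[OF c] by (intro distr_with_fourier_unique series_hat_weighted_L2(1) c) auto
  from half_norm2_cong_AE[OF this m]
  show "weighted_L2_norm (1/2) (series_hat c) \<le> weighted_L2_norm (1/2) g"
    by (simp add: weighted_L2_norm_sobolev_measure m)
qed

subsection \<open>The space \<open>H\<close> of order minus one half\<close>

definition half_wave :: "(nat \<Rightarrow> complex) \<Rightarrow> real \<Rightarrow> complex" where
  "half_wave c \<xi> = of_real (\<bar>\<xi>\<bar> / 2) * series_hat c \<xi>"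

text \<open>The factor |xi| / 2 costs one order, since (|xi| / 2)^2 \<le> 1 + xi^2.\<close>

lemma half_wave_weighted_L2:
  assumes c: "half_summable c"
  shows "half_wave c \<in> weighted_L2 (-1/2)"
    "weighted_L2_norm (-1/2) (half_wave c) \<le> weighted_L2_norm (1/2) (series_hat c)"
proof -
  have [measurable]: "series_hat c \<in> borel_measurable borel" by (rule series_hat_measurable[OF half_summable_square(1)[OF c]])
  have m: "half_wave c \<in> borel_measurable borel" unfolding half_wave_def[abs_def] by measurable
  have i: "integrable lborel (\<lambda>\<xi>. (1 + \<xi>\<^sup>2) powr (1/2) * (cmod (series_hat c \<xi>))\<^sup>2)"
    using series_hat_weighted_L2(1)[OF c] by (simp add: weighted_L2_def)
  have le: "(1 + \<xi>\<^sup>2) powr (-1/2) * (cmod (half_wave c \<xi>))\<^sup>2 \<le> (1 + \<xi>\<^sup>2) powr (1/2) * (cmod (series_hat c \<xi>))\<^sup>2" for \<xi>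
  proof -
    have "(cmod (half_wave c \<xi>))\<^sup>2 = (\<bar>\<xi>\<bar> / 2)\<^sup>2 * (cmod (series_hat c \<xi>))\<^sup>2"
      unfolding half_wave_def norm_mult norm_of_real power_mult_distrib by simp
    also have "\<dots> \<le> (1 + \<xi>\<^sup>2) * (cmod (series_hat c \<xi>))\<^sup>2"
      by (intro mult_right_mono) (simp_all add: power_divide add_increasing)
    finally have "(1 + \<xi>\<^sup>2) powr (-1/2) * (cmod (half_wave c \<xi>))\<^sup>2 \<le> (1 + \<xi>\<^sup>2) powr (-1/2) * ((1 + \<xi>\<^sup>2) * (cmod (series_hat c \<xi>))\<^sup>2)"
      by (intro mult_left_mono) auto
    also have "\<dots> = ((1 + \<xi>\<^sup>2) powr (-1/2) * (1 + \<xi>\<^sup>2) powr 1) * (cmod (series_hat c \<xi>))\<^sup>2"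
      using one_plus_sq_pos[of \<xi>] by simp
    also have "(1 + \<xi>\<^sup>2) powr (-1/2) * (1 + \<xi>\<^sup>2) powr 1 = (1 + \<xi>\<^sup>2) powr (1/2)"
      unfolding powr_add[symmetric] by simp
    finally show ?thesis .
  qed
  have i2: "integrable lborel (\<lambda>\<xi>. (1 + \<xi>\<^sup>2) powr (-1/2) * (cmod (half_wave c \<xi>))\<^sup>2)"
  proof (rule Bochner_Integration.integrable_bound[OF i])
    show "AE \<xi> in lborel. norm ((1 + \<xi>\<^sup>2) powr (-1/2) * (cmod (half_wave c \<xi>))\<^sup>2) \<le> norm ((1 + \<xi>\<^sup>2) powr (1/2) * (cmod (series_hat c \<xi>))\<^sup>2)"
      using le by (intro AE_I2) simp
  qed (use m in measurable)
  then show "half_wave c \<in> weighted_L2 (-1/2)" using m by (simp add: weighted_L2_def)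
  show "weighted_L2_norm (-1/2) (half_wave c) \<le> weighted_L2_norm (1/2) (series_hat c)"
    unfolding weighted_L2_norm_def by (intro real_sqrt_le_mono integral_mono i2 i le)
qed

text \<open>The candidate for \<open>N0 (times_omega c)\<close>, available before \<open>N0\<close>
  is known to exist.\<close>

definition hypersing :: "(nat \<Rightarrow> complex) \<Rightarrow> distr" where
  "hypersing c = restrict_distr seg (distr_with_fourier (half_wave c))"

lemma hypersing_apply:
  assumes \<psi>: "\<psi> \<in> test_functions seg"
  shows "hypersing c \<psi> = 1 / (4 * of_real pi) * (LINT \<xi>|lborel. of_real \<bar>\<xi>\<bar> * (series_hat c \<xi> * fourier \<psi> (- \<xi>)))"
proof -
  have "half_wave c \<xi> * fourier \<psi> (- \<xi>) = (1/2) * (of_real \<bar>\<xi>\<bar> * (series_hat c \<xi> * fourier \<psi> (- \<xi>)))" for \<xi>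
    by (simp add: half_wave_def)
  then have eq: "(LINT \<xi>|lborel. half_wave c \<xi> * fourier \<psi> (- \<xi>)) = (1/2) * (LINT \<xi>|lborel. of_real \<bar>\<xi>\<bar> * (series_hat c \<xi> * fourier \<psi> (- \<xi>)))"
    by (simp only: integral_mult_right_zero)
  have "hypersing c \<psi> = 1 / (2 * of_real pi) * (LINT \<xi>|lborel. half_wave c \<xi> * fourier \<psi> (- \<xi>))"
    using \<psi> test_functions_UNIV[OF \<psi>] by (simp add: hypersing_def restrict_distr_def distr_with_fourier_def)
  then show ?thesis unfolding eq by simp
qed

lemma hypersing_lincomb:
  assumes "half_summable c" "half_summable d"
  shows "hypersing (\<lambda>n. a * c n + b * d n) = (\<lambda>\<psi>. a * hypersing c \<psi> + b * hypersing d \<psi>)"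
proof -
  have eq1: "half_wave (\<lambda>n. a * c n + b * d n) = (\<lambda>\<xi>. a * half_wave c \<xi> + b * half_wave d \<xi>)"
    unfolding half_wave_def series_hat_lincomb[OF assms] by (auto simp: algebra_simps)
  have eq2: "distr_with_fourier (\<lambda>\<xi>. a * half_wave c \<xi> + b * half_wave d \<xi>)
      = (\<lambda>\<phi>. a * distr_with_fourier (half_wave c) \<phi> + b * distr_with_fourier (half_wave d) \<phi>)"
    by (rule distr_with_fourier_lincomb[OF half_wave_weighted_L2(1)[OF assms(1)] half_wave_weighted_L2(1)[OF assms(2)]]) simp
  show ?thesis unfolding hypersing_def restrict_distr_def eq1 eq2 by auto
qed

definition hypersing_diag :: "(nat \<Rightarrow> complex) \<Rightarrow> nat \<Rightarrow> complex" where
  "hypersing_diag c = diag (\<lambda>n. real (n + 1) / 2) c"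

definition hypersing_inv :: "(nat \<Rightarrow> complex) \<Rightarrow> nat \<Rightarrow> complex" where
  "hypersing_inv c = diag (\<lambda>n. 2 / real (n + 1)) c"

lemma hypersing_diag_inv: "hypersing_diag (hypersing_inv c) = c" "hypersing_inv (hypersing_diag c) = c"
proof -
  have "real (n + 1) / 2 * (2 / real (n + 1)) = 1" "2 / real (n + 1) * (real (n + 1) / 2) = 1" for n by simp_all
  then show "hypersing_diag (hypersing_inv c) = c" "hypersing_inv (hypersing_diag c) = c"
    unfolding hypersing_diag_def hypersing_inv_def diag_def fun_eq_iff mult.assoc[symmetric] of_real_mult[symmetric]
    by (simp_all only: of_real_1 mult_1_left simp_thms)
qed

lemma hypersing_diag_bound: "(real (n + 1) / 2)\<^sup>2 \<le> 1 * uw n powr (- (-1))"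
proof -
  have "(x / 2)\<^sup>2 \<le> 1 + x\<^sup>2" for x :: real by (simp add: power_divide add_increasing)
  then show ?thesis using uw_pos[of n] by simp
qed

lemma hypersing_inv_bound: "(2 / real (n + 1))\<^sup>2 \<le> 8 * uw n powr (- 1)"
proof -
  have *: "(2 / x)\<^sup>2 \<le> 8 * (1 / (1 + x\<^sup>2))" if "x \<ge> 1" for x :: real
  proof -
    have "1 \<le> x\<^sup>2" using that by (simp add: one_le_power)
    moreover have "(2 / x)\<^sup>2 = 8 * (1 / (2 * x\<^sup>2))" by (simp add: power_divide)
    ultimately show ?thesis using that by (simp only:) (intro mult_left_mono frac_le one_plus_sq_pos, auto)
  qed
  have "uw n powr - 1 = 1 / uw n" using uw_pos[of n] by (simp add: powr_minus_divide)
  then show ?thesis using *[of "real (n + 1)"] by simp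
qed

lemma hypersing_diag_U_summable: "U_summable s c \<Longrightarrow> U_summable (s - 1) (hypersing_diag c)"
  unfolding hypersing_diag_def using diag_U_space(1)[OF hypersing_diag_bound, of s c] by simp

lemma hypersing_inv_U_summable: "U_summable s c \<Longrightarrow> U_summable (s + 1) (hypersing_inv c)"
  unfolding hypersing_inv_def by (rule diag_U_space(1)[OF hypersing_inv_bound])

lemma hypersing_diag_half: "half_summable c \<Longrightarrow> U_summable (-1/2) (hypersing_diag c)"
  using hypersing_diag_U_summable[of "1/2" c] by (simp add: half_summable_iff)

lemma hypersing_inv_half: "U_summable (-1/2) c \<Longrightarrow> half_summable (hypersing_inv c)"
  using hypersing_inv_U_summable[of "-1/2" c] by (simp add: half_summable_iff)

text \<open>Here the eigenvalue appears: 1 / (4 pi) from the form times pi^2 (n + 1) from Parseval's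
  identity equals (n + 1) / 2 times pi / 2, the last factor being the squared norm of U_n in the
  pairing.\<close>

lemma distr_of_series_hypersing:
  assumes c: "half_summable c"
  shows "distr_of_series (hypersing_diag c) = hypersing c"
proof
  fix \<psi>
  show "distr_of_series (hypersing_diag c) \<psi> = hypersing c \<psi>"
  proof (cases "\<psi> \<in> test_functions seg")
    case True
    let ?d = "cheb_coeff (\<lambda>x. \<psi> x / of_real (omega x))"
    note d = test_coeff_half_summable[OF True]
    have "(\<lambda>n. 1 / (4 * of_real pi) * (of_real (pi\<^sup>2 * real (n + 1)) * (c n * ?d n))) sums hypersing c \<psi>"
      unfolding hypersing_apply[OF True] fourier_test_eq_series_hat[OF True] by (rule sums_mult[OF series_hat_pairing[OF c d]])
    moreover have "1 / (4 * of_real pi) * (of_real (pi\<^sup>2 * real (n + 1)) * (c n * ?d n))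
        = hypersing_diag c n * ?d n * form_omega (chebU n) (chebU n)" for n
    proof -
      have "1 / (4 * pi) * (pi\<^sup>2 * real (n + 1)) = real (n + 1) / 2 * (pi / 2)" by (simp add: power2_eq_square)
      then have "complex_of_real (1 / (4 * pi) * (pi\<^sup>2 * real (n + 1))) = of_real (real (n + 1) / 2 * (pi / 2))" by (simp only:)
      then show ?thesis
        unfolding form_omega_chebU hypersing_diag_def diag_def of_real_mult of_real_divide of_real_1 of_real_numeral
        by (simp only: mult.assoc[symmetric]) (simp only: mult_ac)
    qed
    ultimately have "(\<lambda>n. hypersing_diag c n * ?d n * form_omega (chebU n) (chebU n)) sums hypersing c \<psi>" by (simp only:)
    then show ?thesis using True by (simp add: distr_of_series_def U_pairing_def sums_iff)
  qed (simp add: distr_of_series_def hypersing_def restrict_distr_def)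
qed

lemma distr_of_series_mem:
  assumes "U_summable (-1/2) c" shows "distr_of_series c \<in> H_minus_half"
proof -
  note h = hypersing_inv_half[OF assms]
  have "distr_of_series c = hypersing (hypersing_inv c)" using distr_of_series_hypersing[OF h] by (simp only: hypersing_diag_inv)
  then show ?thesis
    using half_wave_weighted_L2(1)[OF h] by (auto simp: hypersing_def sobolev_on_def sobolev_def)
qed

text \<open>Pairing a transform of order -1/2 with the series of order 1/2 is a bounded functional,
  whose coefficients \<open>half_functional\<close> yields; on test functions of the segment it
  agrees with the distribution.\<close>

lemma H_minus_representation:
  assumes "F \<in> H_minus_half" shows "\<exists>c. U_summable (-1/2) c \<and> F = distr_of_series c"
proof -
  obtain g where g: "g \<in> weighted_L2 (-1/2)" and F: "F = restrict_distr seg (distr_with_fourier g)"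
    using assms by (auto simp: sobolev_on_def sobolev_def)
  define L where "L d = 1 / (2 * of_real pi) * (LINT \<xi>|lborel. g \<xi> * series_hat d (- \<xi>))" for d
  have h: "(\<lambda>\<xi>. series_hat d (- \<xi>)) \<in> weighted_L2 (- (-1/2))" if "half_summable d" for d
    using weighted_L2_reflect(1)[OF series_hat_weighted_L2(1)[OF that]] by simp
  have lin: "L (\<lambda>n. a * c n + b * d n) = a * L c + b * L d" if "half_summable c" "half_summable d" for a b c d
  proof -
    note i = weighted_L2_pairing(1)[OF g h[OF that(1)]] weighted_L2_pairing(1)[OF g h[OF that(2)]]
    have "g \<xi> * (a * series_hat c (- \<xi>) + b * series_hat d (- \<xi>)) = a * (g \<xi> * series_hat c (- \<xi>)) + b * (g \<xi> * series_hat d (- \<xi>))" for \<xi>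
      by (simp add: algebra_simps)
    then have "(LINT \<xi>|lborel. g \<xi> * series_hat (\<lambda>n. a * c n + b * d n) (- \<xi>))
        = a * (LINT \<xi>|lborel. g \<xi> * series_hat c (- \<xi>)) + b * (LINT \<xi>|lborel. g \<xi> * series_hat d (- \<xi>))"
      unfolding series_hat_lincomb[OF that] using i by simp
    then show ?thesis by (simp add: L_def algebra_simps)
  qed
  let ?K = "weighted_L2_norm (-1/2) g * 8"
  have bound: "cmod (L d) \<le> ?K * sqrt (half_sum d)" if d: "half_summable d" for d
  proof -
    have "weighted_L2_norm (1/2) (series_hat d) = sqrt (half_norm2 (series_hat d))"
      using weighted_L2_measurable[OF series_hat_weighted_L2(1)[OF d]] by (rule weighted_L2_norm_sobolev_measure)
    also have "\<dots> \<le> sqrt (64 * half_sum d)" by (intro real_sqrt_le_mono series_hat_weighted_L2(2) d)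
    also have "\<dots> = 8 * sqrt (half_sum d)" by (simp add: real_sqrt_mult)
    finally have n: "weighted_L2_norm (1/2) (series_hat d) \<le> 8 * sqrt (half_sum d)" .
    have "cmod (L d) = (1 / (2 * pi)) * cmod (LINT \<xi>|lborel. g \<xi> * series_hat d (- \<xi>))"
      by (simp add: L_def norm_mult norm_divide)
    also have "\<dots> \<le> 1 * cmod (LINT \<xi>|lborel. g \<xi> * series_hat d (- \<xi>))"
      using pi_gt3 by (intro mult_right_mono) auto
    also have "\<dots> \<le> weighted_L2_norm (-1/2) g * weighted_L2_norm (1/2) (series_hat d)"
      using weighted_L2_pairing(2)[OF g h[OF d]] weighted_L2_reflect(2)[OF series_hat_weighted_L2(1)[OF d]] by simp
    also have "\<dots> \<le> weighted_L2_norm (-1/2) g * (8 * sqrt (half_sum d))"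
      by (intro mult_left_mono n weighted_L2_norm_nonneg)
    finally show ?thesis by simp
  qed
  have "\<exists>l. (\<forall>d. half_summable d \<longrightarrow> (\<lambda>n. l n * d n) sums L d) \<and> summable (\<lambda>n. (cmod (l n))\<^sup>2 / real (n + 1))"
  proof (rule half_functional)
    show "L (\<lambda>n. a * c n + b * d n) = a * L c + b * L d" if "half_summable c" "half_summable d" for a b c d
      using that by (rule lin)
    show "cmod (L d) \<le> ?K * sqrt (half_sum d)" if "half_summable d" for d using that by (rule bound)
    show "?K \<ge> 0" using weighted_L2_norm_nonneg[of "-1/2" g] by simp
  qed
  then obtain l where l: "\<forall>d. half_summable d \<longrightarrow> (\<lambda>n. l n * d n) sums L d" "summable (\<lambda>n. (cmod (l n))\<^sup>2 / real (n + 1))"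
    by (elim exE conjE) (rule that)
  \<comment> \<open>\<open>U_pairing\<close> weighs each product with pi / 2, which is divided out
    here.\<close>
  define c where "c n = of_real (2 / pi) * l n" for n
  have "U_summable (-1/2) l"
    unfolding U_summable_shift
  proof (rule summable_nonneg_le[OF l(2), where C = 1])
    fix n
    have "uw n powr (-1/2) = 1 / uw n powr (1/2)" by (simp add: powr_minus_divide)
    also have "\<dots> = 1 / sqrt (uw n)" using uw_pos[of n] by (simp add: powr_half_sqrt)
    also have "\<dots> \<le> 1 / sqrt ((real (n + 1))\<^sup>2)" by (intro divide_left_mono real_sqrt_le_mono mult_pos_pos) (auto simp: one_plus_sq_pos)
    also have "sqrt ((real (n + 1))\<^sup>2) = real (n + 1)" by simp
    finally have "uw n powr (-1/2) * (cmod (l n))\<^sup>2 \<le> 1 / real (n + 1) * (cmod (l n))\<^sup>2" by (rule mult_right_mono) simp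
    then show "uw n powr (-1/2) * (cmod (l n))\<^sup>2 \<le> 1 * ((cmod (l n))\<^sup>2 / real (n + 1))" by simp
  qed simp
  then have c: "U_summable (-1/2) c" unfolding c_def[abs_def] by (rule U_summable_cmult)
  have "F = distr_of_series c"
  proof
    fix \<psi>
    show "F \<psi> = distr_of_series c \<psi>"
    proof (cases "\<psi> \<in> test_functions seg")
      case True
      let ?d = "cheb_coeff (\<lambda>x. \<psi> x / of_real (omega x))"
      have "F \<psi> = L ?d"
        using True test_functions_UNIV[OF True]
        by (simp add: F restrict_distr_def distr_with_fourier_def L_def fourier_test_eq_series_hat[OF True])
      moreover have "l n * ?d n = c n * ?d n * form_omega (chebU n) (chebU n)" for n
        unfolding form_omega_chebU by (simp add: c_def)
      ultimately have "(\<lambda>n. c n * ?d n * form_omega (chebU n) (chebU n)) sums F \<psi>"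
        using l(1)[rule_format, OF test_coeff_half_summable[OF True]] by (simp only:)
      then show ?thesis using True by (simp add: distr_of_series_def U_pairing_def sums_iff)
    qed (simp add: F distr_of_series_def restrict_distr_def)
  qed
  then show ?thesis using c by blast
qed

text \<open>Vanishing on test functions extends by density to all series of order 1/2, and pairing
  with unit sequences then isolates each coefficient.\<close>

lemma hypersing_zero:
  assumes c: "half_summable c" and z: "\<And>\<psi>. \<psi> \<in> test_functions seg \<Longrightarrow> hypersing c \<psi> = 0"
  shows "c = (\<lambda>n. 0)"
proof -
  note hw = half_wave_weighted_L2(1)[OF c]
  have p0: "(LINT \<xi>|lborel. half_wave c \<xi> * series_hat d (- \<xi>)) = 0" if d: "half_summable d" for d
  proof -
    let ?I = "LINT \<xi>|lborel. half_wave c \<xi> * series_hat d (- \<xi>)"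
    have "cmod ?I \<le> 0 + \<epsilon>" if \<epsilon>: "\<epsilon> > 0" for \<epsilon>
    proof -
      let ?W = "weighted_L2_norm (-1/2) (half_wave c) + 1"
      have W: "?W > 0" using weighted_L2_norm_nonneg[of "-1/2" "half_wave c"] by simp
      obtain \<phi> where \<phi>: "\<phi> \<in> test_functions seg" "half_norm2 (\<lambda>\<xi>. series_hat d \<xi> - fourier \<phi> \<xi>) < (\<epsilon> / ?W)\<^sup>2"
        using test_functions_dense_series_hat[OF d, of "(\<epsilon> / ?W)\<^sup>2"] \<epsilon> W by auto
      let ?h = "\<lambda>\<xi>. series_hat d \<xi> - fourier \<phi> \<xi>"
      have w1: "series_hat d \<in> weighted_L2 (1/2)" "fourier \<phi> \<in> weighted_L2 (1/2)"
        by (rule series_hat_weighted_L2(1)[OF d], rule fourier_weighted_L2[OF \<phi>(1)]) simp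
      have h: "?h \<in> weighted_L2 (1/2)" by (rule weighted_L2_diff[OF w1])
      have r: "(\<lambda>\<xi>. g (- \<xi>)) \<in> weighted_L2 (- (-1/2))" if "g \<in> weighted_L2 (1/2)" for g
        using weighted_L2_reflect(1)[OF that] by simp
      have "(LINT \<xi>|lborel. half_wave c \<xi> * fourier \<phi> (- \<xi>)) = 0"
        using z[OF \<phi>(1)] \<phi>(1) test_functions_UNIV[OF \<phi>(1)] by (simp add: hypersing_def restrict_distr_def distr_with_fourier_def)
      then have "?I = (LINT \<xi>|lborel. half_wave c \<xi> * ?h (- \<xi>))"
        using weighted_L2_pairing(1)[OF hw r[OF w1(1)]] weighted_L2_pairing(1)[OF hw r[OF w1(2)]]
        by (simp add: right_diff_distrib)
      then have "cmod ?I \<le> weighted_L2_norm (-1/2) (half_wave c) * weighted_L2_norm (1/2) ?h"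
        using weighted_L2_pairing(2)[OF hw r[OF h]] weighted_L2_reflect(2)[OF h] by simp
      also have "weighted_L2_norm (1/2) ?h = sqrt (half_norm2 ?h)"
        using weighted_L2_measurable[OF h] by (rule weighted_L2_norm_sobolev_measure)
      also have "weighted_L2_norm (-1/2) (half_wave c) * sqrt (half_norm2 ?h) \<le> ?W * sqrt ((\<epsilon> / ?W)\<^sup>2)"
        using W \<phi>(2) by (intro mult_mono real_sqrt_le_mono) auto
      also have "\<dots> = \<epsilon>" using W \<epsilon> by simp
      finally show ?thesis by simp
    qed
    then have "cmod ?I \<le> 0" by (rule field_le_epsilon)
    then show ?thesis by simp
  qed
  show ?thesis
  proof
    fix k
    let ?u = "\<lambda>n::nat. if n = k then 1 else (0::complex)"
    have u: "half_summable ?u" unfolding half_summable_def by (rule summable_finite[of "{k}"]) auto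
    have "(LINT \<xi>|lborel. of_real \<bar>\<xi>\<bar> * (series_hat c \<xi> * series_hat ?u (- \<xi>))) = (LINT \<xi>|lborel. 2 * (half_wave c \<xi> * series_hat ?u (- \<xi>)))"
      by (intro Bochner_Integration.integral_cong refl) (simp add: half_wave_def)
    also have "\<dots> = 0" using p0[OF u] by simp
    finally have "(\<lambda>n. of_real (pi\<^sup>2 * real (n + 1)) * (c n * ?u n)) sums 0" using series_hat_pairing[OF c u] by simp
    moreover have "(\<lambda>n. of_real (pi\<^sup>2 * real (n + 1)) * (c n * ?u n)) = (\<lambda>n. if n = k then of_real (pi\<^sup>2 * real (n + 1)) * c n else 0)"
      by (auto simp: fun_eq_iff)
    ultimately have "of_real (pi\<^sup>2 * real (k + 1)) * c k = 0"
      using sums_single[of k "\<lambda>n. of_real (pi\<^sup>2 * real (n + 1)) * c n"] sums_unique2 by (simp only:) blast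
    moreover have "complex_of_real (pi\<^sup>2 * real (k + 1)) \<noteq> 0" unfolding of_real_eq_0_iff by simp
    ultimately show "c k = 0" by (simp only: mult_eq_0_iff simp_thms)
  qed
qed

lemma hypersing_inj: "inj_on hypersing {c. half_summable c}"
proof (rule inj_onI, clarify)
  fix c d assume cd: "half_summable c" "half_summable d" "hypersing c = hypersing d"
  have "(\<lambda>n. 1 * c n + (-1) * d n) = (\<lambda>n. 0)"
    by (rule hypersing_zero[OF half_summable_lincomb[OF cd(1,2)]]) (simp only: hypersing_lincomb[OF cd(1,2)] cd(3), simp)
  then show "c = d" by (simp add: fun_eq_iff)
qed

lemma distr_of_series_bij: "bij_betw distr_of_series (U_space (-1/2)) H_minus_half"
  unfolding bij_betw_def
proof
  show "inj_on distr_of_series (U_space (-1/2))"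
  proof (rule inj_onI)
    fix c d assume "c \<in> U_space (-1/2)" "d \<in> U_space (-1/2)" and eq: "distr_of_series c = distr_of_series d"
    then have h: "half_summable (hypersing_inv c)" "half_summable (hypersing_inv d)" by (simp_all add: U_space_eq hypersing_inv_half)
    have "hypersing (hypersing_inv c) = hypersing (hypersing_inv d)"
      using distr_of_series_hypersing[OF h(1)] distr_of_series_hypersing[OF h(2)] eq by (simp only: hypersing_diag_inv)
    then have "hypersing_inv c = hypersing_inv d" using inj_onD[OF hypersing_inj] h by simp
    then have "hypersing_diag (hypersing_inv c) = hypersing_diag (hypersing_inv d)" by (simp only:)
    then show "c = d" by (simp only: hypersing_diag_inv)
  qed
  show "distr_of_series ` U_space (-1/2) = H_minus_half"
    using distr_of_series_mem H_minus_representation by (auto simp: U_space_eq)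
qed

lemma series_of_distr_of_series:
  assumes "U_summable (-1/2) c" shows "series_of_distr (distr_of_series c) = c"
  unfolding series_of_distr_def
proof (rule the_equality)
  show "c \<in> U_space (-1/2) \<and> distr_of_series c = distr_of_series c" using assms by (simp add: U_space_eq)
  fix d assume "d \<in> U_space (-1/2) \<and> distr_of_series d = distr_of_series c"
  then show "d = c"
    using inj_onD[OF bij_betw_imp_inj_on[OF distr_of_series_bij], of d c] assms by (simp add: U_space_eq)
qed

subsection \<open>The hypersingular operator\<close>

lemma hypersing_smooth:
  assumes \<phi>: "\<phi> \<in> test_functions seg"
  shows "hypersing (cheb_coeff (\<lambda>x. \<phi> x / of_real (omega x))) = N0_smooth \<phi>"
proof
  fix \<psi>
  show "hypersing (cheb_coeff (\<lambda>x. \<phi> x / of_real (omega x))) \<psi> = N0_smooth \<phi> \<psi>"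
  proof (cases "\<psi> \<in> test_functions seg")
    case True
    then show ?thesis
      unfolding hypersing_apply[OF True] fourier_test_eq_series_hat[OF \<phi>, symmetric] by (simp add: N0_smooth_def N0_form_fourier(1)[OF \<phi>])
  qed (simp add: hypersing_def restrict_distr_def N0_smooth_def)
qed

text \<open>The operators are compared after evaluation at one test function \<psi>, which is
  continuous by \<open>sobolev_on_norm_bound\<close>; the quotient norm of a difference is thus
  avoided. Density of the test functions in the domain concludes.\<close>

lemma bounded_operator_continuation_unique:
  assumes N: "bounded_operator Htilde_half (sobolev_norm (1/2)) H_minus_half (sobolev_on_norm (-1/2) seg) N"
    and N': "bounded_operator Htilde_half (sobolev_norm (1/2)) H_minus_half (sobolev_on_norm (-1/2) seg) N'"
    and eq: "\<And>\<phi>. \<phi> \<in> test_functions seg \<Longrightarrow> N (distr_of_fun \<phi>) = N' (distr_of_fun \<phi>)"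
    and T: "T \<in> Htilde_half"
  shows "N T = N' T"
proof
  fix \<psi>
  obtain c where c: "half_summable c" and Tc: "T = times_omega c" using Htilde_representation[OF T] by blast
  have maps: "M u \<in> H_minus_half" "M (\<lambda>i. u i + v i) = (\<lambda>j. M u j + M v j)"
    if "bounded_operator Htilde_half (sobolev_norm (1/2)) H_minus_half (sobolev_on_norm (-1/2) seg) M"
      "u \<in> Htilde_half" "v \<in> Htilde_half" for M u v
    using that unfolding bounded_operator_def by auto
  show "N T \<psi> = N' T \<psi>"
  proof (cases "\<psi> \<in> test_functions seg")
    case False
    have z: "F \<psi> = 0" if "F \<in> H_minus_half" for F
      using that False by (auto simp: sobolev_on_def restrict_distr_def)
    show ?thesis unfolding z[OF maps(1)[OF N T T]] z[OF maps(1)[OF N' T T]] ..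
  next
    case True
    let ?P = "weighted_L2_norm (- (-1/2)) (fourier \<psi>) + 1"
    have P: "?P > 0" using weighted_L2_norm_nonneg[of "1/2" "fourier \<psi>"] by simp
    obtain C where C: "C \<ge> 0" "\<And>u. u \<in> Htilde_half \<Longrightarrow> cmod (N u \<psi>) \<le> C * sobolev_norm (1/2) u"
      "\<And>u. u \<in> Htilde_half \<Longrightarrow> cmod (N' u \<psi>) \<le> C * sobolev_norm (1/2) u"
    proof -
      obtain C1 where C1: "\<And>u. u \<in> Htilde_half \<Longrightarrow> sobolev_on_norm (-1/2) seg (N u) \<le> C1 * sobolev_norm (1/2) u"
        using N unfolding bounded_operator_def by blast
      obtain C2 where C2: "\<And>u. u \<in> Htilde_half \<Longrightarrow> sobolev_on_norm (-1/2) seg (N' u) \<le> C2 * sobolev_norm (1/2) u"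
        using N' unfolding bounded_operator_def by blast
      have b: "cmod (M u \<psi>) \<le> ?P * (\<bar>D\<bar> * sobolev_norm (1/2) u)"
        if M: "bounded_operator Htilde_half (sobolev_norm (1/2)) H_minus_half (sobolev_on_norm (-1/2) seg) M"
          and D: "sobolev_on_norm (-1/2) seg (M u) \<le> D * sobolev_norm (1/2) u" and u: "u \<in> Htilde_half" for M D u
      proof -
        have "cmod (M u \<psi>) \<le> ?P * sobolev_on_norm (-1/2) seg (M u)"
          by (rule sobolev_on_norm_bound[OF maps(1)[OF M u u] _ True]) simp
        also have "\<dots> \<le> ?P * (D * sobolev_norm (1/2) u)" using P D by (intro mult_left_mono) auto
        also have "\<dots> \<le> ?P * (\<bar>D\<bar> * sobolev_norm (1/2) u)"
          using P u sobolev_norm_nonneg[of u "1/2"] by (intro mult_left_mono mult_right_mono) (auto simp: sobolev_supported_def)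
        finally show ?thesis .
      qed
      show ?thesis
      proof (rule that[of "?P * (\<bar>C1\<bar> + \<bar>C2\<bar>)"])
        show "0 \<le> ?P * (\<bar>C1\<bar> + \<bar>C2\<bar>)" using P by simp
        fix u assume u: "u \<in> Htilde_half"
        then have s: "sobolev_norm (1/2) u \<ge> 0" by (intro sobolev_norm_nonneg) (simp add: sobolev_supported_def)
        have "cmod (N u \<psi>) \<le> ?P * (\<bar>C1\<bar> * sobolev_norm (1/2) u)" by (rule b[OF N C1[OF u] u])
        also have "\<dots> \<le> ?P * ((\<bar>C1\<bar> + \<bar>C2\<bar>) * sobolev_norm (1/2) u)"
          using P s by (intro mult_left_mono mult_right_mono) auto
        finally show "cmod (N u \<psi>) \<le> ?P * (\<bar>C1\<bar> + \<bar>C2\<bar>) * sobolev_norm (1/2) u" by (simp only: mult.assoc)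
        have "cmod (N' u \<psi>) \<le> ?P * (\<bar>C2\<bar> * sobolev_norm (1/2) u)" by (rule b[OF N' C2[OF u] u])
        also have "\<dots> \<le> ?P * ((\<bar>C1\<bar> + \<bar>C2\<bar>) * sobolev_norm (1/2) u)"
          using P s by (intro mult_left_mono mult_right_mono) auto
        finally show "cmod (N' u \<psi>) \<le> ?P * (\<bar>C1\<bar> + \<bar>C2\<bar>) * sobolev_norm (1/2) u" by (simp only: mult.assoc)
      qed
    qed
    have "cmod (N T \<psi> - N' T \<psi>) \<le> 0 + \<epsilon>" if \<epsilon>: "\<epsilon> > 0" for \<epsilon>
    proof -
      \<comment> \<open>Two operators with the common constant C give an error 2 C \<delta>; the
        added 1 covers C = 0.\<close>
      let ?\<delta> = "\<epsilon> / (2 * (C + 1))"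
      have \<delta>: "?\<delta> > 0" using \<epsilon> C(1) by simp
      obtain \<phi> where \<phi>: "\<phi> \<in> test_functions seg" "half_norm2 (\<lambda>\<xi>. series_hat c \<xi> - fourier \<phi> \<xi>) < ?\<delta>\<^sup>2"
        using test_functions_dense_series_hat[OF c zero_less_power[OF \<delta>, of 2]] by blast
      define d where "d = cheb_coeff (\<lambda>x. \<phi> x / of_real (omega x))"
      have d: "half_summable d" "fourier \<phi> = series_hat d" "distr_of_fun \<phi> = times_omega d"
        unfolding d_def using test_coeff_half_summable fourier_test_eq_series_hat test_eq_times_omega \<phi>(1) by blast+
      let ?e = "\<lambda>n. 1 * c n + (-1) * d n"
      have e: "half_summable ?e" by (rule half_summable_lincomb[OF c d(1)])
      have "T = (\<lambda>i. distr_of_fun \<phi> i + times_omega ?e i)"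
        unfolding Tc d(3) times_omega_lincomb[OF c d(1)] by simp
      moreover have m: "distr_of_fun \<phi> \<in> Htilde_half" "times_omega ?e \<in> Htilde_half"
        unfolding d(3) by (rule times_omega_mem[OF d(1)], rule times_omega_mem[OF e])
      ultimately have "N T \<psi> - N' T \<psi> = N (times_omega ?e) \<psi> - N' (times_omega ?e) \<psi>"
        using maps(2)[OF N m] maps(2)[OF N' m] eq[OF \<phi>(1)] by simp
      then have "cmod (N T \<psi> - N' T \<psi>) \<le> cmod (N (times_omega ?e) \<psi>) + cmod (N' (times_omega ?e) \<psi>)"
        by (simp only: norm_triangle_ineq4)
      also have "\<dots> \<le> 2 * (C * sobolev_norm (1/2) (times_omega ?e))"
        using C(2)[OF m(2)] C(3)[OF m(2)] by simp
      also have "\<dots> \<le> 2 * (C * ?\<delta>)"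
      proof (intro mult_left_mono C(1))
        note w = series_hat_weighted_L2(1)[OF e]
        have "sobolev_norm (1/2) (times_omega ?e) \<le> weighted_L2_norm (1/2) (series_hat ?e)"
          unfolding times_omega_half[OF e] by (rule sobolev_norm_le[OF w])
        also have "\<dots> = sqrt (half_norm2 (series_hat ?e))" using weighted_L2_measurable[OF w] by (rule weighted_L2_norm_sobolev_measure)
        also have "\<dots> \<le> sqrt (?\<delta>\<^sup>2)"
          using \<phi>(2) unfolding series_hat_lincomb[OF c d(1)] d(2) by (intro real_sqrt_le_mono) simp
        also have "\<dots> = ?\<delta>" using \<delta> by (simp only: real_sqrt_abs abs_of_pos)
        finally show "sobolev_norm (1/2) (times_omega ?e) \<le> ?\<delta>" .
      qed simp
      also have "\<dots> \<le> \<epsilon>"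
      proof -
        have "2 * (C * (\<epsilon> / (2 * D))) = \<epsilon> * (C / D)" for D by simp
        from this[of "C + 1"] have "2 * (C * ?\<delta>) = \<epsilon> * (C / (C + 1))" .
        also have "\<dots> \<le> \<epsilon> * 1" using \<epsilon> C(1) by (intro mult_left_mono) auto
        finally show ?thesis by simp
      qed
      finally show ?thesis by simp
    qed
    then have "cmod (N T \<psi> - N' T \<psi>) \<le> 0" by (rule field_le_epsilon)
    then show ?thesis by simp
  qed
qed

text \<open>\<open>hypersing\<close>, transported along the bijection \<open>times_omega\<close>,
  satisfies the three conditions of the description, and continuation from test functions makes it
  the only operator that does.\<close>

lemma N0_times_omega:
  assumes c: "half_summable c" shows "N0 (times_omega c) = hypersing c"
proof -
  define N where "N = restrict (\<lambda>T. hypersing (inv_into {c. half_summable c} times_omega T)) Htilde_half"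
  have N_eq: "N (times_omega d) = hypersing d" if "half_summable d" for d
    using that times_omega_mem[OF that] inv_into_f_f[OF times_omega_inj, of d] by (simp add: N_def)
  have hypersing_mem: "hypersing d \<in> H_minus_half" if "half_summable d" for d
    using half_wave_weighted_L2(1)[OF that] by (auto simp: hypersing_def sobolev_on_def sobolev_def)
  have mem: "N T \<in> H_minus_half" if "T \<in> Htilde_half" for T
    using Htilde_representation[OF that] N_eq hypersing_mem by auto
  have N1: "N \<in> Htilde_half \<rightarrow>\<^sub>E H_minus_half"
    using mem by (auto simp: N_def)
  have N2: "bounded_operator Htilde_half (sobolev_norm (1/2)) H_minus_half (sobolev_on_norm (-1/2) seg) N"
    unfolding bounded_operator_def
  proof (intro conjI ballI allI)
    fix u v assume "u \<in> Htilde_half" "v \<in> Htilde_half"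
    then obtain d e where de: "half_summable d" "u = times_omega d" "half_summable e" "v = times_omega e"
      using Htilde_representation by blast
    have "(\<lambda>i. u i + v i) = times_omega (\<lambda>n. 1 * d n + 1 * e n)"
      unfolding times_omega_lincomb[OF de(1,3)] de(2,4) by simp
    then show "N (\<lambda>i. u i + v i) = (\<lambda>j. N u j + N v j)"
      using de N_eq half_summable_lincomb[OF de(1,3), of 1 1] hypersing_lincomb[OF de(1,3), of 1 1] by simp
  next
    fix a u assume "u \<in> Htilde_half"
    then obtain d where d: "half_summable d" "u = times_omega d"
      using Htilde_representation by blast
    have "(\<lambda>i. a * u i) = times_omega (\<lambda>n. a * d n + 0 * d n)"
      unfolding times_omega_lincomb[OF d(1) d(1)] d(2) by simp
    then show "N (\<lambda>i. a * u i) = (\<lambda>j. a * N u j)"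
      using d N_eq half_summable_lincomb[OF d(1) d(1), of a 0] hypersing_lincomb[OF d(1) d(1), of a 0] by simp
  next
    have "sobolev_on_norm (-1/2) seg (N u) \<le> 1 * sobolev_norm (1/2) u" if u: "u \<in> Htilde_half" for u
    proof -
      obtain d where d: "half_summable d" "u = times_omega d" using Htilde_representation[OF u] by blast
      have "sobolev_on_norm (-1/2) seg (hypersing d) \<le> weighted_L2_norm (-1/2) (half_wave d)"
        unfolding hypersing_def by (rule sobolev_on_norm_le[OF half_wave_weighted_L2(1)[OF d(1)]])
      also have "\<dots> \<le> weighted_L2_norm (1/2) (series_hat d)" by (rule half_wave_weighted_L2(2)[OF d(1)])
      also have "\<dots> \<le> sobolev_norm (1/2) (times_omega d)" by (rule sobolev_norm_times_omega[OF d(1)])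
      finally show ?thesis using d N_eq by simp
    qed
    then show "\<exists>C. \<forall>u\<in>Htilde_half. sobolev_on_norm (-1/2) seg (N u) \<le> C * sobolev_norm (1/2) u" by blast
  qed (rule mem)
  have N3: "N (distr_of_fun \<phi>) = N0_smooth \<phi>" if "\<phi> \<in> test_functions seg" for \<phi>
    unfolding test_eq_times_omega[OF that] N_eq[OF test_coeff_half_summable[OF that]] by (rule hypersing_smooth[OF that])
  have "N0 = N"
    unfolding N0_def
  proof (rule the_equality)
    show "N \<in> Htilde_half \<rightarrow>\<^sub>E H_minus_half \<and>
        bounded_operator Htilde_half (sobolev_norm (1/2)) H_minus_half (sobolev_on_norm (-1/2) seg) N \<and>
        (\<forall>\<phi>\<in>test_functions seg. N (distr_of_fun \<phi>) = N0_smooth \<phi>)"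
      using N1 N2 N3 by blast
  next
    fix N' assume N': "N' \<in> Htilde_half \<rightarrow>\<^sub>E H_minus_half \<and>
        bounded_operator Htilde_half (sobolev_norm (1/2)) H_minus_half (sobolev_on_norm (-1/2) seg) N' \<and>
        (\<forall>\<phi>\<in>test_functions seg. N' (distr_of_fun \<phi>) = N0_smooth \<phi>)"
    show "N' = N"
    proof (rule PiE_ext[of N' Htilde_half "\<lambda>_. H_minus_half"])
      show "N' T = N T" if "T \<in> Htilde_half" for T
        by (rule bounded_operator_continuation_unique[OF _ N2 _ that]) (use N' N3 in auto)
    qed (use N' N1 in auto)
  qed
  then show ?thesis using N_eq[OF c] by simp
qed

text \<open>On order 1/2 the operator is already known to be diagonal, and diagonality passes to the
  extension.\<close>

lemma N0_omega_eq:
  assumes "c \<in> U_minus_inf" shows "N0_omega c = hypersing_diag c"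
  unfolding N0_omega_def hypersing_diag_def
proof (rule scale_extension_diag[where K = 1, OF hypersing_diag_bound _ assms])
  fix c assume "c \<in> U_space (1/2)"
  then have c: "half_summable c" by (simp add: U_space_eq half_summable_iff)
  show "series_of_distr (N0 (times_omega c)) = diag (\<lambda>n. real (n + 1) / 2) c"
    unfolding hypersing_diag_def[symmetric] N0_times_omega[OF c] distr_of_series_hypersing[OF c, symmetric]
    by (rule series_of_distr_of_series[OF hypersing_diag_half[OF c]])
qed

lemma hypersing_diag_bij: "bij_betw hypersing_diag U_minus_inf U_minus_inf"
proof (rule bij_betw_byWitness[where f' = hypersing_inv])
  show "hypersing_diag ` U_minus_inf \<subseteq> U_minus_inf"
    using hypersing_diag_U_summable by (fastforce simp: U_minus_inf_def U_space_eq)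
  show "hypersing_inv ` U_minus_inf \<subseteq> U_minus_inf"
    using hypersing_inv_U_summable by (fastforce simp: U_minus_inf_def U_space_eq)
qed (simp_all add: hypersing_diag_inv)

lemma inv_sqrt_op_hypersing_inv: "c \<in> U_minus_inf \<Longrightarrow> (\<lambda>n. 2 * inv_sqrt_op c n) = hypersing_inv c"
  by (simp add: inv_sqrt_op_eq hypersing_inv_def diag_def fun_eq_iff)

theorem theorem2:
  shows "(bij_betw N0_omega U_minus_inf U_minus_inf \<and>
          (\<forall>c\<in>U_minus_inf. inv_into U_minus_inf N0_omega c = (\<lambda>n. 2 * inv_sqrt_op c n)))
       \<and> (bij_betw N0 Htilde_half H_minus_half \<and>
          (\<forall>F\<in>H_minus_half. inv_into Htilde_half N0 F =
             (\<lambda>\<phi>. 2 * times_omega (inv_sqrt_op (series_of_distr F)) \<phi>)))"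
proof (intro conjI ballI)
  show bij1: "bij_betw N0_omega U_minus_inf U_minus_inf"
    using hypersing_diag_bij by (simp only: N0_omega_eq cong: bij_betw_cong)
  fix c assume c: "c \<in> U_minus_inf"
  have m: "hypersing_inv c \<in> U_minus_inf"
    using c hypersing_inv_U_summable by (fastforce simp: U_minus_inf_def U_space_eq)
  have "inv_into U_minus_inf N0_omega c = hypersing_inv c"
    by (rule inv_into_f_eq[OF bij_betw_imp_inj_on[OF bij1] m]) (simp only: N0_omega_eq[OF m] hypersing_diag_inv)
  then show "inv_into U_minus_inf N0_omega c = (\<lambda>n. 2 * inv_sqrt_op c n)"
    by (simp only: inv_sqrt_op_hypersing_inv[OF c])
next
  \<comment> \<open>On coefficients, \<open>N0 \<circ> times_omega\<close> is
    \<open>distr_of_series \<circ> hypersing_diag\<close>, a composition of bijections; as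
    \<open>times_omega\<close> is a bijection too, so is \<open>N0\<close>.\<close>
  have "bij_betw (distr_of_series \<circ> hypersing_diag) {c. half_summable c} H_minus_half"
  proof (rule bij_betw_trans[OF _ distr_of_series_bij])
    show "bij_betw hypersing_diag {c. half_summable c} (U_space (-1/2))"
      by (rule bij_betw_byWitness[where f' = hypersing_inv])
         (auto simp only: hypersing_diag_inv U_space_eq mem_Collect_eq hypersing_diag_half hypersing_inv_half)
  qed
  then have "bij_betw (N0 \<circ> times_omega) {c. half_summable c} H_minus_half"
    by (rule bij_betw_cong[THEN iffD1, rotated]) (simp add: N0_times_omega distr_of_series_hypersing)
  then show bij2: "bij_betw N0 Htilde_half H_minus_half"
    by (rule bij_betw_comp_iff[OF times_omega_bij, THEN iffD2])
  fix F assume "F \<in> H_minus_half"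
  then obtain c where c: "U_summable (-1/2) c" and F: "F = distr_of_series c" using H_minus_representation by blast
  note h = hypersing_inv_half[OF c]
  have c_mem: "c \<in> U_minus_inf" using c by (auto simp: U_minus_inf_def U_space_eq)
  have "inv_into Htilde_half N0 F = times_omega (hypersing_inv c)"
    by (rule inv_into_f_eq[OF bij_betw_imp_inj_on[OF bij2] times_omega_mem[OF h]])
       (simp only: N0_times_omega[OF h] F distr_of_series_hypersing[OF h, symmetric] hypersing_diag_inv)
  \<comment> \<open>The summand with factor 0 only brings the sequence into the shape of
    \<open>times_omega_lincomb\<close>.\<close>
  also have "hypersing_inv c = (\<lambda>n. 2 * inv_sqrt_op c n + 0 * inv_sqrt_op c n)" by (simp add: inv_sqrt_op_hypersing_inv[OF c_mem])
  also have "times_omega \<dots> = (\<lambda>\<phi>. 2 * times_omega (inv_sqrt_op c) \<phi> + 0 * times_omega (inv_sqrt_op c) \<phi>)"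
  proof -
    have "inv_sqrt_op c = (\<lambda>n. (1/2) * hypersing_inv c n + 0 * hypersing_inv c n)" by (simp add: inv_sqrt_op_hypersing_inv[OF c_mem, symmetric])
    then have "half_summable (inv_sqrt_op c)" using half_summable_lincomb[OF h h] by metis
    then show ?thesis by (intro times_omega_lincomb)
  qed
  finally show "inv_into Htilde_half N0 F = (\<lambda>\<phi>. 2 * times_omega (inv_sqrt_op (series_of_distr F)) \<phi>)"
    by (simp add: F series_of_distr_of_series[OF c])
qed

end
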